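(* For $(i,j,k)\in\mathbf{N}^3\setminus\{(3,3,4),(4,4,4)\}$, there is a planar graph $G$ with $(\mathrm{ch}_{sep}(G),\mathrm{ch}_{ad}(G),\chi_{\nleftrightarrow}(G))=(i,j,k)$ if and only if $$(i,j,k)\in\{(1,1,1),(2,2,2),(2,3,3),(3,3,3),(3,4,4)\}.$$
   Context: Graphs are finite, simple and have at least one vertex; $\mathbf{N}$ is the set of positive integers. $\mathrm{ch}_{sep}(G)$ (separation choosability) is the smallest $k$ such that for every assignment of lists $L(v)$ of $k$ colors to the vertices with $|L(x)\cap L(y)|\le 1$ for every edge $xy$, there is a proper coloring $\varphi$ of $G$ with $\varphi(v)\in L(v)$ for all $v$. Given an edge coloring $f$ of $G$ (an arbitrary map from edges to colors, not necessarily proper), a vertex coloring $c$ (not necessarily proper) is adapted to $f$ if no edge $xy$ satisfies $c(x)=c(y)=f(xy)$. $\mathrm{ch}_{ad}(G)$ (adaptable choosability) is the smallest $k$ such that for every edge coloring $f$ and every assignment of lists $L(v)$ of $k$ colors to the vertices, there is a coloring $c$ adapted to $f$ with $c(v)\in L(v)$ for all $v$. A local $k$-partition of $G$ is a collection $\{c_v\}_{v\in V(G)}$ of maps $c_v : E(v)\to\{1,\dots,k\}$, where $E(v)$ is the set of edges incident with $v$. $G$ is conflict $\{c_v\}$-colorable if there is a map $\varphi : V(G)\to\{1,\dots,k\}$ such that no edge $e=xy$ satisfies both $\varphi(x)=c_x(e)$ and $\varphi(y)=c_y(e)$. $\chi_{\nleftrightarrow}(G)$ (single conflict chromatic number) is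 the smallest $k$ such that $G$ is conflict $\{c_v\}$-colorable for every local $k$-partition. *)

theory Defs
  imports "HOL-Analysis.Analysis"
begin

text \<open>
  A graph is a pair of a vertex set \<open>V\<close> and an edge set \<open>E\<close> whose members are two-element
  subsets of \<open>V\<close>.
\<close>

definition simple_graph :: "'a set \<Rightarrow> 'a set set \<Rightarrow> bool" where
  "simple_graph V E \<longleftrightarrow>
     finite V \<and> V \<noteq> {} \<and> (\<forall>e\<in>E. \<exists>x\<in>V. \<exists>y\<in>V. x \<noteq> y \<and> e = {x, y})"

text \<open>
  A drawing in the plane, with the plane taken to be the complex numbers: distinct vertices are
  distinct points, every edge is a simple arc joining its two ends, arcs contain no vertices
  besides their ends, and two arcs meet only in common ends.
\<close>

definition plane_drawing ::
    "'a set \<Rightarrow> 'a set set \<Rightarrow> ('a \<Rightarrow> complex) \<Rightarrow> ('a set \<Rightarrow> real \<Rightarrow> complex) \<Rightarrow> bool" where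
  "plane_drawing V E p \<gamma> \<longleftrightarrow>
     inj_on p V \<and>
     (\<forall>e\<in>E. arc (\<gamma> e) \<and> {pathstart (\<gamma> e), pathfinish (\<gamma> e)} = p ` e \<and>
             path_image (\<gamma> e) \<inter> p ` V = p ` e) \<and>
     (\<forall>e\<in>E. \<forall>e'\<in>E. e \<noteq> e' \<longrightarrow>
             path_image (\<gamma> e) \<inter> path_image (\<gamma> e') \<subseteq> p ` (e \<inter> e'))"

definition planar_graph :: "'a set \<Rightarrow> 'a set set \<Rightarrow> bool" where
  "planar_graph V E \<longleftrightarrow> simple_graph V E \<and> (\<exists>p \<gamma>. plane_drawing V E p \<gamma>)"

text \<open>
  Colors are natural numbers. Since only finitely many colors occur in lists on a finite graph,
  any infinite supply of colors gives the same parameters. Maps on vertices or edges are total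
  functions of which only the values on \<open>V\<close> and \<open>E\<close> matter.
\<close>

definition list_assignment :: "'a set \<Rightarrow> nat \<Rightarrow> ('a \<Rightarrow> nat set) \<Rightarrow> bool" where
  "list_assignment V k L \<longleftrightarrow> (\<forall>v\<in>V. finite (L v) \<and> card (L v) = k)"

definition separated :: "'a set set \<Rightarrow> ('a \<Rightarrow> nat set) \<Rightarrow> bool" where
  "separated E L \<longleftrightarrow> (\<forall>x y. {x, y} \<in> E \<longrightarrow> card (L x \<inter> L y) \<le> 1)"

definition proper_coloring :: "'a set set \<Rightarrow> ('a \<Rightarrow> nat) \<Rightarrow> bool" where
  "proper_coloring E \<phi> \<longleftrightarrow> (\<forall>x y. {x, y} \<in> E \<longrightarrow> \<phi> x \<noteq> \<phi> y)"

definition adapted_coloring :: "'a set set \<Rightarrow> ('a set \<Rightarrow> nat) \<Rightarrow> ('a \<Rightarrow> nat) \<Rightarrow> bool" where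
  "adapted_coloring E f c \<longleftrightarrow>
     (\<forall>x y. {x, y} \<in> E \<longrightarrow> \<not> (c x = c y \<and> c y = f {x, y}))"

text \<open>\<open>c v e\<close> is the value of the map \<open>c\<^sub>v\<close> at an edge \<open>e\<close> incident with \<open>v\<close>.\<close>

definition local_partition ::
    "'a set \<Rightarrow> 'a set set \<Rightarrow> nat \<Rightarrow> ('a \<Rightarrow> 'a set \<Rightarrow> nat) \<Rightarrow> bool" where
  "local_partition V E k c \<longleftrightarrow> (\<forall>v\<in>V. \<forall>e\<in>E. v \<in> e \<longrightarrow> c v e \<in> {1..k})"

definition conflict_colorable ::
    "'a set \<Rightarrow> 'a set set \<Rightarrow> nat \<Rightarrow> ('a \<Rightarrow> 'a set \<Rightarrow> nat) \<Rightarrow> bool" where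
  "conflict_colorable V E k c \<longleftrightarrow>
     (\<exists>\<phi>. (\<forall>v\<in>V. \<phi> v \<in> {1..k}) \<and>
          (\<forall>x y. {x, y} \<in> E \<longrightarrow> \<not> (\<phi> x = c x {x, y} \<and> \<phi> y = c y {x, y})))"

text \<open>
  The minima range over positive integers. For \<open>chi_conflict\<close> the bound \<open>1 \<le> k\<close> is essential: a
  graph with an edge has no local \<open>0\<close>-partition, so \<open>k = 0\<close> would satisfy the rest vacuously.
\<close>

definition ch_sep :: "'a set \<Rightarrow> 'a set set \<Rightarrow> nat" where
  "ch_sep V E = (LEAST k. 1 \<le> k \<and>
     (\<forall>L. list_assignment V k L \<and> separated E L \<longrightarrow>
        (\<exists>\<phi>. proper_coloring E \<phi> \<and> (\<forall>v\<in>V. \<phi> v \<in> L v))))"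

definition ch_ad :: "'a set \<Rightarrow> 'a set set \<Rightarrow> nat" where
  "ch_ad V E = (LEAST k. 1 \<le> k \<and>
     (\<forall>f L. list_assignment V k L \<longrightarrow>
        (\<exists>c. adapted_coloring E f c \<and> (\<forall>v\<in>V. c v \<in> L v))))"

definition chi_conflict :: "'a set \<Rightarrow> 'a set set \<Rightarrow> nat" where
  "chi_conflict V E = (LEAST k. 1 \<le> k \<and>
     (\<forall>c. local_partition V E k c \<longrightarrow> conflict_colorable V E k c))"

end

(* Upper bounds. A planar graph has at most 3|S| edges on every vertex set S, and by Hall's theorem a
   graph with at most k|S| edges on every S has an orientation with out-degrees at most k, which makes it
   conflict (k+1)-colorable. Hence all three parameters of a planar graph are at most 4, and the
   conflict chromatic number dominates the adaptable one, which dominates the separation one.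

   If the adaptable number is at most 2, so is the conflict number. In a connected graph of minimum
   degree 2 two cycles that share at most one vertex, two parallel ears on a cycle, or two crossing ears
   on a cycle give adapted list assignments that cannot be colored. What remains is a cycle with at most one ear, in which
   all cycles pass through a single vertex of degree at most 3.

   If the separation number is at most 2, then every vertex set S spans at most 2|S| edges, so the
   conflict number is at most 3. A minimal counterexample has minimum degree 3, and any two of its cycles of
   length at least 4 share two vertices. Counting along a longest cycle bounds the number of its edges.

   This leaves (1,1,1), (2,2,2), (2,3,3), (3,3,3), (3,4,4) and the two excluded triples; the first five
   are attained by a vertex, an edge, two triangles sharing a vertex, K_{2,4}, and two hubs joined to the
   ends of nine disjoint edges. *)

theory Submission
  imports Defs
begin

text \<open>The edge bound for planar graphs is obtained without Euler's formula. Its induction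
  contracts edges, and a drawing by arcs has no evident contraction, so vertices and edges are drawn
  as closed path-connected sets. The bound proved is \<open>3 * card V - 5\<close>, one more than
  Euler's. The complete graph on five vertices attains it, so K_{3,3} is the only graph whose
  nonplanarity has to be proved topologically; the orientation argument asks for
  \<open>3 * card S\<close> only.

  The lower bounds rest on one device: the color of an edge is put into the lists of both ends, so
  that taking it at one end forbids it at the other and a choice is pushed along a path. Two
  distinct two-element sets share at most one color, so such a configuration also refutes separated
  lists of size 2 once its lists are pairwise distinct. In a triangle two of the lists coincide;
  this is why cycles of length at least 3 govern the adaptable case, and cycles of length at least 4
  the separated one.\<close>

section \<open>Nonplanarity of the complete bipartite graph on 3 + 3 vertices\<close>

lemma connected_subset_inside:
  assumes "connected K" "K \<inter> S = {}" "k \<in> K" "k \<in> inside S"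
  shows "K \<subseteq> inside S"
proof
  fix x assume "x \<in> K"
  then have "connected_component (- S) k x"
    using assms by (auto simp: connected_component_def intro!: exI[of _ K])
  then show "x \<in> inside S"
    using assms(4) inside_same_component by blast
qed

lemma connected_subset_outside:
  assumes "connected K" "K \<inter> S = {}" "k \<in> K" "k \<in> outside S"
  shows "K \<subseteq> outside S"
proof
  fix x assume "x \<in> K"
  then have "connected_component (- S) k x"
    using assms by (auto simp: connected_component_def intro!: exI[of _ K])
  then show "x \<in> outside S"
    using assms(4) outside_same_component by blast
qed

lemma connected_component_outside:
  assumes "connected (outside S)" "x \<in> outside S" "y \<in> outside S"
  shows "connected_component (- S) x y"
proof -
  have "outside S \<subseteq> - S" using outside_no_overlap[of S] by blast
  then show ?thesis
    using assms unfolding connected_component_def by blast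
qed

lemma closure_inside_closed_subset:
  fixes S :: "complex set"
  assumes "closed S" "K \<subseteq> inside S"
  shows "closure K \<subseteq> inside S \<union> S"
proof -
  have "closed (inside S \<union> S)"
    by (metis assms(1) closed_Compl open_outside union_with_inside Un_commute)
  then show ?thesis
    by (meson assms(2) closure_minimal le_supI1)
qed

locale theta =
  fixes c1 c2 c3 :: "real \<Rightarrow> complex" and a b :: complex
  assumes arcs: "arc c1" "arc c2" "arc c3"
    and ends: "pathstart c1 = a" "pathfinish c1 = b" "pathstart c2 = a" "pathfinish c2 = b"
      "pathstart c3 = a" "pathfinish c3 = b"
    and inter: "path_image c1 \<inter> path_image c2 = {a,b}" "path_image c1 \<inter> path_image c3 = {a,b}"
      "path_image c2 \<inter> path_image c3 = {a,b}"
begin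

lemma ne: "a \<noteq> b"
  using arcs(1) ends arc_distinct_ends by metis

lemma theta_perms: "theta c2 c1 c3 a b" "theta c1 c3 c2 a b" "theta c3 c2 c1 a b" "theta c2 c3 c1 a b"
  using arcs ends inter by (unfold_locales; auto)+

lemma Jordan12:
  "inside (path_image c1 \<union> path_image c2) \<noteq> {}"
  "open (inside (path_image c1 \<union> path_image c2))"
  "connected (inside (path_image c1 \<union> path_image c2))"
  "connected (outside (path_image c1 \<union> path_image c2))"
  "frontier (inside (path_image c1 \<union> path_image c2)) = path_image c1 \<union> path_image c2"
proof -
  have s: "simple_path (c1 +++ reversepath c2)"
    using arcs ends inter by (auto simp: simple_path_join_loop_eq arc_reversepath)
  have l: "pathfinish (c1 +++ reversepath c2) = pathstart (c1 +++ reversepath c2)"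
    using ends by simp
  have i: "path_image (c1 +++ reversepath c2) = path_image c1 \<union> path_image c2"
    using ends by (simp add: path_image_join)
  show "inside (path_image c1 \<union> path_image c2) \<noteq> {}"
  "open (inside (path_image c1 \<union> path_image c2))"
  "connected (inside (path_image c1 \<union> path_image c2))"
  "connected (outside (path_image c1 \<union> path_image c2))"
  "frontier (inside (path_image c1 \<union> path_image c2)) = path_image c1 \<union> path_image c2"
    using Jordan_inside_outside[OF s l] unfolding i by auto
qed

lemma closed_images: "closed (path_image c1)" "closed (path_image c2)" "closed (path_image c3)"
  using arcs by (auto simp: closed_arc_image)

lemma inner_point: obtains p where "p \<in> path_image c1" "p \<noteq> a" "p \<noteq> b"
proof -
  have "path_image c1 - {a,b} \<noteq> {}"
    using nonempty_simple_path_endless[of c1] arcs ends by (metis arc_simple_path)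
  then show ?thesis using that by auto
qed

text \<open>The inside of \<open>c1\<close> and \<open>c2\<close> is connected and misses
  \<open>c1\<close> and \<open>c3\<close>, so a single common point \<open>z\<close> puts all of it
  inside \<open>c1\<close> and \<open>c3\<close>. Its closure contains \<open>c2\<close>, whose
  inner points lie on neither of the other arcs.\<close>

lemma middle_arc_aux:
  assumes out: "path_image c3 \<inter> inside (path_image c1 \<union> path_image c2) = {}"
    and z: "z \<in> inside (path_image c1 \<union> path_image c2)"
    and z13: "z \<in> inside (path_image c1 \<union> path_image c3)"
  shows "path_image c2 \<inter> inside (path_image c1 \<union> path_image c3) \<noteq> {}"
proof -
  let ?I = "inside (path_image c1 \<union> path_image c2)"
  interpret t: theta c2 c1 c3 a b by (rule theta_perms)
  obtain p where p: "p \<in> path_image c2" "p \<noteq> a" "p \<noteq> b" by (rule t.inner_point)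
  have "?I \<inter> (path_image c1 \<union> path_image c3) = {}"
    using out inside_no_overlap[of "path_image c1 \<union> path_image c2"] by blast
  then have "?I \<subseteq> inside (path_image c1 \<union> path_image c3)"
    using connected_subset_inside Jordan12(3) z z13 by blast
  then have "closure ?I \<subseteq> inside (path_image c1 \<union> path_image c3) \<union> (path_image c1 \<union> path_image c3)"
    by (rule closure_inside_closed_subset[rotated]) (intro closed_Un closed_images)
  moreover have "p \<in> closure ?I"
    using Jordan12(5) p by (metis Diff_iff UnI2 frontier_def)
  ultimately show ?thesis
    using p inter by auto
qed

text \<open>Suppose \<open>c3\<close> misses the inside of \<open>c1\<close> and \<open>c2\<close>,
  and let \<open>z\<close> be a point there. If \<open>z\<close> were outside both other closed
  curves, Janiszewski's theorem, applicable because these two meet in the connected set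
  \<open>c3\<close>, would join \<open>z\<close> to a far point avoiding all three arcs. So
  \<open>z\<close> lies inside one of them, and \<open>middle_arc_aux\<close> applies.\<close>

lemma middle_arc:
  "path_image c3 \<inter> inside (path_image c1 \<union> path_image c2) \<noteq> {} \<or>
   path_image c2 \<inter> inside (path_image c1 \<union> path_image c3) \<noteq> {} \<or>
   path_image c1 \<inter> inside (path_image c2 \<union> path_image c3) \<noteq> {}"
proof (cases "path_image c3 \<inter> inside (path_image c1 \<union> path_image c2) = {}")
  case True
  let ?A = "path_image c1" and ?B = "path_image c2" and ?C = "path_image c3"
  interpret t13: theta c1 c3 c2 a b by (rule theta_perms)
  interpret t23: theta c2 c3 c1 a b by (rule theta_perms)
  interpret t21: theta c2 c1 c3 a b by (rule theta_perms)
  obtain z where z: "z \<in> inside (?A \<union> ?B)" using Jordan12(1) by blast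
  have zn: "z \<notin> ?A" "z \<notin> ?B" "z \<notin> ?C"
    using z True inside_no_overlap[of "?A \<union> ?B"] by blast+
  have "z \<in> inside (?A \<union> ?C) \<or> z \<in> inside (?B \<union> ?C)"
  proof (rule ccontr)
    assume neg: "\<not> ?thesis"
    then have zo: "z \<in> outside (?A \<union> ?C)" "z \<in> outside (?B \<union> ?C)"
      using zn inside_Un_outside[of "?A \<union> ?C"] inside_Un_outside[of "?B \<union> ?C"] by blast+
    have bdd: "bounded ?A" "bounded ?B" "bounded ?C"
      using arcs by (auto simp: bounded_arc_image)
    \<comment> \<open>All three curves are bounded, so some point \<open>w\<close> lies outside each
      of them.\<close>
    have "bounded (- outside (?A \<union> ?B) \<union> - outside (?A \<union> ?C) \<union> - outside (?B \<union> ?C))"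
      using bdd by (simp add: cobounded_outside)
    then have "- outside (?A \<union> ?B) \<union> - outside (?A \<union> ?C) \<union> - outside (?B \<union> ?C) \<noteq> UNIV"
      using not_bounded_UNIV by metis
    then obtain w where w: "w \<in> outside (?A \<union> ?B)" "w \<in> outside (?A \<union> ?C)" "w \<in> outside (?B \<union> ?C)"
      by auto
    have "connected_component (- (?A \<union> ?C)) z w"
      using connected_component_outside t13.Jordan12(4) zo(1) w(2) by blast
    moreover have "connected_component (- (?B \<union> ?C)) z w"
      using connected_component_outside t23.Jordan12(4) zo(2) w(3) by blast
    moreover have "(?A \<union> ?C) \<inter> (?B \<union> ?C) = ?C"
      using inter by auto
    then have "connected ((?A \<union> ?C) \<inter> (?B \<union> ?C))"
      using arcs by (simp add: connected_arc_image)
    moreover have "compact (?A \<union> ?C)" "closed (?B \<union> ?C)"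
      using arcs closed_images by (auto simp: compact_arc_image compact_Un)
    ultimately have "connected_component (- ((?A \<union> ?C) \<union> (?B \<union> ?C))) z w"
      using Janiszewski by blast
    then have "connected_component (- (?A \<union> ?B)) z w"
      by (rule connected_component_of_subset) auto
    then have "z \<in> outside (?A \<union> ?B)"
      using w outside_same_component connected_component_sym by blast
    then show False using z inside_Int_outside by blast
  qed
  then show ?thesis
  proof
    assume "z \<in> inside (?A \<union> ?C)"
    then show ?thesis using middle_arc_aux[OF True z] by simp
  next
    assume "z \<in> inside (?B \<union> ?C)"
    moreover have "?C \<inter> inside (?B \<union> ?A) = {}" "z \<in> inside (?B \<union> ?A)"
      using True z by (simp_all add: Un_commute)
    ultimately show ?thesis using t21.middle_arc_aux by simp
  qed
qed auto

text \<open>The middle arc \<open>c3\<close> splits the inside of \<open>c1\<close> and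
  \<open>c2\<close> into two regions. Hence \<open>K\<close> lies in one of three faces, and the
  closure of each face meets one of the arcs at most in its ends.\<close>

lemma separation_aux:
  assumes mid: "path_image c3 \<inter> inside (path_image c1 \<union> path_image c2) \<noteq> {}"
    and K: "connected K" "K \<inter> (path_image c1 \<union> path_image c2 \<union> path_image c3) = {}"
  shows "closure K \<inter> path_image c1 \<subseteq> {a,b} \<or> closure K \<inter> path_image c2 \<subseteq> {a,b} \<or>
         closure K \<inter> path_image c3 \<subseteq> {a,b}"
proof (cases "K = {}")
  case False
  let ?A = "path_image c1" and ?B = "path_image c2" and ?C = "path_image c3"
  obtain k where k: "k \<in> K" using False by auto
  obtain disj: "inside(?A \<union> ?C) \<inter> inside(?B \<union> ?C) = {}"
     and un: "inside(?A \<union> ?C) \<union> inside(?B \<union> ?C) \<union> (?C - {a,b}) = inside(?A \<union> ?B)"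
    using split_inside_simple_closed_curve[OF arc_imp_simple_path[OF arcs(1)] ends(1,2)
        arc_imp_simple_path[OF arcs(2)] ends(3,4) arc_imp_simple_path[OF arcs(3)] ends(5,6) ne inter mid]
    by blast
  have part: "closure K \<inter> Y \<subseteq> {a,b}"
    if "k \<in> inside (X \<union> ?C)" "inside (X \<union> ?C) \<subseteq> inside (?A \<union> ?B)" "X \<inter> Y = {a,b}" "Y \<inter> ?C = {a,b}"
      "Y \<subseteq> ?A \<union> ?B" "K \<inter> X = {}" "closed X" for X Y
  proof -
    have "K \<subseteq> inside (X \<union> ?C)"
      using connected_subset_inside[OF K(1) _ k that(1)] K(2) that(6) by blast
    then have "closure K \<subseteq> inside (X \<union> ?C) \<union> (X \<union> ?C)"
      by (rule closure_inside_closed_subset[rotated]) (intro closed_Un that(7) closed_images)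
    moreover have "inside (X \<union> ?C) \<inter> Y = {}"
      using that(2,5) inside_no_overlap[of "?A \<union> ?B"] by blast
    ultimately have "closure K \<inter> Y \<subseteq> (X \<inter> Y) \<union> (Y \<inter> ?C)" by blast
    then show ?thesis using that(3,4) by simp
  qed
  consider "k \<in> outside (?A \<union> ?B)" | "k \<in> inside (?A \<union> ?C)" | "k \<in> inside (?B \<union> ?C)"
    using un k K(2) inside_Un_outside[of "?A \<union> ?B"] by blast
  then show ?thesis
  proof cases
    case 1
    then have "K \<subseteq> outside (?A \<union> ?B)"
      using connected_subset_outside[OF K(1) _ k] K(2) by blast
    then have "K \<subseteq> - inside (?A \<union> ?B)"
      using inside_Int_outside by blast
    then have "closure K \<subseteq> - inside (?A \<union> ?B)"
      using Jordan12(2) by (simp add: closure_minimal closed_Compl)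
    then show ?thesis using un by blast
  next
    case 2
    then have "closure K \<inter> ?B \<subseteq> {a,b}"
    proof (intro part)
      show "inside (?A \<union> ?C) \<subseteq> inside (?A \<union> ?B)" using un by blast
      show "K \<inter> ?A = {}" using K(2) by blast
    qed (use 2 inter closed_images in auto)
    then show ?thesis by simp
  next
    case 3
    then have "closure K \<inter> ?A \<subseteq> {a,b}"
    proof (intro part)
      show "inside (?B \<union> ?C) \<subseteq> inside (?A \<union> ?B)" using un by blast
      show "K \<inter> ?B = {}" using K(2) by blast
      show "?B \<inter> ?A = {a,b}" using inter(1) by blast
    qed (use 3 inter closed_images in auto)
    then show ?thesis by simp
  qed
qed auto

end

lemma (in theta) separation:
  assumes K: "connected K" "K \<inter> (path_image c1 \<union> path_image c2 \<union> path_image c3) = {}"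
  shows "closure K \<inter> path_image c1 \<subseteq> {a,b} \<or> closure K \<inter> path_image c2 \<subseteq> {a,b} \<or>
         closure K \<inter> path_image c3 \<subseteq> {a,b}"
proof -
  interpret t13: theta c1 c3 c2 a b by (rule theta_perms)
  interpret t23: theta c2 c3 c1 a b by (rule theta_perms)
  have "K \<inter> (path_image c1 \<union> path_image c3 \<union> path_image c2) = {}"
    "K \<inter> (path_image c2 \<union> path_image c3 \<union> path_image c1) = {}"
    using K(2) by blast+
  then show ?thesis
    using middle_arc separation_aux[OF _ K] t13.separation_aux[OF _ K(1)] t23.separation_aux[OF _ K(1)]
    by blast
qed

section \<open>Arcs cut out of path-connected sets\<close>

lemma path_first_hit:
  fixes g :: "real \<Rightarrow> 'a::t2_space"
  assumes "path g" "closed S" "pathfinish g \<in> S" "pathstart g \<notin> S"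
  obtains u where "0 < u" "u \<le> 1" "g u \<in> S" "\<And>t. 0 \<le> t \<Longrightarrow> t < u \<Longrightarrow> g t \<notin> S"
proof -
  let ?P = "{0..1} \<inter> g -` S"
  have "compact ?P"
    using assms(1,2) continuous_closed_preimage[of "{0..1}" g S] unfolding path_def
    by (auto simp: compact_eq_bounded_closed intro: bounded_subset[OF bounded_closed_interval])
  moreover have "1 \<in> ?P" using assms(3) by (auto simp: pathfinish_def)
  then have "?P \<noteq> {}" by blast
  ultimately obtain u where u: "u \<in> ?P" "\<forall>t\<in>?P. u \<le> t"
    using compact_attains_inf by blast
  have "u \<noteq> 0" using u(1) assms(4) by (auto simp: pathstart_def)
  with u show ?thesis
    by (intro that[of u]) (auto simp: not_le[symmetric])
qed

lemma first_hit_image: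
  fixes u :: real
  assumes "0 < u" "g u \<in> S" "\<And>t. 0 \<le> t \<Longrightarrow> t < u \<Longrightarrow> g t \<notin> S"
  shows "g ` {0..u} \<inter> S = {g u}"
proof -
  have "t = u" if "0 \<le> t" "t \<le> u" "g t \<in> S" for t
    using assms(3)[of t] that by force
  then show ?thesis using assms(1,2) by fastforce
qed

lemma path_connected_arc_image: "arc g \<Longrightarrow> path_connected (path_image g)"
  by (simp add: arc_imp_path path_connected_path_image)

lemma path_connected_obtain_arc:
  fixes S :: "complex set"
  assumes "path_connected S" "x \<in> S" "y \<in> S" "x \<noteq> y"
  obtains g where "arc g" "path_image g \<subseteq> S" "pathstart g = x" "pathfinish g = y"
  using assms unfolding path_connected_arcwise by blast

text \<open>An arc from \<open>X\<close> to \<open>Y\<close> is cut at its first point in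
  \<open>Y\<close>, reversed, and cut again at its first point in \<open>X\<close>. The remaining
  piece meets each of the two sets in one end only.\<close>

lemma arc_between_closed_sets:
  fixes G :: "complex set"
  assumes "path_connected G" "closed X" "closed Y" "X \<inter> Y = {}" "G \<inter> X \<noteq> {}" "G \<inter> Y \<noteq> {}"
  obtains g where "arc g" "path_image g \<subseteq> G" "path_image g \<inter> X = {pathstart g}"
    "path_image g \<inter> Y = {pathfinish g}"
proof -
  obtain x y where x: "x \<in> G" "x \<in> X" and y: "y \<in> G" "y \<in> Y" using assms by auto
  then have "x \<noteq> y" using assms by auto
  then obtain g where g: "arc g" "path_image g \<subseteq> G" "pathstart g = x" "pathfinish g = y"
    using assms(1) x y unfolding path_connected_arcwise by blast
  obtain u where u: "0 < u" "u \<le> 1" "g u \<in> Y" "\<And>t. 0 \<le> t \<Longrightarrow> t < u \<Longrightarrow> g t \<notin> Y"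
    using path_first_hit[of g Y] g x y assms by (auto simp: arc_imp_path)
  define h where "h = subpath u 0 g"
  have g0: "g 0 = x" using g by (simp add: pathstart_def)
  have "g u \<noteq> g 0" using u(3) x assms g0 by auto
  then have h: "arc h" "path_image h = g ` {0..u}" "pathstart h = g u" "pathfinish h = x"
    unfolding h_def using g u g0 by (auto simp: arc_subpath_arc path_image_subpath)
  have "g u \<notin> X" using u(3) assms(4) by blast
  then obtain v where v: "0 < v" "v \<le> 1" "h v \<in> X" "\<And>t. 0 \<le> t \<Longrightarrow> t < v \<Longrightarrow> h t \<notin> X"
    using path_first_hit[of h X] h x assms(2) by (auto simp: arc_imp_path)
  have h0: "h 0 = g u" using h by (simp add: pathstart_def)
  define k where "k = subpath v 0 h"
  have "h v \<noteq> h 0" using v(3) u(3) assms h0 by auto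
  then have k: "arc k" "path_image k = h ` {0..v}" "pathstart k = h v" "pathfinish k = g u"
    unfolding k_def using h v h0 by (auto simp: arc_subpath_arc path_image_subpath)
  have "path_image k \<subseteq> path_image h" using k v by (auto simp: path_image_def)
  then have kh: "path_image k \<subseteq> g ` {0..u}" using h by simp
  show ?thesis
  proof
    show "arc k" by fact
    show "path_image k \<subseteq> G" using kh g u by (force simp: path_image_def)
    show "path_image k \<inter> X = {pathstart k}"
      unfolding k(2,3) using v by (intro first_hit_image)
    have "path_image k \<inter> Y \<subseteq> {g u}" using kh first_hit_image[of u g Y] u by auto
    moreover have "g u \<in> path_image k" using k(4) pathfinish_in_path_image by metis
    ultimately show "path_image k \<inter> Y = {pathfinish k}" using k(4) u(3) by auto
  qed
qed

lemma connected_meets_middle: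
  assumes "connected C" "C \<subseteq> A \<union> M \<union> B" "closed A" "closed B" "A \<inter> B \<subseteq> M"
    "C \<inter> A \<noteq> {}" "C \<inter> B \<noteq> {}"
  shows "C \<inter> M \<noteq> {}"
proof
  assume "C \<inter> M = {}"
  then have "C \<subseteq> A \<union> B" "A \<inter> B \<inter> C = {}" using assms by blast+
  then show False using connected_closedD[OF assms(1) _ _ assms(3,4)] assms(6,7) by blast
qed

text \<open>This turns a fat vertex \<open>Y\<close> with three fat edges into a point with three
  legs. An arc from \<open>x 1\<close> to \<open>x 2\<close> passes through \<open>Y\<close>, since
  \<open>G 1\<close> and \<open>G 2\<close> meet only there. A second arc, from \<open>x 0\<close>
  to such a point, is stopped at \<open>t\<close>, where it first hits the first arc.\<close>

lemma tripod:
  fixes Y :: "complex set" and G :: "nat \<Rightarrow> complex set"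
  assumes Y: "path_connected Y"
    and G: "\<And>i. i < 3 \<Longrightarrow> path_connected (G i)" "\<And>i. i < 3 \<Longrightarrow> closed (G i)"
      "\<And>i. i < 3 \<Longrightarrow> G i \<inter> Y \<noteq> {}"
      "\<And>i j. \<lbrakk>i < 3; j < 3; i \<noteq> j\<rbrakk> \<Longrightarrow> G i \<inter> G j \<subseteq> Y"
    and x: "\<And>i. i < 3 \<Longrightarrow> x i \<in> G i" "\<And>i. i < 3 \<Longrightarrow> x i \<notin> Y"
  shows "\<exists>t a. (\<forall>i<3. arc (a i) \<and> pathstart (a i) = t \<and> pathfinish (a i) = x i \<and> path_image (a i) \<subseteq> Y \<union> G 0 \<union> G 1 \<union> G 2)
      \<and> (\<forall>i<3. \<forall>k<3. i \<noteq> k \<longrightarrow> path_image (a i) \<inter> path_image (a k) = {t})"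
proof -
  have xd: "x i \<notin> G j" if "i < 3" "j < 3" "i \<noteq> j" for i j using that G(4) x by blast
  have pc: "path_connected (G i \<union> Y)" if "i < 3" for i
    using that G Y by (intro path_connected_Un) auto
  have pc12: "path_connected ((G 1 \<union> Y) \<union> (G 2 \<union> Y))"
    using G(3)[of 1] by (intro path_connected_Un pc) auto
  have "x 1 \<noteq> x 2" using xd[of 1 2] x(1)[of 2] by auto
  moreover have "x 1 \<in> (G 1 \<union> Y) \<union> (G 2 \<union> Y)" "x 2 \<in> (G 1 \<union> Y) \<union> (G 2 \<union> Y)" using x(1) by simp_all
  ultimately obtain \<alpha> where \<alpha>: "arc \<alpha>" "path_image \<alpha> \<subseteq> (G 1 \<union> Y) \<union> (G 2 \<union> Y)" "pathstart \<alpha> = x 1" "pathfinish \<alpha> = x 2"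
    using path_connected_obtain_arc[OF pc12] by metis
  have "path_image \<alpha> \<inter> Y \<noteq> {}"
  proof (rule connected_meets_middle)
    show "connected (path_image \<alpha>)" using \<alpha> by (simp add: connected_arc_image)
    show "path_image \<alpha> \<subseteq> G 1 \<union> Y \<union> G 2" using \<alpha> by auto
    show "path_image \<alpha> \<inter> G 1 \<noteq> {}" using \<alpha>(3) x(1)[of 1] pathstart_in_path_image[of \<alpha>] by auto
    show "path_image \<alpha> \<inter> G 2 \<noteq> {}" using \<alpha>(4) x(1)[of 2] pathfinish_in_path_image[of \<alpha>] by auto
  qed (use G in auto)
  then obtain s where s: "s \<in> path_image \<alpha>" "s \<in> Y" by auto
  have "x 0 \<noteq> s" using s x(2)[of 0] by auto
  moreover have "path_connected (G 0 \<union> Y)" "x 0 \<in> G 0 \<union> Y" "s \<in> G 0 \<union> Y" using pc[of 0] x(1) s by simp_all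
  ultimately obtain \<beta> where \<beta>: "arc \<beta>" "path_image \<beta> \<subseteq> G 0 \<union> Y" "pathstart \<beta> = x 0" "pathfinish \<beta> = s"
    using path_connected_obtain_arc by metis
  have x0: "x 0 \<notin> path_image \<alpha>" using \<alpha>(2) xd[of 0 1] xd[of 0 2] x(2)[of 0] by auto
  obtain u where u: "0 < u" "u \<le> 1" "\<beta> u \<in> path_image \<alpha>" "\<And>t. 0 \<le> t \<Longrightarrow> t < u \<Longrightarrow> \<beta> t \<notin> path_image \<alpha>"
    using path_first_hit[of \<beta> "path_image \<alpha>"] \<beta> s x0 \<alpha> by (auto simp: arc_imp_path closed_arc_image)
  define t where "t = \<beta> u"
  have "\<beta> u \<in> path_image \<beta>" using u by (auto simp: path_image_def)
  then have "t \<in> G 0 \<union> Y" using \<beta>(2) by (auto simp: t_def)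
  then have tn: "t \<noteq> x 1" "t \<noteq> x 2" using xd[of 1 0] xd[of 2 0] x(2)[of 1] x(2)[of 2] by auto
  have \<beta>0: "\<beta> 0 = x 0" using \<beta> by (simp add: pathstart_def)
  have tx0: "t \<noteq> x 0" using u(3) x0 by (auto simp: t_def)
  obtain v where v: "v \<in> {0..1}" "t = \<alpha> v" using u(3) by (auto simp: t_def path_image_def)
  have \<alpha>01: "\<alpha> 0 = x 1" "\<alpha> 1 = x 2" using \<alpha> by (simp_all add: pathstart_def pathfinish_def)
  define a where "a i = (if i = 0 then subpath u 0 \<beta> else if i = 1 then subpath v 0 \<alpha> else subpath v 1 \<alpha>)" for i :: nat
  have im: "path_image (a 0) = \<beta> ` {0..u}" "path_image (a 1) = \<alpha> ` {0..v}" "path_image (a 2) = \<alpha> ` {v..1}"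
    using u v by (auto simp: a_def path_image_subpath)
  have inj: "inj_on \<alpha> {0..1}" using \<alpha>(1) by (simp add: arc_def)
  have i12: "\<alpha> ` {0..v} \<inter> \<alpha> ` {v..1} = {t}"
  proof -
    have "\<alpha> ` {0..v} \<inter> \<alpha> ` {v..1} = \<alpha> ` ({0..v} \<inter> {v..1})"
      using inj v by (intro inj_on_image_Int[symmetric, of _ "{0..1}"]) auto
    also have "{0..v} \<inter> {v..1} = {v}" using v by auto
    finally show ?thesis using v by simp
  qed
  have i0: "\<beta> ` {0..u} \<inter> path_image \<alpha> = {t}"
    unfolding t_def using u by (intro first_hit_image)
  have sub: "\<alpha> ` {0..v} \<subseteq> path_image \<alpha>" "\<alpha> ` {v..1} \<subseteq> path_image \<alpha>" "t \<in> \<alpha> ` {0..v}" "t \<in> \<alpha> ` {v..1}" "\<beta> ` {0..u} \<subseteq> path_image \<beta>"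
    using v u by (auto simp: path_image_def)
  have three: "i = 0 \<or> i = 1 \<or> i = 2" if "i < 3" for i :: nat using that by auto
  have ends: "pathstart (a 0) = t" "pathstart (a 1) = t" "pathstart (a 2) = t"
    "pathfinish (a 0) = x 0" "pathfinish (a 1) = x 1" "pathfinish (a 2) = x 2"
    using v(2) \<alpha>01 \<beta>0 by (simp_all add: a_def t_def)
  have "u \<noteq> 0" "v \<noteq> 0" "v \<noteq> 1" using u(1) tn v(2) \<alpha>01 by auto
  then have arcs: "arc (a 0)" "arc (a 1)" "arc (a 2)"
    using \<alpha>(1) \<beta>(1) u(1,2) v(1) by (simp_all add: a_def arc_subpath_arc)
  have "path_image (a 0) \<subseteq> G 0 \<union> Y" "path_image (a 1) \<subseteq> G 1 \<union> G 2 \<union> Y" "path_image (a 2) \<subseteq> G 1 \<union> G 2 \<union> Y"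
    using im sub \<alpha>(2) \<beta>(2) by blast+
  then have imG: "path_image (a 0) \<subseteq> Y \<union> G 0 \<union> G 1 \<union> G 2" "path_image (a 1) \<subseteq> Y \<union> G 0 \<union> G 1 \<union> G 2"
      "path_image (a 2) \<subseteq> Y \<union> G 0 \<union> G 1 \<union> G 2" by blast+
  have t0: "t \<in> \<beta> ` {0..u}" using u(1) by (auto simp: t_def)
  have int: "path_image (a 0) \<inter> path_image (a 1) = {t}" "path_image (a 0) \<inter> path_image (a 2) = {t}"
    "path_image (a 1) \<inter> path_image (a 2) = {t}"
    unfolding im using i12 i0 sub t0 by blast+
  have "arc (a i) \<and> pathstart (a i) = t \<and> pathfinish (a i) = x i \<and> path_image (a i) \<subseteq> Y \<union> G 0 \<union> G 1 \<union> G 2"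
    if "i < 3" for i
    using three[OF that] arcs ends imG by blast
  moreover have "path_image (a i) \<inter> path_image (a k) = {t}" if "i < 3" "k < 3" "i \<noteq> k" for i k
    using three[OF that(1)] three[OF that(2)] that(3) int by (auto simp: Int_commute)
  ultimately show ?thesis by blast
qed

text \<open>Two of the \<open>Y j\<close>, each replaced by a tripod, are joined through the three
  sets \<open>X i\<close> into a theta curve. The third one is connected, avoids the theta curve and
  reaches inner points of all three arcs, which \<open>separation\<close> forbids.\<close>

theorem no_fat_K33:
  fixes X Y :: "nat \<Rightarrow> complex set" and G :: "nat \<Rightarrow> nat \<Rightarrow> complex set"
  assumes X: "\<And>i. i < 3 \<Longrightarrow> closed (X i)" "\<And>i. i < 3 \<Longrightarrow> path_connected (X i)"
    "\<And>i i'. \<lbrakk>i < 3; i' < 3; i \<noteq> i'\<rbrakk> \<Longrightarrow> X i \<inter> X i' = {}"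
    and Y: "\<And>j. j < 3 \<Longrightarrow> closed (Y j)" "\<And>j. j < 3 \<Longrightarrow> path_connected (Y j)"
    "\<And>j j'. \<lbrakk>j < 3; j' < 3; j \<noteq> j'\<rbrakk> \<Longrightarrow> Y j \<inter> Y j' = {}"
    and XY: "\<And>i j. \<lbrakk>i < 3; j < 3\<rbrakk> \<Longrightarrow> X i \<inter> Y j = {}"
    and G: "\<And>i j. \<lbrakk>i < 3; j < 3\<rbrakk> \<Longrightarrow> path_connected (G i j)"
      "\<And>i j. \<lbrakk>i < 3; j < 3\<rbrakk> \<Longrightarrow> G i j \<inter> X i \<noteq> {}"
      "\<And>i j. \<lbrakk>i < 3; j < 3\<rbrakk> \<Longrightarrow> G i j \<inter> Y j \<noteq> {}"
      "\<And>i j i'. \<lbrakk>i < 3; j < 3; i' < 3; i' \<noteq> i\<rbrakk> \<Longrightarrow> G i j \<inter> X i' = {}"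
      "\<And>i j j'. \<lbrakk>i < 3; j < 3; j' < 3; j' \<noteq> j\<rbrakk> \<Longrightarrow> G i j \<inter> Y j' = {}"
      "\<And>i j j'. \<lbrakk>i < 3; j < 3; j' < 3; j' \<noteq> j\<rbrakk> \<Longrightarrow> G i j \<inter> G i j' \<subseteq> X i"
      "\<And>i j i'. \<lbrakk>i < 3; j < 3; i' < 3; i' \<noteq> i\<rbrakk> \<Longrightarrow> G i j \<inter> G i' j \<subseteq> Y j"
      "\<And>i j i' j'. \<lbrakk>i < 3; j < 3; i' < 3; j' < 3; i' \<noteq> i; j' \<noteq> j\<rbrakk> \<Longrightarrow> G i j \<inter> G i' j' = {}"
  shows False
proof -
  let ?P = "\<lambda>i j g. arc g \<and> path_image g \<subseteq> G i j \<and> path_image g \<inter> X i = {pathstart g} \<and> path_image g \<inter> Y j = {pathfinish g}"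
  have P: "\<exists>g. ?P i j g" if "i < 3" "j < 3" for i j
    using arc_between_closed_sets[OF G(1) X(1) Y(1) XY G(2) G(3)] that by metis
  define g where "g i j = (SOME g. ?P i j g)" for i j
  have "?P i j (g i j)" if "i < 3" "j < 3" for i j
    unfolding g_def by (rule someI_ex[OF P[OF that]])
  then have g: "\<And>i j. \<lbrakk>i < 3; j < 3\<rbrakk> \<Longrightarrow> arc (g i j)"
     "\<And>i j. \<lbrakk>i < 3; j < 3\<rbrakk> \<Longrightarrow> path_image (g i j) \<subseteq> G i j"
     "\<And>i j. \<lbrakk>i < 3; j < 3\<rbrakk> \<Longrightarrow> path_image (g i j) \<inter> X i = {pathstart (g i j)}"
     "\<And>i j. \<lbrakk>i < 3; j < 3\<rbrakk> \<Longrightarrow> path_image (g i j) \<inter> Y j = {pathfinish (g i j)}"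
    by blast+
  let ?g = "\<lambda>i j. path_image (g i j)"
  let ?T = "\<lambda>j. Y j \<union> ?g 0 j \<union> ?g 1 j \<union> ?g 2 j"
  have three: "i = 0 \<or> i = 1 \<or> i = 2" if "i < 3" for i :: nat using that by auto
  have tri: "\<exists>t a. (\<forall>i<3. arc (a i) \<and> pathstart (a i) = t \<and> pathfinish (a i) = pathstart (g i j) \<and> path_image (a i) \<subseteq> ?T j)
      \<and> (\<forall>i<3. \<forall>k<3. i \<noteq> k \<longrightarrow> path_image (a i) \<inter> path_image (a k) = {t})" if j: "j < 3" for j
  proof (rule tripod)
    fix i k :: nat assume ik: "i < 3" "k < 3" "i \<noteq> k"
      then show "?g i j \<inter> ?g k j \<subseteq> Y j" using g(2)[OF ik(1) j] g(2)[OF ik(2) j] G(7)[OF ik(1) j ik(2)] by blast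
    next
      fix i :: nat assume i: "i < 3"
      show "path_connected (?g i j)" using g(1)[OF i j] by (simp add: path_connected_arc_image)
      show "closed (?g i j)" using g(1)[OF i j] by (simp add: closed_arc_image)
      show "?g i j \<inter> Y j \<noteq> {}" using g(4)[OF i j] by simp
      show "pathstart (g i j) \<notin> Y j" using g(3)[OF i j] XY[OF i j] by blast
      show "pathstart (g i j) \<in> ?g i j" by (rule pathstart_in_path_image)
  qed (rule Y(2)[OF j])
  have lt: "(0::nat) < 3" "(1::nat) < 3" "(2::nat) < 3" by auto
  have TX: "?T j \<inter> X k \<subseteq> {pathstart (g k j)}" if "j < 3" "k < 3" for j k
  proof -
    have "?g i j \<inter> X k = {}" if "i < 3" "i \<noteq> k" for i
      using g(2)[of i j] G(4)[of i j k] that \<open>j < 3\<close> \<open>k < 3\<close> by blast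
    moreover have "Y j \<inter> X k = {}" using XY that by blast
    moreover have "?g i j \<inter> X k \<subseteq> {pathstart (g k j)}" if "i < 3" for i
      using g(3)[OF \<open>k < 3\<close> \<open>j < 3\<close>] calculation(1)[OF that] by (cases "i = k") simp_all
    ultimately show ?thesis using lt by blast
  qed
  have TT: "?T 0 \<inter> ?T 1 \<subseteq> X 0 \<union> X 1 \<union> X 2"
  proof -
    have gg: "?g i 0 \<inter> ?g k 1 \<subseteq> X i" if "i < 3" "k < 3" for i k
    proof -
      have "G i 0 \<inter> G k 1 \<subseteq> X i"
        using G(6)[of i 0 1] G(8)[of i 0 k 1] that by (cases "i = k") auto
      then show ?thesis using g(2)[of i 0] g(2)[of k 1] that by (auto dest!: subsetD)
    qed
    have gY: "?g i 0 \<inter> Y 1 = {}" if "i < 3" for i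
      using g(2)[OF that lt(1)] G(5)[OF that lt(1,2)] by auto
    have Yg: "Y 0 \<inter> ?g i 1 = {}" if "i < 3" for i
      using g(2)[OF that lt(2)] G(5)[OF that lt(2,1)] by auto
    have YY: "Y 0 \<inter> Y 1 = {}" using Y(3) by simp
    have T: "p \<in> Y j \<or> (\<exists>i<3. p \<in> ?g i j)" if "p \<in> ?T j" for p j
      using that lt by blast
    show ?thesis
    proof
      fix p assume "p \<in> ?T 0 \<inter> ?T 1"
      then have "p \<in> Y 0 \<or> (\<exists>i<3. p \<in> ?g i 0)" "p \<in> Y 1 \<or> (\<exists>i<3. p \<in> ?g i 1)"
        by (metis T IntD1, metis T IntD2)
      then obtain i k where "i < 3" "k < 3" "p \<in> ?g i 0" "p \<in> ?g k 1"
        using YY gY Yg by (metis IntI empty_iff)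
      then have "p \<in> X i" using gg by blast
      then show "p \<in> X 0 \<union> X 1 \<union> X 2" using three[OF \<open>i < 3\<close>] by auto
    qed
  qed
  obtain t0 a where A0: "(\<forall>i<3. arc (a i) \<and> pathstart (a i) = t0 \<and> pathfinish (a i) = pathstart (g i 0) \<and> path_image (a i) \<subseteq> ?T 0)
      \<and> (\<forall>i<3. \<forall>k<3. i \<noteq> k \<longrightarrow> path_image (a i) \<inter> path_image (a k) = {t0})"
    using tri[OF lt(1)] by (elim exE)
  then have a: "\<And>i. i < 3 \<Longrightarrow> arc (a i)" "\<And>i. i < 3 \<Longrightarrow> pathstart (a i) = t0"
     "\<And>i. i < 3 \<Longrightarrow> pathfinish (a i) = pathstart (g i 0)" "\<And>i. i < 3 \<Longrightarrow> path_image (a i) \<subseteq> ?T 0"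
     "\<And>i k. \<lbrakk>i < 3; k < 3; i \<noteq> k\<rbrakk> \<Longrightarrow> path_image (a i) \<inter> path_image (a k) = {t0}"
    by simp_all
  obtain t1 b where B0: "(\<forall>i<3. arc (b i) \<and> pathstart (b i) = t1 \<and> pathfinish (b i) = pathstart (g i 1) \<and> path_image (b i) \<subseteq> ?T 1)
      \<and> (\<forall>i<3. \<forall>k<3. i \<noteq> k \<longrightarrow> path_image (b i) \<inter> path_image (b k) = {t1})"
    using tri[OF lt(2)] by (elim exE)
  then have b: "\<And>i. i < 3 \<Longrightarrow> arc (b i)" "\<And>i. i < 3 \<Longrightarrow> pathstart (b i) = t1"
     "\<And>i. i < 3 \<Longrightarrow> pathfinish (b i) = pathstart (g i 1)" "\<And>i. i < 3 \<Longrightarrow> path_image (b i) \<subseteq> ?T 1"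
     "\<And>i k. \<lbrakk>i < 3; k < 3; i \<noteq> k\<rbrakk> \<Longrightarrow> path_image (b i) \<inter> path_image (b k) = {t1}"
    by simp_all
  let ?a = "\<lambda>i. path_image (a i)" and ?b = "\<lambda>i. path_image (b i)"
  have aX: "?a i \<inter> X k = {}" if "i < 3" "k < 3" "i \<noteq> k" for i k
  proof -
    have "pathstart (g k 0) \<notin> ?a i"
      using a(5)[OF that] a(1,2,3)[of k] that arc_distinct_ends[of "a k"]
      by (metis IntI pathfinish_in_path_image singletonD)
    then show ?thesis using TX[OF lt(1) that(2)] a(4)[OF that(1)] by blast
  qed
  have bX: "?b i \<inter> X k = {}" if "i < 3" "k < 3" "i \<noteq> k" for i k
  proof -
    have "pathstart (g k 1) \<notin> ?b i"
      using b(5)[OF that] b(1,2,3)[of k] that arc_distinct_ends[of "b k"]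
      by (metis IntI pathfinish_in_path_image singletonD)
    then show ?thesis using TX[OF lt(2) that(2)] b(4)[OF that(1)] by blast
  qed
  have t0a: "t0 \<in> ?a i" "t1 \<in> ?b i" if "i < 3" for i
    using a(2)[OF that] b(2)[OF that] by (metis pathstart_in_path_image)+
  have other: "\<exists>i<3. i \<noteq> k" for k :: nat using lt(1,2) by (metis zero_neq_one)
  have t0X: "t0 \<notin> X k" "t1 \<notin> X k" if "k < 3" for k
  proof -
    obtain i where "i < 3" "i \<noteq> k" using other by blast
    then show "t0 \<notin> X k" "t1 \<notin> X k"
      using t0a[OF \<open>i < 3\<close>] aX[OF \<open>i < 3\<close> that] bX[OF \<open>i < 3\<close> that] by blast+
  qed
  have abX: "?a i \<inter> ?b k \<subseteq> X i" "?a i \<inter> ?b k \<subseteq> X k" if "i < 3" "k < 3" for i k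
  proof -
    have "?a i \<inter> ?b k \<subseteq> X 0 \<union> X 1 \<union> X 2" using a(4)[OF that(1)] b(4)[OF that(2)] TT by blast
    then have "\<exists>m<3. p \<in> X m" if "p \<in> ?a i \<inter> ?b k" for p using that lt by blast
    moreover have "m = i \<and> m = k" if "m < 3" "p \<in> ?a i \<inter> ?b k" "p \<in> X m" for m p
      using that aX[of i m] bX[of k m] \<open>i < 3\<close> \<open>k < 3\<close> by auto
    ultimately show "?a i \<inter> ?b k \<subseteq> X i" "?a i \<inter> ?b k \<subseteq> X k"
      by (metis subsetI)+
  qed
  have "t0 \<noteq> t1"
    using abX(1)[OF lt(1) lt(1)] t0a[OF lt(1)] t0X[OF lt(1)] by blast
  \<comment> \<open>Legs of different tripods meet only inside the fat vertices \<open>X i\<close>,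
    so the three sets \<open>W i\<close> share nothing but \<open>t0\<close> and
    \<open>t1\<close>.\<close>
  define W where "W i = ?a i \<union> X i \<union> ?b i" for i
  have "path_connected (W i)" if i: "i < 3" for i
  proof -
    have "pathstart (g i 0) \<in> X i" "pathstart (g i 1) \<in> X i" using g(3)[of i 0] g(3)[of i 1] i by auto
    moreover have "pathstart (g i 0) \<in> ?a i" "pathstart (g i 1) \<in> ?b i"
      using a(3)[OF i] b(3)[OF i] by (metis pathfinish_in_path_image)+
    ultimately show ?thesis
      unfolding W_def using X(2)[OF i] a(1)[OF i] b(1)[OF i]
      by (intro path_connected_Un) (auto simp: path_connected_arc_image)
  qed
  then have "\<exists>c. arc c \<and> path_image c \<subseteq> W i \<and> pathstart c = t0 \<and> pathfinish c = t1" if "i < 3" for i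
    using \<open>t0 \<noteq> t1\<close> t0a[OF that] that unfolding path_connected_arcwise W_def by (metis UnI1 UnI2)
  then obtain c where c: "\<And>i. i < 3 \<Longrightarrow> arc (c i)" "\<And>i. i < 3 \<Longrightarrow> path_image (c i) \<subseteq> W i"
    "\<And>i. i < 3 \<Longrightarrow> pathstart (c i) = t0" "\<And>i. i < 3 \<Longrightarrow> pathfinish (c i) = t1" by metis
  let ?c = "\<lambda>i. path_image (c i)"
  have tc: "t0 \<in> ?c i" "t1 \<in> ?c i" if "i < 3" for i
    using c that by (metis pathstart_in_path_image pathfinish_in_path_image)+
  have cc: "?c i \<inter> ?c k = {t0, t1}" if "i < 3" "k < 3" "i \<noteq> k" for i k
  proof -
    have ki: "k \<noteq> i" using that by simp
    have 1: "?a i \<inter> ?b k = {}" "?a k \<inter> ?b i = {}"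
      using abX[OF that(1,2)] abX[OF that(2,1)] X(3)[OF that] by blast+
    have "W i \<inter> W k = {t0} \<union> {t1}"
      unfolding W_def
      by (simp add: Int_Un_distrib Int_Un_distrib2 a(5)[OF that] b(5)[OF that] aX[OF that] bX[OF that]
        X(3)[OF that] 1 Int_commute[of "X i" "?a k"] Int_commute[of "X i" "?b k"] Int_commute[of "?b i" "?a k"]
        aX[OF that(2,1) ki] bX[OF that(2,1) ki])
    then show ?thesis using c(2)[OF that(1)] c(2)[OF that(2)] tc[OF that(1)] tc[OF that(2)] by blast
  qed
  interpret theta "c 0" "c 1" "c 2" t0 t1
    using c cc by unfold_locales auto
  \<comment> \<open>The two legs in \<open>W i\<close> meet only inside \<open>X i\<close>, so
    \<open>c i\<close> has to pass through \<open>X i\<close>. This is where the third fat vertex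
    can reach it.\<close>
  have cX: "?c i \<inter> X i \<noteq> {}" if "i < 3" for i
  proof (rule connected_meets_middle)
    show "?c i \<subseteq> ?a i \<union> X i \<union> ?b i" using c(2)[OF that] by (simp add: W_def)
    show "?c i \<inter> ?a i \<noteq> {}" "?c i \<inter> ?b i \<noteq> {}" using tc[OF that] t0a[OF that] by auto
  qed (use that abX a b c in \<open>auto simp: connected_arc_image closed_arc_image\<close>)
  have YT: "Y 2 \<inter> ?T j = {}" if "j < 2" for j
  proof -
    have j: "j < 3" "2 \<noteq> j" using that by auto
    have gY: "?g i j \<inter> Y 2 = {}" if "i < 3" for i
      using g(2)[OF that j(1)] G(5)[OF that j(1) lt(3) j(2)] by blast
    show ?thesis
      using gY[OF lt(1)] gY[OF lt(2)] gY[OF lt(3)] Y(3)[OF lt(3) j] by blast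
  qed
  have Yc: "Y 2 \<inter> ?c i = {}" if "i < 3" for i
  proof -
    have "Y 2 \<inter> ?a i = {}" using YT[of 0] a(4)[OF that] by fastforce
    moreover have "Y 2 \<inter> ?b i = {}" using YT[of 1] b(4)[OF that] by fastforce
    moreover have "X i \<inter> Y 2 = {}" using XY[OF that lt(3)] .
    ultimately have "Y 2 \<inter> W i = {}" unfolding W_def by blast
    then show ?thesis using c(2)[OF that] by blast
  qed
  have gT: "?g i 2 \<inter> ?T j \<subseteq> X i" if i: "i < 3" and "j < 2" for i j
  proof -
    have j: "j < 3" "j \<noteq> 2" "2 \<noteq> j" using that by auto
    have gg: "?g i 2 \<inter> ?g m j \<subseteq> X i" if m: "m < 3" for m
    proof -
      have "G i 2 \<inter> G m j \<subseteq> X i"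
      proof (cases "m = i")
        case True
        then show ?thesis using G(6)[OF i lt(3) j(1,2)] by simp
      next
        case False
        then show ?thesis using G(8)[OF i lt(3) m j(1) False j(2)] by simp
      qed
      then show ?thesis using g(2)[OF i lt(3)] g(2)[OF m j(1)] by blast
    qed
    have "?g i 2 \<inter> Y j = {}" using g(2)[OF i lt(3)] G(5)[OF i lt(3) j(1,2)] by blast
    then show ?thesis using gg[OF lt(1)] gg[OF lt(2)] gg[OF lt(3)] by blast
  qed
  define Z where "Z i = ?g i 2 \<union> X i" for i
  have Zc: "Z i \<inter> ?c k = {}" if "i < 3" "k < 3" "i \<noteq> k" for i k
  proof -
    have ki: "k \<noteq> i" using that by simp
    have 1: "?g i 2 \<inter> X k = {}" using g(2)[OF that(1) lt(3)] G(4)[OF that(1) lt(3) that(2) ki] by blast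
    have 2: "?g i 2 \<inter> ?a k = {}"
      using gT[OF that(1), of 0] a(4)[OF that(2)] aX[OF that(2,1) ki] by fastforce
    have 3: "?g i 2 \<inter> ?b k = {}"
      using gT[OF that(1), of 1] b(4)[OF that(2)] bX[OF that(2,1) ki] by fastforce
    have "Z i \<inter> W k = {}"
      unfolding Z_def W_def
      by (simp add: Int_Un_distrib Int_Un_distrib2 1 2 3 Int_commute[of "X i" "?a k"] Int_commute[of "X i" "?b k"]
          aX[OF that(2,1) ki] bX[OF that(2,1) ki] X(3)[OF that])
    then show ?thesis using c(2)[OF that(2)] by blast
  qed
  have tZ: "t0 \<notin> Z i" "t1 \<notin> Z i" if "i < 3" for i
  proof -
    obtain k where "k < 3" "k \<noteq> i" using other by blast
    then show "t0 \<notin> Z i" "t1 \<notin> Z i" using Zc[OF that \<open>k < 3\<close>] tc[OF \<open>k < 3\<close>] by auto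
  qed
  \<comment> \<open>\<open>D\<close> will be the initial part of a path from \<open>Y 2\<close>
    through \<open>g i 2\<close> and \<open>X i\<close>, cut just before its first point
    \<open>q\<close> on \<open>c i\<close>.\<close>
  define Q where "Q i D q \<longleftrightarrow> connected D \<and> D \<inter> Y 2 \<noteq> {} \<and> D \<subseteq> Z i \<and> D \<inter> ?c i = {} \<and> q \<in> closure D \<and> q \<in> ?c i \<and> q \<notin> {t0, t1}" for i D q
  have DQ: "\<exists>D q. connected D \<and> D \<inter> Y 2 \<noteq> {} \<and> D \<subseteq> Z i \<and> D \<inter> ?c i = {} \<and> q \<in> closure D \<and> q \<in> ?c i \<and> q \<notin> {t0, t1}"
    if i: "i < 3" for i
  proof -
    obtain s where s: "s \<in> ?c i" "s \<in> X i" using cX[OF i] by auto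
    have y: "pathfinish (g i 2) \<in> Y 2" "pathfinish (g i 2) \<in> ?g i 2" using g(4)[of i 2] i by auto
    have "path_connected (Z i)"
      unfolding Z_def using g(1)[of i 2] g(3)[of i 2] X(2)[OF i] i
      by (intro path_connected_Un) (auto simp: path_connected_arc_image)
    then obtain \<beta> where \<beta>: "path \<beta>" "path_image \<beta> \<subseteq> Z i" "pathstart \<beta> = pathfinish (g i 2)" "pathfinish \<beta> = s"
      unfolding path_connected_def using s y by (metis UnI1 UnI2 Z_def)
    obtain u where u: "0 < u" "u \<le> 1" "\<beta> u \<in> ?c i" "\<And>t. 0 \<le> t \<Longrightarrow> t < u \<Longrightarrow> \<beta> t \<notin> ?c i"
      using path_first_hit[of \<beta> "?c i"] \<beta> s y Yc[OF i] c(1)[OF i] by (auto simp: closed_arc_image)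
    have sub: "{0..u} \<subseteq> {0..1}" using u by auto
    have co: "continuous_on {0..u} \<beta>" using \<beta>(1) sub unfolding path_def by (rule continuous_on_subset)
    have "closure {0..<u} = {0..u}" using u by simp
    then have "\<beta> ` {0..u} \<subseteq> closure (\<beta> ` {0..<u})"
      using continuous_image_closure_subset[of "{0..u}" \<beta> "{0..<u}"] co by auto
    then have "\<beta> u \<in> closure (\<beta> ` {0..<u})" using u by auto
    moreover have "connected (\<beta> ` {0..<u})"
      using co by (intro connected_continuous_image continuous_on_subset[OF co]) auto
    moreover have "\<beta> ` {0..<u} \<inter> ?c i = {}" using u(4) by auto
    moreover have "\<beta> 0 \<in> \<beta> ` {0..<u}" "\<beta> 0 \<in> Y 2" by (rule imageI, use u(1) in simp) (use y \<beta>(3) in \<open>simp add: pathstart_def\<close>)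
    moreover from this have "\<beta> ` {0..<u} \<inter> Y 2 \<noteq> {}" by blast
    moreover have "\<beta> ` {0..<u} \<subseteq> Z i" "\<beta> u \<in> Z i" using \<beta>(2) u by (auto simp: path_image_def image_subset_iff)
    ultimately have "connected (\<beta> ` {0..<u}) \<and> \<beta> ` {0..<u} \<inter> Y 2 \<noteq> {} \<and> \<beta> ` {0..<u} \<subseteq> Z i \<and>
      \<beta> ` {0..<u} \<inter> ?c i = {} \<and> \<beta> u \<in> closure (\<beta> ` {0..<u}) \<and> \<beta> u \<in> ?c i \<and> \<beta> u \<notin> {t0, t1}"
      using u(3) tZ[OF i] by auto
    then show ?thesis by blast
  qed
  have "\<exists>D q. Q i D q" if "i < 3" for i
    unfolding Q_def using DQ[OF that] .
  then have "\<forall>i. \<exists>D q. i < 3 \<longrightarrow> Q i D q" by metis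
  then obtain D where "\<forall>i. \<exists>q. i < 3 \<longrightarrow> Q i (D i) q" by (rule choice[THEN exE])
  then obtain q where DQ: "\<forall>i. i < 3 \<longrightarrow> Q i (D i) (q i)" by (rule choice[THEN exE])
  then have D: "\<And>i. i < 3 \<Longrightarrow> connected (D i)" "\<And>i. i < 3 \<Longrightarrow> D i \<inter> Y 2 \<noteq> {}"
    "\<And>i. i < 3 \<Longrightarrow> D i \<subseteq> Z i" "\<And>i. i < 3 \<Longrightarrow> D i \<inter> ?c i = {}" "\<And>i. i < 3 \<Longrightarrow> q i \<in> closure (D i)"
    "\<And>i. i < 3 \<Longrightarrow> q i \<in> ?c i" "\<And>i. i < 3 \<Longrightarrow> q i \<notin> {t0,t1}"
    unfolding Q_def by simp_all
  define K where "K = (\<Union>i<3. D i \<union> Y 2)"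
  have "connected K"
    unfolding K_def
  proof (rule connected_Union)
    fix s assume "s \<in> (\<lambda>i. D i \<union> Y 2) ` {..<3}"
    then obtain i where i: "i < 3" "s = D i \<union> Y 2" by auto
    show "connected s"
      unfolding i(2) by (intro connected_Un D(1,2)[OF i(1)] path_connected_imp_connected Y(2) lt)
  next
    have "Y 2 \<noteq> {}" using D(2)[OF lt(1)] by blast
    then show "\<Inter> ((\<lambda>i. D i \<union> Y 2) ` {..<3}) \<noteq> {}" by auto
  qed
  moreover have Kc: "K \<inter> ?c k = {}" if "k < 3" for k
  proof -
    have "D i \<inter> ?c k = {}" if i: "i < 3" for i
      using D(3)[OF i] D(4)[OF i] Zc[OF i \<open>k < 3\<close>] by (cases "i = k") auto
    then show ?thesis using Yc[OF that] unfolding K_def by auto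
  qed
  have "K \<inter> (?c 0 \<union> ?c 1 \<union> ?c 2) = {}"
    using Kc[OF lt(1)] Kc[OF lt(2)] Kc[OF lt(3)] by blast
  ultimately have "closure K \<inter> ?c 0 \<subseteq> {t0,t1} \<or> closure K \<inter> ?c 1 \<subseteq> {t0,t1} \<or> closure K \<inter> ?c 2 \<subseteq> {t0,t1}"
    by (intro separation)
  moreover have qK: "q i \<in> closure K" if "i < 3" for i
  proof -
    have "D i \<subseteq> K" using that unfolding K_def by blast
    then show ?thesis using D(5)[OF that] closure_mono by blast
  qed
  ultimately show False
    using D(6)[OF lt(1)] D(7)[OF lt(1)] D(6)[OF lt(2)] D(7)[OF lt(2)] D(6)[OF lt(3)] D(7)[OF lt(3)]
      qK[OF lt(1)] qK[OF lt(2)] qK[OF lt(3)] by blast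
qed

section \<open>Comparison of the parameters\<close>

text \<open>Unlike \<open>simple_graph\<close>, this admits the empty graph, which inductions over
  vertex subsets reach.\<close>

definition sgraph :: "'a set \<Rightarrow> 'a set set \<Rightarrow> bool" where
  "sgraph V E \<longleftrightarrow> finite V \<and> (\<forall>e\<in>E. \<exists>x\<in>V. \<exists>y\<in>V. x \<noteq> y \<and> e = {x, y})"

definition nb :: "'a set set \<Rightarrow> 'a \<Rightarrow> 'a set" where
  "nb E v = {u. {v, u} \<in> E}"

lemma in_nb [simp]: "u \<in> nb E v \<longleftrightarrow> {v, u} \<in> E"
  by (simp add: nb_def)

lemma sgraphD: "sgraph V E \<Longrightarrow> {x, y} \<in> E \<Longrightarrow> x \<in> V \<and> y \<in> V \<and> x \<noteq> y"
  unfolding sgraph_def by (metis doubleton_eq_iff)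

lemma sgraphE:
  assumes "sgraph V E" "e \<in> E"
  obtains x y where "x \<in> V" "y \<in> V" "x \<noteq> y" "e = {x, y}"
  using assms unfolding sgraph_def by blast

lemma sgraph_finite: "sgraph V E \<Longrightarrow> finite V" by (simp add: sgraph_def)

lemma sgraph_finite_edges: "sgraph V E \<Longrightarrow> finite E"
  by (rule finite_subset[of _ "Pow V"]) (auto simp: sgraph_def)

lemma sgraph_mono: "sgraph V E \<Longrightarrow> E' \<subseteq> E \<Longrightarrow> sgraph V E'"
  unfolding sgraph_def by blast

lemma sgraph_induced: "sgraph V E \<Longrightarrow> S \<subseteq> V \<Longrightarrow> sgraph S {e \<in> E. e \<subseteq> S}"
  unfolding sgraph_def
proof (intro conjI ballI)
  assume a: "finite V \<and> (\<forall>e\<in>E. \<exists>x\<in>V. \<exists>y\<in>V. x \<noteq> y \<and> e = {x, y})" "S \<subseteq> V"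
  then show "finite S" using finite_subset by blast
  fix e assume "e \<in> {e \<in> E. e \<subseteq> S}"
  then obtain x y where "x \<noteq> y" "e = {x, y}" "e \<subseteq> S" using a(1) by blast
  then show "\<exists>x\<in>S. \<exists>y\<in>S. x \<noteq> y \<and> e = {x, y}" by auto
qed

lemma nb_subset: "sgraph V E \<Longrightarrow> nb E v \<subseteq> V - {v}"
  using sgraphD unfolding nb_def by fast

lemma finite_nb: "sgraph V E \<Longrightarrow> finite (nb E v)"
  using nb_subset sgraph_finite by (metis finite_Diff finite_subset)

lemma incident_eq: "sgraph V E \<Longrightarrow> {e \<in> E. v \<in> e} = (\<lambda>u. {v, u}) ` nb E v"
proof (intro equalityI subsetI)
  fix e assume "sgraph V E" "e \<in> {e \<in> E. v \<in> e}"
  then obtain x y where "e = {x, y}" "e \<in> E" "v \<in> e" by (auto elim: sgraphE)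
  then have "e = {v, x} \<or> e = {v, y}" by auto
  then show "e \<in> (\<lambda>u. {v, u}) ` nb E v" using \<open>e \<in> E\<close> by auto
qed auto

lemma card_incident: "sgraph V E \<Longrightarrow> card {e \<in> E. v \<in> e} = card (nb E v)"
  by (subst incident_eq) (auto intro!: card_image inj_onI simp: doubleton_eq_iff)

lemma handshake:
  assumes "sgraph V E"
  shows "(\<Sum>v\<in>V. card (nb E v)) = 2 * card E"
proof -
  have "(\<Sum>v\<in>V. card {e \<in> E. v \<in> e}) = 2 * card E"
  proof (rule sum_multicount[OF sgraph_finite[OF assms] sgraph_finite_edges[OF assms]])
    show "\<forall>e\<in>E. card {v \<in> V. v \<in> e} = 2"
    proof
      fix e assume "e \<in> E"
      then obtain x y where "x \<in> V" "y \<in> V" "x \<noteq> y" "e = {x, y}" using sgraphE[OF assms] by metis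
      then have "{v \<in> V. v \<in> e} = {x, y}" by auto
      then show "card {v \<in> V. v \<in> e} = 2" using \<open>x \<noteq> y\<close> by simp
    qed
  qed
  then show ?thesis by (simp add: card_incident[OF assms])
qed

lemma card_edges_remove:
  assumes "sgraph V E"
  shows "card {e \<in> E. v \<notin> e} + card (nb E v) = card E"
proof -
  have "card E = card ({e \<in> E. v \<notin> e} \<union> {e \<in> E. v \<in> e})" by (rule arg_cong[where f = card]) auto
  also have "\<dots> = card {e \<in> E. v \<notin> e} + card {e \<in> E. v \<in> e}"
    using sgraph_finite_edges[OF assms] by (intro card_Un_disjoint) auto
  finally show ?thesis by (simp add: card_incident[OF assms])
qed

text \<open>Rado's proof of Hall's theorem: an index with two candidates can always drop one of them, by
  submodularity of \<open>J \<mapsto> card (\<Union> (A ` J))\<close>.\<close>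

lemma hall_capacity:
  fixes A :: "'e \<Rightarrow> 'v set"
  assumes "finite E" "\<And>e. e \<in> E \<Longrightarrow> finite (A e)"
    and "\<And>J. J \<subseteq> E \<Longrightarrow> card J \<le> k * card (\<Union> (A ` J))"
  shows "\<exists>t. (\<forall>e\<in>E. t e \<in> A e) \<and> (\<forall>v. card {e \<in> E. t e = v} \<le> k)"
  using assms
proof (induction "\<Sum>e\<in>E. card (A e)" arbitrary: A rule: less_induct)
  case less
  have ne: "A e \<noteq> {}" if "e \<in> E" for e
    using less.prems(3)[of "{e}"] that by auto
  show ?case
  proof (cases "\<exists>e\<in>E. \<exists>x\<in>A e. \<exists>y\<in>A e. x \<noteq> y")
    case False
    define t where "t e = (SOME x. x \<in> A e)" for e
    have t: "A e = {t e}" if "e \<in> E" for e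
      using ne[OF that] False that someI_ex[of "\<lambda>x. x \<in> A e"] unfolding t_def by blast
    have "card {e \<in> E. t e = v} \<le> k" for v
    proof (cases "{e \<in> E. t e = v} = {}")
      case False
      have "\<Union> (A ` {e \<in> E. t e = v}) = {v}" using t False by auto
      then show ?thesis using less.prems(3)[of "{e \<in> E. t e = v}"] by auto
    qed (metis card.empty le0)
    then show ?thesis using t by blast
  next
    case True
    then obtain e x y where exy: "e \<in> E" "x \<in> A e" "y \<in> A e" "x \<noteq> y" by blast
    let ?B = "\<lambda>z. A(e := A e - {z})"
    have "\<exists>z\<in>{x,y}. \<forall>J\<subseteq>E. card J \<le> k * card (\<Union> (?B z ` J))"
    proof (rule ccontr)
      assume "\<not> ?thesis"
      then obtain J1 J2 where J: "J1 \<subseteq> E" "J2 \<subseteq> E"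
         "card J1 > k * card (\<Union> (?B x ` J1))" "card J2 > k * card (\<Union> (?B y ` J2))"
        by (auto simp: not_le)
      have inJ: "e \<in> J" if "card J > k * card (\<Union> (?B z ` J))" "J \<subseteq> E" for J z
      proof (rule ccontr)
        assume "e \<notin> J"
        then have "\<Union> (?B z ` J) = \<Union> (A ` J)" by auto
        then show False using less.prems(3)[OF that(2)] that(1) by simp
      qed
      have e: "e \<in> J1" "e \<in> J2" using inJ[OF J(3,1)] inJ[OF J(4,2)] by auto
      let ?U = "\<lambda>J. \<Union> (A ` (J - {e}))"
      let ?S1 = "?U J1 \<union> (A e - {x})" and ?S2 = "?U J2 \<union> (A e - {y})"
      have u: "\<Union> (?B x ` J1) = ?S1" "\<Union> (?B y ` J2) = ?S2" using e by auto
      have fJ: "finite J1" "finite J2" using J less.prems(1) finite_subset by auto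
      have fin: "finite ?S1" "finite ?S2" using J less.prems(2) fJ exy(1) by (auto intro!: finite_UN_I)
      \<comment> \<open>\<open>J1\<close> and \<open>J2\<close> both contain \<open>e\<close>, and
        their reduced unions together still cover \<open>A e\<close>. Submodularity and the
        hypothesis for \<open>J1 \<union> J2\<close> and \<open>J1 \<inter> J2 - {e}\<close>
        contradict the two failures: dropping \<open>e\<close> costs one, the two strict
        inequalities gain two.\<close>
      have "card (\<Union> (A ` (J1 \<union> J2))) + card (\<Union> (A ` (J1 \<inter> J2 - {e}))) \<le> card (?S1 \<union> ?S2) + card (?S1 \<inter> ?S2)"
      proof (rule add_mono)
        have "\<Union> (A ` (J1 \<union> J2)) \<subseteq> \<Union> (A ` (J1 - {e})) \<union> \<Union> (A ` (J2 - {e})) \<union> A e" by blast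
        also have "\<dots> \<subseteq> ?S1 \<union> ?S2" using exy(4) by blast
        finally have 1: "\<Union> (A ` (J1 \<union> J2)) \<subseteq> ?S1 \<union> ?S2" .
        have fU: "finite (?S1 \<union> ?S2)" by (rule finite_UnI[OF fin])
        show "card (\<Union> (A ` (J1 \<union> J2))) \<le> card (?S1 \<union> ?S2)" by (rule card_mono[OF fU 1])
        have 2: "\<Union> (A ` (J1 \<inter> J2 - {e})) \<subseteq> ?S1 \<inter> ?S2" by blast
        have fI: "finite (?S1 \<inter> ?S2)" by (rule finite_Int) (rule disjI1, rule fin(1))
        show "card (\<Union> (A ` (J1 \<inter> J2 - {e}))) \<le> card (?S1 \<inter> ?S2)" by (rule card_mono[OF fI 2])
      qed
      also have "\<dots> = card ?S1 + card ?S2" by (rule card_Un_Int[OF fin, symmetric])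
      finally have "k * card (\<Union> (A ` (J1 \<union> J2))) + k * card (\<Union> (A ` (J1 \<inter> J2 - {e}))) \<le> k * card ?S1 + k * card ?S2"
        by (metis add_mult_distrib2 mult_le_mono2)
      moreover have "card (J1 \<union> J2) \<le> k * card (\<Union> (A ` (J1 \<union> J2)))"
        "card (J1 \<inter> J2 - {e}) \<le> k * card (\<Union> (A ` (J1 \<inter> J2 - {e})))"
        using J by (intro less.prems(3); blast)+
      moreover have "card (J1 \<inter> J2 - {e}) + 1 = card (J1 \<inter> J2)"
        using e fJ by (metis IntI Suc_eq_plus1 card_Suc_Diff1 finite_Int)
      moreover have "card (J1 \<union> J2) + card (J1 \<inter> J2) = card J1 + card J2"
        by (rule card_Un_Int[OF fJ, symmetric])
      ultimately show False using J(3,4) unfolding u by linarith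
    qed
    then obtain z where z: "z \<in> {x,y}" "\<And>J. J \<subseteq> E \<Longrightarrow> card J \<le> k * card (\<Union> (?B z ` J))" by blast
    have zA: "z \<in> A e" using z(1) exy by auto
    have "(\<Sum>e\<in>E. card (?B z e)) < (\<Sum>e\<in>E. card (A e))"
    proof (rule sum_strict_mono_ex1[OF less.prems(1)])
      show "\<forall>f\<in>E. card (?B z f) \<le> card (A f)" using less.prems(2) by (auto intro: card_mono)
      show "\<exists>f\<in>E. card (?B z f) < card (A f)"
        using exy(1) card_Diff1_less[OF less.prems(2)[OF exy(1)] zA] by (intro bexI[of _ e]) simp_all
    qed
    then have "\<exists>t. (\<forall>f\<in>E. t f \<in> ?B z f) \<and> (\<forall>v. card {f \<in> E. t f = v} \<le> k)"
    proof (rule less.hyps[OF _ less.prems(1)])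
      fix f assume "f \<in> E"
      then show "finite (?B z f)" using less.prems(2)[of f] by auto
    next
      fix J assume "J \<subseteq> E"
      then show "card J \<le> k * card (\<Union> (?B z ` J))" by (rule z(2))
    qed
    then obtain t where "\<forall>f\<in>E. t f \<in> ?B z f" "\<forall>v. card {f \<in> E. t f = v} \<le> k" by (elim exE conjE)
    then show ?thesis by (intro exI[of _ t]) (auto split: if_splits)
  qed
qed

section \<open>The parameters at a fixed number of colors\<close>

definition Psep :: "'a set \<Rightarrow> 'a set set \<Rightarrow> nat \<Rightarrow> bool" where
  "Psep V E k \<longleftrightarrow> (\<forall>L. list_assignment V k L \<and> separated E L \<longrightarrow>
        (\<exists>\<phi>. proper_coloring E \<phi> \<and> (\<forall>v\<in>V. \<phi> v \<in> L v)))"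

definition Pad :: "'a set \<Rightarrow> 'a set set \<Rightarrow> nat \<Rightarrow> bool" where
  "Pad V E k \<longleftrightarrow> (\<forall>f L. list_assignment V k L \<longrightarrow>
        (\<exists>c. adapted_coloring E f c \<and> (\<forall>v\<in>V. c v \<in> L v)))"

definition Pconf :: "'a set \<Rightarrow> 'a set set \<Rightarrow> nat \<Rightarrow> bool" where
  "Pconf V E k \<longleftrightarrow> (\<forall>c. local_partition V E k c \<longrightarrow> conflict_colorable V E k c)"

lemma exists_avoiding_color:
  fixes F :: "nat set"
  assumes "finite F" "card F < k"
  obtains a where "a \<in> {1..k}" "a \<notin> F"
proof -
  have "\<not> {1..k} \<subseteq> F" using card_mono[OF assms(1), of "{1..k}"] assms(2) by auto
  then show ?thesis using that by blast
qed

text \<open>An orientation with small outdegree colors any local partition: each vertex avoids the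
  conflicts of its own out-edges.\<close>

lemma Pconf_of_sparse:
  assumes sg: "sgraph V E"
    and sparse: "\<And>S. S \<subseteq> V \<Longrightarrow> card {e \<in> E. e \<subseteq> S} \<le> k * card S"
  shows "Pconf V E (Suc k)"
  unfolding Pconf_def
proof (intro allI impI)
  fix c assume lp: "local_partition V E (Suc k) c"
  have fE: "finite E" by (rule sgraph_finite_edges[OF sg])
  have "\<exists>t. (\<forall>e\<in>E. t e \<in> id e) \<and> (\<forall>v. card {e \<in> E. t e = v} \<le> k)"
  proof (rule hall_capacity[OF fE])
    fix e assume "e \<in> E" then show "finite (id e)" using sg by (auto elim!: sgraphE)
  next
    fix J assume J: "J \<subseteq> E"
    have "\<Union> J \<subseteq> V" using J sg by (auto elim!: sgraphE dest!: subsetD)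
    then have "card {e \<in> E. e \<subseteq> \<Union> J} \<le> k * card (\<Union> J)" by (rule sparse)
    moreover have "card J \<le> card {e \<in> E. e \<subseteq> \<Union> J}" using J fE by (intro card_mono) auto
    ultimately show "card J \<le> k * card (\<Union> (id ` J))" by simp
  qed
  then obtain t where t: "\<And>e. e \<in> E \<Longrightarrow> t e \<in> e" "\<And>v. card {e \<in> E. t e = v} \<le> k" by auto
  have "\<exists>a. a \<in> {1..Suc k} \<and> a \<notin> c v ` {e \<in> E. t e = v}" for v
  proof -
    have "card (c v ` {e \<in> E. t e = v}) < Suc k"
      using card_image_le[of "{e \<in> E. t e = v}" "c v"] fE t(2)[of v] by simp
    then show ?thesis using exists_avoiding_color[of "c v ` {e \<in> E. t e = v}" "Suc k"] fE by auto
  qed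
  then obtain \<phi> where \<phi>: "\<And>v. \<phi> v \<in> {1..Suc k}" "\<And>v. \<phi> v \<notin> c v ` {e \<in> E. t e = v}" by metis
  show "conflict_colorable V E (Suc k) c"
    unfolding conflict_colorable_def
  proof (intro exI[of _ \<phi>] conjI ballI allI impI notI)
    fix x y assume xy: "{x, y} \<in> E" "\<phi> x = c x {x, y} \<and> \<phi> y = c y {x, y}"
    then have "t {x, y} = x \<or> t {x, y} = y" using t(1) by fastforce
    then show False using \<phi>(2) xy by (metis (mono_tags, lifting) image_eqI mem_Collect_eq)
  qed (use \<phi>(1) in auto)
qed

text \<open>Color \<open>i\<close> of the conflict coloring at \<open>v\<close> stands for the \<open>i\<close>-th color of \<open>L v\<close>; an edge whose
  color is missing from a list gets an arbitrary conflict there.\<close>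

lemma Pconf_imp_Pad:
  assumes "Pconf V E k" "sgraph V E" "1 \<le> k"
  shows "Pad V E k"
  unfolding Pad_def
proof (intro allI impI)
  fix f L assume L: "list_assignment V k L"
  have "\<exists>h. bij_betw h {1..k} (L v)" if "v \<in> V" for v
    using L that unfolding list_assignment_def by (intro finite_same_card_bij) auto
  then obtain h where h: "\<And>v. v \<in> V \<Longrightarrow> bij_betw (h v) {1..k} (L v)" by metis
  define c where "c v e = (if f e \<in> L v then inv_into {1..k} (h v) (f e) else 1)" for v and e :: "'a set"
  have "local_partition V E k c"
    unfolding local_partition_def
  proof (intro ballI impI)
    fix v e assume "v \<in> V" "e \<in> E" "v \<in> e"
    have "inv_into {1..k} (h v) (f e) \<in> {1..k}" if "f e \<in> L v"
      using h[OF \<open>v \<in> V\<close>] that by (intro inv_into_into) (auto simp: bij_betw_def)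
    then show "c v e \<in> {1..k}" using assms(3) by (auto simp: c_def)
  qed
  then obtain \<phi> where \<phi>: "\<forall>v\<in>V. \<phi> v \<in> {1..k}"
      "\<And>x y. {x, y} \<in> E \<Longrightarrow> \<not> (\<phi> x = c x {x, y} \<and> \<phi> y = c y {x, y})"
    using assms(1) unfolding Pconf_def conflict_colorable_def by blast
  have hL: "h v (\<phi> v) \<in> L v" if "v \<in> V" for v
    using h[OF that] \<phi>(1) that by (auto simp: bij_betw_def)
  have "c v e = \<phi> v" if "v \<in> V" "f e = h v (\<phi> v)" for v e
    using h[OF that(1)] \<phi>(1) that hL by (simp add: c_def bij_betw_def)
  then have "adapted_coloring E f (\<lambda>v. h v (\<phi> v))"
    unfolding adapted_coloring_def using \<phi>(2) sgraphD[OF assms(2)] by metis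
  then show "\<exists>c. adapted_coloring E f c \<and> (\<forall>v\<in>V. c v \<in> L v)" using hL by blast
qed

text \<open>Each edge receives a color common to the lists of its ends, if there is one. Separation
  makes that color unique, so equal colors at the two ends would also be the color of the
  edge.\<close>

lemma Pad_imp_Psep:
  assumes "Pad V E k" "sgraph V E"
  shows "Psep V E k"
  unfolding Psep_def
proof (intro allI impI)
  fix L assume L: "list_assignment V k L \<and> separated E L"
  define f where "f e = (SOME a. \<forall>v\<in>e. a \<in> L v)" for e
  obtain c where c: "adapted_coloring E f c" "\<forall>v\<in>V. c v \<in> L v"
    using assms L unfolding Pad_def by blast
  have "c x \<noteq> c y" if xy: "{x, y} \<in> E" for x y
  proof
    assume eq: "c x = c y"
    have V: "x \<in> V" "y \<in> V" using sgraphD[OF assms(2) xy] by auto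
    have "c x \<in> L x" "c x \<in> L y" using V c(2) eq by (blast, metis)
    then have "\<forall>v\<in>{x,y}. c x \<in> L v" by simp
    then have "\<forall>v\<in>{x,y}. f {x, y} \<in> L v" unfolding f_def by (rule someI)
    then have "c x \<in> L x \<inter> L y" "f {x, y} \<in> L x \<inter> L y" using \<open>c x \<in> L x\<close> \<open>c x \<in> L y\<close> by auto
    moreover have "card (L x \<inter> L y) \<le> 1" "finite (L x \<inter> L y)"
      using L xy V unfolding separated_def list_assignment_def by auto
    ultimately have "c x = f {x, y}" by (metis One_nat_def card_le_Suc0_iff_eq)
    then show False using c(1) xy eq unfolding adapted_coloring_def by metis
  qed
  then show "\<exists>\<phi>. proper_coloring E \<phi> \<and> (\<forall>v\<in>V. \<phi> v \<in> L v)"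
    using c(2) unfolding proper_coloring_def by blast
qed

text \<open>The component of \<open>u\<close> in the subgraph induced by \<open>S\<close>; by
  reflexivity \<open>u\<close> belongs to it even when it is not in \<open>S\<close>.\<close>

definition reach :: "'a set set \<Rightarrow> 'a set \<Rightarrow> 'a \<Rightarrow> 'a set" where
  "reach E S u = {w. (u, w) \<in> {(x, y). x \<in> S \<and> y \<in> S \<and> {x, y} \<in> E}\<^sup>*}"

lemma self_in_reach: "u \<in> reach E S u"
  by (simp add: reach_def)

lemma reach_subset: "u \<in> S \<Longrightarrow> reach E S u \<subseteq> S"
  unfolding reach_def by (auto elim: rtranclE)

lemma reach_step: "w \<in> reach E S u \<Longrightarrow> w \<in> S \<Longrightarrow> x \<in> S \<Longrightarrow> {w, x} \<in> E \<Longrightarrow> x \<in> reach E S u"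
  unfolding reach_def by (auto intro: rtrancl_into_rtrancl)

text \<open>Walks from \<open>u\<close> in \<open>S\<close> never leave the component, so it is
  connected on its own. Contraction asks for exactly this.\<close>

lemma reach_reach: "reach E S u \<subseteq> reach E (reach E S u) u"
proof
  fix w assume "w \<in> reach E S u"
  then have "(u, w) \<in> {(x, y). x \<in> S \<and> y \<in> S \<and> {x, y} \<in> E}\<^sup>*" by (simp add: reach_def)
  then show "w \<in> reach E (reach E S u) u"
  proof (induction rule: rtrancl_induct)
    case (step a b)
    then have "a \<in> reach E S u" by (simp add: reach_def)
    moreover from step this have "b \<in> reach E S u" by (auto intro: reach_step)
    ultimately show ?case using step by (auto intro: reach_step)
  qed (rule self_in_reach)
qed

section \<open>Sparsity of planar graphs\<close>

text \<open>A drawing in which vertices and edges are arbitrary closed path-connected sets. Unlike plane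
  drawings, these are obviously closed under contraction.\<close>

definition fat_drawing :: "'a set \<Rightarrow> 'a set set \<Rightarrow> ('a \<Rightarrow> complex set) \<Rightarrow> ('a set \<Rightarrow> complex set) \<Rightarrow> bool" where
  "fat_drawing V E X G \<longleftrightarrow>
     (\<forall>v\<in>V. closed (X v) \<and> path_connected (X v)) \<and>
     (\<forall>u\<in>V. \<forall>v\<in>V. u \<noteq> v \<longrightarrow> X u \<inter> X v = {}) \<and>
     (\<forall>e\<in>E. closed (G e) \<and> path_connected (G e)) \<and>
     (\<forall>e\<in>E. \<forall>v\<in>V. G e \<inter> X v \<noteq> {} \<longleftrightarrow> v \<in> e) \<and>
     (\<forall>e\<in>E. \<forall>e'\<in>E. e \<noteq> e' \<longrightarrow> G e \<inter> G e' \<subseteq> \<Union> (X ` (e \<inter> e')))"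

definition fat_graph :: "'a set \<Rightarrow> 'a set set \<Rightarrow> bool" where
  "fat_graph V E \<longleftrightarrow> sgraph V E \<and> (\<exists>X G. fat_drawing V E X G)"

lemma fat_graph_sgraph: "fat_graph V E \<Longrightarrow> sgraph V E"
  by (simp add: fat_graph_def)

lemma planar_imp_fat_graph:
  assumes "planar_graph V E"
  shows "fat_graph V E"
proof -
  have sg: "sgraph V E" using assms by (auto simp: planar_graph_def simple_graph_def sgraph_def)
  obtain p \<gamma> where d: "plane_drawing V E p \<gamma>" using assms by (auto simp: planar_graph_def)
  have inj: "inj_on p V" using d by (simp add: plane_drawing_def)
  have "fat_drawing V E (\<lambda>v. {p v}) (\<lambda>e. path_image (\<gamma> e))"
    unfolding fat_drawing_def
  proof (intro conjI ballI impI)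
    fix u v assume "u \<in> V" "v \<in> V" "u \<noteq> v"
    then show "{p u} \<inter> {p v} = {}" using inj by (auto simp: inj_on_def)
  next
    fix e assume "e \<in> E"
    then have "arc (\<gamma> e)" using d by (simp add: plane_drawing_def)
    then show "closed (path_image (\<gamma> e))" "path_connected (path_image (\<gamma> e))"
      by (auto simp: closed_arc_image path_connected_arc_image)
  next
    fix e v assume "e \<in> E" "v \<in> V"
    then have "path_image (\<gamma> e) \<inter> p ` V = p ` e" "e \<subseteq> V"
      using d sg by (auto simp: plane_drawing_def elim!: sgraphE)
    then have "p v \<in> path_image (\<gamma> e) \<longleftrightarrow> p v \<in> p ` e" using \<open>v \<in> V\<close> by blast
    also have "\<dots> \<longleftrightarrow> v \<in> e" using inj \<open>e \<subseteq> V\<close> \<open>v \<in> V\<close> by (metis inj_on_image_mem_iff)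
    finally show "path_image (\<gamma> e) \<inter> {p v} \<noteq> {} \<longleftrightarrow> v \<in> e" by simp
  next
    fix e e' assume "e \<in> E" "e' \<in> E" "e \<noteq> e'"
    then have "path_image (\<gamma> e) \<inter> path_image (\<gamma> e') \<subseteq> p ` (e \<inter> e')"
      using d by (simp add: plane_drawing_def)
    then show "path_image (\<gamma> e) \<inter> path_image (\<gamma> e') \<subseteq> (\<Union>v\<in>e \<inter> e'. {p v})" by auto
  qed auto
  then show ?thesis using sg by (auto simp: fat_graph_def)
qed

lemma fat_graph_subgraph:
  assumes "fat_graph V E" "V' \<subseteq> V" "E' \<subseteq> E" "\<And>e. e \<in> E' \<Longrightarrow> e \<subseteq> V'"
  shows "fat_graph V' E'"
proof -
  obtain X G where "fat_drawing V E X G" using assms(1) by (auto simp: fat_graph_def)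
  then have "fat_drawing V' E' X G"
    using assms(2,3) unfolding fat_drawing_def by (simp add: subset_iff)
  moreover have "sgraph V' {e \<in> E. e \<subseteq> V'}"
    by (rule sgraph_induced[OF fat_graph_sgraph[OF assms(1)] assms(2)])
  then have "sgraph V' E'" by (rule sgraph_mono) (use assms(3,4) in auto)
  ultimately show ?thesis by (auto simp: fat_graph_def)
qed

text \<open>The graph obtained by contracting \<open>W\<close> to its element \<open>u\<close>.\<close>

definition contract :: "'a set \<Rightarrow> 'a set set \<Rightarrow> 'a set \<Rightarrow> 'a \<Rightarrow> 'a set set" where
  "contract V E W u = {e \<in> E. e \<inter> W = {}} \<union> {{u, x} | x. x \<in> V - W \<and> (\<exists>w\<in>W. {w, x} \<in> E)}"

text \<open>The new fat vertex unites all fat vertices and fat edges inside \<open>W\<close>; it is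
  path-connected because \<open>W\<close> is connected. Where several edges lead from
  \<open>W\<close> to one vertex, one of them is kept.\<close>

lemma fat_graph_contract:
  assumes fat: "fat_graph V E" and W: "W \<subseteq> V" "u \<in> W" "W \<subseteq> reach E W u"
  shows "fat_graph (insert u (V - W)) (contract V E W u)"
proof -
  obtain X G where "fat_drawing V E X G" using fat by (auto simp: fat_graph_def)
  then have X: "\<And>v. v \<in> V \<Longrightarrow> closed (X v)" "\<And>v. v \<in> V \<Longrightarrow> path_connected (X v)"
      "\<And>u v. u \<in> V \<Longrightarrow> v \<in> V \<Longrightarrow> u \<noteq> v \<Longrightarrow> X u \<inter> X v = {}"
    and G: "\<And>e. e \<in> E \<Longrightarrow> closed (G e)" "\<And>e. e \<in> E \<Longrightarrow> path_connected (G e)"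
      "\<And>e v. e \<in> E \<Longrightarrow> v \<in> V \<Longrightarrow> G e \<inter> X v \<noteq> {} \<longleftrightarrow> v \<in> e"
      "\<And>e e'. e \<in> E \<Longrightarrow> e' \<in> E \<Longrightarrow> e \<noteq> e' \<Longrightarrow> G e \<inter> G e' \<subseteq> \<Union> (X ` (e \<inter> e'))"
    unfolding fat_drawing_def by simp_all
  have sg: "sgraph V E" by (rule fat_graph_sgraph[OF fat])
  have fin: "finite W" "finite E" using W(1) sgraph_finite[OF sg] sgraph_finite_edges[OF sg] by (auto intro: finite_subset)
  let ?EW = "{e \<in> E. e \<subseteq> W}"
  define U where "U = \<Union> (X ` W) \<union> \<Union> (G ` ?EW)"
  define pick where "pick x = (SOME w. w \<in> W \<and> {w, x} \<in> E)" for x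
  have pick: "pick x \<in> W" "{pick x, x} \<in> E" if "\<exists>w\<in>W. {w, x} \<in> E" for x
    using someI_ex[of "\<lambda>w. w \<in> W \<and> {w, x} \<in> E"] that unfolding pick_def by blast+
  \<comment> \<open>\<open>orig\<close> sends an edge of the contracted graph to the edge of
    \<open>E\<close> whose fat set draws it. For a new edge \<open>{u, x}\<close> this is the chosen
    \<open>{pick x, x}\<close>.\<close>
  define orig where "orig e = (if u \<in> e then {pick (SOME x. x \<in> e - {u}), SOME x. x \<in> e - {u}} else e)" for e
  let ?X = "X(u := U)" and ?G = "\<lambda>e. G (orig e)"
  let ?V = "insert u (V - W)" and ?E = "contract V E W u"
  have orig_new: "orig {u, x} = {pick x, x}" if "x \<noteq> u" for x
  proof -
    have "{u, x} - {u} = {x}" using that by auto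
    then have "(SOME y. y \<in> {u, x} - {u}) = x" by simp
    then show ?thesis by (simp add: orig_def)
  qed
  have cases: "(e \<in> E \<and> e \<inter> W = {} \<and> orig e = e) \<or>
      (\<exists>x. x \<in> V - W \<and> e = {u, x} \<and> pick x \<in> W \<and> orig e = {pick x, x} \<and> {pick x, x} \<in> E)" if eE: "e \<in> ?E" for e
    using eE
  proof (cases "e \<in> E \<and> e \<inter> W = {}")
    case True
    then show ?thesis using W(2) by (auto simp: orig_def)
  next
    case False
    then obtain x where x: "x \<in> V - W" "e = {u, x}" "\<exists>w\<in>W. {w, x} \<in> E"
      using eE by (auto simp: contract_def)
    then have "x \<noteq> u" using W(2) by auto
    then show ?thesis using x pick[OF x(3)] orig_new by blast
  qed
  have origE: "orig e \<in> E" if "e \<in> ?E" for e using cases[OF that] by auto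
  have orig_mem: "v \<in> orig e \<longleftrightarrow> v \<in> e" if "e \<in> ?E" "v \<in> V - W" for e v
    using cases[OF that(1)] that(2) W(2) by auto
  have orig_W: "orig e \<inter> W \<noteq> {} \<longleftrightarrow> u \<in> e" if "e \<in> ?E" for e
    using cases[OF that] W(2) by auto
  have orig_not_sub: "\<not> orig e \<subseteq> W" if "e \<in> ?E" for e
  proof -
    have "e \<noteq> {}" if "e \<in> E" for e using sgraphE[OF sg that] by auto
    then show ?thesis using cases[OF that] by auto
  qed
  have orig_inj: "orig e \<noteq> orig e'" if "e \<in> ?E" "e' \<in> ?E" "e \<noteq> e'" for e e'
  proof
    assume eq: "orig e = orig e'"
    have "e \<inter> (V - W) = e' \<inter> (V - W)"
      using orig_mem[OF that(1)] orig_mem[OF that(2)] eq by blast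
    moreover have "u \<in> e \<longleftrightarrow> u \<in> e'" using orig_W that eq by metis
    moreover have "e \<subseteq> insert u (V - W)" if "e \<in> ?E" for e
    proof -
      have "e \<subseteq> V" if "e \<in> E" for e using sgraphE[OF sg that] by auto
      then show ?thesis using cases[OF that] by auto
    qed
    ultimately show False using that by blast
  qed
  have Xsub: "X v \<subseteq> U" if "v \<in> W" for v using that by (auto simp: U_def)
  have U_disj: "U \<inter> X v = {}" if "v \<in> V - W" for v
  proof -
    have "X w \<inter> X v = {}" if "w \<in> W" for w using X(3)[of w v] that \<open>v \<in> V - W\<close> W(1) by auto
    moreover have "G e \<inter> X v = {}" if "e \<in> ?EW" for e using G(3)[of e v] that \<open>v \<in> V - W\<close> by auto
    ultimately show ?thesis unfolding U_def by blast
  qed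
  have reach_pc: "\<forall>p\<in>X u. \<forall>q\<in>X w. path_component U p q" if "w \<in> reach E W u" for w
    using that unfolding reach_def mem_Collect_eq
  proof (induction rule: rtrancl_induct)
    case base
    show ?case using X(2)[of u] W Xsub[OF W(2)] by (meson path_component_of_subset path_connected_component subsetD)
  next
    case (step a b)
    then have ab: "a \<in> W" "b \<in> W" "{a, b} \<in> E" by auto
    then have V: "a \<in> V" "b \<in> V" using W by auto
    obtain s where s: "s \<in> G {a,b}" "s \<in> X a" using G(3)[OF ab(3) V(1)] by auto
    obtain t where t: "t \<in> G {a,b}" "t \<in> X b" using G(3)[OF ab(3) V(2)] by auto
    have "G {a,b} \<subseteq> U" using ab by (auto simp: U_def)
    then have st: "path_component U s t"
      using G(2)[OF ab(3)] s t by (meson path_component_of_subset path_connected_component)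
    show ?case
    proof (intro ballI)
      fix p q assume "p \<in> X u" "q \<in> X b"
      have "path_component U t q"
        using X(2)[OF V(2)] t \<open>q \<in> X b\<close> Xsub[OF ab(2)] by (meson path_component_of_subset path_connected_component)
      moreover have "path_component U p s" using step.IH \<open>p \<in> X u\<close> s by blast
      ultimately show "path_component U p q" using st path_component_trans by metis
    qed
  qed
  have pc_U: "path_connected U"
  proof (cases "U = {}")
    case False
    have "\<exists>w\<in>W. \<exists>q\<in>X w. path_component U q p" if "p \<in> U" for p
      using that unfolding U_def
    proof
      assume "p \<in> \<Union> (X ` W)"
      then obtain w where w: "w \<in> W" "p \<in> X w" by auto
      then have "path_component U p p" using Xsub[OF w(1)] by (intro path_component_refl) auto
      then show "\<exists>w\<in>W. \<exists>q\<in>X w. path_component (\<Union> (X ` W) \<union> \<Union> (G ` ?EW)) q p"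
        using w by (auto simp: U_def)
    next
      assume "p \<in> \<Union> (G ` ?EW)"
      then obtain e where e: "e \<in> E" "e \<subseteq> W" "p \<in> G e" by auto
      then obtain w where w: "w \<in> e" by (metis insertI1 sg sgraphE)
      then obtain q where q: "q \<in> G e" "q \<in> X w" using G(3)[OF e(1), of w] e(2) W(1) by auto
      have "G e \<subseteq> U" using e by (auto simp: U_def)
      then have "path_component U q p"
        using G(2)[OF e(1)] e(3) q by (meson path_component_of_subset path_connected_component)
      then show "\<exists>w\<in>W. \<exists>q\<in>X w. path_component (\<Union> (X ` W) \<union> \<Union> (G ` ?EW)) q p"
        using w e q by (auto simp: U_def)
    qed
    then have *: "\<forall>p\<in>X u. path_component U p q" if "q \<in> U" for q
      using reach_pc W(3) path_component_trans that by (meson subsetD)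
    \<comment> \<open>Fat vertices may be empty, but then no fat edge can meet them:
      \<open>u\<close> is isolated, so \<open>W = {u}\<close> and \<open>U\<close> is empty.\<close>
    have "X u \<noteq> {}"
    proof
      assume "X u = {}"
      then have "e \<notin> E" if "u \<in> e" for e using G(3)[of e u] that W by auto
      then have "reach E W u = {u}"
        unfolding reach_def by (auto elim: converse_rtranclE)
      then have "W = {u}" using W by auto
      have False if eE: "e \<in> E" "e \<subseteq> W" for e
      proof -
        obtain x y where "x \<noteq> y" "e = {x, y}" by (rule sgraphE[OF sg eE(1)])
        then show False using eE(2) \<open>W = {u}\<close> by auto
      qed
      then have "?EW = {}" by blast
      then have "\<Union> (G ` ?EW) = {}" by (simp only: image_empty Union_empty)
      moreover have "\<Union> (X ` W) = {}" using \<open>W = {u}\<close> \<open>X u = {}\<close> by simp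
      ultimately have "U = {}" unfolding U_def by (simp only: Un_empty)
      then show False using False by simp
    qed
    then obtain p where p: "p \<in> X u" by auto
    show ?thesis
      unfolding path_connected_component
      using * p path_component_sym path_component_trans by metis
  qed (metis path_connected_empty)
  have "fat_drawing ?V ?E ?X ?G"
    unfolding fat_drawing_def
  proof (intro conjI ballI impI)
    fix v assume "v \<in> ?V"
    have "closed U" unfolding U_def using X(1) G(1) W(1) fin by (intro closed_Un closed_UN) auto
    then show "closed (?X v)" "path_connected (?X v)" using \<open>v \<in> ?V\<close> X pc_U by auto
  next
    fix a b assume "a \<in> ?V" "b \<in> ?V" "a \<noteq> b"
    then show "?X a \<inter> ?X b = {}" using X(3)[of a b] U_disj[of a] U_disj[of b] by auto
  next
    fix e assume "e \<in> ?E"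
    then show "closed (?G e)" "path_connected (?G e)" using G(1,2) origE by auto
  next
    fix e v assume e: "e \<in> ?E" and v: "v \<in> ?V"
    show "?G e \<inter> ?X v \<noteq> {} \<longleftrightarrow> v \<in> e"
    proof (cases "v = u")
      case True
      \<comment> \<open>A kept edge has an end outside \<open>W\<close>, so it differs from every
        edge inside \<open>W\<close> and can meet its fat set only at a common end.\<close>
      have Gf: "G (orig e) \<inter> G f = {} \<or> orig e \<inter> W \<noteq> {}" if "f \<in> ?EW" for f
        using G(4)[OF origE[OF e], of f] that orig_not_sub[OF e] by auto
      have GX: "G (orig e) \<inter> X w \<noteq> {} \<longleftrightarrow> w \<in> orig e" if "w \<in> W" for w
        using G(3)[OF origE[OF e]] that W(1) by auto
      have "G (orig e) \<inter> U \<noteq> {} \<longleftrightarrow> orig e \<inter> W \<noteq> {}"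
      proof
        assume "G (orig e) \<inter> U \<noteq> {}"
        then obtain p where p: "p \<in> G (orig e)" "p \<in> U" by blast
        from p(2) consider w where "w \<in> W" "p \<in> X w" | f where "f \<in> ?EW" "p \<in> G f"
          unfolding U_def by blast
        then show "orig e \<inter> W \<noteq> {}"
        proof cases
          case 1
          then have "w \<in> orig e" using GX[OF 1(1)] p(1) by blast
          then show ?thesis using 1(1) by blast
        next
          case 2
          then show ?thesis using Gf[OF 2(1)] p(1) by blast
        qed
      next
        assume "orig e \<inter> W \<noteq> {}"
        then obtain w where "w \<in> W" "w \<in> orig e" by blast
        then show "G (orig e) \<inter> U \<noteq> {}" using GX[of w] Xsub[of w] by blast
      qed
      then show ?thesis using orig_W[OF e] True by simp
    next
      case False
      then have "v \<in> V - W" using v by auto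
      then show ?thesis using G(3)[OF origE[OF e], of v] orig_mem[OF e] False by auto
    qed
  next
    fix e e' assume e: "e \<in> ?E" "e' \<in> ?E" "e \<noteq> e'"
    have "G (orig e) \<inter> G (orig e') \<subseteq> \<Union> (X ` (orig e \<inter> orig e'))"
      using G(4) origE e orig_inj by auto
    also have "\<dots> \<subseteq> \<Union> (?X ` (e \<inter> e'))"
    proof
      fix p assume "p \<in> \<Union> (X ` (orig e \<inter> orig e'))"
      then obtain v where v: "v \<in> orig e" "v \<in> orig e'" "p \<in> X v" by auto
      show "p \<in> \<Union> (?X ` (e \<inter> e'))"
      proof (cases "v \<in> W")
        case True
        then have "u \<in> e \<inter> e'" using orig_W e v by auto
        then show ?thesis using Xsub[OF True] v by (intro UN_I[of u]) auto
      next
        case False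
        have "v \<in> V" using sgraphE[OF sg origE[OF e(1)]] v(1) by (metis insertE singletonD)
        then have "v \<in> e \<inter> e'" "v \<noteq> u" using orig_mem e v False W(2) by auto
        then show ?thesis using v by (intro UN_I[of v]) auto
      qed
    qed
    finally show "?G e \<inter> ?G e' \<subseteq> \<Union> (?X ` (e \<inter> e'))" .
  qed
  moreover have "sgraph ?V ?E"
    unfolding sgraph_def
  proof (intro conjI ballI)
    show "finite ?V" using sgraph_finite[OF sg] by simp
    fix e assume "e \<in> ?E"
    from cases[OF this] show "\<exists>x\<in>?V. \<exists>y\<in>?V. x \<noteq> y \<and> e = {x, y}"
    proof (elim disjE exE conjE)
      assume "e \<in> E" and eW: "e \<inter> W = {}"
      then obtain x y where xy: "x \<in> V" "y \<in> V" "x \<noteq> y" "e = {x, y}" using sgraphE[OF sg] by metis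
      then have "x \<in> ?V" "y \<in> ?V" using eW by auto
      then show ?thesis using xy by blast
    next
      fix x assume "x \<in> V - W" "e = {u, x}"
      then have "x \<in> ?V" "u \<noteq> x" using W(2) by auto
      then show ?thesis using \<open>e = {u, x}\<close> by blast
    qed
  qed
  ultimately show ?thesis by (auto simp: fat_graph_def)
qed

lemma fat_graph_no_K33:
  assumes fat: "fat_graph V E"
    and dist: "distinct [x0, x1, x2, y0, y1, y2]"
    and edges: "\<And>x y. x \<in> {x0, x1, x2} \<Longrightarrow> y \<in> {y0, y1, y2} \<Longrightarrow> {x, y} \<in> E"
  shows False
proof -
  obtain X G where "fat_drawing V E X G" using fat by (auto simp: fat_graph_def)
  then have X: "\<And>v. v \<in> V \<Longrightarrow> closed (X v)" "\<And>v. v \<in> V \<Longrightarrow> path_connected (X v)"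
      "\<And>u v. u \<in> V \<Longrightarrow> v \<in> V \<Longrightarrow> u \<noteq> v \<Longrightarrow> X u \<inter> X v = {}"
    and G: "\<And>e. e \<in> E \<Longrightarrow> closed (G e)" "\<And>e. e \<in> E \<Longrightarrow> path_connected (G e)"
      "\<And>e v. e \<in> E \<Longrightarrow> v \<in> V \<Longrightarrow> G e \<inter> X v \<noteq> {} \<longleftrightarrow> v \<in> e"
      "\<And>e e'. e \<in> E \<Longrightarrow> e' \<in> E \<Longrightarrow> e \<noteq> e' \<Longrightarrow> G e \<inter> G e' \<subseteq> \<Union> (X ` (e \<inter> e'))"
    unfolding fat_drawing_def by simp_all
  define x where "x i = (if i = 0 then x0 else if i = 1 then x1 else x2)" for i :: nat
  define y where "y i = (if i = 0 then y0 else if i = 1 then y1 else y2)" for i :: nat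
  have xy: "{x i, y j} \<in> E" for i j by (rule edges) (auto simp: x_def y_def)
  have V: "x i \<in> V" "y i \<in> V" for i
    using sgraphD[OF fat_graph_sgraph[OF fat] xy] by blast+
  have xne: "x i \<noteq> x j" "y i \<noteq> y j" if "i < 3" "j < 3" "i \<noteq> j" for i j
    using dist that by (auto simp: x_def y_def)
  have xyne: "x i \<noteq> y j" "y j \<noteq> x i" for i j using dist by (auto simp: x_def y_def)
  show False
  proof (rule no_fat_K33[of "\<lambda>i. X (x i)" "\<lambda>i. X (y i)" "\<lambda>i j. G {x i, y j}"])
    fix i j i' j' :: nat
    show "closed (X (x i))" "path_connected (X (x i))" "closed (X (y j))" "path_connected (X (y j))"
      using X V by auto
    show "X (x i) \<inter> X (y j) = {}" using X(3)[OF V(1) V(2)] xyne by simp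
    show "path_connected (G {x i, y j})" using G(2)[OF xy] .
    show "G {x i, y j} \<inter> X (x i) \<noteq> {}" "G {x i, y j} \<inter> X (y j) \<noteq> {}"
      using G(3)[OF xy] V by auto
    assume i: "i < 3"
    { assume "i' < 3" "i \<noteq> i'" then show "X (x i) \<inter> X (x i') = {}" using X(3)[OF V(1) V(1)] xne i by simp }
    assume j: "j < 3"
    { assume "i' < 3" "i' \<noteq> i"
      then show "G {x i, y j} \<inter> X (x i') = {}" using G(3)[OF xy V(1), of i j i'] xne i xyne by auto }
    { assume "j' < 3" "j' \<noteq> j"
      then show "G {x i, y j} \<inter> X (y j') = {}" using G(3)[OF xy V(2), of i j j'] xne j xyne by auto }
    { assume a: "j' < 3" "j' \<noteq> j"
      have eq: "{x i, y j} \<inter> {x i, y j'} = {x i}" and ne: "{x i, y j} \<noteq> {x i, y j'}"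
        using xne(2)[OF a(1) j a(2)] xyne by (auto simp: doubleton_eq_iff)
      then show "G {x i, y j} \<inter> G {x i, y j'} \<subseteq> X (x i)" using G(4)[OF xy xy ne] unfolding eq by simp }
    { assume a: "i' < 3" "i' \<noteq> i"
      have eq: "{x i, y j} \<inter> {x i', y j} = {y j}" and ne: "{x i, y j} \<noteq> {x i', y j}"
        using xne(1)[OF a(1) i a(2)] xyne by (auto simp: doubleton_eq_iff)
      then show "G {x i, y j} \<inter> G {x i', y j} \<subseteq> X (y j)" using G(4)[OF xy xy ne] unfolding eq by simp }
    { assume a: "i' < 3" "j' < 3" "i' \<noteq> i" "j' \<noteq> j"
      have eq: "{x i, y j} \<inter> {x i', y j'} = {}" and ne: "{x i, y j} \<noteq> {x i', y j'}"
        using xne(1)[OF a(1) i a(3)] xne(2)[OF a(2) j a(4)] xyne by (auto simp: doubleton_eq_iff)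
      then show "G {x i, y j} \<inter> G {x i', y j'} = {}" using G(4)[OF xy xy ne] unfolding eq by simp }
  next
    fix j j' :: nat assume "j < 3" "j' < 3" "j \<noteq> j'"
    then show "X (y j) \<inter> X (y j') = {}" using X(3)[OF V(2) V(2)] xne by simp
  qed
qed

section \<open>The edge bound by deletion and contraction\<close>

lemma card_contract_edge:
  assumes sg: "sgraph V E" and uv: "{u, v} \<in> E"
  shows "card (contract V E {u, v} u) + 1 + card (nb E u \<inter> nb E v) = card E"
proof -
  let ?A = "{e \<in> E. e \<inter> {u, v} = {}}" and ?N = "(nb E u \<union> nb E v) - {u, v}"
  have V: "u \<in> V" "v \<in> V" "u \<noteq> v" using sgraphD[OF sg uv] by auto
  have fin: "finite E" "finite (nb E u)" "finite (nb E v)"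
    using sg by (auto simp: sgraph_finite_edges finite_nb)
  \<comment> \<open>Common neighbors of \<open>u\<close> and \<open>v\<close> would give parallel
    edges; the union of the two neighborhoods counts each such pair once.\<close>
  have "contract V E {u, v} u = ?A \<union> (\<lambda>x. {u, x}) ` ?N"
    using sgraphD[OF sg] by (auto simp: contract_def)
  moreover have "card (?A \<union> (\<lambda>x. {u, x}) ` ?N) = card ?A + card ((\<lambda>x. {u, x}) ` ?N)"
    using fin by (intro card_Un_disjoint) auto
  moreover have "card ((\<lambda>x. {u, x}) ` ?N) = card ?N"
    by (intro card_image inj_onI) (auto simp: doubleton_eq_iff)
  ultimately have 1: "card (contract V E {u, v} u) = card ?A + card ?N" by simp
  have "{u, v} \<subseteq> nb E u \<union> nb E v" using uv by (auto simp: insert_commute)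
  then have "card ?N = card (nb E u \<union> nb E v) - card {u, v}"
    by (intro card_Diff_subset) auto
  moreover have "card {u, v} \<le> card (nb E u \<union> nb E v)"
    using \<open>{u, v} \<subseteq> nb E u \<union> nb E v\<close> fin by (intro card_mono) auto
  ultimately have 2: "card ?N + 2 + card (nb E u \<inter> nb E v) = card (nb E u) + card (nb E v)"
    using card_Un_Int[OF fin(2,3)] V by simp
  have "card E = card (?A \<union> ({e \<in> E. u \<in> e} \<union> {e \<in> E. v \<in> e}))" by (rule arg_cong[where f = card]) auto
  also have "\<dots> = card ?A + card ({e \<in> E. u \<in> e} \<union> {e \<in> E. v \<in> e})"
    using fin by (intro card_Un_disjoint) auto
  finally have 3: "card E = card ?A + card ({e \<in> E. u \<in> e} \<union> {e \<in> E. v \<in> e})" .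
  have "e = {u, v}" if e: "e \<in> E" "u \<in> e" "v \<in> e" for e
  proof -
    obtain x y where "e = {x, y}" by (rule sgraphE[OF sg e(1)])
    then show ?thesis using e(2,3) V by auto
  qed
  then have "{e \<in> E. u \<in> e} \<inter> {e \<in> E. v \<in> e} \<subseteq> {{u, v}}" by blast
  moreover have "{u, v} \<in> {e \<in> E. u \<in> e} \<inter> {e \<in> E. v \<in> e}" using uv by simp
  ultimately have "{e \<in> E. u \<in> e} \<inter> {e \<in> E. v \<in> e} = {{u, v}}" by blast
  then have "card ({e \<in> E. u \<in> e} \<union> {e \<in> E. v \<in> e}) + 1 = card (nb E u) + card (nb E v)"
    using card_Un_Int[of "{e \<in> E. u \<in> e}" "{e \<in> E. v \<in> e}"] fin card_incident[OF sg] by simp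
  then show ?thesis using 1 2 3 by linarith
qed

lemma three_elements:
  assumes "card A \<ge> 3"
  obtains a b c where "a \<in> A" "b \<in> A" "c \<in> A" "a \<noteq> b" "a \<noteq> c" "b \<noteq> c"
proof -
  obtain B where "B \<subseteq> A" "card B = 3" using obtain_subset_with_card_n[OF assms] by metis
  then show ?thesis using that by (auto simp: card_3_iff)
qed

text \<open>The complete graph on five vertices meets the bound with equality, so it is refuted only
  together with a further vertex. The component \<open>W\<close> of that vertex off \<open>Q\<close>
  either has three neighbors in \<open>Q\<close>, and contracting it gives K_{3,3}, or it is cut off
  by at most two vertices, and the bounds for the two sides add up to too few edges.\<close>

lemma fat_graph_K5:
  fixes V :: "'a set"
  assumes fat: "fat_graph V E" and n: "card V \<ge> 6" and cardE: "card E + 4 = 3 * card V"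
    and IH: "\<And>(V' :: 'a set) E'. fat_graph V' E' \<Longrightarrow> 2 \<le> card V' \<Longrightarrow> card V' < card V \<Longrightarrow> card E' + 5 \<le> 3 * card V'"
    and Q: "Q \<subseteq> V" "card Q = 5" "\<And>x y. x \<in> Q \<Longrightarrow> y \<in> Q \<Longrightarrow> x \<noteq> y \<Longrightarrow> {x, y} \<in> E"
  shows False
proof -
  have sg: "sgraph V E" by (rule fat_graph_sgraph[OF fat])
  have fin: "finite V" "finite E" "finite Q"
    using sg Q(1) by (auto simp: sgraph_finite sgraph_finite_edges intro: finite_subset[OF Q(1) sgraph_finite])
  have "\<not> V \<subseteq> Q" using n Q(2) card_mono[OF fin(3), of V] by auto
  then obtain u where u: "u \<in> V" "u \<notin> Q" by blast
  define W where "W = reach E (V - Q) u"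
  define A where "A = {q \<in> Q. \<exists>w\<in>W. {w, q} \<in> E}"
  have W: "u \<in> W" "W \<subseteq> V - Q" "W \<subseteq> reach E W u"
    using self_in_reach[of u E] reach_subset[of u "V - Q" E] reach_reach[of E "V - Q" u] u by (auto simp: W_def)
  have A: "A \<subseteq> Q" by (auto simp: A_def)
  have finWA: "finite W" "finite A" using W(2) A fin by (auto intro: finite_subset)
  have out: "x \<in> W \<union> A" if "w \<in> W" "{w, x} \<in> E" for w x
  proof (cases "x \<in> Q")
    case True then show ?thesis using that by (auto simp: A_def)
  next
    case False
    then have "x \<in> V - Q" using sgraphD[OF sg that(2)] by simp
    moreover have "w \<in> V - Q" using that(1) W(2) by auto
    ultimately show ?thesis using that reach_step unfolding W_def by fast
  qed
  show False
  proof (cases "card A \<ge> 3")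
    case True
    then obtain a b c where abc: "a \<in> A" "b \<in> A" "c \<in> A" "a \<noteq> b" "a \<noteq> c" "b \<noteq> c" by (rule three_elements)
    have "card (Q - {a,b,c}) = 2" using abc A Q(2) by (subst card_Diff_subset) auto
    then obtain p q where pq: "Q - {a,b,c} = {p,q}" "p \<noteq> q" by (auto simp: card_2_iff)
    have fat': "fat_graph (insert u (V - W)) (contract V E W u)"
      using fat_graph_contract[OF fat _ W(1,3)] W(2) by blast
    have uA: "{u, z} \<in> contract V E W u" if "z \<in> A" for z
    proof -
      have "z \<in> V - W" using that A W(2) Q(1) by blast
      moreover have "\<exists>w\<in>W. {w, z} \<in> E" using that by (simp add: A_def)
      ultimately show ?thesis by (auto simp: contract_def)
    qed
    have QQ: "{y, z} \<in> contract V E W u" if "y \<in> Q" "z \<in> Q" "y \<noteq> z" for y z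
      using Q(3)[OF that] that W(2) by (auto simp: contract_def)
    have pqQ: "p \<in> Q" "q \<in> Q" "p \<notin> {a,b,c}" "q \<notin> {a,b,c}" using pq(1) by blast+
    show False
    proof (rule fat_graph_no_K33[OF fat', of u p q a b c])
      show "distinct [u, p, q, a, b, c]" using abc pqQ pq(2) A u(2) by auto
      fix x y assume "x \<in> {u, p, q}" "y \<in> {a, b, c}"
      then show "{x, y} \<in> contract V E W u"
        using uA[of y] QQ[of x y] abc A pqQ by blast
    qed
  next
    case False
    let ?E1 = "{e \<in> E. e \<subseteq> W \<union> A}" and ?E2 = "{e \<in> E. e \<subseteq> V - W}"
    have cover: "E = ?E1 \<union> ?E2"
    proof -
      have "e \<subseteq> W \<union> A \<or> e \<subseteq> V - W" if eE: "e \<in> E" for e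
      proof -
        obtain x y where e: "x \<in> V" "y \<in> V" "e = {x, y}" by (rule sgraphE[OF sg eE])
        have "{y, x} \<in> E" "{x, y} \<in> E" using eE e by (simp_all add: insert_commute)
        then show ?thesis using out[of x y] out[of y x] e by auto
      qed
      then show ?thesis by blast
    qed
    have cUI: "card E + card (?E1 \<inter> ?E2) = card ?E1 + card ?E2"
      using card_Un_Int[of ?E1 ?E2] fin cover by simp
    have WV: "W \<subseteq> V" using W(2) by auto
    have cVW: "card (V - W) + card W = card V"
      using WV fin finWA by (metis card_Diff_subset card_mono le_add_diff_inverse2)
    have w1: "card W \<ge> 1" using W(1) finWA by (auto simp: Suc_le_eq card_gt_0_iff)
    have "Q \<subseteq> V - W" using Q(1) W(2) by auto
    then have "card (V - W) \<ge> 5" using Q(2) fin card_mono[of "V - W" Q] by simp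
    then have V5: "card (V - W) \<ge> 5" .
    have E2: "card ?E2 + 5 \<le> 3 * card (V - W)"
    proof (rule IH)
      show "fat_graph (V - W) ?E2" by (rule fat_graph_subgraph[OF fat]) auto
      show "2 \<le> card (V - W)" "card (V - W) < card V" using V5 w1 cVW by linarith+
    qed
    have AW: "card (W \<union> A) = card W + card A"
      using finWA W(2) A by (intro card_Un_disjoint) auto
    have "card A < 5" using False by simp
    have "card W + card A < card V" using V5 False cVW by linarith
    then have lt: "card (W \<union> A) < card V" using AW by simp
    have E1: "card ?E1 + 5 \<le> 3 * (card W + card A)" if ge: "card W + card A \<ge> 2"
      unfolding AW[symmetric]
    proof (rule IH[OF _ _ lt])
      have "W \<union> A \<subseteq> V" using WV A Q(1) by blast
      then show "fat_graph (W \<union> A) ?E1" by (rule fat_graph_subgraph[OF fat]) auto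
      show "2 \<le> card (W \<union> A)" using ge AW by simp
    qed
    \<comment> \<open>Compared with \<open>3 * n\<close>, the two bounds lose 10 and gain
      \<open>3 * a\<close>, so \<open>3 * n - 4\<close> edges force \<open>a = 2\<close>. But then
      the edge between the two vertices of \<open>A\<close> is counted on both sides.\<close>
    have count: False if "(e::nat) + i = e1 + e2" "e2 + 5 \<le> 3 * vw" "e1 + 5 \<le> 3 * (w + a)" "vw + w = n"
      "e + 4 = 3 * n" "a \<le> 2" and i: "a = 2 \<Longrightarrow> 1 \<le> i" for e i e1 e2 vw w a n
    proof -
      have "6 + i \<le> 3 * a" using that(1-5) by (simp add: algebra_simps)
      then show False using \<open>a \<le> 2\<close> i by (cases "a = 2") auto
    qed
    show False
    proof (cases "card A = 0 \<and> card W = 1")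
      \<comment> \<open>A single isolated vertex is too small for the induction hypothesis, but it
        carries no edges.\<close>
      case True
      then obtain w where "W = {w}" "A = {}" using finWA by (auto simp: card_1_singleton_iff)
      then have "?E1 = {}" using sgraphE[OF sg] by (auto elim!: sgraphE[OF sg])
      then have E10: "card ?E1 = 0" by (simp only: card.empty)
      have count0: False if "(e::nat) + i = 0 + e2" "e2 + 5 \<le> 3 * vw" "vw + 1 = n" "e + 4 = 3 * n" for e i e2 vw n
        using that by linarith
      show False
        by (rule count0[OF cUI[unfolded E10] E2 cVW[unfolded conjunct2[OF True]] cardE])
    next
      case nt: False
      then have ge: "2 \<le> card W + card A" using w1 by linarith
      have "1 \<le> card (?E1 \<inter> ?E2)" if A2: "card A = 2"
      proof -
        obtain a b where ab: "A = {a,b}" "a \<noteq> b" using A2 by (auto simp: card_2_iff)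
        then have "{a,b} \<in> ?E1 \<inter> ?E2" using Q(3)[of a b] A W(2) Q(1) by auto
        then have "?E1 \<inter> ?E2 \<noteq> {}" by blast
        moreover have "finite (?E1 \<inter> ?E2)" using fin by auto
        ultimately show ?thesis by (metis One_nat_def Suc_leI card_gt_0_iff)
      qed
      moreover have "card A \<le> 2" using False by linarith
      ultimately show False using count[OF cUI E2 E1[OF ge] cVW cardE] by blast
    qed
  qed
qed

text \<open>A minimal counterexample, thinned to exactly \<open>3 * card V - 4\<close> edges, has
  minimum degree 4, by deleting a vertex, and each of its edges lies in three triangles, by
  contracting the edge. Averaging gives a vertex of degree 4 or 5, whose neighborhood yields a
  complete graph on five vertices or K_{3,3}.\<close>

theorem fat_graph_edges:
  fixes V :: "'a set"
  assumes "fat_graph V E" "2 \<le> card V"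
  shows "card E + 5 \<le> 3 * card V"
  using assms
proof (induction "card V" arbitrary: V E rule: less_induct)
  case less
  show ?case
  proof (rule ccontr)
    assume "\<not> ?thesis"
    then have "3 * card V - 4 \<le> card E" by linarith
    then obtain E0 where E0: "E0 \<subseteq> E" "card E0 = 3 * card V - 4" using obtain_subset_with_card_n by metis
    have sgE: "sgraph V E" by (rule fat_graph_sgraph[OF less.prems(1)])
    have fat: "fat_graph V E0"
    proof (rule fat_graph_subgraph[OF less.prems(1) order_refl E0(1)])
      fix e assume "e \<in> E0"
      then have "e \<in> E" using E0(1) by blast
      then show "e \<subseteq> V" by (auto elim: sgraphE[OF sgE])
    qed
    have sg: "sgraph V E0" by (rule fat_graph_sgraph[OF fat])
    have fin: "finite V" "finite E0" using sg by (auto simp: sgraph_finite sgraph_finite_edges)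
    have cE: "card E0 + 4 = 3 * card V" using E0(2) less.prems(2) by simp
    have IH: "card E' + 5 \<le> 3 * card V'" if "fat_graph V' E'" "2 \<le> card V'" "card V' < card V" for V' :: "'a set" and E'
      using less.hyps that by blast
    have n3: "card V \<ge> 3"
    proof (rule ccontr)
      assume "\<not> ?thesis"
      then have V2: "card V = 2" using less.prems(2) by simp
      have "e = V" if "e \<in> E0" for e
        using sgraphE[OF sg that] V2 fin by (metis card_2_iff card_subset_eq empty_subsetI insert_subset)
      then have "E0 \<subseteq> {V}" by blast
      then have "card E0 \<le> 1" using card_mono[of "{V}" E0] by simp
      then show False using cE V2 by simp
    qed
    have deg: "card (nb E0 v) \<ge> 4" if v: "v \<in> V" for v
    proof -
      have "fat_graph (V - {v}) {e \<in> E0. v \<notin> e}"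
        by (rule fat_graph_subgraph[OF fat]) (auto elim: sgraphE[OF sg])
      moreover have "card (V - {v}) + 1 = card V" using v fin(1) by (metis Suc_eq_plus1 card_Suc_Diff1)
      ultimately have "card {e \<in> E0. v \<notin> e} + 5 \<le> 3 * card (V - {v})"
        by (intro IH) (use n3 in linarith)+
      then show ?thesis using card_edges_remove[OF sg, of v] cE \<open>card (V - {v}) + 1 = card V\<close> by linarith
    qed
    have tri: "card (nb E0 u \<inter> nb E0 v) \<ge> 3" if uv: "{u, v} \<in> E0" for u v
    proof -
      have V: "u \<in> V" "v \<in> V" "u \<noteq> v" using sgraphD[OF sg uv] by auto
      have eq: "insert u (V - {u, v}) = V - {v}" using V by auto
      have "{u, v} \<subseteq> reach E0 {u, v} u"
        using self_in_reach[of u] reach_step[OF self_in_reach, of u "{u, v}" v] uv by blast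
      then have "fat_graph (V - {v}) (contract V E0 {u, v} u)"
        using fat_graph_contract[OF fat, of "{u, v}" u] V eq by auto
      moreover have c: "card (V - {v}) + 1 = card V" using V(2) fin(1) by (metis Suc_eq_plus1 card_Suc_Diff1)
      ultimately have "card (contract V E0 {u, v} u) + 5 \<le> 3 * card (V - {v})"
        by (intro IH) (use n3 in linarith)+
      then show ?thesis using card_contract_edge[OF sg uv] cE c by linarith
    qed
    have "\<exists>v\<in>V. card (nb E0 v) \<le> 5"
    proof (rule ccontr)
      assume "\<not> ?thesis"
      then have "(\<Sum>v\<in>V. 6) \<le> (\<Sum>v\<in>V. card (nb E0 v))" by (intro sum_mono) auto
      then show False using handshake[OF sg] cE by simp
    qed
    then obtain v where v: "v \<in> V" "card (nb E0 v) \<le> 5" by auto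
    let ?N = "nb E0 v"
    have finN: "finite ?N" by (rule finite_nb[OF sg])
    have vN: "v \<notin> ?N" and NV: "?N \<subseteq> V" using nb_subset[OF sg, of v] by blast+
    have NN: "card (nb E0 a \<inter> ?N) \<ge> 3" if "a \<in> ?N" for a
      using tri[of v a] that by (simp add: Int_commute)
    have aN: "nb E0 a \<inter> ?N \<subseteq> ?N - {a}" for a using nb_subset[OF sg, of a] by blast
    have "card ?N = 4 \<or> card ?N = 5" using deg[OF v(1)] v(2) by linarith
    then show False
    proof
      assume N4: "card ?N = 4"
      have adj: "{a, b} \<in> E0" if "a \<in> ?N" "b \<in> ?N" "a \<noteq> b" for a b
      proof -
        have "nb E0 a \<inter> ?N = ?N - {a}"
          using NN[OF that(1)] N4 that(1) finN by (intro card_seteq aN) auto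
        moreover have "b \<in> ?N - {a}" using that(2,3) by blast
        ultimately have "b \<in> nb E0 a" by blast
        then show ?thesis by simp
      qed
      \<comment> \<open>On 3, 4 or 5 vertices there is no room for \<open>3 * card V - 4\<close>
        edges.\<close>
      have n6: "card V \<ge> 6"
      proof (rule ccontr)
        assume "\<not> ?thesis"
        have "card (nb E0 x) \<le> card V - 1" if "x \<in> V" for x
          using card_mono[OF _ nb_subset[OF sg, of x]] fin that by simp
        then have "(\<Sum>x\<in>V. card (nb E0 x)) \<le> (\<Sum>x\<in>V. card V - 1)" by (intro sum_mono)
        then have le: "2 * card E0 \<le> card V * (card V - 1)" using handshake[OF sg] by simp
        have "card V = 3 \<or> card V = 4 \<or> card V = 5" using n3 \<open>\<not> 6 \<le> card V\<close> by linarith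
        then show False using le cE by auto
      qed
      show False
      proof (rule fat_graph_K5[OF fat n6 cE IH, of "insert v ?N"])
        show "insert v ?N \<subseteq> V" using v NV by auto
        show "card (insert v ?N) = 5" using finN vN N4 by simp
        fix x y assume "x \<in> insert v ?N" "y \<in> insert v ?N" "x \<noteq> y"
        then show "{x, y} \<in> E0" using adj by (auto simp: insert_commute)
      qed auto
    next
      assume N5: "card ?N = 5"
      \<comment> \<open>Among the five neighbors every vertex misses at most one other. Two
        non-adjacent ones, or any two if there are none, see the remaining three, and so does
        \<open>v\<close>.\<close>
      have "\<exists>a a'. a \<in> ?N \<and> a' \<in> ?N \<and> a \<noteq> a' \<and> (\<forall>b\<in>?N - {a,a'}. {a, b} \<in> E0 \<and> {a', b} \<in> E0)"
      proof (cases "\<exists>a\<in>?N. \<exists>a'\<in>?N. a \<noteq> a' \<and> {a, a'} \<notin> E0")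
        case True
        then obtain a a' where a: "a \<in> ?N" "a' \<in> ?N" "a \<noteq> a'" "{a, a'} \<notin> E0" by blast
        have c3: "card (?N - {a, a'}) = 3" using a N5 by (subst card_Diff_subset) auto
        have "nb E0 a \<inter> ?N = ?N - {a, a'}"
        proof (rule card_seteq)
          have "a' \<notin> nb E0 a" using a(4) by simp
          then show "nb E0 a \<inter> ?N \<subseteq> ?N - {a, a'}" using aN[of a] by blast
          show "card (?N - {a, a'}) \<le> card (nb E0 a \<inter> ?N)" using NN[OF a(1)] c3 by simp
        qed (use finN in blast)
        moreover have "nb E0 a' \<inter> ?N = ?N - {a, a'}"
        proof (rule card_seteq)
          have "a \<notin> nb E0 a'" using a(4) by (simp add: insert_commute)
          then show "nb E0 a' \<inter> ?N \<subseteq> ?N - {a, a'}" using aN[of a'] by blast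
          show "card (?N - {a, a'}) \<le> card (nb E0 a' \<inter> ?N)" using NN[OF a(2)] c3 by simp
        qed (use finN in blast)
        ultimately have "b \<in> nb E0 a \<and> b \<in> nb E0 a'" if "b \<in> ?N - {a,a'}" for b using that by blast
        then show ?thesis using a(1-3) unfolding in_nb by blast
      next
        case False
        have "3 \<le> card ?N" using N5 by simp
        then obtain a b c where "a \<in> ?N" "b \<in> ?N" "c \<in> ?N" "a \<noteq> b" "a \<noteq> c" "b \<noteq> c"
          by (rule three_elements)
        note abc = this
        have adj: "{x, y} \<in> E0" if "x \<in> ?N" "y \<in> ?N" "x \<noteq> y" for x y
          using False that by (metis (no_types))
        have az: "{a, z} \<in> E0 \<and> {b, z} \<in> E0" if z: "z \<in> ?N - {a, b}" for z
        proof -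
          have "z \<in> ?N" "a \<noteq> z" "b \<noteq> z" using z by blast+
          then show ?thesis using adj[OF \<open>a \<in> ?N\<close>] adj[OF \<open>b \<in> ?N\<close>] by (metis (no_types))
        qed
        have "\<forall>z\<in>?N - {a, b}. {a, z} \<in> E0 \<and> {b, z} \<in> E0" by (rule ballI) (rule az)
        then have "a \<in> ?N \<and> b \<in> ?N \<and> a \<noteq> b \<and> (\<forall>z\<in>?N - {a, b}. {a, z} \<in> E0 \<and> {b, z} \<in> E0)"
          using abc(1,2,4) by (intro conjI)
        then show ?thesis by (intro exI)
      qed
      then obtain a a' where a: "a \<in> ?N" "a' \<in> ?N" "a \<noteq> a'" "\<forall>b\<in>?N - {a,a'}. {a, b} \<in> E0 \<and> {a', b} \<in> E0"
        by (elim exE conjE)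
      have c3: "card (?N - {a, a'}) = 3" using a(1-3) N5 by (subst card_Diff_subset) auto
      then have "3 \<le> card (?N - {a, a'})" by simp
      then obtain b c d where bcd: "b \<in> ?N - {a,a'}" "c \<in> ?N - {a,a'}" "d \<in> ?N - {a,a'}" "b \<noteq> c" "b \<noteq> d" "c \<noteq> d"
        by (rule three_elements)
      show False
      proof (rule fat_graph_no_K33[OF fat, of v a a' b c d])
        have "v \<noteq> z" if "z \<in> ?N" for z using that vN by blast
        then have "v \<notin> {a, a', b, c, d}" using a(1,2) bcd(1-3) by blast
        moreover have "a \<notin> {a', b, c, d}" "a' \<notin> {b, c, d}" using a(3) bcd(1-3) by blast+
        ultimately show "distinct [v, a, a', b, c, d]" using bcd(4-6) by simp
        fix x y assume x: "x \<in> {v, a, a'}" and "y \<in> {b, c, d}"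
        then have y: "y \<in> ?N - {a,a'}" using bcd by blast
        then have "{v, y} \<in> E0" by simp
        then show "{x, y} \<in> E0" using bspec[OF a(4) y] x by blast
      qed
    qed
  qed
qed

theorem planar_Pconf_4:
  assumes "planar_graph V E"
  shows "Pconf V E 4"
proof -
  have fat: "fat_graph V E" by (rule planar_imp_fat_graph[OF assms])
  have sg: "sgraph V E" by (rule fat_graph_sgraph[OF fat])
  have "Pconf V E (Suc 3)"
  proof (rule Pconf_of_sparse[OF sg])
    fix S assume S: "S \<subseteq> V"
    have sgS: "sgraph S {e \<in> E. e \<subseteq> S}" by (rule sgraph_induced[OF sg S])
    show "card {e \<in> E. e \<subseteq> S} \<le> 3 * card S"
    proof (cases "card S \<ge> 2")
      case True
      have "fat_graph S {e \<in> E. e \<subseteq> S}" by (rule fat_graph_subgraph[OF fat S]) auto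
      then show ?thesis using fat_graph_edges True by fastforce
    next
      case False
      have "{e \<in> E. e \<subseteq> S} = {}"
      proof (rule ccontr)
        assume "\<not> ?thesis"
        then obtain x y where "x \<in> S" "y \<in> S" "x \<noteq> y" using sgS by (auto simp: sgraph_def)
        then have "card {x, y} \<le> card S" using sgraph_finite[OF sgS] by (intro card_mono) auto
        then show False using False \<open>x \<noteq> y\<close> by simp
      qed
      then show ?thesis by (simp only: card.empty)
    qed
  qed
  then show ?thesis by (simp add: eval_nat_numeral)
qed

section \<open>Configurations without colorings\<close>

abbreviation adjs :: "'a set set \<Rightarrow> 'a list \<Rightarrow> bool" where
  "adjs E xs \<equiv> successively (\<lambda>a b. {a, b} \<in> E) xs"

text \<open>Vertices off \<open>xs\<close> receive pairs of fresh colors, disjoint from each other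
  and from all \<open>Lc i\<close>, so that pairwise distinct lists stay pairwise distinct.\<close>

lemma extend_lists:
  fixes xs :: "'a list" and Lc :: "nat \<Rightarrow> nat set"
  assumes xs: "distinct xs" and V: "finite V"
    and Lc: "\<And>i. i < length xs \<Longrightarrow> finite (Lc i) \<and> card (Lc i) = 2"
  obtains L where "list_assignment V 2 L" "\<And>i. i < length xs \<Longrightarrow> L (xs ! i) = Lc i"
    "inj_on Lc {..<length xs} \<Longrightarrow> inj_on L V"
proof -
  obtain idx :: "'a \<Rightarrow> nat" where idx: "inj_on idx V" using V finite_imp_inj_to_nat_seg by metis
  have "finite (\<Union> (Lc ` {..<length xs}))" using Lc by auto
  then obtain M where M: "\<forall>c\<in>\<Union> (Lc ` {..<length xs}). c < M" using finite_nat_set_iff_bounded by blast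
  define pos where "pos v = (SOME i. i < length xs \<and> xs ! i = v)" for v
  have pos: "pos (xs ! i) = i" if "i < length xs" for i
  proof -
    have "pos (xs ! i) < length xs \<and> xs ! (pos (xs ! i)) = xs ! i"
      unfolding pos_def by (rule someI) (use that in simp)
    then show ?thesis using xs that nth_eq_iff_index_eq by blast
  qed
  define L where "L v = (if v \<in> set xs then Lc (pos v) else {M + 2 * idx v, M + 2 * idx v + 1})" for v
  have Lx: "L (xs ! i) = Lc i" if "i < length xs" for i
    using that pos by (simp add: L_def)
  have fresh: "M + 2 * idx v \<notin> L (xs ! i)" if "i < length xs" for v i
    using M that unfolding Lx[OF that] by fastforce
  show ?thesis
  proof (rule that[of L])
    show "list_assignment V 2 L"
      unfolding list_assignment_def
    proof
      fix v show "finite (L v) \<and> card (L v) = 2"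
      proof (cases "v \<in> set xs")
        case True
        then obtain i where "i < length xs" "v = xs ! i" by (metis in_set_conv_nth)
        then show ?thesis using Lx Lc by simp
      qed (simp add: L_def)
    qed
    show "L (xs ! i) = Lc i" if "i < length xs" for i by (rule Lx[OF that])
    assume inj: "inj_on Lc {..<length xs}"
    show "inj_on L V"
    proof (rule inj_onI)
      fix u v assume uv: "u \<in> V" "v \<in> V" "L u = L v"
      have mixed: False if "a \<in> set xs" "b \<notin> set xs" "L a = L b" for a b
      proof -
        obtain i where "i < length xs" "a = xs ! i" using \<open>a \<in> set xs\<close> by (metis in_set_conv_nth)
        then have "M + 2 * idx b \<notin> L a" using fresh by simp
        then show False using that by (simp add: L_def)
      qed
      consider "u \<in> set xs" "v \<in> set xs" | "u \<notin> set xs" "v \<notin> set xs"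
        using mixed[of u v] mixed[of v u] uv(3) by metis
      then show "u = v"
      proof cases
        case 1
        then obtain i j where ij: "i < length xs" "u = xs ! i" "j < length xs" "v = xs ! j" by (metis in_set_conv_nth)
        then have "Lc i = Lc j" using uv(3) Lx by simp
        then have "i = j" using inj ij by (simp add: inj_on_def)
        then show ?thesis using ij by simp
      next
        case 2
        then have "{M + 2 * idx u, M + 2 * idx u + 1} = {M + 2 * idx v, M + 2 * idx v + 1}"
          using uv(3) by (simp add: L_def)
        then have "idx u = idx v" unfolding doubleton_eq_iff by presburger
        then show ?thesis using idx uv by (simp add: inj_on_def)
      qed
    qed
  qed
qed

lemma edge_coloring_by_positions:
  fixes xs :: "'a list" and h :: "nat \<Rightarrow> nat \<Rightarrow> nat"
  assumes "distinct xs"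
  obtains f where "\<And>i j. i < j \<Longrightarrow> j < length xs \<Longrightarrow> f {xs ! i, xs ! j} = h i j"
proof -
  define f where "f e = (SOME c. \<exists>i j. i < j \<and> j < length xs \<and> e = {xs ! i, xs ! j} \<and> c = h i j)" for e
  have "f {xs ! i, xs ! j} = h i j" if "i < j" "j < length xs" for i j
  proof -
    have "\<exists>i' j'. i' < j' \<and> j' < length xs \<and> {xs ! i, xs ! j} = {xs ! i', xs ! j'} \<and> f {xs ! i, xs ! j} = h i' j'"
      unfolding f_def by (rule someI[of _ "h i j"]) (use that in blast)
    then obtain i' j' where ij: "i' < j'" "j' < length xs" "{xs ! i, xs ! j} = {xs ! i', xs ! j'}"
      "f {xs ! i, xs ! j} = h i' j'" by blast
    then have "i = i' \<and> j = j'"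
      using that nth_eq_iff_index_eq[OF assms] unfolding doubleton_eq_iff
      by (metis less_trans not_less_iff_gr_or_eq)
    then show ?thesis using ij(4) by simp
  qed
  then show ?thesis using that by blast
qed

text \<open>A configuration on the vertices \<open>xs\<close> is given by index-level lists \<open>Lc\<close> and edge colors \<open>h\<close>.
  Pairwise distinct two-element lists are separated whatever the edges are.\<close>

lemma bad_configuration:
  fixes xs :: "'a list" and Lc :: "nat \<Rightarrow> nat set" and h :: "nat \<Rightarrow> nat \<Rightarrow> nat"
  assumes sg: "sgraph V E" and xs: "distinct xs" "set xs \<subseteq> V"
    and Lc: "\<And>i. i < length xs \<Longrightarrow> finite (Lc i) \<and> card (Lc i) = 2"
    and bad: "\<And>c. (\<And>i. i < length xs \<Longrightarrow> c i \<in> Lc i) \<Longrightarrow>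
       (\<And>i j. i < j \<Longrightarrow> j < length xs \<Longrightarrow> {xs ! i, xs ! j} \<in> E \<Longrightarrow> \<not> (c i = h i j \<and> c j = h i j)) \<Longrightarrow> False"
  shows "\<not> Pad V E 2" "inj_on Lc {..<length xs} \<Longrightarrow> \<not> Psep V E 2"
proof -
  obtain L where L: "list_assignment V 2 L" "\<And>i. i < length xs \<Longrightarrow> L (xs ! i) = Lc i"
    "inj_on Lc {..<length xs} \<Longrightarrow> inj_on L V"
    by (rule extend_lists[OF xs(1) sgraph_finite[OF sg] Lc]) blast+
  obtain f where f: "\<And>i j. i < j \<Longrightarrow> j < length xs \<Longrightarrow> f {xs ! i, xs ! j} = h i j"
    by (rule edge_coloring_by_positions[OF xs(1), of h]) blast+
  have no: False if ad: "adapted_coloring E f c" and cL: "\<forall>v\<in>V. c v \<in> L v" for c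
  proof (rule bad[of "\<lambda>i. c (xs ! i)"])
    fix i assume i: "i < length xs"
    then have "xs ! i \<in> V" using xs(2) nth_mem by blast
    then show "c (xs ! i) \<in> Lc i" using cL L(2)[OF i] by auto
  next
    fix i j assume ij: "i < j" "j < length xs" "{xs ! i, xs ! j} \<in> E"
    then show "\<not> (c (xs ! i) = h i j \<and> c (xs ! j) = h i j)"
      using ad f[OF ij(1,2)] unfolding adapted_coloring_def by metis
  qed
  then show "\<not> Pad V E 2" unfolding Pad_def using L(1) by blast
  assume "inj_on Lc {..<length xs}"
  then have inj: "inj_on L V" by (rule L(3))
  have "separated E L"
    unfolding separated_def
  proof (intro allI impI)
    fix x y assume "{x, y} \<in> E"
    then have V: "x \<in> V" "y \<in> V" "x \<noteq> y" using sgraphD[OF sg] by auto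
    then have ne: "L x \<noteq> L y" using inj by (auto simp: inj_on_def)
    have fin: "finite (L x)" "card (L x) = 2" "finite (L y)" "card (L y) = 2"
      using L(1) V by (auto simp: list_assignment_def)
    show "card (L x \<inter> L y) \<le> 1"
    proof (rule ccontr)
      assume "\<not> ?thesis"
      then have "2 \<le> card (L x \<inter> L y)" by simp
      then have 1: "card (L x) \<le> card (L x \<inter> L y)" "card (L y) \<le> card (L x \<inter> L y)" using fin by simp_all
      have "L x \<inter> L y = L x" by (rule card_seteq[OF fin(1) Int_lower1 1(1)])
      moreover have "L x \<inter> L y = L y" by (rule card_seteq[OF fin(3) Int_lower2 1(2)])
      ultimately show False using ne by metis
    qed
  qed
  moreover have "adapted_coloring E f \<phi>" if "proper_coloring E \<phi>" for \<phi>
    using that unfolding adapted_coloring_def proper_coloring_def by blast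
  ultimately show "\<not> Psep V E 2" unfolding Psep_def using L(1) no by blast
qed

lemma adjs_subset:
  assumes "sgraph V E" "adjs E xs" "2 \<le> length xs"
  shows "set xs \<subseteq> V"
proof
  fix x assume "x \<in> set xs"
  then obtain i where i: "i < length xs" "x = xs ! i" by (metis in_set_conv_nth)
  show "x \<in> V"
  proof (cases "Suc i < length xs")
    case True
    then show ?thesis using successively_nth[OF assms(2) True] sgraphD[OF assms(1)] i by blast
  next
    case False
    then have "Suc (i - 1) < length xs" "Suc (i - 1) = i" using i assms(3) by auto
    then show ?thesis using successively_nth[OF assms(2), of "i - 1"] sgraphD[OF assms(1)] i by metis
  qed
qed

text \<open>In all configurations below the list of a vertex consists of the colors of its configuration
  edges. Here, choosing \<open>r - 1\<close> at position \<open>r\<close> is impossible because of the first cycle, so that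
  the color is pushed along the path into the second cycle.\<close>

lemma dumbbell:
  assumes sg: "sgraph V E" and xs: "distinct xs" "adjs E xs"
    and rq: "2 \<le> r" "r \<le> q" "q + 2 < length xs"
    and ch: "{xs ! 0, xs ! r} \<in> E" "{xs ! q, xs ! (length xs - 1)} \<in> E"
  shows "\<not> Pad V E 2" "3 \<le> r \<Longrightarrow> q + 3 < length xs \<Longrightarrow> \<not> Psep V E 2"
proof -
  define l where "l = length xs - 1"
  have l: "length xs = Suc l" "q + 2 \<le> l" using rq by (auto simp: l_def)
  \<comment> \<open>The path edge after position \<open>i\<close> has color \<open>i\<close>, except
    that the edge leaving \<open>q\<close> shares color \<open>l\<close> with the closing chord of
    the second cycle. The closing chord of the first cycle repeats the color \<open>r - 1\<close> of
    the path edge entering \<open>r\<close>.\<close>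
  define h where "h i j = (if j = Suc i then (if i = q then l else i) else if i = 0 \<and> j = r then r - 1 else l)" for i j :: nat
  define Lc where "Lc i = (if i = 0 then {0, r - 1} else if i = q then {q - 1, l}
     else if i = Suc q then {Suc q, l} else {i - 1, i})" for i :: nat
  have setV: "set xs \<subseteq> V" using adjs_subset[OF sg xs(2)] l by simp
  have card: "finite (Lc i) \<and> card (Lc i) = 2" for i using rq l by (auto simp: Lc_def card_insert_if)
  have bad: False if c: "\<And>i. i < length xs \<Longrightarrow> c i \<in> Lc i"
    and e: "\<And>i j. i < j \<Longrightarrow> j < length xs \<Longrightarrow> {xs ! i, xs ! j} \<in> E \<Longrightarrow> \<not> (c i = h i j \<and> c j = h i j)" for c
  proof -
    have step: "\<not> (c i = i \<and> c (Suc i) = i)" if "i < l" "i \<noteq> q" for i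
      using e[of i "Suc i"] successively_nth[OF xs(2), of i] that l by (simp add: h_def)
    have c': "c i \<in> {i - 1, i}" if "0 < i" "i \<le> l" "i \<noteq> q" "i \<noteq> Suc q" for i
      using c[of i] that l by (simp add: Lc_def)
    have c0: "c 0 \<in> {0, r - 1}" using c[of 0] l by (simp add: Lc_def)
    have cq: "c q \<in> {q - 1, l}" using c[of q] l rq by (simp add: Lc_def)
    have csq: "c (Suc q) \<in> {Suc q, l}" using c[of "Suc q"] l rq by (simp add: Lc_def)
    have push: "c (i + k) = i + k" if "c i = i" "0 < i \<or> i = 0" "\<And>j. i < j \<Longrightarrow> j \<le> i + k \<Longrightarrow> j \<noteq> q \<and> j \<noteq> Suc q"
      "i + k \<le> l" "i \<noteq> q \<or> k = 0" for i k
      using that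
    proof (induction k)
      case (Suc k)
      then have IH: "c (i + k) = i + k" by force
      have "i + k \<noteq> q" using Suc.prems(3)[of "i + k"] Suc.prems(5) by (cases "k = 0") auto
      then have "c (Suc (i + k)) \<noteq> i + k" using step[of "i + k"] IH Suc.prems(4) by auto
      moreover have "c (Suc (i + k)) \<in> {i + k, Suc (i + k)}"
        using c'[of "Suc (i + k)"] Suc.prems(3)[of "Suc (i + k)"] Suc.prems(4) by simp
      ultimately show ?case by simp
    qed simp
    have cr: "c r \<noteq> r - 1"
    proof
      assume r: "c r = r - 1"
      have "\<not> (c 0 = r - 1 \<and> c r = r - 1)" using e[of 0 r] ch(1) rq l by (simp add: h_def)
      then have "c 0 = 0" using c0 r by auto
      then have "c (0 + (r - 1)) = 0 + (r - 1)" using rq l by (intro push) auto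
      moreover have "r - 1 < l" "r - 1 \<noteq> q" "Suc (r - 1) = r" using rq l by linarith+
      ultimately show False using step[of "r - 1"] r by simp
    qed
    have "c q = l"
    proof (cases "r = q")
      case False
      then have "c r = r" using c'[of r] cr rq l by auto
      then have "c (r + (q - 1 - r)) = r + (q - 1 - r)" using rq l False by (intro push) auto
      then have "c (q - 1) = q - 1" using False rq by simp
      then show ?thesis using step[of "q - 1"] cq rq l by auto
    qed (use cq cr in auto)
    moreover have "c (Suc q) \<noteq> l"
      using e[of q "Suc q"] successively_nth[OF xs(2), of q] calculation l by (simp add: h_def)
    then have "c (Suc q) = Suc q" using csq by simp
    then have "c (Suc q + (l - Suc q)) = Suc q + (l - Suc q)" using l by (intro push) auto
    then have "c l = l" using l by simp
    ultimately show False using e[of q l] ch(2) l rq unfolding l_def[symmetric] by (simp add: h_def)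
  qed
  \<comment> \<open>The second claim assumes that both cycles have at least four vertices: in a
    triangle two lists would coincide, such as \<open>{0, 1}\<close> at positions 0 and 1 for
    \<open>r = 2\<close>.\<close>
  show "\<not> Pad V E 2" by (rule bad_configuration(1)[OF sg xs(1) setV card bad])
  assume "3 \<le> r" "q + 3 < length xs"
  then have inj: "inj_on Lc {..<length xs}"
    using rq l by (auto simp: inj_on_def Lc_def doubleton_eq_iff)
  show "\<not> Psep V E 2" by (rule bad_configuration(2)[OF sg xs(1) setV card bad inj])
qed


text \<open>The edge from \<open>i\<close> to \<open>Suc i\<close> has color \<open>e i\<close>, and
  each later position may choose the color of either edge at it. Choosing the color of the outgoing
  edge forces the same choice at the next position.\<close>

lemma push_up:
  fixes C :: "nat \<Rightarrow> nat"
  assumes "s \<le> t" "C s = e s" "\<And>i. s \<le> i \<Longrightarrow> i < t \<Longrightarrow> \<not> (C i = e i \<and> C (Suc i) = e i)"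
    "\<And>i. s < i \<Longrightarrow> i \<le> t \<Longrightarrow> C i \<in> {e (i - 1), e i}"
  shows "C t = e t"
  using assms(1,3,4)
proof (induction t rule: dec_induct)
  case base
  show ?case by (rule assms(2))
next
  case (step n)
  have "C n = e n" by (rule step.IH) (use step.prems in auto)
  moreover have "\<not> (C n = e n \<and> C (Suc n) = e n)" "C (Suc n) \<in> {e n, e (Suc n)}"
    using step.prems(1)[of n] step.prems(2)[of "Suc n"] step.hyps by auto
  ultimately show ?case by auto
qed

lemma push_down:
  fixes C :: "nat \<Rightarrow> nat"
  assumes "s \<le> t" "C t = e (t - 1)" "\<And>i. s \<le> i \<Longrightarrow> i < t \<Longrightarrow> \<not> (C i = e i \<and> C (Suc i) = e i)"
    "\<And>i. s \<le> i \<Longrightarrow> i < t \<Longrightarrow> C i \<in> {e (i - 1), e i}"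
  shows "C s = e (s - 1)"
  using assms(1,3,4)
proof (induction s rule: inc_induct)
  case base
  show ?case by (rule assms(2))
next
  case (step n)
  have "C (Suc n) = e (Suc n - 1)" by (rule step.IH) (use step.prems in auto)
  then have "C (Suc n) = e n" by simp
  moreover have "\<not> (C n = e n \<and> C (Suc n) = e n)" "C n \<in> {e (n - 1), e n}"
    using step.prems(1)[of n] step.prems(2)[of n] step.hyps by auto
  ultimately show ?case by auto
qed

text \<open>An ear occupies positions \<open>b\<close> to \<open>b + m - 1\<close>, and the edges
  joining it to the cycle have colors \<open>\<alpha>\<close> and \<open>\<beta>\<close>. Once the
  first end on the cycle has taken \<open>\<alpha>\<close>, the last position of the ear is forced
  to \<open>\<beta>\<close>.\<close>

lemma push_ear:
  fixes C :: "nat \<Rightarrow> nat"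
  assumes m: "0 < m" and start: "C b \<noteq> \<alpha>"
    and L: "\<And>i. b \<le> i \<Longrightarrow> i < b + m \<Longrightarrow> C i \<in> {if i = b then \<alpha> else i - 1, if i = b + m - 1 then \<beta> else i}"
    and e: "\<And>i. b \<le> i \<Longrightarrow> Suc i < b + m \<Longrightarrow> \<not> (C i = i \<and> C (Suc i) = i)"
  shows "C (b + m - 1) = \<beta>"
proof (cases "m = 1")
  case True
  then show ?thesis using L[of b] start by simp
next
  case False
  have "C (b + m - 2) = id (b + m - 2)"
  proof (rule push_up[of b "b + m - 2" C id])
    show "b \<le> b + m - 2" using False m by simp
    show "C b = id b" using L[of b] start False m by auto
    fix i assume i: "b \<le> i" "i < b + m - 2"
    then show "\<not> (C i = id i \<and> C (Suc i) = id i)" using e[of i] by simp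
  next
    fix i assume i: "b < i" "i \<le> b + m - 2"
    then have "b \<le> i" "i < b + m" "i \<noteq> b" "i \<noteq> b + m - 1" using False m by linarith+
    then show "C i \<in> {id (i - 1), id i}" using L[of i] by simp
  qed
  moreover define p where "p = m - 2"
  then have mp: "m = Suc (Suc p)" using False m by simp
  ultimately have "C (b + p) = b + p" by simp
  then show ?thesis
    using e[of "b + p"] L[of "Suc (b + p)"] unfolding mp by auto
qed

lemma adjs_ear:
  "adjs E (s # zs @ [t]) \<longleftrightarrow>
    (if zs = [] then {s, t} \<in> E else {s, zs ! 0} \<in> E \<and> adjs E zs \<and> {t, zs ! (length zs - 1)} \<in> E)"
  by (auto simp: successively_Cons successively_append_iff hd_conv_nth last_conv_nth hd_append insert_commute)

lemma adjs_closed: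
  assumes "adjs E (D @ [D ! 0])" "D \<noteq> []"
  shows "\<And>i. Suc i < length D \<Longrightarrow> {D ! i, D ! Suc i} \<in> E" "{D ! 0, D ! (length D - 1)} \<in> E"
  using assms by (auto simp: successively_append_iff last_conv_nth insert_commute intro: successively_nth)

lemma nth_append3:
  "i < length D \<Longrightarrow> (D @ zs @ ws) ! i = D ! i"
  "j < length zs \<Longrightarrow> (D @ zs @ ws) ! (length D + j) = zs ! j"
  "j < length ws \<Longrightarrow> (D @ zs @ ws) ! (length D + length zs + j) = ws ! j"
  by (auto simp: nth_append)

text \<open>The cycle pushes color \<open>0\<close> at one hub to color \<open>k\<close> at the other, and \<open>length D - 1\<close> to
  \<open>k - 1\<close>; each ear excludes one of these two outcomes.\<close>

lemma four_paths:
  assumes sg: "sgraph V E" and dist: "distinct (D @ zs @ ws)" and D: "adjs E (D @ [D ! 0])"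
    and k: "1 \<le> k" "k + 2 \<le> length D" and ne: "zs \<noteq> []" "ws \<noteq> []"
    and zs: "adjs E (D ! 0 # zs @ [D ! k])" and ws: "adjs E (D ! 0 # ws @ [D ! k])"
  shows "\<not> Pad V E 2" "2 \<le> k \<Longrightarrow> length zs = 1 \<Longrightarrow> length ws = 1 \<Longrightarrow> \<not> Psep V E 2"
proof -
  define c m n where "c = length D" and "m = length zs" and "n = length ws"
  have cmn: "1 \<le> k" "k + 2 \<le> c" "0 < m" "0 < n" using k ne by (auto simp: c_def m_def n_def)
  let ?xs = "D @ zs @ ws"
  have len: "length ?xs = c + m + n" by (simp add: c_def m_def n_def)
  have D_ne: "D \<noteq> []" using k by auto
  \<comment> \<open>A cycle edge has the index of its start as color, the closing edge has
    \<open>c - 1\<close>. The first ear begins with 0 and ends with \<open>k\<close>, the second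
    begins with \<open>c - 1\<close> and ends with \<open>k - 1\<close>: these are the colors
    available at the two hubs.\<close>
  define h where "h i j = (if j < c then (if j = Suc i then i else c - 1) else if j < c + m then i
     else if i = 0 then c - 1 else if i = k then k - 1 else i)" for i j :: nat
  define Lc where "Lc i = (if i = 0 then {0, c - 1} else if i < c then {i - 1, i}
     else if i < c + m then {if i = c then 0 else i - 1, if i = c + m - 1 then k else i}
     else {if i = c + m then c - 1 else i - 1, if i = c + m + n - 1 then k - 1 else i})" for i :: nat
  have x: "\<And>i. i < c \<Longrightarrow> ?xs ! i = D ! i" "\<And>j. j < m \<Longrightarrow> ?xs ! (c + j) = zs ! j"
      "\<And>j. j < n \<Longrightarrow> ?xs ! (c + m + j) = ws ! j"
    unfolding c_def m_def n_def by (rule nth_append3; assumption)+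
  have DE: "\<And>i. Suc i < c \<Longrightarrow> {D ! i, D ! Suc i} \<in> E" "{D ! 0, D ! (c - 1)} \<in> E"
    unfolding c_def using adjs_closed[OF D D_ne] by blast+
  have setV: "set ?xs \<subseteq> V"
    using adjs_subset[OF sg D] adjs_subset[OF sg zs] adjs_subset[OF sg ws] k by auto
  have card: "finite (Lc i) \<and> card (Lc i) = 2" for i
  proof -
    have two: "finite {x, y} \<and> card {x, y} = 2" if "x \<noteq> y" for x y :: nat using that by simp
    consider "i = 0" | "0 < i" "i < c" | "c \<le> i" "i < c + m" | "c + m \<le> i" by linarith
    then show ?thesis
    proof cases
      case 1
      then have "Lc i = {0, c - 1}" by (simp add: Lc_def)
      then show ?thesis using two[of 0 "c - 1"] cmn by simp
    next
      case 2
      then have "Lc i = {i - 1, i}" by (simp add: Lc_def)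
      then show ?thesis using two[of "i - 1" i] 2 by simp
    next
      case 3
      then have eq: "Lc i = {if i = c then 0 else i - 1, if i = c + m - 1 then k else i}" using cmn by (simp add: Lc_def)
      have ne: "(if i = c then 0 else i - 1) \<noteq> (if i = c + m - 1 then k else i)" using 3 cmn by (simp split: if_split) linarith
      show ?thesis unfolding eq by (rule two[OF ne])
    next
      case 4
      then have eq: "Lc i = {if i = c + m then c - 1 else i - 1, if i = c + m + n - 1 then k - 1 else i}" using cmn by (simp add: Lc_def)
      have ne: "(if i = c + m then c - 1 else i - 1) \<noteq> (if i = c + m + n - 1 then k - 1 else i)" using 4 cmn by (simp split: if_split) linarith
      show ?thesis unfolding eq by (rule two[OF ne])
    qed
  qed
  have zE: "{D ! 0, zs ! 0} \<in> E" "adjs E zs" "{D ! k, zs ! (m - 1)} \<in> E"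
    using zs ne unfolding adjs_ear m_def by auto
  have wE: "{D ! 0, ws ! 0} \<in> E" "adjs E ws" "{D ! k, ws ! (n - 1)} \<in> E"
    using ws ne unfolding adjs_ear n_def by auto
  have bad: False if CL: "\<And>i. i < length ?xs \<Longrightarrow> C i \<in> Lc i"
    and e: "\<And>i j. i < j \<Longrightarrow> j < length ?xs \<Longrightarrow> {?xs ! i, ?xs ! j} \<in> E \<Longrightarrow> \<not> (C i = h i j \<and> C j = h i j)" for C
  proof -
    have cyc: "\<not> (C i = i \<and> C (Suc i) = i)" if "Suc i < c" for i
      using e[of i "Suc i"] DE(1)[OF that] that x(1)[of i] x(1)[of "Suc i"] len by (simp add: h_def)
    have c3: "c - Suc 0 \<noteq> Suc 0" using cmn by linarith
    have close: "\<not> (C 0 = c - 1 \<and> C (c - 1) = c - 1)"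
      using e[of 0 "c - 1"] c3 DE(2) x(1)[of 0] x(1)[of "c - 1"] len cmn by (simp add: h_def)
    have z1: "\<not> (C 0 = 0 \<and> C c = 0)"
      using e[of 0 c] zE(1) x(1)[of 0] x(2)[of 0] len cmn by (simp add: h_def)
    have z2: "\<not> (C i = i \<and> C (Suc i) = i)" if "c \<le> i" "Suc i < c + m" for i
    proof -
      define j where "j = i - c"
      then have j: "i = c + j" using that(1) by simp
      then have "{?xs ! i, ?xs ! Suc i} \<in> E"
        using successively_nth[OF zE(2), of j] x(2)[of j] x(2)[of "Suc j"] that(2) by (simp add: m_def)
      then show ?thesis using e[of i "Suc i"] that len by (simp add: h_def)
    qed
    have lt: "\<not> c + m - 1 < c" "c + m - 1 < c + m" "k < c + m - 1" "k < c + m + n - 1"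
      "\<not> c + m + n - 1 < c + m" "\<not> c + m + n - 1 < c" "c + m + n - 1 < c + m + n" "c + m - 1 < c + m + n" "k \<noteq> 0"
      using cmn by linarith+
    have hk: "h k (c + m - 1) = k" "h k (c + m + n - 1) = k - 1"
      unfolding h_def using lt by (simp_all only: if_True if_False simp_thms)
    have xk: "?xs ! k = D ! k" "?xs ! (c + m - 1) = zs ! (m - 1)" "?xs ! (c + m + n - 1) = ws ! (n - 1)"
      using x(1)[of k] x(2)[of "m - 1"] x(3)[of "n - 1"] cmn by simp_all
    have z3: "\<not> (C k = k \<and> C (c + m - 1) = k)"
      using e[of k "c + m - 1", OF lt(3)] lt(8) zE(3) unfolding hk xk len by blast
    have w1: "\<not> (C 0 = c - 1 \<and> C (c + m) = c - 1)"
      using e[of 0 "c + m"] wE(1) x(1)[of 0] x(3)[of 0] len cmn by (simp add: h_def)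
    have w2: "\<not> (C i = i \<and> C (Suc i) = i)" if "c + m \<le> i" "Suc i < c + m + n" for i
    proof -
      define j where "j = i - (c + m)"
      then have j: "i = c + m + j" using that(1) by simp
      then have "{?xs ! i, ?xs ! Suc i} \<in> E"
        using successively_nth[OF wE(2), of j] x(3)[of j] x(3)[of "Suc j"] that(2) by (simp add: n_def)
      moreover have "i \<noteq> 0" "i \<noteq> k" using that cmn by auto
      ultimately show ?thesis using e[of i "Suc i"] that len by (simp add: h_def)
    qed
    have w3: "\<not> (C k = k - 1 \<and> C (c + m + n - 1) = k - 1)"
      using e[of k "c + m + n - 1", OF lt(4)] lt(7) wE(3) unfolding hk xk len by blast
    have Lcyc: "C i \<in> {i - 1, i}" if "0 < i" "i < c" for i using CL[of i] that len by (simp add: Lc_def)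
    have Lk: "C k \<in> {k - 1, k}" using Lcyc cmn by simp
    have Lz: "C i \<in> {if i = c then 0 else i - 1, if i = c + m - 1 then k else i}" if "c \<le> i" "i < c + m" for i
      using CL[of i] that len cmn by (simp add: Lc_def)
    have Lw: "C i \<in> {if i = c + m then c - 1 else i - 1, if i = c + m + n - 1 then k - 1 else i}"
      if "c + m \<le> i" "i < c + m + n" for i
      using CL[of i] that len cmn by (simp add: Lc_def)
    have "0 < length ?xs" using len cmn by linarith
    then have "C 0 \<in> {0, c - 1}" using CL[of 0] by (simp add: Lc_def)
    then consider "C 0 = 0" | "C 0 = c - 1" by auto
    then show False
    proof cases
      case 1
      have "C (k - 1) = id (k - 1)"
        by (rule push_up[of 0 "k - 1" C id]) (use 1 cyc Lcyc cmn in auto)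
      moreover have "Suc (k - 1) = k" using cmn by simp
      ultimately have "C k = k" using cyc[of "k - 1"] Lk cmn by auto
      moreover have "C (c + m - 1) = k"
        by (rule push_ear[OF \<open>0 < m\<close> _ Lz z2]) (use z1 1 in auto)
      ultimately show False using z3 by simp
    next
      case 2
      have "C (c - 1) = id (c - 1 - 1)"
        using close 2 Lcyc[of "c - 1"] cmn by auto
      then have "C (Suc k) = id (Suc k - 1)"
        by (intro push_down[of "Suc k" "c - 1" C id]) (use cyc Lcyc cmn in auto)
      then have "C k = k - 1" using cyc[of k] Lk cmn by auto
      moreover have "C (c + m + n - 1) = k - 1"
        by (rule push_ear[OF \<open>0 < n\<close> _ Lw w2]) (use w1 2 in auto)
      ultimately show False using w3 by simp
    qed
  qed
  show "\<not> Pad V E 2" by (rule bad_configuration(1)[OF sg dist setV card bad])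
  \<comment> \<open>For \<open>k = 1\<close> the list \<open>{0, k}\<close> of the first one-vertex
    ear would repeat that of position 1.\<close>
  assume "2 \<le> k" "length zs = 1" "length ws = 1"
  then have inj: "inj_on Lc {..<length ?xs}"
    using cmn unfolding len by (auto simp: inj_on_def Lc_def doubleton_eq_iff m_def n_def)
  show "\<not> Psep V E 2" by (rule bad_configuration(2)[OF sg dist setV card bad inj])
qed

text \<open>Along the cycle the color changes exactly at the \<open>length D - 4\<close> vertices that are not ear ends,
  cyclically through the residues modulo \<open>length D - 4\<close>. This is impossible if there is one such vertex.\<close>

lemma crossing_ears_aux:
  assumes sg: "sgraph V E" and dist: "distinct (D @ ps @ qs)" and D: "adjs E (D @ [D ! 0])"
    and abd: "0 < a" "a < b" "b < d" "d < length D" and c5: "length D \<noteq> 5"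
    and ps: "adjs E (D ! 0 # ps @ [D ! b])" and qs: "adjs E (D ! a # qs @ [D ! d])"
  shows "\<not> Pad V E 2"
proof -
  define c m n where "c = length D" and "m = length ps" and "n = length qs"
  have cmn: "0 < a" "a < b" "b < d" "d < c" "c \<noteq> 5" using abd c5 by (auto simp: c_def)
  let ?xs = "D @ ps @ qs"
  have len: "length ?xs = c + m + n" by (simp add: c_def m_def n_def)
  have D_ne: "D \<noteq> []" using abd by auto
  define N where "N = c + m + n"
  define \<beta>p where "\<beta>p = (if m = 0 then N else N + 1)"
  define \<beta>q where "\<beta>q = (if n = 0 then N + 2 else N + 3)"
  \<comment> \<open>\<open>e i\<close> is the color of the cycle edge from \<open>i\<close> to
    \<open>Suc i\<close>. It counts the vertices other than \<open>a\<close>, \<open>b\<close>,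
    \<open>d\<close>; up to \<open>c - 1\<close> there are \<open>c - 4\<close> of them, so with
    this modulus the closing edge has color 0 again. For \<open>c = 4\<close> the modulus is 0, but
    then all counts are 0.\<close>
  define e where "e i = card ({1..i} - {a, b, d}) mod (c - 4)" for i
  have e0: "e 0 = 0" by (simp add: e_def)
  have "card ({1..c - 1} - {a, b, d}) = c - 1 - 3"
    using cmn by (subst card_Diff_subset) auto
  then have ec: "e (c - 1) = 0" by (simp add: e_def)
  have e_same: "e i = e (i - 1)" if "i \<in> {a, b, d}" for i
  proof -
    have "{1..i} = insert i {1..i - 1}" using that cmn by auto
    then have "{1..i} - {a, b, d} = {1..i - 1} - {a, b, d}" using that by auto
    then show ?thesis by (simp add: e_def)
  qed
  have e_diff: "e i \<noteq> e (i - 1)" if i: "0 < i" "i < c" "i \<notin> {a, b, d}" for i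
  proof -
    have "{1..i} = insert i {1..i - 1}" using i by auto
    then have ins: "{1..i} - {a, b, d} = insert i ({1..i - 1} - {a, b, d})" using i(3) by auto
    have cardS: "card ({1..i} - {a, b, d}) = Suc (card ({1..i - 1} - {a, b, d}))"
      using i(1) unfolding ins by (subst card_insert_disjoint) auto
    have "{0, a, b, d, i} \<subseteq> {..<c}" using cmn i by auto
    then have "card {0, a, b, d, i} \<le> c" using card_mono[of "{..<c}"] by simp
    moreover have "card {0, a, b, d, i} = 5" using cmn i by (auto simp: card_insert_if)
    ultimately have c4: "c - 4 \<ge> 2" using cmn by linarith
    have "Suc x mod p \<noteq> x mod p" if "p \<ge> 2" for x p :: nat using that by (simp add: mod_Suc)
    then show ?thesis using c4 unfolding e_def cardS by blast
  qed
  have e_less: "e i < c" if "i < c" for i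
  proof -
    have "e i \<le> card ({1..i} - {a, b, d})" by (simp add: e_def)
    also have "\<dots> \<le> card {1..i}" by (intro card_mono) auto
    finally show ?thesis using that by simp
  qed
  define h where "h i j = (if j < c then (if j = Suc i then e i else if i = 0 \<and> j = c - 1 then 0
       else if i = 0 then N else N + 2)
     else if j < c + m then (if i = 0 then N else if i = b then \<beta>p else i)
     else (if i = a then N + 2 else if i = d then \<beta>q else i))" for i j :: nat
  \<comment> \<open>Each branch vertex \<open>0\<close>, \<open>a\<close>, \<open>b\<close>,
    \<open>d\<close> chooses between the common color of its two cycle edges and the color of the
    ear edge at it.\<close>
  define Lc where "Lc i = (if i = 0 then {e 0, N} else if i = b then {e b, \<beta>p} else if i = a then {e a, N + 2}
     else if i = d then {e d, \<beta>q} else if i < c then {e (i - 1), e i}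
     else if i < c + m then {if i = c then N else i - 1, if i = c + m - 1 then \<beta>p else i}
     else {if i = c + m then N + 2 else i - 1, if i = c + m + n - 1 then \<beta>q else i})" for i :: nat
  have x: "\<And>i. i < c \<Longrightarrow> ?xs ! i = D ! i" "\<And>j. j < m \<Longrightarrow> ?xs ! (c + j) = ps ! j"
      "\<And>j. j < n \<Longrightarrow> ?xs ! (c + m + j) = qs ! j"
    unfolding c_def m_def n_def by (rule nth_append3; assumption)+
  have DE: "\<And>i. Suc i < c \<Longrightarrow> {D ! i, D ! Suc i} \<in> E" "{D ! 0, D ! (c - 1)} \<in> E"
    unfolding c_def using adjs_closed[OF D D_ne] by blast+
  have setV: "set ?xs \<subseteq> V"
    using adjs_subset[OF sg D] adjs_subset[OF sg ps] adjs_subset[OF sg qs] abd by auto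
  have card: "finite (Lc i) \<and> card (Lc i) = 2" if i: "i < length ?xs" for i
  proof -
    have two: "finite {x, y} \<and> card {x, y} = 2" if "x \<noteq> y" for x y :: nat using that by simp
    have iN: "i < N" using i len N_def by simp
    have eN: "e k < N" if "k < c" for k using e_less[OF that] by (simp add: N_def)
    have \<beta>: "N \<le> \<beta>p" "N \<le> \<beta>q" "N + 2 \<le> \<beta>q" "m \<noteq> 0 \<Longrightarrow> \<beta>p = N + 1" "n \<noteq> 0 \<Longrightarrow> \<beta>q = N + 3"
      by (auto simp: \<beta>p_def \<beta>q_def)
    have abdc: "a < c" "b < c" "d < c" "0 < c" using cmn by auto
    consider "i = 0" | "i = b" | "i = a" | "i = d" | "0 < i" "i < c" "i \<notin> {a, b, d}" | "c \<le> i" "i < c + m" | "c + m \<le> i" by force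
    then show ?thesis
    proof cases
      case 1
      then have eq: "Lc i = {e 0, N}" by (simp add: Lc_def)
      show ?thesis unfolding eq by (rule two) (use eN[of 0] abdc in auto)
    next
      case 2
      then have eq: "Lc i = {e b, \<beta>p}" using cmn by (simp add: Lc_def)
      show ?thesis unfolding eq by (rule two) (use eN[of b] abdc \<beta> in auto)
    next
      case 3
      then have eq: "Lc i = {e a, N + 2}" using cmn by (simp add: Lc_def)
      show ?thesis unfolding eq by (rule two) (use eN[of a] abdc in auto)
    next
      case 4
      then have eq: "Lc i = {e d, \<beta>q}" using cmn by (simp add: Lc_def)
      show ?thesis unfolding eq by (rule two) (use eN[of d] abdc \<beta> in auto)
    next
      case 5
      then have eq: "Lc i = {e (i - 1), e i}" by (simp add: Lc_def)
      show ?thesis unfolding eq by (rule two) (use e_diff[OF 5] in simp)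
    next
      case 6
      then have eq: "Lc i = {if i = c then N else i - 1, if i = c + m - 1 then \<beta>p else i}" using cmn by (simp add: Lc_def)
      have "\<beta>p = N + 1" using 6 \<beta>(4) by linarith
      then have ne: "(if i = c then N else i - 1) \<noteq> (if i = c + m - 1 then \<beta>p else i)"
        using 6 abdc iN by (simp split: if_split) linarith
      show ?thesis unfolding eq by (rule two[OF ne])
    next
      case 7
      then have eq: "Lc i = {if i = c + m then N + 2 else i - 1, if i = c + m + n - 1 then \<beta>q else i}" using cmn by (simp add: Lc_def)
      have "\<beta>q = N + 3" using 7 i len \<beta>(5) by linarith
      then have ne: "(if i = c + m then N + 2 else i - 1) \<noteq> (if i = c + m + n - 1 then \<beta>q else i)"
        using 7 abdc iN by (simp split: if_split) linarith
      show ?thesis unfolding eq by (rule two[OF ne])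
    qed
  qed
  have bad: False if CL: "\<And>i. i < length ?xs \<Longrightarrow> C i \<in> Lc i"
    and no: "\<And>i j. i < j \<Longrightarrow> j < length ?xs \<Longrightarrow> {?xs ! i, ?xs ! j} \<in> E \<Longrightarrow> \<not> (C i = h i j \<and> C j = h i j)" for C
  proof -
    have cyc: "\<not> (C i = e i \<and> C (Suc i) = e i)" if "Suc i < c" for i
      using no[of i "Suc i"] DE(1)[OF that] that x(1)[of i] x(1)[of "Suc i"] len by (simp add: h_def)
    have c3: "c - Suc 0 \<noteq> Suc 0" using cmn by linarith
    have close: "\<not> (C 0 = 0 \<and> C (c - 1) = 0)"
      using no[of 0 "c - 1"] c3 DE(2) x(1)[of 0] x(1)[of "c - 1"] len cmn by (simp add: h_def)
    have Lcyc: "C i \<in> {e (i - 1), e i}" if "0 < i" "i < c" "i \<notin> {a, b, d}" for i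
      using CL[of i] that len by (simp add: Lc_def)
    have L: "C 0 \<in> {e 0, N}" "C b \<in> {e b, \<beta>p}" "C a \<in> {e a, N + 2}" "C d \<in> {e d, \<beta>q}"
    proof -
      have "0 < length ?xs" "a < length ?xs" "b < length ?xs" "d < length ?xs" using len cmn by linarith+
      then show "C 0 \<in> {e 0, N}" "C b \<in> {e b, \<beta>p}" "C a \<in> {e a, N + 2}" "C d \<in> {e d, \<beta>q}"
        using CL[of 0] CL[of b] CL[of a] CL[of d] cmn by (simp_all add: Lc_def)
    qed
    have arc: "C t \<noteq> e (t - 1)" if "s < t" "t < c" "C s = e s" "\<And>i. s < i \<Longrightarrow> i < t \<Longrightarrow> i \<notin> {a, b, d}" for s t
    proof -
      have "C (t - 1) = e (t - 1)"
        by (rule push_up[of s "t - 1" C e]) (use that cyc Lcyc in auto)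
      moreover have "Suc (t - 1) = t" using that(1) by simp
      ultimately show ?thesis using cyc[of "t - 1"] that(2) by auto
    qed
    have wrap: "C 0 \<noteq> 0" if "C d = e d"
    proof -
      have "C (c - 1) = e (c - 1)"
        by (rule push_up[of d "c - 1" C e]) (use that cyc Lcyc cmn in auto)
      then show ?thesis using ec close by auto
    qed
    have P: "C 0 = e 0 \<or> C b = e b"
    proof (rule ccontr)
      assume "\<not> ?thesis"
      then have CN: "C 0 = N" "C b = \<beta>p" using L by auto
      show False
      proof (cases "m = 0")
        case True
        then have "{?xs ! 0, ?xs ! b} \<in> E" using ps x(1) cmn unfolding adjs_ear m_def by auto
        moreover have "b \<noteq> c - Suc 0" "b \<noteq> Suc 0" using cmn by linarith+
        ultimately show False using no[of 0 b] CN True cmn len by (simp add: h_def \<beta>p_def)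
      next
        case False
        have pE: "{D ! 0, ps ! 0} \<in> E" "adjs E ps" "{D ! b, ps ! (m - 1)} \<in> E"
          using ps False unfolding adjs_ear m_def by auto
        have "C (c + m - 1) = \<beta>p"
        proof (rule push_ear[of m C c N])
          show "C c \<noteq> N"
            using no[of 0 c] pE(1) x(1)[of 0] x(2)[of 0] len cmn False CN by (simp add: h_def)
          show "C i \<in> {if i = c then N else i - 1, if i = c + m - 1 then \<beta>p else i}" if "c \<le> i" "i < c + m" for i
            using CL[of i] that len cmn by (simp add: Lc_def)
          show "\<not> (C i = i \<and> C (Suc i) = i)" if i: "c \<le> i" "Suc i < c + m" for i
          proof -
            define j where "j = i - c"
            then have j: "i = c + j" using i(1) by simp
            then have "{?xs ! i, ?xs ! Suc i} \<in> E"
              using successively_nth[OF pE(2), of j] x(2)[of j] x(2)[of "Suc j"] i(2) by (simp add: m_def)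
            moreover have "i \<noteq> 0" "i \<noteq> b" using i cmn by auto
            ultimately show ?thesis using no[of i "Suc i"] i len by (simp add: h_def)
          qed
        qed (use False in simp)
        moreover have "\<not> (C b = \<beta>p \<and> C (c + m - 1) = \<beta>p)"
        proof -
          have lt: "\<not> c + m - 1 < c" "c + m - 1 < c + m" "b < c + m - 1" "c + m - 1 < c + m + n" "b \<noteq> 0"
            using cmn False by linarith+
          have "h b (c + m - 1) = \<beta>p" unfolding h_def using lt by (simp only: if_True if_False simp_thms)
          moreover have "?xs ! b = D ! b" "?xs ! (c + m - 1) = ps ! (m - 1)"
            using x(1)[of b] x(2)[of "m - 1"] cmn False by simp_all
          ultimately show ?thesis using no[of b "c + m - 1", OF lt(3)] lt(4) pE(3) unfolding len by simp
        qed
        ultimately show False using CN by simp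
      qed
    qed
    have Q: "C a = e a \<or> C d = e d"
    proof (rule ccontr)
      assume "\<not> ?thesis"
      then have CN: "C a = N + 2" "C d = \<beta>q" using L by auto
      show False
      proof (cases "n = 0")
        case True
        then have "{?xs ! a, ?xs ! d} \<in> E" using qs x(1) cmn unfolding adjs_ear n_def by auto
        moreover have "d \<noteq> Suc a" using cmn by linarith
        ultimately show False using no[of a d] CN True cmn len by (simp add: h_def \<beta>q_def)
      next
        case False
        have qE: "{D ! a, qs ! 0} \<in> E" "adjs E qs" "{D ! d, qs ! (n - 1)} \<in> E"
          using qs False unfolding adjs_ear n_def by auto
        have "C (c + m + n - 1) = \<beta>q"
        proof (rule push_ear[of n C "c + m" "N + 2"])
          show "C (c + m) \<noteq> N + 2"
            using no[of a "c + m"] qE(1) x(1)[of a] x(3)[of 0] len cmn False CN by (simp add: h_def)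
          show "C i \<in> {if i = c + m then N + 2 else i - 1, if i = c + m + n - 1 then \<beta>q else i}"
            if "c + m \<le> i" "i < c + m + n" for i
            using CL[of i] that len cmn by (simp add: Lc_def)
          show "\<not> (C i = i \<and> C (Suc i) = i)" if i: "c + m \<le> i" "Suc i < c + m + n" for i
          proof -
            define j where "j = i - (c + m)"
            then have j: "i = c + m + j" using i(1) by simp
            then have "{?xs ! i, ?xs ! Suc i} \<in> E"
              using successively_nth[OF qE(2), of j] x(3)[of j] x(3)[of "Suc j"] i(2) by (simp add: n_def)
            moreover have "i \<noteq> a" "i \<noteq> d" using i cmn by auto
            ultimately show ?thesis using no[of i "Suc i"] i len by (simp add: h_def)
          qed
        qed (use False in simp)
        moreover have "\<not> (C d = \<beta>q \<and> C (c + m + n - 1) = \<beta>q)"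
        proof -
          have lt: "\<not> c + m + n - 1 < c" "\<not> c + m + n - 1 < c + m" "d < c + m + n - 1" "c + m + n - 1 < c + m + n" "d \<noteq> a"
            using cmn False by linarith+
          have "h d (c + m + n - 1) = \<beta>q" unfolding h_def using lt by (simp only: if_True if_False simp_thms)
          moreover have "?xs ! d = D ! d" "?xs ! (c + m + n - 1) = qs ! (n - 1)"
            using x(1)[of d] x(3)[of "n - 1"] cmn False by simp_all
          ultimately show ?thesis using no[of d "c + m + n - 1", OF lt(3)] lt(4) qE(3) unfolding len by simp
        qed
        ultimately show False using CN by simp
      qed
    qed
    \<comment> \<open>Two cyclically consecutive branch vertices cannot both take their cycle color.
      The ears demand it of one of \<open>0\<close>, \<open>b\<close> and of one of
      \<open>a\<close>, \<open>d\<close>, and any such two are consecutive.\<close>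
    have 1: "\<not> (C 0 = e 0 \<and> C a = e a)" using arc[of 0 a] e_same[of a] cmn by force
    have 2: "\<not> (C a = e a \<and> C b = e b)" using arc[of a b] e_same[of b] cmn by force
    have 3: "\<not> (C b = e b \<and> C d = e d)" using arc[of b d] e_same[of d] cmn by force
    have 4: "\<not> (C d = e d \<and> C 0 = e 0)" using wrap e0 by auto
    show False using P Q 1 2 3 4 by blast
  qed
  show "\<not> Pad V E 2" by (rule bad_configuration(1)[OF sg dist setV card bad])
qed


text \<open>For a cycle of length five with branch vertices \<open>u, a, v, d\<close> and one further vertex, switch to
  another of the three four-cycles of the subdivided \<open>K\<^sub>4\<close>; not all three can have length five.\<close>

lemma crossing_ears_5:
  assumes sg: "sgraph V E" and dist: "distinct ([u, a, v, d, z] @ ps @ qs)"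
    and D: "{u, a} \<in> E" "{a, v} \<in> E" "{v, d} \<in> E" "{d, z} \<in> E" "{z, u} \<in> E"
    and ps: "adjs E (u # ps @ [v])" and qs: "adjs E (a # qs @ [d])"
  shows "\<not> Pad V E 2"
\<comment> \<open>The two alternative cycles have 4 and 5 vertices besides those of the two ears.
  The first one is usable unless it has length 5, and then the second has length 6.\<close>
proof (cases "length ps + length qs = 1")
  case False
  let ?D = "u # a # qs @ d # v # rev ps"
  have l: "?D ! 0 = u" "?D ! 1 = a" "?D ! (length qs + 2) = d" "?D ! (length qs + 3) = v"
    by (auto simp: nth_append nth_Cons')
  show ?thesis
  proof (rule crossing_ears_aux[OF sg, of ?D "[z]" "[]" 1 "length qs + 2" "length qs + 3"])
    have "adjs E (v # rev ps @ [u])"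
      using ps successively_rev[of "\<lambda>a b. {a, b} \<in> E" "u # ps @ [v]"] by (simp add: insert_commute)
    then show "adjs E (?D @ [?D ! 0])"
      using qs D by (auto simp: successively_Cons successively_append_iff insert_commute hd_append)
    show "adjs E (?D ! 0 # [z] @ [?D ! (length qs + 2)])" unfolding l using D by (simp add: insert_commute)
    show "adjs E (?D ! 1 # [] @ [?D ! (length qs + 3)])" unfolding l using D by simp
  qed (use dist False in auto)
next
  case True
  let ?D = "u # z # d # rev qs @ a # v # rev ps"
  have l: "?D ! 0 = u" "?D ! 2 = d" "?D ! (length qs + 3) = a" "?D ! (length qs + 4) = v"
    by (auto simp: nth_append nth_Cons')
  show ?thesis
  proof (rule crossing_ears_aux[OF sg, of ?D "[]" "[]" 2 "length qs + 3" "length qs + 4"])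
    have "adjs E (v # rev ps @ [u])" "adjs E (d # rev qs @ [a])"
      using ps qs successively_rev[of "\<lambda>a b. {a, b} \<in> E" "u # ps @ [v]"]
        successively_rev[of "\<lambda>a b. {a, b} \<in> E" "a # qs @ [d]"] by (simp_all add: insert_commute)
    then show "adjs E (?D @ [?D ! 0])"
      using D by (auto simp: successively_Cons successively_append_iff insert_commute hd_append)
    show "adjs E (?D ! 0 # [] @ [?D ! (length qs + 3)])" unfolding l using D by simp
    show "adjs E (?D ! 2 # [] @ [?D ! (length qs + 4)])" unfolding l using D by (simp add: insert_commute)
  qed (use dist True in auto)
qed

text \<open>On a cycle of length five exactly one vertex is no ear end. Wherever it lies, a rotation
  makes it the last vertex, as \<open>crossing_ears_5\<close> expects; ears that wrap around are
  reversed.\<close>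

lemma crossing_ears:
  assumes sg: "sgraph V E" and dist: "distinct (D @ ps @ qs)" and D: "adjs E (D @ [D ! 0])"
    and abd: "0 < a" "a < b" "b < d" "d < length D"
    and ps: "adjs E (D ! 0 # ps @ [D ! b])" and qs: "adjs E (D ! a # qs @ [D ! d])"
  shows "\<not> Pad V E 2"
proof (cases "length D = 5")
  case False
  then show ?thesis using crossing_ears_aux[OF sg dist D abd _ ps qs] by blast
next
  case True
  then obtain d0 d1 d2 d3 d4 where D5: "D = [d0, d1, d2, d3, d4]"
    by (auto simp: length_Suc_conv eval_nat_numeral)
  have E: "{d0, d1} \<in> E" "{d1, d2} \<in> E" "{d2, d3} \<in> E" "{d3, d4} \<in> E" "{d4, d0} \<in> E"
    using D by (simp_all add: D5)
  have psr: "adjs E (D ! b # rev ps @ [D ! 0])"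
    using ps successively_rev[of "\<lambda>a b. {a, b} \<in> E" "D ! 0 # ps @ [D ! b]"] by (simp add: insert_commute)
  have qsr: "adjs E (D ! d # rev qs @ [D ! a])"
    using qs successively_rev[of "\<lambda>a b. {a, b} \<in> E" "D ! a # qs @ [D ! d]"] by (simp add: insert_commute)
  consider "a = 1" "b = 2" "d = 3" | "a = 1" "b = 2" "d = 4" | "a = 1" "b = 3" "d = 4" | "a = 2" "b = 3" "d = 4"
    using abd True by linarith
  then show ?thesis
  proof cases
    case 1
    then show ?thesis
      using crossing_ears_5[OF sg, of d0 d1 d2 d3 d4 ps qs] dist E ps qs by (simp add: D5 eval_nat_numeral)
  next
    case 2
    then show ?thesis
      using crossing_ears_5[OF sg, of d4 d0 d1 d2 d3 "rev qs" ps] dist E ps qsr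
      by (simp add: D5 eval_nat_numeral) blast
  next
    case 3
    then show ?thesis
      using crossing_ears_5[OF sg, of d3 d4 d0 d1 d2 "rev ps" "rev qs"] dist E psr qsr
      by (simp add: D5 eval_nat_numeral) blast
  next
    case 4
    then show ?thesis
      using crossing_ears_5[OF sg, of d2 d3 d4 d0 d1 qs "rev ps"] dist E psr qs
      by (simp add: D5 eval_nat_numeral) blast
  qed
qed

section \<open>Paths and cycles\<close>

definition lcyc :: "'a set set \<Rightarrow> 'a list \<Rightarrow> bool" where
  "lcyc E xs \<longleftrightarrow> distinct xs \<and> 3 \<le> length xs \<and> adjs E xs \<and> {last xs, hd xs} \<in> E"

definition path_in :: "'a set set \<Rightarrow> 'a set \<Rightarrow> 'a list \<Rightarrow> bool" where
  "path_in E S p \<longleftrightarrow> p \<noteq> [] \<and> distinct p \<and> adjs E p \<and> set p \<subseteq> S"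

definition connected_in :: "'a set set \<Rightarrow> 'a set \<Rightarrow> bool" where
  "connected_in E S \<longleftrightarrow> (\<forall>x\<in>S. \<forall>y\<in>S. \<exists>p. path_in E S p \<and> hd p = x \<and> last p = y)"

lemma adjs_rev: "adjs E (rev xs) \<longleftrightarrow> adjs E xs"
  by (simp add: insert_commute)

lemma adjs_ear_rev: "adjs E (s # p @ [t]) \<longleftrightarrow> adjs E (t # rev p @ [s])"
  using adjs_rev[of E "s # p @ [t]"] by simp

lemma path_in_rev: "path_in E S (rev p) \<longleftrightarrow> path_in E S p"
  unfolding path_in_def adjs_rev by simp

lemma path_in_mono: "path_in E S p \<Longrightarrow> S \<subseteq> T \<Longrightarrow> path_in E T p"
  by (auto simp: path_in_def)

lemma adjs_take_drop: "adjs E p \<Longrightarrow> adjs E (take n p)" "adjs E p \<Longrightarrow> adjs E (drop n p)"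
proof -
  assume "adjs E p"
  then have "adjs E (take n p @ drop n p)" by simp
  then show "adjs E (take n p)" "adjs E (drop n p)" unfolding successively_append_iff by blast+
qed

lemma path_in_take: "path_in E S p \<Longrightarrow> 0 < n \<Longrightarrow> path_in E S (take n p)"
  using set_take_subset[of n p] by (auto simp: path_in_def adjs_take_drop)

lemma path_in_drop: "path_in E S p \<Longrightarrow> n < length p \<Longrightarrow> path_in E S (drop n p)"
  using set_drop_subset[of n p] by (auto simp: path_in_def adjs_take_drop)

lemma path_in_length: "finite S \<Longrightarrow> path_in E S p \<Longrightarrow> length p \<le> card S"
  unfolding path_in_def by (metis card_mono distinct_card)

lemma last_take_Suc: "n < length p \<Longrightarrow> last (take (Suc n) p) = p ! n"
  by (simp add: take_Suc_conv_app_nth)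

lemma path_from_reach:
  assumes "y \<in> reach E S x" "x \<in> S"
  shows "\<exists>p. path_in E S p \<and> hd p = x \<and> last p = y"
  using assms(1) unfolding reach_def mem_Collect_eq
proof (induction rule: rtrancl_induct)
  case base
  show ?case using assms(2) by (intro exI[of _ "[x]"]) (simp add: path_in_def)
next
  case (step y z)
  then obtain p where p: "path_in E S p" "hd p = x" "last p = y" by blast
  show ?case
  proof (cases "z \<in> set p")
    case True
    then obtain n where n: "n < length p" "p ! n = z" by (metis in_set_conv_nth)
    have "last (take (Suc n) p) = z" using n by (simp add: last_take_Suc)
    moreover have "hd (take (Suc n) p) = x" using p by (cases p) (auto simp: path_in_def)
    ultimately show ?thesis using path_in_take[OF p(1), of "Suc n"] by blast
  next
    case False
    then have "path_in E S (p @ [z])"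
      using p step(2) by (auto simp: path_in_def successively_append_iff)
    moreover have "hd (p @ [z]) = x" using p by (simp add: path_in_def)
    ultimately show ?thesis by (intro exI[of _ "p @ [z]"]) simp
  qed
qed

lemma reach_refl_sym_trans:
  assumes "y \<in> reach E S x" shows "x \<in> reach E S y"
proof -
  have "sym ({(x, y). x \<in> S \<and> y \<in> S \<and> {x, y} \<in> E}\<^sup>*)"
    by (intro sym_rtrancl symI) (auto simp: insert_commute)
  then show ?thesis using assms by (auto simp: reach_def dest: symD)
qed

lemma reach_trans: "y \<in> reach E S x \<Longrightarrow> z \<in> reach E S y \<Longrightarrow> z \<in> reach E S x"
  by (auto simp: reach_def)

lemma connected_in_reach:
  assumes "u \<in> S" shows "connected_in E (reach E S u)"
  unfolding connected_in_def
proof (intro ballI)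
  fix x y assume xy: "x \<in> reach E S u" "y \<in> reach E S u"
  then have "y \<in> reach E S x" using reach_refl_sym_trans reach_trans by metis
  moreover have xS: "x \<in> S" using xy(1) reach_subset[OF assms] by blast
  ultimately obtain p where p: "path_in E S p" "hd p = x" "last p = y" using path_from_reach by metis
  have "set p \<subseteq> reach E S u"
  proof -
    have "p ! i \<in> reach E S u" if "i < length p" for i
      using that
    proof (induction i)
      case 0
      then show ?case using p xy(1) by (simp add: path_in_def hd_conv_nth)
    next
      case (Suc i)
      then have "p ! i \<in> S" "p ! Suc i \<in> S" using p by (auto simp: path_in_def)
      moreover have "{p ! i, p ! Suc i} \<in> E" using p Suc.prems by (auto simp: path_in_def successively_conv_nth)
      ultimately show ?case using Suc reach_step by (metis Suc_lessD)
    qed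
    then show ?thesis by (auto simp: in_set_conv_nth)
  qed
  then show "\<exists>p. path_in E (reach E S u) p \<and> hd p = x \<and> last p = y" using p by (auto simp: path_in_def)
qed

lemma shortest_path_between:
  assumes conn: "connected_in E S" and A: "A \<inter> S \<noteq> {}" and B: "B \<inter> S \<noteq> {}"
  obtains p where "path_in E S p" "hd p \<in> A" "last p \<in> B"
    "\<And>i. 0 < i \<Longrightarrow> i < length p \<Longrightarrow> p ! i \<notin> A" "\<And>i. Suc i < length p \<Longrightarrow> p ! i \<notin> B"
proof -
  let ?P = "\<lambda>p. path_in E S p \<and> hd p \<in> A \<and> last p \<in> B"
  obtain a b where "a \<in> A" "a \<in> S" "b \<in> B" "b \<in> S" using A B by blast
  then obtain p0 where "?P p0" using conn unfolding connected_in_def by metis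
  then have "\<exists>p. ?P p \<and> (\<forall>q. ?P q \<longrightarrow> length p \<le> length q)" by (rule ex_has_least_nat)
  then obtain p where p: "?P p" "\<And>q. ?P q \<Longrightarrow> length p \<le> length q" by metis
  show ?thesis
  proof (rule that[of p])
    show "path_in E S p" "hd p \<in> A" "last p \<in> B" using p(1) by auto
    show "p ! i \<notin> A" if "0 < i" "i < length p" for i
    proof
      assume "p ! i \<in> A"
      then have "?P (drop i p)" using p(1) path_in_drop[of E S p i] that by (simp add: hd_drop_conv_nth)
      then show False using p(2)[of "drop i p"] that by simp
    qed
    show "p ! i \<notin> B" if "Suc i < length p" for i
    proof
      assume "p ! i \<in> B"
      moreover have "hd (take (Suc i) p) = hd p" using p(1) by (cases p) (auto simp: path_in_def)
      moreover have "last (take (Suc i) p) = p ! i" using that by (simp add: last_take_Suc)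
      ultimately have "?P (take (Suc i) p)" using p(1) path_in_take[of E S p "Suc i"] by simp
      then show False using p(2)[of "take (Suc i) p"] that by simp
    qed
  qed
qed

lemma longest_path:
  assumes "finite S" "S \<noteq> {}"
  obtains p where "path_in E S p" "\<And>y. y \<in> S \<Longrightarrow> {hd p, y} \<in> E \<Longrightarrow> y \<in> set p"
    "\<And>y. y \<in> S \<Longrightarrow> {last p, y} \<in> E \<Longrightarrow> y \<in> set p" "\<And>q. path_in E S q \<Longrightarrow> length q \<le> length p"
proof -
  obtain x where "x \<in> S" using assms(2) by blast
  then have "path_in E S [x]" by (simp add: path_in_def)
  moreover have "\<forall>q. path_in E S q \<longrightarrow> length q < Suc (card S)" using path_in_length[OF assms(1)] le_imp_less_Suc by blast
  ultimately have "\<exists>p. path_in E S p \<and> (\<forall>q. path_in E S q \<longrightarrow> length q \<le> length p)"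
    by (rule ex_has_greatest_nat)
  then obtain p where p: "path_in E S p" "\<And>q. path_in E S q \<Longrightarrow> length q \<le> length p" by metis
  show ?thesis
  proof (rule that[OF p(1) _ _ p(2)])
    fix y assume y: "y \<in> S"
    show "y \<in> set p" if "{hd p, y} \<in> E"
    proof (rule ccontr)
      assume "y \<notin> set p"
      then have "path_in E S (y # p)" using p(1) y that by (auto simp: path_in_def successively_Cons insert_commute)
      then show False using p(2)[of "y # p"] by simp
    qed
    show "y \<in> set p" if "{last p, y} \<in> E"
    proof (rule ccontr)
      assume "y \<notin> set p"
      then have "path_in E S (p @ [y])" using p(1) y that by (auto simp: path_in_def successively_append_iff)
      then show False using p(2)[of "p @ [y]"] by simp
    qed
  qed
qed

lemma lcyc_take:
  assumes "path_in E S p" "i < length p" "2 \<le> i" "{hd p, p ! i} \<in> E"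
  shows "lcyc E (take (Suc i) p)" "set (take (Suc i) p) \<subseteq> S" "length (take (Suc i) p) = Suc i"
proof -
  have "path_in E S (take (Suc i) p)" using path_in_take[OF assms(1)] by simp
  moreover have "hd (take (Suc i) p) = hd p" using assms(2) by (cases p) auto
  moreover have "last (take (Suc i) p) = p ! i" using assms(2) by (simp add: last_take_Suc)
  ultimately show "lcyc E (take (Suc i) p)" "set (take (Suc i) p) \<subseteq> S" "length (take (Suc i) p) = Suc i"
    using assms by (auto simp: lcyc_def path_in_def insert_commute)
qed

text \<open>All neighbors in \<open>S\<close> of the first vertex of a longest path lie on that
  path, so one of them has index at least \<open>d\<close> and closes a cycle.\<close>

lemma long_cycle_of_min_degree:
  assumes sg: "sgraph V E" and S: "S \<subseteq> V" "S \<noteq> {}" and deg: "\<And>v. v \<in> S \<Longrightarrow> d \<le> card (nb E v \<inter> S)" and d: "2 \<le> d"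
  obtains xs where "lcyc E xs" "set xs \<subseteq> S" "Suc d \<le> length xs"
proof -
  have fS: "finite S" using S sgraph_finite[OF sg] finite_subset by blast
  obtain p where p: "path_in E S p" "\<And>y. y \<in> S \<Longrightarrow> {hd p, y} \<in> E \<Longrightarrow> y \<in> set p"
    by (rule longest_path[OF fS S(2)]) blast
  have hdS: "hd p \<in> S" using p(1) by (auto simp: path_in_def)
  have "nb E (hd p) \<inter> S \<subseteq> (\<lambda>i. p ! i) ` {i. 0 < i \<and> i < length p \<and> {hd p, p ! i} \<in> E}"
  proof
    fix y assume y: "y \<in> nb E (hd p) \<inter> S"
    then have "y \<in> set p" "y \<noteq> hd p" using p(2)[of y] sgraphD[OF sg, of "hd p" y] by auto
    then obtain i where "i < length p" "p ! i = y" by (metis in_set_conv_nth)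
    moreover have "0 < i"
    proof (rule ccontr)
      assume "\<not> 0 < i"
      then have "y = hd p" using \<open>p ! i = y\<close> p(1) by (simp add: path_in_def hd_conv_nth)
      then show False using \<open>y \<noteq> hd p\<close> by simp
    qed
    ultimately show "y \<in> (\<lambda>i. p ! i) ` {i. 0 < i \<and> i < length p \<and> {hd p, p ! i} \<in> E}" using y by auto
  qed
  then have "card (nb E (hd p) \<inter> S) \<le> card ((\<lambda>i. p ! i) ` {i. 0 < i \<and> i < length p \<and> {hd p, p ! i} \<in> E})"
    by (intro card_mono) auto
  also have "\<dots> \<le> card {i. 0 < i \<and> i < length p \<and> {hd p, p ! i} \<in> E}" by (intro card_image_le) auto
  finally have ge: "d \<le> card {i. 0 < i \<and> i < length p \<and> {hd p, p ! i} \<in> E}" using deg[OF hdS] by linarith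
  have "\<exists>i\<ge>d. i < length p \<and> {hd p, p ! i} \<in> E"
  proof (rule ccontr)
    assume "\<not> ?thesis"
    then have "i < d" if "i < length p" "{hd p, p ! i} \<in> E" for i using that not_le by blast
    then have "{i. 0 < i \<and> i < length p \<and> {hd p, p ! i} \<in> E} \<subseteq> {1..<d}" by fastforce
    then have "card {i. 0 < i \<and> i < length p \<and> {hd p, p ! i} \<in> E} \<le> card {1..<d}" by (intro card_mono) auto
    then show False using ge d by simp
  qed
  then obtain i where i: "d \<le> i" "i < length p" "{hd p, p ! i} \<in> E" by blast
  then have "2 \<le> i" using d by linarith
  show ?thesis
    by (rule that[of "take (Suc i) p"]) (use lcyc_take[OF p(1) i(2) \<open>2 \<le> i\<close> i(3)] i in auto)
qed

text \<open>A nonempty set without cycles has a vertex of degree at most 1, whose removal costs at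
  most one edge.\<close>

lemma acyclic_edge_count:
  assumes "sgraph V E" "S \<subseteq> V" "S \<noteq> {}" "\<And>xs. lcyc E xs \<Longrightarrow> \<not> set xs \<subseteq> S"
  shows "card {e \<in> E. e \<subseteq> S} + 1 \<le> card S"
  using assms(2-4)
proof (induction "card S" arbitrary: S rule: less_induct)
  case less
  note sg = assms(1)
  have fS: "finite S" using less.prems(1) sgraph_finite[OF sg] finite_subset by blast
  have "\<exists>v\<in>S. card (nb E v \<inter> S) < 2"
  proof (rule ccontr)
    assume "\<not> ?thesis"
    then have "2 \<le> card (nb E v \<inter> S)" if "v \<in> S" for v using that by force
    then obtain xs where "lcyc E xs" "set xs \<subseteq> S"
      by (rule long_cycle_of_min_degree[OF sg less.prems(1,2)]) auto
    then show False using less.prems(3) by blast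
  qed
  then obtain v where v: "v \<in> S" "card (nb E v \<inter> S) \<le> 1" by force
  have sgS: "sgraph S {e \<in> E. e \<subseteq> S}" by (rule sgraph_induced[OF sg less.prems(1)])
  have nbS: "nb {e \<in> E. e \<subseteq> S} v = nb E v \<inter> S" using v(1) by (auto simp: nb_def)
  have eq: "{e \<in> {e \<in> E. e \<subseteq> S}. v \<notin> e} = {e \<in> E. e \<subseteq> S - {v}}" by auto
  have cnt: "card {e \<in> E. e \<subseteq> S - {v}} + card (nb E v \<inter> S) = card {e \<in> E. e \<subseteq> S}"
    using card_edges_remove[OF sgS, of v] unfolding eq nbS .
  have cS: "card (S - {v}) + 1 = card S" using v(1) fS by (metis Suc_eq_plus1 card_Suc_Diff1)
  show ?case
  proof (cases "S - {v} = {}")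
    case True
    then have "nb E v \<inter> S = {}" using nb_subset[OF sg, of v] by blast
    then have 1: "card (nb E v \<inter> S) = 0" by (simp only: card.empty)
    have "\<not> e \<subseteq> S - {v}" if e: "e \<in> E" for e
    proof -
      obtain x y where "e = {x, y}" by (rule sgraphE[OF sg e])
      then show ?thesis unfolding True by simp
    qed
    then have "{e \<in> E. e \<subseteq> S - {v}} = {}" by blast
    then have "card {e \<in> E. e \<subseteq> S - {v}} = 0" by (simp only: card.empty)
    then show ?thesis using cnt cS 1 by linarith
  next
    case False
    have "card {e \<in> E. e \<subseteq> S - {v}} + 1 \<le> card (S - {v})"
    proof (rule less.hyps)
      show "card (S - {v}) < card S" using cS by linarith
      show "S - {v} \<subseteq> V" using less.prems(1) by blast
      show "\<not> set xs \<subseteq> S - {v}" if "lcyc E xs" for xs using less.prems(3)[OF that] by blast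
    qed (rule False)
    then show ?thesis using cnt cS v(2) by linarith
  qed
qed

lemma lcyc_rotate:
  assumes "lcyc E xs" "x \<in> set xs"
  obtains ys where "lcyc E ys" "set ys = set xs" "length ys = length xs" "hd ys = x"
proof -
  obtain as bs where ab: "xs = as @ x # bs" using assms(2) by (meson split_list)
  show ?thesis
  proof (rule that[of "x # bs @ as"])
    show "lcyc E (x # bs @ as)"
      using assms(1) unfolding ab lcyc_def
      by (cases "as = []") (auto simp: successively_append_iff successively_Cons hd_append split: if_splits)
  qed (auto simp: ab)
qed

lemma lcyc_rotate_last:
  assumes "lcyc E xs" "x \<in> set xs"
  obtains ys where "lcyc E ys" "set ys = set xs" "length ys = length xs" "last ys = x"
proof -
  obtain zs where zs: "lcyc E zs" "set zs = set xs" "length zs = length xs" "hd zs = x"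
    by (rule lcyc_rotate[OF assms])
  obtain z zt where z: "zs = z # zt" using zs(1) by (cases zs) (auto simp: lcyc_def)
  have ne: "zt \<noteq> []" using zs(1) by (auto simp: z lcyc_def)
  show ?thesis
  proof (rule that[of "zt @ [z]"])
    show "lcyc E (zt @ [z])"
      using zs(1) ne unfolding z lcyc_def by (auto simp: successively_append_iff successively_Cons insert_commute)
  qed (use zs z in auto)
qed

text \<open>Cut open at the shared vertex, or at the ends of a shortest connecting path, the two
  cycles become the two ends of one path to which \<open>dumbbell\<close> applies.\<close>

lemma two_cycles:
  assumes sg: "sgraph V E" and conn: "connected_in E V"
    and xs: "lcyc E xs" and ys: "lcyc E ys" and common: "card (set xs \<inter> set ys) \<le> 1"
  shows "\<not> Pad V E 2" "4 \<le> length xs \<Longrightarrow> 4 \<le> length ys \<Longrightarrow> \<not> Psep V E 2"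
proof -
  have sub: "set xs \<subseteq> V" "set ys \<subseteq> V"
    using adjs_subset[OF sg] xs ys by (auto simp: lcyc_def)
  have "\<exists>P. distinct P \<and> adjs E P \<and> (\<exists>q. length xs - 1 \<le> q \<and> q + length ys = length P \<and>
      {P ! 0, P ! (length xs - 1)} \<in> E \<and> {P ! q, P ! (length P - 1)} \<in> E)"
  proof (cases "set xs \<inter> set ys = {}")
    case False
    then obtain x where x: "x \<in> set xs" "x \<in> set ys" by blast
    then have int: "set xs \<inter> set ys = {x}"
      using common card_le_Suc0_iff_eq[of "set xs \<inter> set ys"] by auto
    obtain xs' where xs': "lcyc E xs'" "set xs' = set xs" "length xs' = length xs" "last xs' = x"
      by (rule lcyc_rotate_last[OF xs x(1)])
    obtain ys' where ys': "lcyc E ys'" "set ys' = set ys" "length ys' = length ys" "hd ys' = x"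
      by (rule lcyc_rotate[OF ys x(2)])
    then obtain yt where yt: "ys' = x # yt" by (cases ys') (auto simp: lcyc_def)
    have ne: "xs' \<noteq> []" "yt \<noteq> []" using xs' ys' yt by (auto simp: lcyc_def)
    have "set xs \<inter> set yt = {}"
    proof -
      have "x \<notin> set yt" "set yt \<subseteq> set ys" using ys'(1,2) yt by (auto simp: lcyc_def)
      then have "set xs \<inter> set yt \<subseteq> set xs \<inter> set ys - {x}" by blast
      then show ?thesis using int by simp
    qed
    then have P: "distinct (xs' @ yt)" using xs'(1,2) ys'(1) yt by (auto simp: lcyc_def)
    have A: "adjs E (xs' @ yt)"
      using xs' ys' yt ne by (auto simp: lcyc_def successively_append_iff successively_Cons)
    have n: "length xs \<noteq> 0" using xs by (auto simp: lcyc_def)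
    have "(xs' @ yt) ! 0 = hd xs'" "(xs' @ yt) ! (length xs - 1) = x"
      using ne xs' n by (auto simp: nth_append hd_conv_nth last_conv_nth)
    moreover have "(xs' @ yt) ! (length (xs' @ yt) - 1) = last yt"
      using last_conv_nth[of "xs' @ yt"] ne by simp
    ultimately have 1: "(xs' @ yt) ! 0 = hd xs'" "(xs' @ yt) ! (length xs - 1) = x" "(xs' @ yt) ! (length (xs' @ yt) - 1) = last yt"
      by blast+
    have 2: "{hd xs', x} \<in> E" "{x, last yt} \<in> E" using xs' ys' yt ne by (auto simp: lcyc_def insert_commute)
    have 3: "length xs - 1 + length ys = length (xs' @ yt)" 
    proof -
      have "length ys = Suc (length yt)" "length (xs' @ yt) = length xs + length yt" using xs'(3) ys'(3) yt by simp_all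
      then show ?thesis using n by linarith
    qed
    show ?thesis using P A 1 2 3 by (intro exI[of _ "xs' @ yt"] conjI exI[of _ "length xs - 1"]) auto
  next
    case True
    have "xs \<noteq> []" "ys \<noteq> []" using xs ys by (auto simp: lcyc_def)
    then have "hd xs \<in> set xs \<inter> V" "hd ys \<in> set ys \<inter> V" using sub by (auto dest!: hd_in_set)
    then have "set xs \<inter> V \<noteq> {}" "set ys \<inter> V \<noteq> {}" by blast+
    then obtain p where p: "path_in E V p" "hd p \<in> set xs" "last p \<in> set ys"
        "\<And>i. 0 < i \<Longrightarrow> i < length p \<Longrightarrow> p ! i \<notin> set xs" "\<And>i. Suc i < length p \<Longrightarrow> p ! i \<notin> set ys"
      by (rule shortest_path_between[OF conn]) blast
    have "hd p \<noteq> last p" using True p by auto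
    then obtain m where m: "p = hd p # m @ [last p]"
      using p(1) by (cases p; cases "tl p" rule: rev_cases) (auto simp: path_in_def)
    have mx: "z \<notin> set xs \<and> z \<notin> set ys" if zm: "z \<in> set m" for z
    proof -
      obtain i where i: "i < length m" "m ! i = z" using zm by (metis in_set_conv_nth)
      have "p ! Suc i = z" using i by (subst m) (simp add: nth_append)
      moreover have "length p = length m + 2" by (subst m) simp
      ultimately show ?thesis using p(4)[of "Suc i"] p(5)[of "Suc i"] i by auto
    qed
    obtain xs' where xs': "lcyc E xs'" "set xs' = set xs" "length xs' = length xs" "last xs' = hd p"
      by (rule lcyc_rotate_last[OF xs p(2)])
    obtain ys' where ys': "lcyc E ys'" "set ys' = set ys" "length ys' = length ys" "hd ys' = last p"
      by (rule lcyc_rotate[OF ys p(3)])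
    have ne: "xs' \<noteq> []" "ys' \<noteq> []" using xs' ys' by (auto simp: lcyc_def)
    have "adjs E p" "distinct p" using p(1) by (auto simp: path_in_def)
    then have "adjs E (hd p # m @ [last p])" "distinct (hd p # m @ [last p])" using m by simp_all
    then have adjm: "adjs E (hd p # m @ [last p])" and "distinct m" by simp_all
    then have A: "adjs E (xs' @ m @ ys')"
      using xs' ys' ne by (cases "m = []") (auto simp: lcyc_def successively_append_iff successively_Cons hd_append)
    have P: "distinct (xs' @ m @ ys')" using xs' ys' True mx \<open>distinct m\<close> by (auto simp: lcyc_def)
    let ?P = "xs' @ m @ ys'" and ?q = "length xs + length m"
    have n: "length xs \<noteq> 0" "length ys \<noteq> 0" using xs ys by (auto simp: lcyc_def)
    have "?P ! 0 = hd xs'" "?P ! (length xs - 1) = last xs'" "?P ! ?q = hd ys'"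
      using ne xs'(3) n by (simp_all add: nth_append hd_conv_nth last_conv_nth)
    moreover have "?P ! (length ?P - 1) = last ys'"
      using last_conv_nth[of ?P] ne by simp
    ultimately have 1: "?P ! 0 = hd xs'" "?P ! (length xs - 1) = last xs'" "?P ! (length ?P - 1) = last ys'" "?P ! ?q = hd ys'"
      by blast+
    have 2: "{hd xs', last xs'} \<in> E" "{hd ys', last ys'} \<in> E" using xs' ys' by (auto simp: lcyc_def insert_commute)
    have 3: "length xs - 1 \<le> ?q" "?q + length ys = length ?P" using xs'(3) ys'(3) by auto
    show ?thesis using P A 1 2 3 by (intro exI[of _ ?P] conjI exI[of _ ?q]) auto
  qed
  then obtain P q where P: "distinct P" "adjs E P" "length xs - 1 \<le> q" "q + length ys = length P"
      "{P ! 0, P ! (length xs - 1)} \<in> E" "{P ! q, P ! (length P - 1)} \<in> E" by blast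
  have l: "3 \<le> length xs" "3 \<le> length ys" using xs ys by (auto simp: lcyc_def)
  show "\<not> Pad V E 2"
    by (rule dumbbell(1)[OF sg P(1,2) _ P(3) _ P(5,6)]) (use l P(4) in linarith)+
  assume "4 \<le> length xs" "4 \<le> length ys"
  then show "\<not> Psep V E 2"
    by (intro dumbbell(2)[OF sg P(1,2) _ P(3) _ P(5,6)]) (use l P(4) in linarith)+
qed

section \<open>Arcs of a long cycle\<close>

lemma sum_interval_mod_unique:
  fixes p q c :: nat
  assumes "p mod c = q mod c" "i \<le> p" "i \<le> q" "p < i + c" "q < i + c"
  shows "p = q"
proof -
  have *: "p = q" if "p mod c = q mod c" "p \<le> q" "q < p + c" for p q :: nat
  proof (rule ccontr)
    assume "p \<noteq> q"
    have "c dvd q - p" using that by (metis mod_eq_dvd_iff_nat)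
    then have "c \<le> q - p" using \<open>p \<noteq> q\<close> that(2) by (intro dvd_imp_le) auto
    then show False using that(2,3) by linarith
  qed
  show ?thesis
  proof (cases "p \<le> q")
    case True
    then show ?thesis using *[of p q] assms by linarith
  next
    case False
    then show ?thesis using *[of q p] assms by linarith
  qed
qed

text \<open>A cycle is traversed by a periodic function \<open>f\<close>, so that its arcs are images of intervals. The
  hypothesis says that any two cycles of length at least \<open>\<mu>\<close> share two vertices.\<close>

locale big_cycle =
  fixes V :: "'a set" and E :: "'a set set" and f :: "nat \<Rightarrow> 'a" and c \<mu> :: nat
  assumes sg: "sgraph V E"
    and nodis: "\<And>xs ys. lcyc E xs \<Longrightarrow> lcyc E ys \<Longrightarrow> \<mu> \<le> length xs \<Longrightarrow> \<mu> \<le> length ys \<Longrightarrow> 2 \<le> card (set xs \<inter> set ys)"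
    and \<mu>: "3 \<le> \<mu>" "\<mu> \<le> c"
    and per: "\<And>i. f (i + c) = f i"
    and inj: "inj_on f {..<c}"
    and step: "\<And>i. {f i, f (Suc i)} \<in> E"
begin

abbreviation Z :: "'a set" where "Z \<equiv> range f"

lemma c_pos: "3 \<le> c" using \<mu> by linarith

lemma f_mod: "f (i mod c) = f i"
proof -
  have "f (k + n * c) = f k" for k n
  proof (induction n)
    case (Suc n)
    have "k + Suc n * c = (k + n * c) + c" by simp
    then show ?case using per[of "k + n * c"] Suc by metis
  qed simp
  from this[of "i mod c" "i div c"] show ?thesis by (simp add: mod_div_mult_eq)
qed

lemma f_eq_iff: "f i = f j \<longleftrightarrow> i mod c = j mod c"
proof
  assume "f i = f j"
  then have "f (i mod c) = f (j mod c)" by (simp add: f_mod)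
  moreover have "i mod c < c" "j mod c < c" using c_pos by auto
  ultimately show "i mod c = j mod c" using inj by (auto simp: inj_on_def)
qed (metis f_mod)

lemma f_inj: "f p = f q \<Longrightarrow> i \<le> p \<Longrightarrow> i \<le> q \<Longrightarrow> p < i + c \<Longrightarrow> q < i + c \<Longrightarrow> p = q"
  using f_eq_iff sum_interval_mod_unique by metis

lemma Z_eq: "Z = f ` {i..<i + c}"
proof
  show "Z \<subseteq> f ` {i..<i + c}"
  proof
    fix y assume "y \<in> Z"
    then obtain k where k: "y = f k" by auto
    have "k mod c < c" using c_pos by simp
    define j where "j = i + ((k + c * i) - i) mod c"
    have "i \<le> k + c * i" using c_pos by (simp add: trans_le_add2)
    then have "j mod c = (k + c * i) mod c"
      unfolding j_def by (metis le_add_diff_inverse mod_add_right_eq)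
    then have "f j = f k" unfolding f_eq_iff by simp
    moreover have "j \<in> {i..<i + c}" using c_pos by (simp add: j_def)
    ultimately show "y \<in> f ` {i..<i + c}" using k by (metis imageI)
  qed
qed auto

lemma Z_index: "y \<in> Z \<Longrightarrow> \<exists>k<c. y = f k"
  using Z_eq[of 0] by auto

lemma finite_Z: "finite Z" using Z_eq[of 0] by simp

lemma card_Z: "card Z = c"
  using Z_eq[of 0] inj by (simp add: card_image atLeast0LessThan)

lemma Z_subset: "Z \<subseteq> V" using step sgraphD[OF sg] by blast

lemma f_neq: "i < j \<Longrightarrow> j < i + c \<Longrightarrow> f i \<noteq> f j"
  using f_inj[of i j i] by fastforce

text \<open>Moving the starting point of the cycle. It lets later arguments place an ear, a chord or
  a missing chord at index 0.\<close>

lemma shift: "big_cycle V E (\<lambda>i. f (i + k)) c \<mu>"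
proof
  show "f (i + c + k) = f (i + k)" for i using per[of "i + k"] by (simp add: ac_simps)
  show "inj_on (\<lambda>i. f (i + k)) {..<c}"
  proof (rule inj_onI)
    fix p q assume "p \<in> {..<c}" "q \<in> {..<c}" "f (p + k) = f (q + k)"
    then show "p = q" using f_inj[of "p + k" "q + k" k] by auto
  qed
  show "{f (i + k), f (Suc i + k)} \<in> E" for i using step[of "i + k"] by simp
qed (use sg nodis \<mu> in auto)

lemma range_shift: "range (\<lambda>i. f (i + k)) = Z"
proof -
  interpret s: big_cycle V E "\<lambda>i. f (i + k)" c \<mu> by (rule shift)
  have "range (\<lambda>i. f (i + k)) = (\<lambda>i. f (i + k)) ` {0..<c}" using s.Z_eq[of 0] by simp
  also have "\<dots> = f ` ((\<lambda>i. i + k) ` {0..<c})" by (simp only: image_image)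
  also have "(\<lambda>i. i + k) ` {0..<c} = {k..<k + c}"
    using image_add_atLeastLessThan'[of k 0 c] by (simp add: add.commute)
  finally show ?thesis using Z_eq[of k] by simp
qed

definition arc_list :: "nat \<Rightarrow> nat \<Rightarrow> 'a list" where
  "arc_list i j = map f [i..<j]"

lemma arc_list_simps [simp]:
  "set (arc_list i j) = f ` {i..<j}" "length (arc_list i j) = j - i"
  "i < j \<Longrightarrow> hd (arc_list i j) = f i" "i < j \<Longrightarrow> last (arc_list i j) = f (j - 1)"
  "arc_list i j = [] \<longleftrightarrow> j \<le> i"
  by (auto simp: arc_list_def hd_map last_map)

lemma arc_list_nth [simp]: "k < j - i \<Longrightarrow> arc_list i j ! k = f (i + k)"
  by (simp add: arc_list_def)

lemma distinct_arc_list: "j \<le> i + c \<Longrightarrow> distinct (arc_list i j)"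
  unfolding arc_list_def by (auto simp: distinct_map inj_on_def intro: f_inj[of _ _ i])

lemma adjs_arc_list: "adjs E (arc_list i j)"
  unfolding successively_conv_nth using step by (auto simp: arc_list_def)

lemma arc_list_Cons: "i < j \<Longrightarrow> arc_list i j = f i # arc_list (Suc i) j"
  by (simp add: arc_list_def upt_conv_Cons)

lemma arc_list_snoc: "i \<le> j \<Longrightarrow> arc_list i (Suc j) = arc_list i j @ [f j]"
  by (simp add: arc_list_def)

lemma arc_list_append: "i \<le> j \<Longrightarrow> j \<le> k \<Longrightarrow> arc_list i k = arc_list i j @ arc_list j k"
  unfolding arc_list_def by (metis le_Suc_ex map_append upt_add_eq_append)

lemma adjs_arc_ear: "i < j \<Longrightarrow> adjs E (f i # arc_list (Suc i) j @ [f j])"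
  using adjs_arc_list[of i "Suc j"] arc_list_Cons[of i "Suc j"] arc_list_snoc[of "Suc i" j] by simp

lemma lcyc_Z: "lcyc E (arc_list 0 c)"
proof -
  have "f c = f 0" using per[of 0] by simp
  then have "{f (c - 1), f 0} \<in> E" using step[of "c - 1"] c_pos by simp
  then show ?thesis using distinct_arc_list[of c 0] adjs_arc_list c_pos by (simp add: lcyc_def)
qed

lemma set_Z_list: "set (arc_list 0 c) = Z"
  using Z_eq[of 0] by simp

lemma cycle_meets_Z: "lcyc E xs \<Longrightarrow> \<mu> \<le> length xs \<Longrightarrow> 2 \<le> card (set xs \<inter> Z)"
  using nodis[OF _ lcyc_Z] set_Z_list \<mu> by simp

text \<open>Closed up through \<open>s\<close>, the path is a long cycle that meets the main cycle
  only in \<open>s\<close>.\<close>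

lemma same_attachment:
  assumes p: "path_in E (V - Z) p" "2 \<le> length p" "\<mu> \<le> length p + 1"
    and s: "s \<in> Z" "{s, hd p} \<in> E" "{s, last p} \<in> E"
  shows False
proof -
  have "s \<notin> set p" using p(1) s(1) by (auto simp: path_in_def)
  then have "lcyc E (s # p)"
    using p s by (auto simp: lcyc_def path_in_def successively_Cons insert_commute)
  then have "2 \<le> card (set (s # p) \<inter> Z)" using p(3) by (intro cycle_meets_Z) auto
  moreover have "set (s # p) \<inter> Z = {s}" using p(1) s(1) by (auto simp: path_in_def)
  ultimately show False by simp
qed

text \<open>For \<open>nodis\<close> only the location of a cycle matters. Cycles confined to an arc
  and a set \<open>X\<close> off the main cycle can be compared by their arcs alone.\<close>

definition arc_cycle :: "'a set \<Rightarrow> nat \<Rightarrow> nat \<Rightarrow> bool" where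
  "arc_cycle X i j \<longleftrightarrow> (\<exists>xs. lcyc E xs \<and> \<mu> \<le> length xs \<and> set xs \<subseteq> f ` {i..j} \<union> X)"

lemma arc_cycle_ear:
  assumes "i < j" "j < i + c" and p: "adjs E (f j # p @ [f i])" "distinct p" "set p \<inter> Z = {}"
    and len: "\<mu> \<le> j - i + 1 + length p"
  shows "arc_cycle (set p) i j"
  unfolding arc_cycle_def
proof (intro exI conjI)
  let ?xs = "arc_list i (Suc j) @ p"
  have "set (arc_list i (Suc j)) \<inter> set p = {}" using p(3) by auto
  moreover have "adjs E ?xs \<and> {last ?xs, hd ?xs} \<in> E"
  proof (cases "p = []")
    case True
    then show ?thesis using adjs_arc_list[of i "Suc j"] p(1) assms(1) by simp
  next
    case False
    then show ?thesis
      using adjs_arc_list[of i "Suc j"] p(1) assms(1)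
      by (simp add: successively_append_iff successively_Cons hd_append)
  qed
  ultimately show "lcyc E ?xs"
    using distinct_arc_list[of "Suc j" i] assms \<mu> by (auto simp: lcyc_def)
  show "\<mu> \<le> length ?xs" using len assms(1) by simp
  show "set ?xs \<subseteq> f ` {i..j} \<union> set p" by auto
qed

text \<open>Arcs without common inner vertices share at most one end, unless together they make up
  the entire cycle, which the fifth hypothesis excludes. Two long cycles on such arcs would share at
  most one vertex.\<close>

lemma noncrossing:
  assumes o: "i < j" "j \<le> k" "k < l" "l \<le> i + c" "\<not> (j = k \<and> l = i + c)"
    and A: "arc_cycle X i j" "arc_cycle Y k l" and XY: "X \<inter> Y = {}" "X \<inter> Z = {}" "Y \<inter> Z = {}"
  shows False
proof -
  obtain xs where xs: "lcyc E xs" "\<mu> \<le> length xs" "set xs \<subseteq> f ` {i..j} \<union> X"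
    using A(1) by (auto simp: arc_cycle_def)
  obtain ys where ys: "lcyc E ys" "\<mu> \<le> length ys" "set ys \<subseteq> f ` {k..l} \<union> Y"
    using A(2) by (auto simp: arc_cycle_def)
  let ?z = "if j = k then f j else f i"
  have "f p = ?z" if pq: "p \<in> {i..j}" "q \<in> {k..l}" "f p = f q" for p q
  proof (cases "q < i + c")
    case True
    then have "p = q" using f_inj[of p q i] pq o by simp
    then have "j = k" "p = j" using pq o by auto
    then show ?thesis by simp
  next
    case False
    then have ql: "q = i + c" "l = i + c" using pq o by auto
    then have "f p = f i" using pq(3) per by simp
    then have "p = i" using f_inj[of p i i] pq(1) o by simp
    moreover have "j \<noteq> k" using ql o by simp
    ultimately show ?thesis by simp
  qed
  then have "f ` {i..j} \<inter> f ` {k..l} \<subseteq> {?z}" by fastforce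
  moreover have "set xs \<inter> set ys \<subseteq> f ` {i..j} \<inter> f ` {k..l}"
  proof
    fix z assume z: "z \<in> set xs \<inter> set ys"
    then have "z \<in> f ` {i..j} \<union> X" "z \<in> f ` {k..l} \<union> Y" using xs ys by blast+
    then show "z \<in> f ` {i..j} \<inter> f ` {k..l}" using XY by auto
  qed
  ultimately have "set xs \<inter> set ys \<subseteq> {?z}" by blast
  then have "card (set xs \<inter> set ys) \<le> 1" using card_mono[of "{?z}"] by fastforce
  then show False using nodis[OF xs(1) ys(1) xs(2) ys(2)] by simp
qed

end

lemma big_cycle_of_lcyc:
  assumes "sgraph V E" "lcyc E xs" "\<mu> \<le> length xs" "3 \<le> \<mu>"
    "\<And>xs ys. lcyc E xs \<Longrightarrow> lcyc E ys \<Longrightarrow> \<mu> \<le> length xs \<Longrightarrow> \<mu> \<le> length ys \<Longrightarrow> 2 \<le> card (set xs \<inter> set ys)"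
  shows "big_cycle V E (\<lambda>i. xs ! (i mod length xs)) (length xs) \<mu>"
proof
  let ?c = "length xs"
  have c: "3 \<le> ?c" using assms by linarith
  then have xs_ne: "xs \<noteq> []" by auto
  show "xs ! ((i + ?c) mod ?c) = xs ! (i mod ?c)" for i by simp
  show "inj_on (\<lambda>i. xs ! (i mod ?c)) {..<?c}"
    using assms(2) by (auto simp: inj_on_def lcyc_def nth_eq_iff_index_eq)
  show "{xs ! (i mod ?c), xs ! (Suc i mod ?c)} \<in> E" for i
  proof (cases "Suc (i mod ?c) = ?c")
    case True
    then have "Suc i mod ?c = 0" by (simp add: mod_Suc)
    moreover have "i mod ?c = ?c - 1" using True by simp
    ultimately show ?thesis using assms(2) xs_ne by (simp add: lcyc_def hd_conv_nth last_conv_nth)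
  next
    case False
    then have "Suc i mod ?c = Suc (i mod ?c)" by (simp add: mod_Suc)
    moreover have "i mod ?c < ?c" using c by (simp add: xs_ne)
    then have "Suc (i mod ?c) < ?c" using False by simp
    ultimately show ?thesis using assms(2) by (simp add: lcyc_def successively_conv_nth)
  qed
qed (use assms in auto)

section \<open>Ears and adaptable colorings\<close>

context big_cycle
begin

text \<open>An empty \<open>p\<close> stands for a chord; the last clause keeps the edges of the
  cycle itself from counting as ears. Indices may exceed \<open>c\<close>, so that an ear can be
  read from either end.\<close>

definition ear :: "nat \<Rightarrow> nat \<Rightarrow> 'a list \<Rightarrow> bool" where
  "ear i j p \<longleftrightarrow> i < j \<and> j < i + c \<and> adjs E (f i # p @ [f j]) \<and> distinct p \<and> set p \<inter> Z = {}
    \<and> (p = [] \<longrightarrow> i + 2 \<le> j \<and> j + 2 \<le> i + c)"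

lemma ear_rev:
  assumes "ear i j p" shows "ear j (i + c) (rev p)"
proof -
  have "adjs E (f j # rev p @ [f (i + c)])"
    using assms adjs_ear_rev[of E "f i" p "f j"] by (simp add: ear_def per)
  then show ?thesis using assms by (auto simp: ear_def)
qed

lemma ear_arc_cycle:
  assumes "ear i j p" "\<mu> \<le> j - i + 1 + length p"
  shows "arc_cycle (set p) i j"
proof -
  have "adjs E (f j # rev p @ [f i])" using assms(1) adjs_ear_rev[of E "f i" p "f j"] by (simp add: ear_def)
  then have "arc_cycle (set (rev p)) i j" using assms by (intro arc_cycle_ear) (auto simp: ear_def)
  then show ?thesis by simp
qed

lemma ear_shift:
  assumes "ear (i + k) (j + k) p"
  shows "big_cycle.ear E (\<lambda>n. f (n + k)) c i j p"
proof -
  interpret s: big_cycle V E "\<lambda>n. f (n + k)" c \<mu> by (rule shift)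
  show ?thesis using assms unfolding ear_def s.ear_def range_shift by simp
qed

lemma ear_of_chord:
  assumes "{f k, f l} \<in> E" "k < l" "l < k + c"
  shows "l = Suc k \<or> Suc l = k + c \<or> ear k l []"
  using assms by (auto simp: ear_def)

lemma ear_of_path:
  assumes Q: "path_in E (V - Z) Q" and st: "s \<in> Z" "t \<in> Z" "s \<noteq> t"
    and e: "{s, hd Q} \<in> E" "{last Q, t} \<in> E"
  obtains k l q where "k < l" "l < c" "ear k l q" "set q = set Q" "q \<noteq> []" "{f k, f l} = {s, t}" "q = Q \<or> q = rev Q"
proof -
  obtain k l where kl: "k < c" "s = f k" "l < c" "t = f l" using Z_index st by metis
  have Qn: "Q \<noteq> []" and Qd: "distinct Q" and QZ: "set Q \<inter> Z = {}" using Q by (auto simp: path_in_def)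
  have a: "adjs E (s # Q @ [t])"
    using Q e by (simp add: path_in_def successively_Cons successively_append_iff hd_append)
  have ar: "adjs E (t # rev Q @ [s])" using a adjs_ear_rev[of E s Q t] by simp
  have "k \<noteq> l" using kl st by auto
  then consider "k < l" | "l < k" by linarith
  then show ?thesis
  proof cases
    case 1
    then have "ear k l Q" using a kl Qn Qd QZ by (simp add: ear_def)
    then show ?thesis using that[of k l Q] 1 kl Qn by simp
  next
    case 2
    then have "ear l k (rev Q)" using ar kl Qn Qd QZ by (simp add: ear_def)
    then show ?thesis using that[of l k "rev Q"] 2 kl Qn by auto
  qed
qed

lemma adjs_closed_arc: "i < j \<Longrightarrow> j < i + c \<Longrightarrow> adjs E (f i # p @ [f j]) \<Longrightarrow>
  adjs E ((f i # p @ arc_list j (i + c)) @ [f i])"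
proof -
  assume ij: "i < j" "j < i + c" and p: "adjs E (f i # p @ [f j])"
  have a: "adjs E (arc_list j (Suc (i + c)))" by (rule adjs_arc_list)
  have "arc_list j (Suc (i + c)) = arc_list j (i + c) @ [f i]" using ij by (simp add: arc_list_snoc per)
  then have b: "adjs E (arc_list j (i + c) @ [f i])" using a by simp
  have "arc_list j (i + c) = f j # arc_list (Suc j) (i + c)" using ij by (simp add: arc_list_Cons)
  then show ?thesis using p b by (cases p) (auto simp: successively_Cons successively_append_iff hd_append)
qed

lemma arc_closed: "adjs E (arc_list i (i + c) @ [f i])"
proof -
  have "arc_list i (i + c) = f i # arc_list (Suc i) (i + c)" using c_pos by (simp add: arc_list_Cons)
  moreover have "arc_list i (Suc (i + c)) = arc_list i (i + c) @ [f i]" by (simp add: arc_list_snoc per)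
  ultimately show ?thesis using adjs_arc_list[of i "Suc (i + c)"] by simp
qed

text \<open>The two ears and the two arcs of the cycle are four paths between \<open>f 0\<close> and
  \<open>f j\<close>. The case distinction serves the side conditions of \<open>four_paths\<close>:
  a chord has to become a cycle edge instead of an ear, and the second hub must not be the last
  vertex of the cycle.\<close>

lemma parallel_ears:
  assumes p: "ear 0 j p" and q: "ear 0 j q" and pq: "set p \<inter> set q = {}" "q \<noteq> []" and j: "j < c"
  shows "\<not> Pad V E 2"
proof -
  have dq: "distinct q" "set q \<inter> Z = {}" "adjs E (f 0 # q @ [f j])" using q by (auto simp: ear_def)
  have dp: "distinct p" "set p \<inter> Z = {}" "adjs E (f 0 # p @ [f j])" "0 < j" using p by (auto simp: ear_def)
  have Zl: "set (arc_list 0 c) = Z" by (rule set_Z_list)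
  consider "p = []" | "p \<noteq> []" "j + 2 \<le> c" | "p \<noteq> []" "j + 1 = c" using j by linarith
  then show ?thesis
  proof cases
    case 1
    then have j2: "2 \<le> j" "j + 2 \<le> c" using p by (auto simp: ear_def)
    have un: "arc_list 0 c = f 0 # arc_list 1 j @ arc_list j c"
      using arc_list_Cons[of 0 c] arc_list_append[of 1 j c] j2 by simp
    have d0: "distinct (f 0 # arc_list 1 j @ arc_list j c)" using distinct_arc_list[of c 0] un by simp
    have sets: "set (f 0 # arc_list 1 j @ arc_list j c) = Z" using Zl un by simp
    let ?D = "f 0 # arc_list j c"
    have D1: "?D ! 1 = f j" using j2 by simp
    show ?thesis
    proof (rule four_paths(1)[OF sg, of ?D "arc_list 1 j" q 1])
      show "distinct (?D @ arc_list 1 j @ q)" using d0 sets dq by auto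
      show "adjs E (?D @ [?D ! 0])" using adjs_closed_arc[of 0 j p] 1 dp j by simp
      show "adjs E (?D ! 0 # arc_list 1 j @ [?D ! 1])" using adjs_arc_ear[of 0 j] j2 D1 by simp
      show "adjs E (?D ! 0 # q @ [?D ! 1])" using dq D1 by simp
    qed (use j2 pq in auto)
  next
    case 2
    show ?thesis
    proof (rule four_paths(1)[OF sg, of "arc_list 0 c" p q j])
      show "distinct (arc_list 0 c @ p @ q)" using distinct_arc_list[of c 0] Zl dp dq pq by auto
      show "adjs E (arc_list 0 c @ [arc_list 0 c ! 0])" using arc_closed[of 0] c_pos by simp
    qed (use 2 dp dq pq j in auto)
  next
    case 3
    have Zc: "set (arc_list j (j + c)) = Z" using Z_eq[of j] by simp
    have rev: "adjs E (f j # rev p @ [f 0])" "adjs E (f j # rev q @ [f 0])"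
      using dp dq adjs_ear_rev[of E "f 0" _ "f j"] by auto
    have f0: "f (j + 1) = f 0" using 3 per[of 0] by simp
    show ?thesis
    proof (rule four_paths(1)[OF sg, of "arc_list j (j + c)" "rev p" "rev q" 1])
      show "distinct (arc_list j (j + c) @ rev p @ rev q)"
        using distinct_arc_list[of "j + c" j] Zc dp dq pq by auto
      show "adjs E (arc_list j (j + c) @ [arc_list j (j + c) ! 0])" using arc_closed[of j] c_pos by simp
    qed (use 3 rev pq c_pos f0 in auto)
  qed
qed

end

section \<open>Ears when two colors suffice for adapted colorings\<close>

locale pad_cycle = big_cycle V E f c 3 for V E f c +
  assumes pad: "Pad V E 2" and deg: "\<And>v. v \<in> V \<Longrightarrow> 2 \<le> card (nb E v)"
begin

lemma pad_shift: "pad_cycle V E (\<lambda>n. f (n + k)) c"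
  using shift pad deg by (simp add: pad_cycle_def pad_cycle_axioms_def)

text \<open>Ears with disjoint interiors have the same ends, where \<open>parallel_ears\<close>
  applies, or they cut off arcs sharing at most one vertex, where \<open>noncrossing\<close>
  applies, or they interlace, where \<open>crossing_ears\<close> applies. Only one and the same
  chord survives.\<close>

lemma two_ears:
  assumes p: "ear 0 j p" "j < c" and q: "ear k l q" "l < c" and pq: "set p \<inter> set q = {}"
  shows "p = [] \<and> q = [] \<and> k = 0 \<and> l = j"
proof -
  have kl: "k < l" and j: "0 < j" using p q by (auto simp: ear_def)
  have len: "3 \<le> j - i + 1 + length p" if "ear i j p" for i j p
    using that by (cases p) (auto simp: ear_def)
  have ac: "arc_cycle (set p) 0 j" "arc_cycle (set p) j (0 + c)"
    using ear_arc_cycle[OF p(1) len[OF p(1)]] ear_arc_cycle[OF ear_rev[OF p(1)] len[OF ear_rev[OF p(1)]]] by simp_all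
  have ac': "arc_cycle (set q) k l" "arc_cycle (set q) l (k + c)"
    using ear_arc_cycle[OF q(1) len[OF q(1)]] ear_arc_cycle[OF ear_rev[OF q(1)] len[OF ear_rev[OF q(1)]]] by simp_all
  have d: "set p \<inter> Z = {}" "set q \<inter> Z = {}" "distinct p" "distinct q" using p q by (auto simp: ear_def)
  have qp: "set q \<inter> set p = {}" using pq by blast
  consider "k = 0" "l = j" | "l \<le> j" "\<not> (k = 0 \<and> l = j)" | "j \<le> k" | "k = 0" "j < l" | "0 < k" "k < j" "j < l"
    by linarith
  then show ?thesis
  proof cases
    case 1
    then have "q = []" "p = []" using parallel_ears[of j p q] parallel_ears[of j q p] p q pq qp pad by blast+
    then show ?thesis using 1 by simp
  next
    case 2
    then show ?thesis using noncrossing[of k l j "0 + c", OF _ _ _ _ _ ac'(1) ac(2) qp d(2) d(1)] kl p(2) by auto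
  next
    case 3
    then show ?thesis using noncrossing[of 0 j k l, OF _ _ _ _ _ ac(1) ac'(1) pq d(1) d(2)] kl j q(2) by auto
  next
    case 4
    then show ?thesis using noncrossing[of 0 j l "k + c", OF _ _ _ _ _ ac(1) ac'(2) pq d(1) d(2)] j q(2) by auto
  next
    case 5
    have "\<not> Pad V E 2"
    proof (rule crossing_ears[OF sg, of "arc_list 0 c" p q k j l])
      show "distinct (arc_list 0 c @ p @ q)" using distinct_arc_list[of c 0] set_Z_list d pq by auto
      show "adjs E (arc_list 0 c @ [arc_list 0 c ! 0])" using arc_closed[of 0] c_pos by simp
    qed (use 5 p q in \<open>auto simp: ear_def\<close>)
    then show ?thesis using pad by simp
  qed
qed

lemma no_cycle_outside: "lcyc E xs \<Longrightarrow> \<not> set xs \<subseteq> V - Z"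
proof
  assume xs: "lcyc E xs" "set xs \<subseteq> V - Z"
  have "set xs \<inter> Z = {}" using xs(2) by blast
  then show False using cycle_meets_Z[OF xs(1)] xs(1) by (simp add: lcyc_def)
qed

text \<open>A second neighbor off \<open>Z\<close> would lie on \<open>Q\<close> and close a cycle
  disjoint from \<open>Z\<close>. The degree bound therefore leaves the other neighbors to
  \<open>Z\<close>.\<close>

lemma outer_neighbour:
  assumes Q: "path_in E (V - Z) Q" and mx: "\<And>y. y \<in> V - Z \<Longrightarrow> {hd Q, y} \<in> E \<Longrightarrow> y \<in> set Q"
  shows "\<exists>s\<in>Z. {hd Q, s} \<in> E" "length Q = 1 \<Longrightarrow> \<exists>s\<in>Z. \<exists>t\<in>Z. s \<noteq> t \<and> {hd Q, s} \<in> E \<and> {hd Q, t} \<in> E"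
proof -
  have Qn: "Q \<noteq> []" using Q by (simp add: path_in_def)
  have hdV: "hd Q \<in> V" using Q hd_in_set[OF Qn] unfolding path_in_def by blast
  have sub: "nb E (hd Q) - Z \<subseteq> (if length Q = 1 then {} else {Q ! 1})"
  proof
    fix y assume y: "y \<in> nb E (hd Q) - Z"
    then have yV: "y \<in> V" "y \<noteq> hd Q" using sgraphD[OF sg, of "hd Q" y] by auto
    then have "y \<in> set Q" using mx y by simp
    then obtain i where i: "i < length Q" "Q ! i = y" by (metis in_set_conv_nth)
    have "i \<noteq> 0" using i yV Qn by (metis hd_conv_nth)
    moreover have "\<not> 2 \<le> i"
      using lcyc_take[OF Q i(1)] no_cycle_outside y i(2) by auto
    ultimately have "i = 1" by simp
    then show "y \<in> (if length Q = 1 then {} else {Q ! 1})" using i by auto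
  qed
  have fin: "finite (nb E (hd Q))" by (rule finite_nb[OF sg])
  have "card (nb E (hd Q)) = card (nb E (hd Q) \<inter> Z) + card (nb E (hd Q) - Z)"
    using fin by (metis card_Int_Diff)
  then have ge: "2 \<le> card (nb E (hd Q) \<inter> Z) + card (nb E (hd Q) - Z)" using deg[OF hdV] by simp
  have "card (nb E (hd Q) - Z) \<le> card (if length Q = 1 then {} else {Q ! 1})"
    using sub by (intro card_mono) auto
  then have le: "card (nb E (hd Q) - Z) \<le> (if length Q = 1 then 0 else 1)" by (simp split: if_splits)
  show "\<exists>s\<in>Z. {hd Q, s} \<in> E"
  proof -
    have "card (nb E (hd Q) \<inter> Z) \<noteq> 0" using ge le by (auto split: if_splits)
    then have "nb E (hd Q) \<inter> Z \<noteq> {}" by (metis card.empty)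
    then show ?thesis by auto
  qed
  show "\<exists>s\<in>Z. \<exists>t\<in>Z. s \<noteq> t \<and> {hd Q, s} \<in> E \<and> {hd Q, t} \<in> E" if "length Q = 1"
  proof -
    have "\<not> card (nb E (hd Q) \<inter> Z) \<le> Suc 0" using ge le that by auto
    then obtain s t where "s \<in> nb E (hd Q) \<inter> Z" "t \<in> nb E (hd Q) \<inter> Z" "s \<noteq> t"
      using fin card_le_Suc0_iff_eq[of "nb E (hd Q) \<inter> Z"] by blast
    then show ?thesis by auto
  qed
qed

text \<open>Both ends of a longest path in the component have neighbors on the cycle, and these
  differ by \<open>same_attachment\<close>. If the path is a single vertex, that vertex has two such
  neighbors.\<close>

lemma component_path:
  assumes u: "u \<in> V - Z"
  obtains Q s t where "path_in E (reach E (V - Z) u) Q" "s \<in> Z" "t \<in> Z" "s \<noteq> t" "{s, hd Q} \<in> E" "{last Q, t} \<in> E"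
proof -
  let ?W = "reach E (V - Z) u"
  have WU: "?W \<subseteq> V - Z" by (rule reach_subset[OF u])
  have fW: "finite ?W" using WU sgraph_finite[OF sg] finite_subset by blast
  have Wne: "?W \<noteq> {}" using self_in_reach[of u E "V - Z"] by blast
  obtain Q where Q: "path_in E ?W Q" "\<And>y. y \<in> ?W \<Longrightarrow> {hd Q, y} \<in> E \<Longrightarrow> y \<in> set Q"
    "\<And>y. y \<in> ?W \<Longrightarrow> {last Q, y} \<in> E \<Longrightarrow> y \<in> set Q"
    by (rule longest_path[OF fW Wne]) blast
  have QU: "path_in E (V - Z) Q" "path_in E (V - Z) (rev Q)" using path_in_mono[OF Q(1) WU] path_in_rev by auto
  have ends: "hd Q \<in> ?W" "last Q \<in> ?W" "Q \<noteq> []" using Q(1) by (auto simp: path_in_def)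
  have mx1: "y \<in> set Q" if "y \<in> V - Z" "{hd Q, y} \<in> E" for y
    using Q(2)[OF reach_step[OF ends(1)] that(2)] WU ends(1) that by blast
  have mx2: "y \<in> set (rev Q)" if "y \<in> V - Z" "{hd (rev Q), y} \<in> E" for y
    using Q(3)[OF reach_step[OF ends(2)]] WU ends that by (simp add: hd_rev subset_iff)
  show ?thesis
  proof (cases "length Q = 1")
    case True
    then have hl: "hd Q = last Q" by (cases Q) auto
    obtain s t where "s \<in> Z" "t \<in> Z" "s \<noteq> t" "{hd Q, s} \<in> E" "{hd Q, t} \<in> E"
      using outer_neighbour(2)[OF QU(1) mx1 True] by blast
    then show ?thesis using that[OF Q(1), of s t] hl by (simp add: insert_commute)
  next
    case False
    then have l2: "2 \<le> length Q" using ends by (cases Q) (auto simp: Suc_le_eq)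
    obtain s where s: "s \<in> Z" "{hd Q, s} \<in> E" using outer_neighbour(1)[OF QU(1) mx1] by blast
    obtain t where t: "t \<in> Z" "{hd (rev Q), t} \<in> E" using outer_neighbour(1)[OF QU(2) mx2] by blast
    have t': "{last Q, t} \<in> E" using t(2) ends by (simp add: hd_rev)
    have "s \<noteq> t" using same_attachment[OF QU(1) l2 _ t(1), of] s t' l2 by (auto simp: insert_commute)
    then show ?thesis using that[OF Q(1) s(1) t(1)] s(2) t' by (simp add: insert_commute)
  qed
qed

text \<open>Reroute the cycle through the ear \<open>q\<close>. The bypassed arc from
  \<open>f 0\<close> to \<open>f b\<close> becomes an ear, and a path inside the component from
  \<open>q\<close> to \<open>f d\<close> becomes a second one that crosses it.\<close>

lemma third_attachment_aux:
  assumes u: "u \<in> V - Z" and Q: "ear 0 b q" "q \<noteq> []" "set q \<subseteq> reach E (V - Z) u" "b < c"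
    and d: "b < d" "d < c" and w: "w \<in> reach E (V - Z) u" "{f d, w} \<in> E"
  shows False
proof -
  let ?W = "reach E (V - Z) u"
  have WU: "?W \<subseteq> V - Z" by (rule reach_subset[OF u])
  have conn: "connected_in E ?W" by (rule connected_in_reach[OF u])
  have ne: "set q \<inter> ?W \<noteq> {}" "{w} \<inter> ?W \<noteq> {}" using Q w by (cases q; auto)+
  obtain R where R: "path_in E ?W R" "hd R \<in> set q" "last R \<in> {w}"
    "\<And>i. 0 < i \<Longrightarrow> i < length R \<Longrightarrow> R ! i \<notin> set q"
    by (rule shortest_path_between[OF conn ne]) blast
  obtain y R' where R': "R = y # R'" using R(1) by (cases R) (auto simp: path_in_def)
  have yq: "y \<in> set q" using R(2) R' by simp
  then obtain m where m: "m < length q" "q ! m = y" by (metis in_set_conv_nth)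
  have R'q: "set R' \<inter> set q = {}"
  proof -
    have "R' ! i \<notin> set q" if "i < length R'" for i using R(4)[of "Suc i"] that R' by simp
    then show ?thesis by (auto simp: in_set_conv_nth)
  qed
  have R'W: "set R' \<subseteq> V - Z" "distinct R'" using R(1) WU by (auto simp: R' path_in_def)
  have e: "adjs E (y # R' @ [f d])"
  proof -
    have "adjs E (R @ [f d])" using R(1,3) w(2) by (auto simp: path_in_def successively_append_iff insert_commute)
    then show ?thesis by (simp add: R')
  qed
  have qe: "adjs E (f 0 # q @ [f b])" "distinct q" "set q \<inter> Z = {}" "0 < b" using Q(1) by (auto simp: ear_def)
  let ?D = "f 0 # q @ arc_list b c"
  have un: "arc_list 0 c = f 0 # arc_list 1 b @ arc_list b c"
    using arc_list_Cons[of 0 c] arc_list_append[of 1 b c] qe(4) Q(4) by simp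
  have d0: "distinct (f 0 # arc_list 1 b @ arc_list b c)" using distinct_arc_list[of c 0] un by simp
  have sets: "set (f 0 # arc_list 1 b @ arc_list b c) = Z" using set_Z_list un by simp
  have "((f 0 # q) @ arc_list b c) ! (length (f 0 # q) + (d - b)) = f d"
    unfolding nth_append_length_plus using d by simp
  then have nths: "?D ! (m + 1) = y" "?D ! (length q + 1) = f b" "?D ! (length q + 1 + (d - b)) = f d"
    using m d Q(4) by (simp_all add: nth_append)
  have "\<not> Pad V E 2"
  proof (rule crossing_ears[OF sg, of ?D "arc_list 1 b" R' "m + 1" "length q + 1" "length q + 1 + (d - b)"])
    show "distinct (?D @ arc_list 1 b @ R')" using d0 sets qe R'W R'q by auto
    show "adjs E (?D @ [?D ! 0])" using adjs_closed_arc[of 0 b q] qe Q(4) by simp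
    show "adjs E (?D ! 0 # arc_list 1 b @ [?D ! (length q + 1)])" using adjs_arc_ear[of 0 b] qe(4) nths by simp
    show "adjs E (?D ! (m + 1) # R' @ [?D ! (length q + 1 + (d - b))])" unfolding nths by (rule e)
  qed (use m d in auto)
  then show False using pad by simp
qed


lemma third_attachment:
  assumes u: "u \<in> V - Z" and Q: "ear 0 b q" "q \<noteq> []" "set q \<subseteq> reach E (V - Z) u" "b < c"
    and d: "0 < d" "d < c" "d \<noteq> b" and w: "w \<in> reach E (V - Z) u" "{f d, w} \<in> E"
  shows False
proof (cases "b < d")
  case True
  then show False using third_attachment_aux[OF u Q _ d(2) w] by simp
next
  case False
  then have db: "d < b" using d(3) by linarith
  interpret s: pad_cycle V E "\<lambda>n. f (n + b)" c by (rule pad_shift)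
  have "ear (0 + b) ((c - b) + b) (rev q)" using ear_rev[OF Q(1)] Q(4) by simp
  then have e: "s.ear 0 (c - b) (rev q)" by (rule ear_shift)
  have idx: "c - b < d + c - b" "d + c - b < c" "c - b < c" "d + c - b + b = d + c" using db Q(4) d by linarith+
  have u': "u \<in> V - range (\<lambda>n. f (n + b))" using u range_shift by simp
  have W: "set (rev q) \<subseteq> reach E (V - range (\<lambda>n. f (n + b))) u" "w \<in> reach E (V - range (\<lambda>n. f (n + b))) u"
    using Q(3) w(1) range_shift by simp_all
  have "{f (d + c - b + b), w} \<in> E" unfolding idx per by (rule w(2))
  then show False
    using s.third_attachment_aux[OF u' e _ W(1) idx(3) idx(1,2) W(2)] Q(2) by simp
qed

text \<open>Let \<open>i\<close> and \<open>j\<close> be the first and the last index that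
  \<open>xs\<close> meets. Edges on \<open>Z\<close> away from \<open>f 0\<close> join consecutive
  indices only, so \<open>f i\<close> and \<open>f j\<close> each have at most one neighbor on
  \<open>xs\<close> inside \<open>Z\<close>. Both thus have a neighbor outside, which
  \<open>h2\<close> excludes.\<close>

lemma no_cycle_avoiding:
  assumes h1: "\<And>k l. 0 < k \<Longrightarrow> k < l \<Longrightarrow> l < c \<Longrightarrow> {f k, f l} \<in> E \<Longrightarrow> l = Suc k"
    and h2: "\<And>k l w w'. 0 < k \<Longrightarrow> k < l \<Longrightarrow> l < c \<Longrightarrow> w \<in> V - Z \<Longrightarrow> w' \<in> V - Z \<Longrightarrow>
      {f k, w} \<in> E \<Longrightarrow> {f l, w'} \<in> E \<Longrightarrow> False"
    and xs: "lcyc E xs"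
  shows "f 0 \<in> set xs"
proof (rule ccontr)
  assume no: "f 0 \<notin> set xs"
  define I where "I = {k. k < c \<and> f k \<in> set xs}"
  have fI: "finite I" by (simp add: I_def)
  have "set xs \<inter> Z \<subseteq> f ` I" using Z_index by (fastforce simp: I_def)
  then have "card (set xs \<inter> Z) \<le> card (f ` I)" using fI by (intro card_mono) auto
  also have "\<dots> \<le> card I" by (rule card_image_le[OF fI])
  finally have I2: "2 \<le> card I" using cycle_meets_Z[OF xs] xs by (simp add: lcyc_def)
  then have Ine: "I \<noteq> {}" by auto
  define i j where "i = Min I" and "j = Max I"
  have ij: "i \<in> I" "j \<in> I" using fI Ine by (auto simp: i_def j_def)
  have bd: "i \<le> k" "k \<le> j" if "k \<in> I" for k using that fI by (auto simp: i_def j_def)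
  have lt: "i < j"
  proof (rule ccontr)
    assume "\<not> i < j"
    then have "I \<subseteq> {i}" using bd by fastforce
    then show False using I2 card_mono[of "{i}" I] by simp
  qed
  have i0: "0 < i"
  proof (rule ccontr)
    assume "\<not> 0 < i"
    then show False using no ij(1) by (simp add: I_def)
  qed
  have two: "\<exists>y z. y \<noteq> z \<and> y \<in> set xs \<and> z \<in> set xs \<and> {x, y} \<in> E \<and> {x, z} \<in> E" if x: "x \<in> set xs" for x
  proof -
    obtain ys where ys: "lcyc E ys" "set ys = set xs" "length ys = length xs" "hd ys = x"
      by (rule lcyc_rotate[OF xs x])
    obtain a b zs where abz: "ys = a # b # zs" "zs \<noteq> []"
      using ys(1) by (cases ys; cases "tl ys"; cases "tl (tl ys)") (auto simp: lcyc_def)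
    have l: "lcyc E (a # b # zs)" "x = a" "set xs = set (a # b # zs)" using ys abz by simp_all
    have "b \<noteq> last zs" using l(1) last_in_set[OF abz(2)] by (auto simp: lcyc_def)
    moreover have "{x, b} \<in> E" using l(1,2) by (simp add: lcyc_def)
    moreover have "{x, last zs} \<in> E" using l(1,2) abz(2) by (simp add: lcyc_def insert_commute)
    moreover have "b \<in> set xs" "last zs \<in> set xs" unfolding l(3) using abz(2) by simp_all
    ultimately show ?thesis by blast
  qed
  have outside: "\<exists>w\<in>V - Z. {f m, w} \<in> E"
    if m: "m \<in> I" "\<And>k. k \<in> I \<Longrightarrow> k \<noteq> m \<Longrightarrow> {f m, f k} \<in> E \<Longrightarrow> k = n" for m n
  proof -
    obtain y z where yz: "y \<noteq> z" "y \<in> set xs" "z \<in> set xs" "{f m, y} \<in> E" "{f m, z} \<in> E"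
      using two[of "f m"] m(1) by (auto simp: I_def)
    have in_Z: "y = f n" if "y \<in> Z" "y \<in> set xs" "{f m, y} \<in> E" for y
    proof -
      obtain k where k: "k < c" "y = f k" using Z_index[OF \<open>y \<in> Z\<close>] by blast
      then have "k \<in> I" using that by (simp add: I_def)
      moreover have "k \<noteq> m" using sgraphD[OF sg that(3)] k by auto
      ultimately show ?thesis using m(2) that k by simp
    qed
    have yzV: "y \<in> V" "z \<in> V" using sgraphD[OF sg yz(4)] sgraphD[OF sg yz(5)] by simp_all
    show ?thesis
    proof (cases "y \<in> Z")
      case True
      then have "z \<notin> Z" using in_Z[OF _ yz(2,4)] in_Z[OF _ yz(3,5)] yz(1) by metis
      then show ?thesis using yzV(2) yz(5) by (intro bexI[of _ z] DiffI)
    next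
      case False
      then show ?thesis using yzV(1) yz(4) by (intro bexI[of _ y] DiffI)
    qed
  qed
  have oi: "\<exists>w\<in>V - Z. {f i, w} \<in> E"
  proof (rule outside[OF ij(1)])
    fix k assume k: "k \<in> I" "k \<noteq> i" "{f i, f k} \<in> E"
    then have "i < k" "k < c" using bd(1)[OF k(1)] by (auto simp: I_def)
    then show "k = Suc i" using h1[OF i0] k(3) by blast
  qed
  have oj: "\<exists>w\<in>V - Z. {f j, w} \<in> E"
  proof (rule outside[OF ij(2)])
    fix k assume k: "k \<in> I" "k \<noteq> j" "{f j, f k} \<in> E"
    then have "k < j" "j < c" "0 < k" using bd[OF k(1)] ij i0 by (auto simp: I_def)
    then have "j = Suc k" using h1[of k j] k(3) by (simp add: insert_commute)
    then show "k = j - 1" by simp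
  qed
  have "j < c" using ij by (simp add: I_def)
  then show False using h2[OF i0 lt] oi oj by blast
qed

lemma nb_on_cycle:
  assumes "\<And>l. l < c \<Longrightarrow> ear 0 l [] \<Longrightarrow> l = j"
  shows "nb E (f 0) \<inter> Z \<subseteq> {f 1, f (c - 1), f j}" "(\<And>l. l < c \<Longrightarrow> \<not> ear 0 l []) \<Longrightarrow> nb E (f 0) \<inter> Z \<subseteq> {f 1, f (c - 1)}"
proof -
  have *: "l = 1 \<or> l = c - 1 \<or> ear 0 l []" if "{f 0, f l} \<in> E" "l < c" for l
  proof -
    have "l \<noteq> 0"
    proof
      assume "l = 0"
      then show False using sgraphD[OF sg that(1)] by simp
    qed
    then show ?thesis using ear_of_chord[of 0 l] that by auto
  qed
  have idx: "\<exists>l<c. y = f l \<and> {f 0, f l} \<in> E" if y: "y \<in> nb E (f 0) \<inter> Z" for y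
    using Z_index[of y] y by auto
  show "nb E (f 0) \<inter> Z \<subseteq> {f 1, f (c - 1), f j}" using idx * assms by fast
  show "nb E (f 0) \<inter> Z \<subseteq> {f 1, f (c - 1)}" if "\<And>l. l < c \<Longrightarrow> \<not> ear 0 l []"
    using idx * that by fast
qed

abbreviation apex :: "'a \<Rightarrow> bool" where
  "apex x \<equiv> x \<in> V \<and> card (nb E x) \<le> 3 \<and> (\<forall>xs. lcyc E xs \<longrightarrow> x \<in> set xs)"

lemma f0_V: "f 0 \<in> V" using Z_subset by blast

lemma ear_of_outside:
  assumes u: "u \<in> V - Z"
  obtains k l q where "k < l" "l < c" "ear k l q" "q \<noteq> []" "set q \<subseteq> reach E (V - Z) u"
proof -
  obtain Q s t where Q: "path_in E (reach E (V - Z) u) Q" "s \<in> Z" "t \<in> Z" "s \<noteq> t" "{s, hd Q} \<in> E" "{last Q, t} \<in> E"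
    by (rule component_path[OF u])
  have QU: "path_in E (V - Z) Q" by (rule path_in_mono[OF Q(1) reach_subset[OF u]])
  obtain k l q where "k < l" "l < c" "ear k l q" "set q = set Q" "q \<noteq> []"
    by (rule ear_of_path[OF QU Q(2-)])
  moreover have "set Q \<subseteq> reach E (V - Z) u" using Q(1) by (simp add: path_in_def)
  ultimately show ?thesis using that by metis
qed

lemma chord_index:
  assumes "0 < k" "k < l" "l < c" "{f k, f l} \<in> E" "\<not> ear k l []"
  shows "l = Suc k"
  using ear_of_chord[OF assms(4,2)] assms by auto

lemma apex_inside:
  assumes VZ: "V = Z" and chord: "\<And>k l. l < c \<Longrightarrow> ear k l [] \<Longrightarrow> k = 0 \<and> l = j"
  shows "apex (f 0)"
proof -
  have "nb E (f 0) \<subseteq> {f 1, f (c - 1), f j}"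
    using nb_on_cycle(1)[of j] chord nb_subset[OF sg, of "f 0"] VZ by blast
  then have "card (nb E (f 0)) \<le> card {f 1, f (c - 1), f j}" by (intro card_mono) auto
  also have "\<dots> \<le> 3" by (simp add: card_insert_if)
  finally have "card (nb E (f 0)) \<le> 3" .
  moreover have "f 0 \<in> set xs" if "lcyc E xs" for xs
  proof (rule no_cycle_avoiding[OF _ _ that])
    fix k l assume kl: "0 < k" "k < l" "l < c" "{f k, f l} \<in> E"
    show "l = Suc k" by (rule chord_index[OF kl]) (use chord[of l k] kl in auto)
  qed (use VZ in auto)
  ultimately show ?thesis using f0_V by blast
qed

text \<open>By \<open>two_ears\<close> the ear \<open>p\<close> excludes chords and a second outside
  component. So \<open>f 0\<close> has its two cycle neighbors and, by
  \<open>same_attachment\<close>, at most one neighbor outside. By \<open>third_attachment\<close>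
  only \<open>f 0\<close> and \<open>f j\<close> are attached to the outside, so no cycle avoids
  \<open>f 0\<close>.\<close>

lemma apex_outside:
  assumes u: "u \<in> V - Z" and p: "ear 0 j p" "p \<noteq> []" "set p \<subseteq> reach E (V - Z) u" "j < c"
  shows "apex (f 0)"
proof -
  let ?W = "reach E (V - Z) u"
  have WU: "?W \<subseteq> V - Z" by (rule reach_subset[OF u])
  have all: "w \<in> ?W" if w: "w \<in> V - Z" for w
  proof (rule ccontr)
    assume nw: "w \<notin> ?W"
    obtain k l q where q: "k < l" "l < c" "ear k l q" "q \<noteq> []" "set q \<subseteq> reach E (V - Z) w"
      by (rule ear_of_outside[OF w])
    have "set p \<inter> set q = {}"
    proof (rule ccontr)
      assume "set p \<inter> set q \<noteq> {}"
      then obtain z where z: "z \<in> ?W" "z \<in> reach E (V - Z) w" using p(3) q(5) by blast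
      then show False using reach_trans[OF z(1) reach_refl_sym_trans[OF z(2)]] nw by blast
    qed
    then show False using two_ears[OF p(1,4) q(3,2)] p(2) by blast
  qed
  have nochord: "\<not> ear k l []" if "l < c" for k l
    using two_ears[OF p(1,4), of k l "[]"] that p(2) by auto
  have nbZ: "nb E (f 0) \<inter> Z \<subseteq> {f 1, f (c - 1)}" using nb_on_cycle(2) nochord by blast
  have fin: "finite (nb E (f 0))" by (rule finite_nb[OF sg])
  have "card (nb E (f 0) - Z) \<le> Suc 0"
  proof (subst card_le_Suc0_iff_eq)
    show "\<forall>a\<in>nb E (f 0) - Z. \<forall>b\<in>nb E (f 0) - Z. a = b"
    proof (intro ballI, rule ccontr)
      fix a b assume a: "a \<in> nb E (f 0) - Z" and b: "b \<in> nb E (f 0) - Z" and ab: "a \<noteq> b"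
      have abW: "a \<in> ?W" "b \<in> ?W" using a b all nb_subset[OF sg, of "f 0"] by blast+
      obtain r where r: "path_in E ?W r" "hd r = a" "last r = b"
        using connected_in_reach[OF u, of E] abW unfolding connected_in_def by blast
      have "r \<noteq> []" "length r \<noteq> 1" using r ab by (auto simp: path_in_def length_Suc_conv)
      then have "2 \<le> length r" by (cases r) (auto simp: Suc_le_eq)
      then show False using same_attachment[OF path_in_mono[OF r(1) WU], of "f 0"] r a b by auto
    qed
  qed (use fin in auto)
  moreover have "card (nb E (f 0) \<inter> Z) \<le> 2"
  proof -
    have "card (nb E (f 0) \<inter> Z) \<le> card {f 1, f (c - 1)}" using nbZ by (intro card_mono) auto
    also have "\<dots> \<le> 2" by (simp add: card_insert_if)
    finally show ?thesis .
  qed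
  moreover have "card (nb E (f 0)) = card (nb E (f 0) \<inter> Z) + card (nb E (f 0) - Z)"
    using fin by (metis card_Int_Diff)
  ultimately have "card (nb E (f 0)) \<le> 3" by linarith
  moreover have "f 0 \<in> set xs" if xs: "lcyc E xs" for xs
  proof (rule no_cycle_avoiding[OF _ _ xs])
    fix k l assume kl: "0 < k" "k < l" "l < c" "{f k, f l} \<in> E"
    show "l = Suc k" by (rule chord_index[OF kl nochord[OF kl(3)]])
  next
    fix k l w w' assume a: "0 < k" "k < l" "l < c" "w \<in> V - Z" "w' \<in> V - Z" "{f k, w} \<in> E" "{f l, w'} \<in> E"
    consider "k \<noteq> j" | "l \<noteq> j" using a by linarith
    then show False
    proof cases
      case 1
      then show False using third_attachment[OF u p, of k w] a all by auto
    next
      case 2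
      then show False using third_attachment[OF u p, of l w'] a all by auto
    qed
  qed
  ultimately show ?thesis using f0_V by blast
qed

text \<open>The starting point of an ear is moved to index 0. Without ears the graph is the cycle
  itself and every vertex serves.\<close>

lemma apex_exists: "\<exists>x. apex x"
proof (cases "V = Z")
  case False
  then obtain u where u: "u \<in> V - Z" using Z_subset by blast
  obtain k l q where q: "k < l" "l < c" "ear k l q" "q \<noteq> []" "set q \<subseteq> reach E (V - Z) u"
    by (rule ear_of_outside[OF u])
  interpret s: pad_cycle V E "\<lambda>n. f (n + k)" c by (rule pad_shift)
  have "ear (0 + k) (l - k + k) q" using q by simp
  then have "s.ear 0 (l - k) q" by (rule ear_shift)
  then have "apex (f (0 + k))" using s.apex_outside[of u "l - k" q] u q(2,4,5) less_imp_diff_less unfolding range_shift by blast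
  then show ?thesis by blast
next
  case VZ: True
  show ?thesis
  proof (cases "\<exists>k l. l < c \<and> ear k l []")
    case True
    then obtain k l where q: "l < c" "ear k l []" by blast
    interpret s: pad_cycle V E "\<lambda>n. f (n + k)" c by (rule pad_shift)
    have "k < l" using q(2) by (simp add: ear_def)
    then have "ear (0 + k) (l - k + k) []" using q by simp
    then have e: "s.ear 0 (l - k) []" by (rule ear_shift)
    have "k' = 0 \<and> l' = l - k" if "l' < c" "s.ear k' l' []" for k' l'
      using s.two_ears[OF e _ that(2,1)] q by auto
    then have "apex (f (0 + k))" using s.apex_inside[of "l - k"] VZ unfolding range_shift by blast
    then show ?thesis by blast
  next
    case False
    then have "apex (f 0)" using apex_inside[OF VZ] by blast
    then show ?thesis by blast
  qed
qed

end

lemma apex_of_adaptable: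
  assumes sg: "sgraph V E" and conn: "connected_in E V" and V: "V \<noteq> {}"
    and pad: "Pad V E 2" and deg: "\<And>v. v \<in> V \<Longrightarrow> 2 \<le> card (nb E v)"
  shows "\<exists>x\<in>V. card (nb E x) \<le> 3 \<and> (\<forall>xs. lcyc E xs \<longrightarrow> x \<in> set xs)"
proof -
  have d: "2 \<le> card (nb E v \<inter> V)" if "v \<in> V" for v
    using nb_subset[OF sg, of v] deg[OF that] by (simp add: Int_absorb2 subset_Diff_insert)
  obtain xs where xs: "lcyc E xs"
    by (rule long_cycle_of_min_degree[OF sg subset_refl V d]) auto
  have "big_cycle V E (\<lambda>i. xs ! (i mod length xs)) (length xs) 3"
  proof (rule big_cycle_of_lcyc[OF sg xs])
    fix as bs assume ab: "lcyc E as" "lcyc E bs"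
    show "2 \<le> card (set as \<inter> set bs)" using two_cycles(1)[OF sg conn ab] pad by linarith
  qed (use xs in \<open>auto simp: lcyc_def\<close>)
  then interpret pad_cycle V E "\<lambda>i. xs ! (i mod length xs)" "length xs"
    using pad deg by (simp add: pad_cycle_def pad_cycle_axioms_def)
  show ?thesis using apex_exists by blast
qed

section \<open>Passing to induced subgraphs\<close>

lemma nb_induced: "v \<in> S \<Longrightarrow> nb {e \<in> E. e \<subseteq> S} v = nb E v \<inter> S"
  by auto

lemma adjs_induced: "set xs \<subseteq> S \<Longrightarrow> adjs {e \<in> E. e \<subseteq> S} xs \<longleftrightarrow> adjs E xs"
  by (induction xs rule: induct_list012) auto

lemma path_in_induced: "path_in {e \<in> E. e \<subseteq> S} S p \<longleftrightarrow> path_in E S p"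
  unfolding path_in_def using adjs_induced[of p S E] by blast

lemma connected_in_induced: "connected_in {e \<in> E. e \<subseteq> S} S \<longleftrightarrow> connected_in E S"
  by (simp add: connected_in_def path_in_induced)

lemma lcyc_induced: "set xs \<subseteq> S \<Longrightarrow> lcyc {e \<in> E. e \<subseteq> S} xs \<longleftrightarrow> lcyc E xs"
  unfolding lcyc_def using adjs_induced[of xs S E] by (cases xs) auto

lemma Pad_induced:
  assumes "Pad V E k" "S \<subseteq> V" shows "Pad S {e \<in> E. e \<subseteq> S} k"
  unfolding Pad_def
proof (intro allI impI)
  fix f L assume L: "list_assignment S k L"
  define L' where "L' v = (if v \<in> S then L v else {1..k})" for v
  have "list_assignment V k L'" using L by (simp add: list_assignment_def L'_def)
  then obtain c where c: "adapted_coloring E f c" "\<forall>v\<in>V. c v \<in> L' v" using assms unfolding Pad_def by blast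
  have "adapted_coloring {e \<in> E. e \<subseteq> S} f c" using c(1) by (simp add: adapted_coloring_def)
  moreover have "\<forall>v\<in>S. c v \<in> L v"
  proof
    fix v assume v: "v \<in> S"
    then have "c v \<in> L' v" using c(2) assms(2) by (simp add: subset_iff)
    then show "c v \<in> L v" using v by (simp add: L'_def)
  qed
  ultimately show "\<exists>c. adapted_coloring {e \<in> E. e \<subseteq> S} f c \<and> (\<forall>v\<in>S. c v \<in> L v)" by blast
qed

text \<open>Vertices outside \<open>S\<close> receive fresh and pairwise disjoint lists, so the
  extended lists remain separated.\<close>

lemma Psep_induced:
  assumes P: "Psep V E 2" and sg: "sgraph V E" and S: "S \<subseteq> V" shows "Psep S {e \<in> E. e \<subseteq> S} 2"
  unfolding Psep_def
proof (intro allI impI)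
  fix L assume L: "list_assignment S 2 L \<and> separated {e \<in> E. e \<subseteq> S} L"
  have fS: "finite S" using sgraph_finite[OF sg] S finite_subset by blast
  have "finite (\<Union> (L ` S))" using L fS by (auto simp: list_assignment_def)
  then obtain M where M: "\<forall>c\<in>\<Union> (L ` S). c < M" using finite_nat_set_iff_bounded by blast
  obtain idx :: "'a \<Rightarrow> nat" where idx: "inj_on idx V" using sgraph_finite[OF sg] finite_imp_inj_to_nat_seg by metis
  define L' where "L' v = (if v \<in> S then L v else {M + 2 * idx v, M + 2 * idx v + 1})" for v
  have la: "list_assignment V 2 L'" using L by (auto simp: list_assignment_def L'_def)
  have mixed: "L' x \<inter> L' y = {}" if "x \<in> S" "y \<notin> S" for x y
    using M that by (fastforce simp: L'_def)
  have "card (L' x \<inter> L' y) \<le> 1" if e: "{x, y} \<in> E" for x y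
  proof -
    have xy: "x \<in> V" "y \<in> V" "x \<noteq> y" using sgraphD[OF sg e] by simp_all
    consider "x \<in> S" "y \<in> S" | "x \<in> S" "y \<notin> S" | "x \<notin> S" "y \<in> S" | "x \<notin> S" "y \<notin> S" by blast
    then show ?thesis
    proof cases
      case 1
      then show ?thesis using L e by (simp add: separated_def L'_def)
    next
      case 2
      then show ?thesis using mixed by simp
    next
      case 3
      then show ?thesis using mixed[of y x] by (simp add: Int_commute)
    next
      case 4
      have "idx x \<noteq> idx y" using idx xy by (auto simp: inj_on_def)
      then have "L' x \<inter> L' y = {}" using 4 by (auto simp: L'_def)
      then show ?thesis by simp
    qed
  qed
  then have "separated E L'" by (simp add: separated_def)
  then obtain \<phi> where \<phi>: "proper_coloring E \<phi>" "\<forall>v\<in>V. \<phi> v \<in> L' v" using la P unfolding Psep_def by blast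
  have "proper_coloring {e \<in> E. e \<subseteq> S} \<phi>" using \<phi>(1) by (simp add: proper_coloring_def)
  moreover have "\<forall>v\<in>S. \<phi> v \<in> L v"
  proof
    fix v assume v: "v \<in> S"
    then have "\<phi> v \<in> L' v" using \<phi>(2) S by (simp add: subset_iff)
    then show "\<phi> v \<in> L v" using v by (simp add: L'_def)
  qed
  ultimately show "\<exists>\<phi>. proper_coloring {e \<in> E. e \<subseteq> S} \<phi> \<and> (\<forall>v\<in>S. \<phi> v \<in> L v)" by blast
qed

section \<open>Conflict colorings with two colors\<close>

definition conflict_free :: "'a set set \<Rightarrow> ('a \<Rightarrow> 'a set \<Rightarrow> nat) \<Rightarrow> 'a set \<Rightarrow> ('a \<Rightarrow> nat) \<Rightarrow> bool" where
  "conflict_free E c S \<phi> \<longleftrightarrow> (\<forall>x\<in>S. \<forall>y\<in>S. {x, y} \<in> E \<longrightarrow> \<not> (\<phi> x = c x {x, y} \<and> \<phi> y = c y {x, y}))"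

lemma extend_conflict_free:
  assumes sg: "sgraph V E" and v: "v \<in> S" and \<phi>: "conflict_free E c (S - {v}) \<phi>"
    and F: "finite F" "card (nb E v \<inter> S) + card F < k"
  obtains a where "a \<in> {1..k}" "a \<notin> F" "conflict_free E c S (\<phi>(v := a))"
proof -
  let ?B = "(\<lambda>y. c v {v, y}) ` (nb E v \<inter> S)"
  have fin: "finite (nb E v \<inter> S)" using finite_nb[OF sg] by simp
  have "card (?B \<union> F) \<le> card ?B + card F" by (rule card_Un_le)
  also have "\<dots> < k" using card_image_le[OF fin, of "\<lambda>y. c v {v, y}"] F(2) by simp
  finally obtain a where a: "a \<in> {1..k}" "a \<notin> ?B \<union> F"
    using exists_avoiding_color[of "?B \<union> F" k] fin F(1) by blast
  have nv: "a \<noteq> c v {v, y}" if "{v, y} \<in> E" "y \<in> S" for y using a(2) that by auto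
  have "conflict_free E c S (\<phi>(v := a))"
    unfolding conflict_free_def
  proof (intro ballI impI)
    fix x y assume xy: "x \<in> S" "y \<in> S" "{x, y} \<in> E"
    have ne: "x \<noteq> y" using sgraphD[OF sg xy(3)] by simp
    consider "x = v" | "y = v" | "x \<noteq> v" "y \<noteq> v" by blast
    then show "\<not> ((\<phi>(v := a)) x = c x {x, y} \<and> (\<phi>(v := a)) y = c y {x, y})"
    proof cases
      case 1
      then show ?thesis using nv xy by auto
    next
      case 2
      then show ?thesis using nv[of x] xy by (auto simp: insert_commute)
    next
      case 3
      then show ?thesis using \<phi> xy by (simp add: conflict_free_def)
    qed
  qed
  then show ?thesis using that a by blast
qed

lemma sum_degrees_induced:
  assumes "sgraph V E" "S \<subseteq> V"
  shows "(\<Sum>v\<in>S. card (nb E v \<inter> S)) = 2 * card {e \<in> E. e \<subseteq> S}"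
  using handshake[OF sgraph_induced[OF assms]] nb_induced[of _ S E] by simp

text \<open>The degrees in a nonempty forest and the single forbidden color sum to less than
  \<open>2 * card S\<close>, so some vertex keeps a color whatever the others receive, and can be
  colored last.\<close>

lemma color_forest:
  assumes sg: "sgraph V E" and "S \<subseteq> V" "\<And>xs. lcyc E xs \<Longrightarrow> \<not> set xs \<subseteq> S"
    and "\<And>v. finite (F v)" "(\<Sum>v\<in>S. card (F v)) \<le> 1"
  shows "\<exists>\<phi>. (\<forall>v\<in>S. \<phi> v \<in> {1..2} \<and> \<phi> v \<notin> F v) \<and> conflict_free E c S \<phi>"
  using assms(2,3,5)
proof (induction "card S" arbitrary: S rule: less_induct)
  case less
  have fS: "finite S" using less.prems(1) sgraph_finite[OF sg] finite_subset by blast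
  show ?case
  proof (cases "S = {}")
    case True
    then show ?thesis by (simp add: conflict_free_def)
  next
    case False
    have "\<exists>v\<in>S. card (nb E v \<inter> S) + card (F v) < 2"
    proof (rule ccontr)
      assume no: "\<not> ?thesis"
      have "(\<Sum>v\<in>S. 2) \<le> (\<Sum>v\<in>S. card (nb E v \<inter> S) + card (F v))"
      proof (rule sum_mono)
        fix v assume "v \<in> S"
        then show "2 \<le> card (nb E v \<inter> S) + card (F v)" using no not_less by blast
      qed
      also have "\<dots> \<le> 2 * card {e \<in> E. e \<subseteq> S} + 1"
        using sum_degrees_induced[OF sg less.prems(1)] less.prems(3) by (simp add: sum.distrib)
      finally show False using acyclic_edge_count[OF sg less.prems(1) False less.prems(2)] by simp
    qed
    then obtain v where v: "v \<in> S" "card (nb E v \<inter> S) + card (F v) < 2" by blast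
    have "card (S - {v}) < card S" using v fS by (intro psubset_card_mono) auto
    moreover have "S - {v} \<subseteq> V" "\<And>xs. lcyc E xs \<Longrightarrow> \<not> set xs \<subseteq> S - {v}" using less.prems(1,2) by blast+
    moreover have "(\<Sum>v\<in>S - {v}. card (F v)) \<le> 1"
      using less.prems(3) sum_mono2[OF fS, of "S - {v}" "\<lambda>v. card (F v)"] by auto
    ultimately obtain \<phi> where \<phi>: "\<forall>v\<in>S - {v}. \<phi> v \<in> {1..2} \<and> \<phi> v \<notin> F v" "conflict_free E c (S - {v}) \<phi>"
      using less.hyps[of "S - {v}"] by blast
    obtain a where a: "a \<in> {1..2}" "a \<notin> F v" "conflict_free E c S (\<phi>(v := a))"
      by (rule extend_conflict_free[OF sg v(1) \<phi>(2) assms(4) v(2)])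
    show ?thesis
    proof (intro exI conjI)
      show "\<forall>u\<in>S. (\<phi>(v := a)) u \<in> {1..2} \<and> (\<phi>(v := a)) u \<notin> F u" using \<phi>(1) a by simp
    qed (rule a(3))
  qed
qed

text \<open>One of the two colors at the apex is in conflict with at most one neighbor; with that color
  the remaining forest has a single restricted vertex.\<close>

lemma color_apex:
  assumes sg: "sgraph V E" and S: "S \<subseteq> V" "x \<in> S" "card (nb E x \<inter> S) \<le> 3"
    and cyc: "\<And>xs. lcyc E xs \<Longrightarrow> \<not> set xs \<subseteq> S - {x}"
  shows "\<exists>\<phi>. (\<forall>v\<in>S. \<phi> v \<in> {1..2}) \<and> conflict_free E c S \<phi>"
proof -
  define A where "A a = {y \<in> nb E x \<inter> S. c x {x, y} = a}" for a
  have fin: "finite (nb E x \<inter> S)" using finite_nb[OF sg] by simp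
  have fA: "finite (A a)" for a unfolding A_def using fin by (rule rev_finite_subset) blast
  have "card (A 1) + card (A 2) = card (A 1 \<union> A 2)" using fA by (subst card_Un_disjoint) (auto simp: A_def)
  also have "\<dots> \<le> card (nb E x \<inter> S)" using fin by (intro card_mono) (auto simp: A_def)
  finally have "card (A 1) \<le> 1 \<or> card (A 2) \<le> 1" using S(3) by linarith
  moreover have "(1::nat) \<in> {1..2}" "(2::nat) \<in> {1..2}" by simp_all
  ultimately obtain a where a: "a \<in> {1..2}" "card (A a) \<le> 1" by blast
  define F where "F y = (if y \<in> A a then {c y {x, y}} else {})" for y
  have fS: "finite (S - {x})" using S sgraph_finite[OF sg] finite_subset by blast
  have "(\<Sum>v\<in>S - {x}. card (F v)) = (\<Sum>v\<in>S - {x}. if v \<in> A a then 1 else 0)"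
    by (intro sum.cong) (auto simp: F_def)
  also have "\<dots> = card ((S - {x}) \<inter> A a)" using fS by (simp add: sum.If_cases)
  also have "\<dots> \<le> card (A a)" using fA by (intro card_mono) auto
  finally have sumF: "(\<Sum>v\<in>S - {x}. card (F v)) \<le> 1" using a(2) by linarith
  have fF: "finite (F v)" for v by (simp add: F_def)
  have SV: "S - {x} \<subseteq> V" using S by blast
  obtain \<phi> where \<phi>: "\<forall>v\<in>S - {x}. \<phi> v \<in> {1..2} \<and> \<phi> v \<notin> F v" "conflict_free E c (S - {x}) \<phi>"
    using color_forest[OF sg SV cyc fF sumF] by blast
  have key: "\<not> (a = c x {x, y} \<and> \<phi> y = c y {x, y})" if "y \<in> S" "{x, y} \<in> E" for y
  proof
    assume h: "a = c x {x, y} \<and> \<phi> y = c y {x, y}"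
    then have "y \<in> A a" using that by (simp add: A_def)
    moreover have "y \<noteq> x" using sgraphD[OF sg that(2)] by blast
    ultimately have "\<phi> y \<notin> F y" "F y = {c y {x, y}}" using \<phi>(1) that(1) by (blast, simp add: F_def)
    then show False using h by simp
  qed
  have "conflict_free E c S (\<phi>(x := a))"
    unfolding conflict_free_def
  proof (intro ballI impI)
    fix u w assume uw: "u \<in> S" "w \<in> S" "{u, w} \<in> E"
    have ne: "u \<noteq> w" using sgraphD[OF sg uw(3)] by simp
    consider "u = x" | "w = x" | "u \<noteq> x" "w \<noteq> x" by blast
    then show "\<not> ((\<phi>(x := a)) u = c u {u, w} \<and> (\<phi>(x := a)) w = c w {u, w})"
    proof cases
      case 1
      then show ?thesis using key[of w] uw ne by simp
    next
      case 2
      then show ?thesis using key[of u] uw ne by (auto simp: insert_commute)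
    next
      case 3
      then show ?thesis using \<phi>(2) uw by (simp add: conflict_free_def)
    qed
  qed
  moreover have "\<forall>v\<in>S. (\<phi>(x := a)) v \<in> {1..2}" using \<phi>(1) a(1) by simp
  ultimately show ?thesis by blast
qed

text \<open>A vertex of degree at most 1 is colored last, and components are colored separately.
  What remains is connected of minimum degree 2 and has an apex.\<close>

lemma color_of_adaptable:
  assumes sg: "sgraph V E" and pad: "Pad V E 2" and "S \<subseteq> V"
  shows "\<exists>\<phi>. (\<forall>v\<in>S. \<phi> v \<in> {1..2}) \<and> conflict_free E c S \<phi>"
  using assms(3)
proof (induction "card S" arbitrary: S rule: less_induct)
  case less
  have fS: "finite S" using less.prems sgraph_finite[OF sg] finite_subset by blast
  have IH: "\<exists>\<phi>. (\<forall>v\<in>T. \<phi> v \<in> {1..2}) \<and> conflict_free E c T \<phi>" if "T \<subset> S" for T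
    using less.hyps[OF psubset_card_mono[OF fS that]] that less.prems by blast
  consider "S = {}" | v where "v \<in> S" "card (nb E v \<inter> S) < 2"
    | u where "u \<in> S" "reach E S u \<noteq> S"
    | u where "u \<in> S" "reach E S u = S" "\<And>v. v \<in> S \<Longrightarrow> 2 \<le> card (nb E v \<inter> S)"
  proof (cases "\<exists>v\<in>S. card (nb E v \<inter> S) < 2")
    case True
    then show ?thesis using that(2) by blast
  next
    case False
    then have "\<And>v. v \<in> S \<Longrightarrow> 2 \<le> card (nb E v \<inter> S)" using not_less by blast
    then show ?thesis using that(1,3,4) by blast
  qed
  then show ?case
  proof cases
    case 1
    then show ?thesis by (simp add: conflict_free_def)
  next
    case (2 v)
    obtain \<phi> where \<phi>: "\<forall>v\<in>S - {v}. \<phi> v \<in> {1..2}" "conflict_free E c (S - {v}) \<phi>"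
      using IH[of "S - {v}"] 2(1) by blast
    obtain a where a: "a \<in> {1..2}" "conflict_free E c S (\<phi>(v := a))"
      by (rule extend_conflict_free[OF sg 2(1) \<phi>(2), of "{}" 2]) (use 2 in auto)
    have "\<forall>u\<in>S. (\<phi>(v := a)) u \<in> {1..2}" using \<phi>(1) a(1) by simp
    then show ?thesis using a(2) by blast
  next
    case (3 u)
    let ?W = "reach E S u"
    have WS: "?W \<subseteq> S" by (rule reach_subset[OF 3(1)])
    have uW: "u \<in> ?W" by (rule self_in_reach)
    obtain \<phi> where \<phi>: "\<forall>v\<in>?W. \<phi> v \<in> {1..2}" "conflict_free E c ?W \<phi>" using IH[of ?W] WS 3(2) by blast
    obtain \<psi> where \<psi>: "\<forall>v\<in>S - ?W. \<psi> v \<in> {1..2}" "conflict_free E c (S - ?W) \<psi>"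
      using IH[of "S - ?W"] uW 3(1) by blast
    let ?\<chi> = "\<lambda>v. if v \<in> ?W then \<phi> v else \<psi> v"
    have "conflict_free E c S ?\<chi>"
      unfolding conflict_free_def
    proof (intro ballI impI)
      fix x y assume xy: "x \<in> S" "y \<in> S" "{x, y} \<in> E"
      have yx: "{y, x} \<in> E" using xy(3) by (simp add: insert_commute)
      have "x \<in> ?W \<longleftrightarrow> y \<in> ?W" using reach_step[OF _ xy] reach_step[OF _ xy(2,1) yx] by blast
      then show "\<not> (?\<chi> x = c x {x, y} \<and> ?\<chi> y = c y {x, y})"
        using \<phi>(2) \<psi>(2) xy by (cases "x \<in> ?W") (simp_all add: conflict_free_def)
    qed
    moreover have "\<forall>v\<in>S. ?\<chi> v \<in> {1..2}" using \<phi>(1) \<psi>(1) by simp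
    ultimately show ?thesis by (intro exI[of _ ?\<chi>] conjI)
  next
    case (4 u)
    let ?E = "{e \<in> E. e \<subseteq> S}"
    have "connected_in E S" using connected_in_reach[OF 4(1), of E] 4(2) by simp
    then have conn: "connected_in ?E S" by (simp add: connected_in_induced)
    have Sne: "S \<noteq> {}" using 4(1) by blast
    have d: "2 \<le> card (nb ?E v)" if "v \<in> S" for v using 4(3)[OF that] nb_induced[OF that, of E] by simp
    obtain x where x: "x \<in> S" "card (nb ?E x) \<le> 3" "\<forall>xs. lcyc ?E xs \<longrightarrow> x \<in> set xs"
      using apex_of_adaptable[OF sgraph_induced[OF sg less.prems] conn Sne Pad_induced[OF pad less.prems] d] by blast
    have "\<not> set xs \<subseteq> S - {x}" if "lcyc E xs" for xs
    proof
      assume s: "set xs \<subseteq> S - {x}"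
      then have "lcyc ?E xs" using lcyc_induced[of xs S E] that by blast
      then show False using x(3) s by blast
    qed
    then show ?thesis using color_apex[OF sg less.prems x(1)] x(2) nb_induced[OF x(1), of E] by simp
  qed
qed

theorem Pad_2_imp_Pconf_2:
  assumes sg: "sgraph V E" and pad: "Pad V E 2" shows "Pconf V E 2"
  unfolding Pconf_def
proof (intro allI impI)
  fix c
  obtain \<phi> where \<phi>: "\<forall>v\<in>V. \<phi> v \<in> {1..2}" "conflict_free E c V \<phi>"
    using color_of_adaptable[OF sg pad subset_refl] by blast
  have "\<not> (\<phi> x = c x {x, y} \<and> \<phi> y = c y {x, y})" if e: "{x, y} \<in> E" for x y
    using \<phi>(2) sgraphD[OF sg e] e by (simp add: conflict_free_def)
  then show "conflict_colorable V E 2 c" using \<phi>(1) unfolding conflict_colorable_def by blast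
qed

section \<open>Edge bounds from separated lists\<close>

lemma lcyc_of_closed:
  assumes "distinct D" "3 \<le> length D" "adjs E (D @ [D ! 0])" shows "lcyc E D"
proof -
  have ne: "D \<noteq> []" using assms(2) by auto
  have "adjs E D" "{last D, D ! 0} \<in> E" using assms(3) ne unfolding successively_append_iff by simp_all
  then show ?thesis using assms(1,2) ne by (simp add: lcyc_def hd_conv_nth)
qed

lemma card_induced_remove:
  assumes sg: "sgraph V E" and S: "S \<subseteq> V" "v \<in> S"
  shows "card {e \<in> E. e \<subseteq> S} = card {e \<in> E. e \<subseteq> S - {v}} + card (nb E v \<inter> S)"
proof -
  have "{e \<in> {e \<in> E. e \<subseteq> S}. v \<notin> e} = {e \<in> E. e \<subseteq> S - {v}}" by blast
  then show ?thesis
    using card_edges_remove[OF sgraph_induced[OF sg S(1)], of v] nb_induced[OF S(2), of E] by simp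
qed

text \<open>A neighbor beyond index 2 of the path would close a cycle of length at least 4.\<close>

lemma longest_path_end:
  assumes sg: "sgraph V E" and P: "path_in E S P" and mx: "\<And>q. path_in E S q \<Longrightarrow> length q \<le> length P"
    and no4: "\<And>xs. lcyc E xs \<Longrightarrow> 4 \<le> length xs \<Longrightarrow> \<not> set xs \<subseteq> S"
  shows "nb E (hd P) \<inter> S \<subseteq> (\<lambda>i. P ! i) ` ({1, 2} \<inter> {..<length P})"
proof
  fix y assume y: "y \<in> nb E (hd P) \<inter> S"
  have Pn: "P \<noteq> []" using P by (simp add: path_in_def)
  have ne: "y \<noteq> hd P" using sgraphD[OF sg, of "hd P" y] y by auto
  have "y \<in> set P"
  proof (rule ccontr)
    assume ny: "y \<notin> set P"
    have "path_in E S (y # P)"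
      using P y ny Pn by (auto simp: path_in_def successively_Cons insert_commute)
    then show False using mx[of "y # P"] by simp
  qed
  then obtain i where i: "i < length P" "P ! i = y" by (metis in_set_conv_nth)
  have "i \<noteq> 0" using ne i Pn by (metis hd_conv_nth)
  moreover have "i < 3"
  proof (rule ccontr)
    assume i3: "\<not> i < 3"
    then have i2: "2 \<le> i" by simp
    have e: "{hd P, P ! i} \<in> E" using y i by simp
    note c = lcyc_take[OF P i(1) i2 e]
    have "4 \<le> length (take (Suc i) P)" using c(3) i3 by linarith
    then show False using no4[OF c(1)] c(2) by blast
  qed
  ultimately have "i \<in> {1, 2} \<inter> {..<length P}" using i by auto
  then show "y \<in> (\<lambda>i. P ! i) ` ({1, 2} \<inter> {..<length P})" using i(2) by blast
qed

text \<open>A triangle at the start of a path can be traversed in the other order, so the second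
  vertex is an end of an equally long path.\<close>

lemma longest_path_swap:
  assumes P: "path_in E S P" and l: "3 \<le> length P" and e: "{P ! 0, P ! 2} \<in> E"
  obtains P' where "path_in E S P'" "length P' = length P" "hd P' = P ! 1" "P' ! 1 = P ! 0" "P' ! 2 = P ! 2"
    "last P' = last P"
proof -
  obtain a b d zs where abd: "P = a # b # d # zs"
    using l by (cases P; cases "tl P"; cases "tl (tl P)") auto
  have "path_in E S (b # a # d # zs)"
    using P e unfolding abd by (auto simp: path_in_def insert_commute)
  then show ?thesis using that[of "b # a # d # zs"] by (simp add: abd)
qed

text \<open>All cycles inside \<open>S\<close> are triangles. The first vertex of a longest path has
  degree at most 1, or it lies in a triangle with the second one; then these two vertices together
  carry at most three edges, exactly the allowed ratio.\<close>

lemma cactus_edge_count: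
  assumes sg: "sgraph V E" and "S \<subseteq> V" "\<And>xs. lcyc E xs \<Longrightarrow> 4 \<le> length xs \<Longrightarrow> \<not> set xs \<subseteq> S"
  shows "2 * card {e \<in> E. e \<subseteq> S} \<le> 3 * card S"
  using assms(2,3)
proof (induction "card S" arbitrary: S rule: less_induct)
  case less
  have fS: "finite S" using less.prems(1) sgraph_finite[OF sg] finite_subset by blast
  have IH: "2 * card {e \<in> E. e \<subseteq> T} \<le> 3 * card T" if T: "T \<subset> S" for T
  proof (rule less.hyps[OF psubset_card_mono[OF fS T]])
    show "T \<subseteq> V" using T less.prems(1) by blast
    fix xs assume xs: "lcyc E xs" "4 \<le> length xs"
    show "\<not> set xs \<subseteq> T" using less.prems(2)[OF xs] T by blast
  qed
  show ?case
  proof (cases "S = {}")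
    case True
    have "{e \<in> E. e \<subseteq> S} = {}" using sg by (auto simp: sgraph_def True)
    then show ?thesis by (simp only: card.empty)
  next
    case False
    obtain P where P: "path_in E S P" "\<And>q. path_in E S q \<Longrightarrow> length q \<le> length P"
      by (rule longest_path[OF fS False]) blast
    have Pn: "P \<noteq> []" using P by (simp add: path_in_def)
    have hS: "hd P \<in> S" using P(1) hd_in_set[OF Pn] unfolding path_in_def by blast
    have hn: "nb E (hd P) \<inter> S \<subseteq> (\<lambda>i. P ! i) ` ({1, 2} \<inter> {..<length P})"
      by (rule longest_path_end[OF sg P less.prems(2)])
    have rem: "card {e \<in> E. e \<subseteq> S} = card {e \<in> E. e \<subseteq> S - {hd P}} + card (nb E (hd P) \<inter> S)"
      by (rule card_induced_remove[OF sg less.prems(1) hS])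
    have cS: "card (S - {hd P}) + 1 = card S" using hS fS card_gt_0_iff[of S] by auto
    have IH1: "2 * card {e \<in> E. e \<subseteq> S - {hd P}} \<le> 3 * card (S - {hd P})" using IH[of "S - {hd P}"] hS by blast
    show ?thesis
    proof (cases "card (nb E (hd P) \<inter> S) \<le> 1")
      case True
      then show ?thesis using rem IH1 cS by linarith
    next
      case c2: False
      have l3: "3 \<le> length P"
      proof (rule ccontr)
        assume "\<not> 3 \<le> length P"
        then have "(\<lambda>i. P ! i) ` ({1, 2} \<inter> {..<length P}) \<subseteq> {P ! 1}" by auto
        with hn have "nb E (hd P) \<inter> S \<subseteq> {P ! 1}" by (rule subset_trans)
        then show False using c2 card_mono[of "{P ! 1}" "nb E (hd P) \<inter> S"] by simp
      qed
      have h0: "hd P = P ! 0" using Pn by (rule hd_conv_nth)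
      have "(\<lambda>i. P ! i) ` ({1, 2} \<inter> {..<length P}) \<subseteq> {P ! 1, P ! 2}" by auto
      with hn have sub: "nb E (hd P) \<inter> S \<subseteq> {P ! 1, P ! 2}" by (rule subset_trans)
      have ub: "card (nb E (hd P) \<inter> S) \<le> 2"
        using card_mono[OF _ sub] by (simp add: card_insert_if split: if_splits)
      have e02: "P ! 2 \<in> nb E (hd P)"
      proof (rule ccontr)
        assume "P ! 2 \<notin> nb E (hd P)"
        then have "nb E (hd P) \<inter> S \<subseteq> {P ! 1}" using sub by blast
        then show False using c2 card_mono[of "{P ! 1}" "nb E (hd P) \<inter> S"] by simp
      qed
      then have e: "{P ! 0, P ! 2} \<in> E" using h0 by simp
      obtain P' where P': "path_in E S P'" "length P' = length P" "hd P' = P ! 1" "P' ! 1 = P ! 0" "P' ! 2 = P ! 2"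
        by (rule longest_path_swap[OF P(1) l3 e])
      have mx': "length q \<le> length P'" if "path_in E S q" for q using P(2)[OF that] P'(2) by simp
      have hn': "nb E (P ! 1) \<inter> S \<subseteq> {P ! 0, P ! 2}"
      proof -
        have "(\<lambda>i. P' ! i) ` ({1, 2} \<inter> {..<length P'}) \<subseteq> {P' ! 1, P' ! 2}" by auto
        with longest_path_end[OF sg P'(1) mx' less.prems(2)] have "nb E (hd P') \<inter> S \<subseteq> {P' ! 1, P' ! 2}"
          by (rule subset_trans)
        then show ?thesis by (simp only: P'(3-5))
      qed
      let ?T = "S - {hd P}"
      have P1: "P ! 1 \<in> ?T"
      proof -
        have "P ! 1 \<noteq> P ! 0" using P(1) l3 by (auto simp: path_in_def nth_eq_iff_index_eq)
        moreover have "P ! 1 \<in> S" using P(1) l3 by (auto simp: path_in_def)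
        ultimately show ?thesis using h0 by simp
      qed
      have TV: "?T \<subseteq> V" using less.prems(1) by blast
      have "nb E (P ! 1) \<inter> ?T \<subseteq> {P ! 2}" using hn' h0 by auto
      then have d1: "card (nb E (P ! 1) \<inter> ?T) \<le> 1" using card_mono[of "{P ! 2}"] by fastforce
      have rem1: "card {e \<in> E. e \<subseteq> ?T} = card {e \<in> E. e \<subseteq> ?T - {P ! 1}} + card (nb E (P ! 1) \<inter> ?T)"
        by (rule card_induced_remove[OF sg TV P1])
      have cT: "card (?T - {P ! 1}) + 1 = card ?T" using P1 fS card_gt_0_iff[of ?T] by auto
      have "2 * card {e \<in> E. e \<subseteq> ?T - {P ! 1}} \<le> 3 * card (?T - {P ! 1})" using IH[of "?T - {P ! 1}"] hS by blast
      then show ?thesis using rem rem1 d1 ub cS cT by linarith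
    qed
  qed
qed

lemma three_members:
  fixes A :: "nat set"
  assumes "finite A" "3 \<le> card A"
  obtains x y z where "x \<in> A" "y \<in> A" "z \<in> A" "x < y" "y < z"
proof -
  have ne: "A \<noteq> {}" using assms(2) by auto
  have "card (A - {Min A, Max A}) \<ge> card A - card {Min A, Max A}" by (rule diff_card_le_card_Diff) simp
  moreover have "card {Min A, Max A} \<le> 2" by (simp add: card_insert_if)
  ultimately have "card (A - {Min A, Max A}) \<noteq> 0" using assms(2) by linarith
  then have "A - {Min A, Max A} \<noteq> {}" by (metis card.empty)
  then obtain y where y: "y \<in> A" "y \<noteq> Min A" "y \<noteq> Max A" by blast
  then have "Min A < y" "y < Max A" using assms(1) by (simp_all add: le_neq_implies_less Min_le Max_ge)
  then show ?thesis using that[of "Min A" y "Max A"] y assms(1) ne by simp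
qed

section \<open>Chords of the long cycle\<close>

context big_cycle
begin

lemma f_eq_add: "f i = f j \<Longrightarrow> f (i + r) = f (j + r)"
  unfolding f_eq_iff by (rule mod_add_cong) auto

lemma inj_shift: "inj_on (\<lambda>i. f (i + r)) {..<c}"
proof (rule inj_onI)
  fix p q assume "p \<in> {..<c}" "q \<in> {..<c}" "f (p + r) = f (q + r)"
  then show "p = q" using f_inj[of "p + r" "q + r" r] by auto
qed

lemma card_shifted: "A \<subseteq> {..<c} \<Longrightarrow> card ((\<lambda>i. f (i + r)) ` A) = card A"
  using inj_shift inj_on_subset by (blast intro: card_image)

text \<open>The vertices whose index satisfies \<open>P\<close>, their translate by 1, and the
  translate by 2 of those satisfying \<open>P2\<close> are pairwise disjoint subsets of the
  cycle.\<close>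

lemma card_spread:
  assumes cong: "\<And>i j. f i = f j \<Longrightarrow> P i \<Longrightarrow> P j"
    and P: "\<And>i. P i \<Longrightarrow> \<not> P (Suc i)" and P2: "\<And>i. P2 i \<Longrightarrow> P i \<and> \<not> P (i + 2)"
  shows "2 * card {i. i < c \<and> P i} + card {i. i < c \<and> P2 i} \<le> c"
proof -
  let ?T = "{i. i < c \<and> P i}" and ?T2 = "{i. i < c \<and> P2 i}"
  define A where "A r T = (\<lambda>i. f (i + r)) ` T" for r :: nat and T
  have fin: "finite (A 0 ?T)" "finite (A 1 ?T)" "finite (A 2 ?T2)" by (auto simp: A_def)
  have d01: "A 0 ?T \<inter> A 1 ?T = {}"
  proof (rule ccontr)
    assume "A 0 ?T \<inter> A 1 ?T \<noteq> {}"
    then obtain i j where "P i" "P j" "f i = f (j + 1)" by (auto simp: A_def)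
    then show False using cong[of i "j + 1"] P[of j] by simp
  qed
  have d02: "A 0 ?T \<inter> A 2 ?T2 = {}"
  proof (rule ccontr)
    assume "A 0 ?T \<inter> A 2 ?T2 \<noteq> {}"
    then obtain i j where "P i" "P2 j" "f i = f (j + 2)" unfolding A_def by auto
    then show False using cong[of i "j + 2"] P2[of j] by simp
  qed
  have d12: "A 1 ?T \<inter> A 2 ?T2 = {}"
  proof (rule ccontr)
    assume "A 1 ?T \<inter> A 2 ?T2 \<noteq> {}"
    then obtain i j where ij: "P i" "P2 j" "f (i + 1) = f (j + 2)" unfolding A_def by auto
    have "i + 1 + (c - 1) = i + c" "j + 2 + (c - 1) = j + 1 + c" using c_pos by linarith+
    then have "f i = f (j + 1)" using f_eq_add[OF ij(3), of "c - 1"] per by metis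
    then show False using cong[of i "j + 1"] ij P2[of j] P[of j] by simp
  qed
  have "card (A 0 ?T \<union> A 1 ?T \<union> A 2 ?T2) = card ?T + card ?T + card ?T2"
    using fin d01 d02 d12 card_shifted[of ?T 0] card_shifted[of ?T 1] card_shifted[of ?T2 2]
    by (simp add: card_Un_disjoint Int_Un_distrib2 A_def subset_iff)
  moreover have "card (A 0 ?T \<union> A 1 ?T \<union> A 2 ?T2) \<le> card Z"
    by (rule card_mono[OF finite_Z]) (auto simp: A_def)
  ultimately show ?thesis using card_Z by simp
qed

text \<open>A short chord, cutting off the single vertex \<open>f (i + 1)\<close>. On that side it
  closes only a triangle, so a single one is out of reach of \<open>noncrossing\<close> for
  \<open>\<mu> = 4\<close>.\<close>

definition sh :: "nat \<Rightarrow> bool" where "sh i \<longleftrightarrow> {f i, f (i + 2)} \<in> E"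

lemma sh_cong: "f i = f j \<Longrightarrow> sh i \<Longrightarrow> sh j"
  using f_eq_add[of i j 2] by (simp add: sh_def)

text \<open>Two consecutive short chords and two cycle edges form a four-cycle on an arc of four
  vertices.\<close>

lemma block:
  assumes "sh i" "sh (Suc i)" and \<mu>: "\<mu> = 4"
  shows "arc_cycle {} i (i + 3)"
  unfolding arc_cycle_def
proof (intro exI conjI)
  let ?xs = "[f i, f (i + 2), f (i + 3), f (Suc i)]"
  have c4: "4 \<le> c" using \<mu> big_cycle.\<mu>(2)[OF big_cycle_axioms] by simp
  have "distinct ?xs"
    using f_neq[of i "i + 2"] f_neq[of i "i + 3"] f_neq[of i "Suc i"] f_neq[of "i + 2" "i + 3"]
      f_neq[of "Suc i" "i + 2"] f_neq[of "Suc i" "i + 3"] c4 by auto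
  moreover have "{f (i + 2), f (i + 3)} \<in> E" using step[of "i + 2"] by (simp add: eval_nat_numeral)
  moreover have "{f (i + 3), f (Suc i)} \<in> E" using assms(2) by (simp add: sh_def insert_commute eval_nat_numeral)
  moreover have "{f (Suc i), f i} \<in> E" using step[of i] by (simp add: insert_commute)
  ultimately show "lcyc E ?xs" using assms(1) by (simp add: lcyc_def sh_def)
qed (use assms(3) in auto)

text \<open>Long chords only: both sides have at least two inner vertices, so both arcs close to a
  cycle of length at least 4.\<close>

definition chords :: "'a set set" where
  "chords = {{f k, f l} |k l. {f k, f l} \<in> E \<and> k + 3 \<le> l \<and> l + 3 \<le> k + c}"

lemma card_inside:
  "card {e \<in> E. e \<subseteq> Z} \<le> c + card {i. i < c \<and> sh i} + card chords"
proof -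
  let ?A = "(\<lambda>i. {f i, f (Suc i)}) ` {..<c}" and ?B = "(\<lambda>i. {f i, f (i + 2)}) ` {i. i < c \<and> sh i}"
  have fin: "finite chords"
    using sgraph_finite_edges[OF sg] by (rule rev_finite_subset) (auto simp: chords_def)
  have "{e \<in> E. e \<subseteq> Z} \<subseteq> ?A \<union> ?B \<union> chords"
  proof
    fix e assume "e \<in> {e \<in> E. e \<subseteq> Z}"
    then have eE: "e \<in> E" and eZ: "e \<subseteq> Z" by simp_all
    obtain x y where xy: "x \<noteq> y" "e = {x, y}" using sgraphE[OF sg eE] by metis
    obtain k l where kl: "k < c" "l < c" "k < l" "e = {f k, f l}"
    proof -
      obtain k l where kl: "k < c" "x = f k" "l < c" "y = f l" using Z_index[of x] Z_index[of y] xy eZ by auto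
      then have "k \<noteq> l" using xy by auto
      then show ?thesis using that[of k l] that[of l k] kl xy by (cases "k < l") (auto simp: insert_commute)
    qed
    consider "l = Suc k" | "Suc l = k + c" | "l = k + 2" | "l + 2 = k + c" | "k + 3 \<le> l" "l + 3 \<le> k + c"
      using kl by linarith
    then show "e \<in> ?A \<union> ?B \<union> chords"
    proof cases
      case 1
      then show ?thesis using kl by blast
    next
      case 2
      then have "f (Suc l) = f k" using per by simp
      then have "e = {f l, f (Suc l)}" using kl by (simp add: insert_commute)
      then show ?thesis using kl(2) by blast
    next
      case 3
      then have "sh k" using kl eE by (simp add: sh_def)
      then show ?thesis using kl 3 by blast
    next
      case 4
      then have "f (l + 2) = f k" using per by simp
      then have e: "e = {f l, f (l + 2)}" using kl by (simp add: insert_commute)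
      then have "sh l" using eE by (simp add: sh_def)
      then show ?thesis using kl(2) e by blast
    next
      case 5
      then show ?thesis using kl eE by (auto simp: chords_def)
    qed
  qed
  then have "card {e \<in> E. e \<subseteq> Z} \<le> card (?A \<union> ?B \<union> chords)" using fin by (intro card_mono) auto
  also have "\<dots> \<le> card ?A + card ?B + card chords" by (meson add_mono card_Un_le le_refl order_trans)
  also have "\<dots> \<le> c + card {i. i < c \<and> sh i} + card chords"
    using card_image_le[of "{..<c}" "\<lambda>i. {f i, f (Suc i)}"]
      card_image_le[of "{i. i < c \<and> sh i}" "\<lambda>i. {f i, f (i + 2)}"] by simp
  finally show ?thesis .
qed

lemma chord_arc_cycle:
  assumes "{f k, f l} \<in> E" "k + 3 \<le> l" "l + 3 \<le> k + c" "\<mu> = 4"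
  shows "arc_cycle {} k l" "arc_cycle {} l (k + c)"
proof -
  have e: "ear k l []" using assms by (simp add: ear_def)
  show "arc_cycle {} k l" using ear_arc_cycle[OF e] assms by simp
  show "arc_cycle {} l (k + c)" using ear_arc_cycle[OF ear_rev[OF e]] assms by simp
qed

end

lemma lcyc_mono: "lcyc F xs \<Longrightarrow> F \<subseteq> E \<Longrightarrow> lcyc E xs"
  unfolding lcyc_def by (auto elim!: successively_mono)

context big_cycle
begin

lemma arc_split:
  assumes "i < j" "j \<le> i + c"
  shows "distinct (f i # arc_list (Suc i) j @ arc_list j (i + c))"
    "set (f i # arc_list (Suc i) j @ arc_list j (i + c)) = Z"
proof -
  have eq: "arc_list i (i + c) = f i # arc_list (Suc i) j @ arc_list j (i + c)"
    using arc_list_Cons[of i "i + c"] arc_list_append[of "Suc i" j "i + c"] assms by simp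
  have s: "set (arc_list i (i + c)) = Z" unfolding arc_list_simps(1) by (rule Z_eq[symmetric])
  have d: "distinct (arc_list i (i + c))" by (rule distinct_arc_list) simp
  show "distinct (f i # arc_list (Suc i) j @ arc_list j (i + c))" using d unfolding eq .
  show "set (f i # arc_list (Suc i) j @ arc_list j (i + c)) = Z" using s unfolding eq .
qed

lemma ear_of_ends:
  assumes p: "path_in E (V - Z) p" and e: "{f a, hd p} \<in> E" "{f b, last p} \<in> E" and ab: "a < b" "b < a + c"
  shows "ear a b p"
proof -
  have "p \<noteq> []" "distinct p" "adjs E p" "set p \<inter> Z = {}" using p unfolding path_in_def by blast+
  moreover from this have "adjs E (f a # p @ [f b])"
    using e by (simp add: successively_Cons successively_append_iff hd_append insert_commute)
  ultimately show ?thesis using ab by (simp add: ear_def)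
qed

lemma arc_cycle_shift:
  assumes "arc_cycle X (i + k) (j + k)"
  shows "big_cycle.arc_cycle E (\<lambda>n. f (n + k)) \<mu> X i j"
proof -
  interpret s: big_cycle V E "\<lambda>n. f (n + k)" c \<mu> by (rule shift)
  have "(\<lambda>n. f (n + k)) ` {i..j} = f ` ((\<lambda>n. n + k) ` {i..j})" by (simp only: image_image)
  also have "(\<lambda>n. n + k) ` {i..j} = {i + k..j + k}" by (rule image_add_atLeastAtMost')
  finally show ?thesis using assms unfolding arc_cycle_def s.arc_cycle_def by simp
qed

lemma chord_at:
  assumes "e \<in> chords" "f i \<in> e"
  obtains l where "e = {f i, f l}" "i + 3 \<le> l" "l + 3 \<le> i + c"
proof -
  obtain k l where kl: "e = {f k, f l}" "k + 3 \<le> l" "l + 3 \<le> k + c" using assms(1) by (auto simp: chords_def)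
  consider "f k = f i" | "f l = f i" using assms(2) kl(1) by auto
  then show ?thesis
  proof cases
    case 1
    have "k + (l - k) = l" using kl by simp
    then have "f l = f (i + (l - k))" using f_eq_add[OF 1, of "l - k"] by simp
    then show ?thesis using that[of "i + (l - k)"] kl 1 by simp
  next
    case 2
    have "l + (k + c - l) = k + c" using kl by simp
    then have "f k = f (i + (k + c - l))" using f_eq_add[OF 2, of "k + c - l"] per[of k] by simp
    then show ?thesis using that[of "i + (k + c - l)"] kl 2 by (simp add: insert_commute)
  qed
qed

lemma chord_window:
  assumes "e \<in> chords"
  obtains a b where "i \<le> a" "a + 3 \<le> b" "b < i + c" "b + 3 \<le> a + c" "e = {f a, f b}"
proof -
  obtain k l where kl: "e = {f k, f l}" using assms by (auto simp: chords_def)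
  have "f k \<in> f ` {i..<i + c}" using Z_eq[of i] by blast
  then obtain a where a: "f k = f a" "i \<le> a" "a < i + c" by auto
  have "f a \<in> e" using kl a by simp
  then obtain l' where l': "e = {f a, f l'}" "a + 3 \<le> l'" "l' + 3 \<le> a + c" by (rule chord_at[OF assms])
  show ?thesis
  proof (cases "l' < i + c")
    case True
    then show ?thesis using that[of a l'] a l' by simp
  next
    case False
    define b where "b = l' - c"
    have b: "l' = b + c" "i \<le> b" using False by (simp_all add: b_def)
    then have "f l' = f b" using per by simp
    then show ?thesis using that[of b a] a l' b by (simp add: insert_commute)
  qed
qed

lemma chord_in_E: "e \<in> chords \<Longrightarrow> e \<in> E"
  by (auto simp: chords_def)

end

text \<open>At most two of the 15 pairs are missing, and they touch at most four vertices. Two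
  further vertices are adjacent to everything and give K_{2,4}, a four-cycle with two one-vertex
  ears.\<close>

lemma dense_on_six_vertices:
  assumes sg: "sgraph V E" and V: "card V = 6" and e: "13 \<le> card E"
  shows "\<not> Psep V E 2"
proof -
  let ?P = "{A. A \<subseteq> V \<and> card A = 2}"
  have fV: "finite V" by (rule sgraph_finite[OF sg])
  have cP: "card ?P = 15" using n_subsets[OF fV, of 2] V by (simp add: choose_two)
  have EP: "E \<subseteq> ?P" using sg by (auto simp: sgraph_def card_insert_if)
  have fP: "finite ?P" using fV by (simp add: finite_subset)
  have fE: "finite E" by (rule sgraph_finite_edges[OF sg])
  let ?N = "?P - E"
  have cN: "card ?N \<le> 2" using card_Diff_subset[OF fE EP] cP e by simp
  have "card (\<Union> ?N) \<le> (\<Sum>A\<in>?N. card A)" by (rule card_Union_le_sum_card)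
  also have "\<dots> = (\<Sum>A\<in>?N. 2)" by (intro sum.cong) auto
  also have "\<dots> \<le> 4" using cN by simp
  finally have cU: "card (\<Union> ?N) \<le> 4" .
  have UV: "\<Union> ?N \<subseteq> V" by blast
  have "card (V - \<Union> ?N) = card V - card (\<Union> ?N)" by (rule card_Diff_subset[OF finite_subset[OF UV fV] UV])
  then have le: "2 \<le> card (V - \<Union> ?N)" using cU V by linarith
  obtain T where T: "T \<subseteq> V - \<Union> ?N" "card T = 2" by (rule obtain_subset_with_card_n[OF le])
  then obtain x y where xy: "T = {x, y}" "x \<noteq> y" by (auto simp: card_2_iff)
  have fT: "finite T" using xy by simp
  have "card (V - T) = 4" using card_Diff_subset[of T V] T V fT by auto
  moreover obtain xs where xs: "set xs = V - T" "distinct xs"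
    using finite_distinct_list[OF finite_Diff[OF fV, of T]] by blast
  ultimately have "length xs = 4" using distinct_card[OF xs(2)] by simp
  then obtain a b p q where abpq: "xs = [a, b, p, q]" by (auto simp: length_Suc_conv eval_nat_numeral)
  have E: "{s, z} \<in> E" if "s \<in> T" "z \<in> V - T" for s z
  proof (rule ccontr)
    assume "{s, z} \<notin> E"
    moreover have "{s, z} \<in> ?P" using that T(1) by (auto simp: card_insert_if)
    ultimately have "s \<in> \<Union> ?N" by blast
    then show False using that(1) T(1) by blast
  qed
  have E2: "{z, s} \<in> E" if "s \<in> T" "z \<in> V - T" for s z
    using E[OF that] by (simp add: insert_commute)
  have mem: "x \<in> T" "y \<in> T" "a \<in> V - T" "b \<in> V - T" "p \<in> V - T" "q \<in> V - T"
    unfolding xs(1)[symmetric] abpq using xy(1) by auto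
  show ?thesis
  proof (rule four_paths(2)[OF sg, of "[x, a, y, b]" "[p]" "[q]" 2])
    have "x \<notin> set xs" "y \<notin> set xs" using mem(1,2) xs(1) by blast+
    then show "distinct ([x, a, y, b] @ [p] @ [q])" using xs(2) xy(2) unfolding abpq by auto
    have "{x, a} \<in> E" "{a, y} \<in> E" "{y, b} \<in> E" "{b, x} \<in> E" "{x, p} \<in> E" "{p, y} \<in> E" "{x, q} \<in> E" "{q, y} \<in> E"
      using mem E E2 by blast+
    then show "adjs E ([x, a, y, b] @ [[x, a, y, b] ! 0])" "adjs E ([x, a, y, b] ! 0 # [p] @ [[x, a, y, b] ! 2])"
      "adjs E ([x, a, y, b] ! 0 # [q] @ [[x, a, y, b] ! 2])" by simp_all
  qed simp_all
qed

section \<open>A longest cycle when two colors suffice for separated lists\<close>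

locale sep_cycle = big_cycle V E f c 4 for V E f c +
  assumes sep: "Psep V E 2" and deg: "\<And>v. v \<in> V \<Longrightarrow> 3 \<le> card (nb E v)"
    and longest: "\<And>xs. lcyc E xs \<Longrightarrow> length xs \<le> c"
begin

lemma sep_shift: "sep_cycle V E (\<lambda>n. f (n + k)) c"
  using shift sep deg longest by (simp add: sep_cycle_def sep_cycle_axioms_def)

text \<open>Otherwise replacing an arc by the ear would lengthen the cycle.\<close>

lemma ear_long:
  assumes "ear i j p" "p \<noteq> []"
  shows "length p + 1 \<le> j - i" "length p + 1 \<le> i + c - j"
proof -
  have *: "length p + 1 \<le> j - i" if e: "ear i j p" "p \<noteq> []" for i j p
  proof -
    have ij: "i < j" "j < i + c" "adjs E (f i # p @ [f j])" "distinct p" "set p \<inter> Z = {}"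
      using e(1) unfolding ear_def by blast+
    let ?D = "f i # p @ arc_list j (i + c)"
    have s: "set (f i # arc_list (Suc i) j @ arc_list j (i + c)) = Z"
      and d: "distinct (f i # arc_list (Suc i) j @ arc_list j (i + c))" using arc_split[of i j] ij by simp_all
    have "f i \<in> Z" "set (arc_list j (i + c)) \<subseteq> Z" by auto
    then have "f i \<notin> set p" "set p \<inter> set (arc_list j (i + c)) = {}" using ij(5) by blast+
    then have dD: "distinct ?D" using d ij(4) by simp
    have l: "length ?D = 1 + length p + (i + c - j)" by simp
    have "0 < length p" using e(2) by simp
    then have "3 \<le> length ?D" using l ij by linarith
    moreover have "adjs E (?D @ [?D ! 0])" using adjs_closed_arc[OF ij(1-3)] by simp
    ultimately have "length ?D \<le> c" using longest[OF lcyc_of_closed[OF dD]] by blast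
    then show ?thesis using l ij by linarith
  qed
  show "length p + 1 \<le> j - i" by (rule *[OF assms])
  show "length p + 1 \<le> i + c - j" using *[OF ear_rev[OF assms(1)]] assms(2) by simp
qed

lemma no_cycle_outside: "lcyc E xs \<Longrightarrow> 4 \<le> length xs \<Longrightarrow> \<not> set xs \<subseteq> V - Z"
proof
  assume xs: "lcyc E xs" "4 \<le> length xs" "set xs \<subseteq> V - Z"
  have "set xs \<inter> Z = {}" using xs(3) by blast
  then show False using cycle_meets_Z[OF xs(1,2)] by simp
qed

abbreviation att :: "'a set \<Rightarrow> nat \<Rightarrow> bool" where "att W k \<equiv> \<exists>w\<in>W. {f k, w} \<in> E"

text \<open>Cycles inside the component are triangles, so an end of a longest path \<open>P\<close>
  in it has at most two neighbors there and, by the degree bound, one on \<open>Z\<close>. If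
  \<open>P\<close> has one or two vertices, its vertices see three attachments or form two parallel
  one-vertex ears. If \<open>P\<close> is longer, \<open>same_attachment\<close> tells three
  attachments apart.\<close>

lemma component_attachments:
  assumes u: "u \<in> V - Z"
  shows "3 \<le> card {z \<in> Z. \<exists>w\<in>reach E (V - Z) u. {z, w} \<in> E}" (is "3 \<le> card ?A")
proof (rule ccontr)
  assume "\<not> 3 \<le> card ?A"
  then have A2: "card ?A \<le> 2" by simp
  let ?W = "reach E (V - Z) u"
  have WU: "?W \<subseteq> V - Z" by (rule reach_subset[OF u])
  have fW: "finite ?W" using WU sgraph_finite[OF sg] finite_subset by blast
  have Wne: "?W \<noteq> {}" using self_in_reach[of u E "V - Z"] by blast
  have fA: "finite ?A" using finite_Z by simp
  have inA: "s \<in> ?A" if "s \<in> Z" "{w, s} \<in> E" "w \<in> ?W" for s w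
    using that by (auto simp: insert_commute)
  have three: False if "x \<in> ?A" "y \<in> ?A" "z \<in> ?A" "x \<noteq> y" "x \<noteq> z" "y \<noteq> z" for x y z
  proof -
    have "{x, y, z} \<subseteq> ?A" using that(1-3) by blast
    then have "card {x, y, z} \<le> card ?A" by (rule card_mono[OF fA])
    then show False using that(4-6) A2 by simp
  qed
  have subA: "nb E w \<inter> Z \<subseteq> ?A" if "w \<in> ?W" for w
    using inA[OF _ _ that] by auto
  have split: "3 \<le> card (nb E w \<inter> Z) + card (nb E w \<inter> ?W)" if w: "w \<in> ?W" for w
  proof -
    have wV: "w \<in> V - Z" using w WU by blast
    have "nb E w \<subseteq> (nb E w \<inter> Z) \<union> (nb E w \<inter> ?W)"
    proof
      fix y assume y: "y \<in> nb E w"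
      then have yV: "y \<in> V" using sgraphD[OF sg, of w y] by simp
      show "y \<in> (nb E w \<inter> Z) \<union> (nb E w \<inter> ?W)"
      proof (cases "y \<in> Z")
        case False
        then have "y \<in> ?W" using reach_step[OF w wV, of y] yV y by simp
        then show ?thesis using y by blast
      qed (use y in blast)
    qed
    then have "card (nb E w) \<le> card ((nb E w \<inter> Z) \<union> (nb E w \<inter> ?W))"
      using finite_nb[OF sg, of w] by (intro card_mono) auto
    also have "\<dots> \<le> card (nb E w \<inter> Z) + card (nb E w \<inter> ?W)" by (rule card_Un_le)
    finally show ?thesis using deg[of w] wV by simp
  qed
  have no4: "\<not> set xs \<subseteq> ?W" if "lcyc E xs" "4 \<le> length xs" for xs using no_cycle_outside[OF that] WU by blast
  define top where "top P \<longleftrightarrow> path_in E ?W P \<and> (\<forall>q. path_in E ?W q \<longrightarrow> length q \<le> length P)" for P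
  have topD: "path_in E (V - Z) P" "P \<noteq> []" "hd P \<in> ?W" "last P \<in> ?W" if "top P" for P
  proof -
    have p: "path_in E ?W P" using that by (simp add: top_def)
    then show "path_in E (V - Z) P" using WU by (rule path_in_mono)
    show Pn: "P \<noteq> []" using p by (simp add: path_in_def)
    show "hd P \<in> ?W" "last P \<in> ?W" using p hd_in_set[OF Pn] last_in_set[OF Pn] unfolding path_in_def by blast+
  qed
  have topend: "nb E (hd P) \<inter> ?W \<subseteq> (\<lambda>i. P ! i) ` ({1, 2} \<inter> {..<length P})" if "top P" for P
  proof (rule longest_path_end[OF sg _ _ no4])
    show "path_in E ?W P" using that by (simp add: top_def)
    show "length q \<le> length P" if "path_in E ?W q" for q using \<open>top P\<close> that by (simp add: top_def)
  qed
  have toprev: "top (rev P)" if "top P" for P using that by (simp add: top_def path_in_rev)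
  have few: "card (nb E (hd P) \<inter> ?W) \<le> 2" "card (nb E (hd P) \<inter> ?W) \<le> length P - 1" if "top P" for P
  proof -
    have le: "card (nb E (hd P) \<inter> ?W) \<le> card I" if "{1, 2} \<inter> {..<length P} \<subseteq> I" "finite I" for I
    proof -
      have "card (nb E (hd P) \<inter> ?W) \<le> card ((\<lambda>i. P ! i) ` ({1, 2} \<inter> {..<length P}))"
        by (rule card_mono[OF _ topend[OF \<open>top P\<close>]]) simp
      also have "\<dots> \<le> card ({1, 2} \<inter> {..<length P})" by (rule card_image_le) simp
      also have "\<dots> \<le> card I" using that by (intro card_mono)
      finally show ?thesis .
    qed
    show "card (nb E (hd P) \<inter> ?W) \<le> 2" using le[of "{1, 2}"] by simp
    show "card (nb E (hd P) \<inter> ?W) \<le> length P - 1" using le[of "{1..<length P}"] by fastforce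
  qed
  have few1: "card (nb E (hd P) \<inter> ?W) \<le> 1" if "top P" "P ! 2 \<notin> nb E (hd P)" for P
  proof -
    have "(\<lambda>i. P ! i) ` ({1, 2} \<inter> {..<length P}) \<subseteq> {P ! 1, P ! 2}" by auto
    with topend[OF that(1)] have "nb E (hd P) \<inter> ?W \<subseteq> {P ! 1, P ! 2}" by (rule subset_trans)
    then have "nb E (hd P) \<inter> ?W \<subseteq> {P ! 1}" using that(2) by blast
    then show ?thesis using card_mono[of "{P ! 1}"] by fastforce
  qed
  have nbr: "\<exists>s\<in>Z. {hd P, s} \<in> E" if "top P" for P
  proof -
    have "card (nb E (hd P) \<inter> Z) \<noteq> 0" using split[OF topD(3)[OF that]] few(1)[OF that] by linarith
    then have "nb E (hd P) \<inter> Z \<noteq> {}" by (metis card.empty)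
    then obtain s where "s \<in> nb E (hd P) \<inter> Z" by blast
    then show ?thesis by (intro bexI[of _ s]) simp_all
  qed
  obtain P where P0: "path_in E ?W P" "\<And>q. path_in E ?W q \<Longrightarrow> length q \<le> length P"
    by (rule longest_path[OF fW Wne]) blast
  then have P: "top P" by (simp add: top_def)
  note R = toprev[OF P]
  have hr: "hd (rev P) = last P" using topD(2)[OF P] by (simp add: hd_rev)
  obtain r where r: "r \<in> Z" "{last P, r} \<in> E" using nbr[OF R] hr by auto
  have rA: "r \<in> ?A" by (rule inA[OF r topD(4)[OF P]])
  have "0 < length P" using topD(2)[OF P] by simp
  then consider "length P = 1" | "length P = 2" | "3 \<le> length P" by linarith
  then show False
  proof cases
    case 1
    then have "3 \<le> card (nb E (hd P) \<inter> Z)" using split[OF topD(3)[OF P]] few(2)[OF P] by simp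
    also have "\<dots> \<le> card ?A" by (rule card_mono[OF fA subA[OF topD(3)[OF P]]])
    finally show False using A2 by simp
  next
    case 2
    \<comment> \<open>Each of the two vertices of \<open>P\<close> sees both attachments and so is a
      one-vertex ear between them. The ear formed by all of \<open>P\<close> keeps the attachments
      at distance at least 3 on the cycle.\<close>
    have full: "nb E w \<inter> Z = ?A \<and> card ?A = 2" if "w \<in> ?W" "card (nb E w \<inter> ?W) \<le> 1" for w
    proof -
      have "2 \<le> card (nb E w \<inter> Z)" using split[OF that(1)] that(2) by simp
      moreover have "card (nb E w \<inter> Z) \<le> card ?A" by (rule card_mono[OF fA subA[OF that(1)]])
      ultimately show ?thesis using card_seteq[OF fA subA[OF that(1)]] A2 by simp
    qed
    have x: "nb E (hd P) \<inter> Z = ?A" "card ?A = 2" using full[OF topD(3)[OF P]] few(2)[OF P] 2 by simp_all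
    have y: "nb E (last P) \<inter> Z = ?A" using full[OF topD(4)[OF P]] few(2)[OF R] 2 hr by simp
    obtain s t where st: "?A = {s, t}" "s \<noteq> t" using x(2) by (auto simp: card_2_iff)
    have sx: "s \<in> nb E (hd P) \<inter> Z" "t \<in> nb E (hd P) \<inter> Z" "s \<in> nb E (last P) \<inter> Z" "t \<in> nb E (last P) \<inter> Z"
      unfolding x y st by simp_all
    have sx': "{hd P, s} \<in> E" "{hd P, t} \<in> E" "{last P, s} \<in> E" "{last P, t} \<in> E" "s \<in> Z" "t \<in> Z"
      using sx by simp_all
    obtain x0 y0 where xy: "P = [x0, y0]" using 2 by (auto simp: length_Suc_conv eval_nat_numeral)
    obtain k l q where kl: "k < l" "l < c" "ear k l q" "q \<noteq> []" "{f k, f l} = {s, t}" "q = P \<or> q = rev P"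
      using ear_of_path[OF topD(1)[OF P] sx'(5,6) st(2)] sx' by (metis insert_commute)
    have lq: "length q = 2" using kl(6) 2 by auto
    have far: "3 \<le> l - k" "3 \<le> k + c - l" using ear_long[OF kl(3,4)] lq by simp_all
    have "f k \<in> {s, t}" "f l \<in> {s, t}" using kl(5) by blast+
    then have e: "{f k, x0} \<in> E" "{x0, f l} \<in> E" "{f k, y0} \<in> E" "{y0, f l} \<in> E"
      using sx'(1-4) unfolding xy by (auto simp: insert_commute)
    have "\<not> Psep V E 2"
    proof (rule four_paths(2)[OF sg, of "arc_list k (k + c)" "[x0]" "[y0]" "l - k"])
      have "set (arc_list k (k + c)) = Z" using Z_eq[of k] by simp
      moreover have "x0 \<notin> Z" "y0 \<notin> Z" "x0 \<noteq> y0" using topD(1)[OF P] unfolding xy path_in_def by auto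
      ultimately show "distinct (arc_list k (k + c) @ [x0] @ [y0])" using distinct_arc_list[of "k + c" k] by simp
      show "adjs E (arc_list k (k + c) @ [arc_list k (k + c) ! 0])" using arc_closed[of k] c_pos by simp
      have idx: "arc_list k (k + c) ! (l - k) = f l" "arc_list k (k + c) ! 0 = f k" using kl c_pos by simp_all
      show "adjs E (arc_list k (k + c) ! 0 # [x0] @ [arc_list k (k + c) ! (l - k)])"
        "adjs E (arc_list k (k + c) ! 0 # [y0] @ [arc_list k (k + c) ! (l - k)])" unfolding idx using e by simp_all
    qed (use far kl in simp_all)
    then show False using sep by simp
  next
    case 3
    show False
    proof (cases "P ! 2 \<in> nb E (hd P)")
      case False
      have le: "2 \<le> card (nb E (hd P) \<inter> Z)" using split[OF topD(3)[OF P]] few1[OF P False] by linarith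
      obtain T where T: "T \<subseteq> nb E (hd P) \<inter> Z" "card T = 2" by (rule obtain_subset_with_card_n[OF le])
      then obtain s t where st: "T = {s, t}" "s \<noteq> t" by (auto simp: card_2_iff)
      have s: "s \<in> nb E (hd P) \<inter> Z" "t \<in> nb E (hd P) \<inter> Z" using T st by blast+
      have A: "s \<in> ?A" "t \<in> ?A" using subA[OF topD(3)[OF P]] s by blast+
      have "z \<noteq> r" if "z \<in> nb E (hd P) \<inter> Z" for z
      proof
        assume "z = r"
        then have "{r, hd P} \<in> E" using that by (simp add: insert_commute)
        then show False using same_attachment[OF topD(1)[OF P] _ _ r(1)] r(2) 3 by (simp add: insert_commute)
      qed
      then have "s \<noteq> r" "t \<noteq> r" using s by blast+
      then show False using three[OF A rA st(2)] by blast
    next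
      case True
      \<comment> \<open>The path may also start at its second vertex. Attachments of the first,
        second and last vertex differ pairwise, by closing up \<open>P\<close>, \<open>P'\<close>
        and the path \<open>P ! 0\<close>, \<open>P ! 2\<close>, \<open>P ! 1\<close>.\<close>
      have h0: "hd P = P ! 0" using topD(2)[OF P] by (rule hd_conv_nth)
      have e02: "{P ! 0, P ! 2} \<in> E" using True h0 by simp
      obtain P' where P': "path_in E ?W P'" "length P' = length P" "hd P' = P ! 1" "last P' = last P"
        by (rule longest_path_swap[OF P0(1) 3 e02])
      have top': "top P'" using P0(2) P'(1,2) by (simp add: top_def)
      obtain s where s: "s \<in> Z" "{hd P, s} \<in> E" using nbr[OF P] by blast
      obtain t where t: "t \<in> Z" "{hd P', t} \<in> E" using nbr[OF top'] by blast
      have A: "s \<in> ?A" "t \<in> ?A" by (rule inA[OF s topD(3)[OF P]], rule inA[OF t topD(3)[OF top']])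
      have sr: "s \<noteq> r"
        using same_attachment[OF topD(1)[OF P] _ _ r(1)] r(2) s(2) 3 by (auto simp: insert_commute)
      have tr: "t \<noteq> r"
        using same_attachment[OF topD(1)[OF top'] _ _ r(1)] r(2) t(2) 3 P'(2,4) by (auto simp: insert_commute)
      have st: "s \<noteq> t"
      proof
        assume "s = t"
        have "path_in E (V - Z) [P ! 0, P ! 2, P ! 1]"
        proof -
          obtain a b d zs where abd: "P = a # b # d # zs"
            using 3 by (cases P; cases "tl P"; cases "tl (tl P)") auto
          show ?thesis using topD(1)[OF P] e02 unfolding abd by (auto simp: path_in_def insert_commute)
        qed
        then show False
          using same_attachment[of "[P ! 0, P ! 2, P ! 1]" s] s t \<open>s = t\<close> h0 P'(3) by (simp add: insert_commute)
      qed
      show False using three[OF A rA st sr tr] .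
    qed
  qed
qed

lemma three_attached:
  assumes u: "u \<in> V - Z"
  obtains a b d where "a < b" "b < d" "d < c" "att (reach E (V - Z) u) a" "att (reach E (V - Z) u) b" "att (reach E (V - Z) u) d"
proof -
  let ?W = "reach E (V - Z) u"
  let ?A = "{z \<in> Z. \<exists>w\<in>?W. {z, w} \<in> E}" and ?I = "{k. k < c \<and> att ?W k}"
  have sub: "?A \<subseteq> f ` ?I"
  proof
    fix z assume z: "z \<in> ?A"
    then obtain k where "k < c" "z = f k" using Z_index[of z] by blast
    then show "z \<in> f ` ?I" using z by blast
  qed
  have "card ?A \<le> card (f ` ?I)" by (rule card_mono[OF _ sub]) simp
  also have "\<dots> \<le> card ?I" by (rule card_image_le) simp
  finally have I3: "3 \<le> card ?I" using component_attachments[OF u] by linarith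
  have fI: "finite ?I" by simp
  obtain a b d where abd: "a \<in> ?I" "b \<in> ?I" "d \<in> ?I" "a < b" "b < d" by (rule three_members[OF fI I3])
  have "d < c" "att ?W a" "att ?W b" "att ?W d" using abd(1-3) by simp_all
  with abd(4,5) show ?thesis by (rule that)
qed

lemma attached_ear:
  assumes u: "u \<in> V - Z" and ab: "a < b" "b < a + c" and w: "w \<in> reach E (V - Z) u" "w' \<in> reach E (V - Z) u"
    and e: "{f a, w} \<in> E" "{f b, w'} \<in> E"
  obtains q where "ear a b q" "q \<noteq> []" "hd q = w" "last q = w'" "set q \<subseteq> reach E (V - Z) u"
    "arc_cycle (set q) a b" "arc_cycle (set q) b (a + c)" "a + 2 \<le> b" "b + 2 \<le> a + c"
proof -
  let ?W = "reach E (V - Z) u"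
  obtain p where p: "path_in E ?W p" "hd p = w" "last p = w'"
    using connected_in_reach[OF u, of E] w unfolding connected_in_def by blast
  have pU: "path_in E (V - Z) p" by (rule path_in_mono[OF p(1) reach_subset[OF u]])
  have pn: "p \<noteq> []" "set p \<subseteq> ?W" using p(1) by (simp_all add: path_in_def)
  have ear: "ear a b p" by (rule ear_of_ends[OF pU]) (use e p ab in simp_all)
  have l: "length p + 1 \<le> b - a" "length p + 1 \<le> a + c - b" using ear_long[OF ear pn(1)] by simp_all
  have "0 < length p" using pn by simp
  then have l4: "4 \<le> b - a + 1 + length p" "4 \<le> a + c - b + 1 + length (rev p)"
    unfolding length_rev using l by linarith+
  have "arc_cycle (set p) a b" by (rule ear_arc_cycle[OF ear l4(1)])
  moreover have "arc_cycle (set (rev p)) b (a + c)" by (rule ear_arc_cycle[OF ear_rev[OF ear] l4(2)])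
  moreover have "a + 2 \<le> b" "b + 2 \<le> a + c" using l \<open>0 < length p\<close> by linarith+
  ultimately show ?thesis using that[OF ear pn(1) p(2,3) pn(2)] by simp
qed

text \<open>The component attaches at three indices \<open>a < b < d\<close>. Of the arcs from
  \<open>a\<close> to \<open>b\<close> and from \<open>b\<close> to \<open>d\<close>, one stays on
  one side of \<open>l\<close>, and on the opposite side \<open>X\<close> supplies a long cycle,
  against \<open>noncrossing\<close>.\<close>

lemma blocker:
  assumes u: "u \<in> V - Z" and l: "0 < l" "l < c" and X: "arc_cycle X 0 l" "arc_cycle X l (0 + c)"
    "X \<inter> reach E (V - Z) u = {}" "X \<inter> Z = {}"
  shows False
proof -
  let ?W = "reach E (V - Z) u"
  have WZ: "?W \<inter> Z = {}" using reach_subset[OF u, of E] by blast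
  obtain a b d where abd: "a < b" "b < d" "d < c" "att ?W a" "att ?W b" "att ?W d" by (rule three_attached[OF u])
  obtain w1 w2 w3 where w: "w1 \<in> ?W" "{f a, w1} \<in> E" "w2 \<in> ?W" "{f b, w2} \<in> E" "w3 \<in> ?W" "{f d, w3} \<in> E"
    using abd(4-6) by blast
  obtain q where q: "set q \<subseteq> ?W" "arc_cycle (set q) a b"
    by (rule attached_ear[OF u abd(1) _ w(1,3,2,4)]) (use abd in simp_all)
  obtain q' where q': "set q' \<subseteq> ?W" "arc_cycle (set q') b d"
    by (rule attached_ear[OF u abd(2) _ w(3,5,4,6)]) (use abd in simp_all)
  have dis: "set q \<inter> X = {}" "set q \<inter> Z = {}" "X \<inter> set q' = {}" "set q' \<inter> Z = {}" using q(1) q'(1) X(3) WZ by blast+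
  consider "b \<le> l" "\<not> (b = l \<and> a = 0)" | "b = l" | "l < b" by linarith
  then show False
  proof cases
    case 1
    then show False using noncrossing[of a b l "0 + c", OF _ _ _ _ _ q(2) X(2) dis(1,2) X(4)] abd l by auto
  next
    case 2
    then show False using noncrossing[of 0 l b d, OF _ _ _ _ _ X(1) q'(2) dis(3) X(4) dis(4)] abd l by auto
  next
    case 3
    then show False using noncrossing[of 0 l b d, OF _ _ _ _ _ X(1) q'(2) dis(3) X(4) dis(4)] abd l by auto
  qed
qed

text \<open>An ear through a second component would be a blocker for the first.\<close>

lemma outside_connected:
  assumes u: "u \<in> V - Z"
  shows "reach E (V - Z) u = V - Z"
proof (rule ccontr)
  let ?W = "reach E (V - Z) u"
  assume "?W \<noteq> V - Z"
  then obtain w where w: "w \<in> V - Z" "w \<notin> ?W" using reach_subset[OF u, of E] by blast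
  let ?X = "reach E (V - Z) w"
  have XW: "?X \<inter> ?W = {}"
  proof (rule ccontr)
    assume "?X \<inter> ?W \<noteq> {}"
    then obtain z where z: "z \<in> ?X" "z \<in> ?W" by blast
    then show False using reach_trans[OF z(2) reach_refl_sym_trans[OF z(1)]] w(2) by blast
  qed
  obtain a b d where abd: "a < b" "b < d" "d < c" "att ?X a" "att ?X b" by (rule three_attached[OF w(1)])
  obtain w1 w2 where ww: "w1 \<in> ?X" "{f a, w1} \<in> E" "w2 \<in> ?X" "{f b, w2} \<in> E" using abd(4,5) by blast
  obtain q where q: "set q \<subseteq> ?X" "arc_cycle (set q) a b" "arc_cycle (set q) b (a + c)"
    by (rule attached_ear[OF w(1) abd(1) _ ww(1,3,2,4)]) (use abd in simp_all)
  interpret s: sep_cycle V E "\<lambda>n. f (n + a)" c by (rule sep_shift)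
  have i: "arc_cycle (set q) (0 + a) ((b - a) + a)" "arc_cycle (set q) ((b - a) + a) ((0 + c) + a)"
    using q(2,3) abd by (simp_all add: add.commute)
  note X = arc_cycle_shift[OF i(1)] arc_cycle_shift[OF i(2)]
  have "set q \<inter> ?W = {}" "set q \<inter> Z = {}" using q(1) XW reach_subset[OF w(1), of E] by blast+
  moreover have "b - a < c" using abd by linarith
  ultimately show False using s.blocker[of u "b - a" "set q", OF _ _ _ X] u abd unfolding range_shift by simp
qed

text \<open>A long chord closes long cycles on both sides and would be a blocker.\<close>

lemma no_chords_if_outside:
  assumes u: "u \<in> V - Z" shows "chords = {}"
proof (rule ccontr)
  assume "chords \<noteq> {}"
  then obtain k l where kl: "{f k, f l} \<in> E" "k + 3 \<le> l" "l + 3 \<le> k + c" by (auto simp: chords_def)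
  interpret s: sep_cycle V E "\<lambda>n. f (n + k)" c by (rule sep_shift)
  have i: "arc_cycle {} (0 + k) ((l - k) + k)" "arc_cycle {} ((l - k) + k) ((0 + c) + k)"
    using chord_arc_cycle[OF kl] kl by (simp_all add: add.commute)
  note X = arc_cycle_shift[OF i(1)] arc_cycle_shift[OF i(2)]
  have "l - k < c" using kl by linarith
  then show False using s.blocker[of u "l - k" "{}", OF _ _ _ X] u kl unfolding range_shift by simp
qed

text \<open>The block on indices 0 to 3 is a long cycle. Attachments are at distance at least 2, so
  the arc from \<open>b\<close> to \<open>d\<close> or the one from \<open>d\<close> to
  \<open>a + c\<close> avoids its inner vertices.\<close>

lemma sh_not_consecutive_aux:
  assumes u: "u \<in> V - Z" and s: "sh 0" "sh (Suc 0)" shows False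
proof -
  let ?W = "reach E (V - Z) u"
  have WZ: "?W \<inter> Z = {}" using reach_subset[OF u, of E] by blast
  have B: "arc_cycle {} 0 3" using block[OF s refl] by simp
  obtain a b d where abd: "a < b" "b < d" "d < c" "att ?W a" "att ?W b" "att ?W d" by (rule three_attached[OF u])
  obtain w1 w2 w3 where w: "w1 \<in> ?W" "{f a, w1} \<in> E" "w2 \<in> ?W" "{f b, w2} \<in> E" "w3 \<in> ?W" "{f d, w3} \<in> E"
    using abd(4-6) by blast
  have far1: "a + 2 \<le> b" by (rule attached_ear[OF u abd(1) _ w(1,3,2,4)]) (use abd in simp_all)
  obtain q' where q': "set q' \<subseteq> ?W" "arc_cycle (set q') b d" "b + 2 \<le> d"
    by (rule attached_ear[OF u abd(2) _ w(3,5,4,6)]) (use abd in simp_all)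
  obtain r where r: "set r \<subseteq> ?W" "arc_cycle (set r) d (a + c)"
    by (rule attached_ear[OF u _ _ w(1,5,2,6)]) (use abd in simp_all)
  have dis: "set q' \<inter> Z = {}" "set r \<inter> Z = {}" using q'(1) r(1) WZ by blast+
  consider "3 \<le> b" | "a = 0" "3 < d" using far1 q'(3) by linarith
  then show False
  proof cases
    case 1
    then show False using noncrossing[of 0 3 b d, OF _ _ _ _ _ B q'(2) _ _ dis(1)] abd by auto
  next
    case 2
    then show False using noncrossing[of 0 3 d "a + c", OF _ _ _ _ _ B r(2) _ _ dis(2)] abd by auto
  qed
qed

lemma sh_not_consecutive:
  assumes u: "u \<in> V - Z" and s: "sh i" shows "\<not> sh (Suc i)"
proof
  assume s': "sh (Suc i)"
  interpret s: sep_cycle V E "\<lambda>n. f (n + i)" c by (rule sep_shift)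
  have "s.sh 0" "s.sh (Suc 0)" using s s' by (simp_all add: sh_def s.sh_def add.commute)
  then show False using s.sh_not_consecutive_aux[of u] u unfolding range_shift by simp
qed

end

context sep_cycle
begin

text \<open>Write s for the number of short chords, t for the attached indices, t2 for those
  attached twice, and n for the vertices outside. There are at most (c + s) + 3n/2 + (t + t2) edges,
  and 2s <= c, 2t + t2 <= c and t2 < n bring this below 2(c + n).\<close>

lemma edges_with_outside:
  assumes u: "u \<in> V - Z" shows "card E \<le> 2 * card V"
proof -
  let ?U = "V - Z"
  have fV: "finite V" by (rule sgraph_finite[OF sg])
  have WU: "reach E ?U u = ?U" by (rule outside_connected[OF u])
  define N where "N i = nb E (f i) \<inter> ?U" for i
  have fN: "finite (N i)" for i using finite_nb[OF sg] by (simp add: N_def)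
  have NU: "N i \<subseteq> ?U" for i by (simp add: N_def)
  have Ncong: "N i = N j" if "f i = f j" for i j using that by (simp add: N_def)
  have Ne: "{f i, w} \<in> E" if "w \<in> N i" for w i using that by (simp add: N_def)
  have path: "\<exists>p. path_in E ?U p \<and> hd p = w \<and> last p = w'" if "w \<in> ?U" "w' \<in> ?U" for w w'
    using connected_in_reach[OF u, of E] that unfolding WU connected_in_def by blast
  \<comment> \<open>Otherwise the path closes through \<open>f i\<close> to a cycle of length at
    least 4 with a single vertex on \<open>Z\<close>.\<close>
  have short: "length p \<le> 2" if p: "path_in E ?U p" "hd p \<in> N i" "last p \<in> N i" for p i
  proof (rule ccontr)
    assume "\<not> length p \<le> 2"
    then have "2 \<le> length p" "4 \<le> length p + 1" by simp_all
    then show False using same_attachment[OF p(1), of "f i"] Ne[OF p(2)] Ne[OF p(3)] by simp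
  qed
  have adj: "{w, w'} \<in> E" if w: "w \<in> N i" "w' \<in> N i" "w \<noteq> w'" for w w' i
  proof -
    have wU: "w \<in> ?U" "w' \<in> ?U" using w NU by blast+
    obtain p where p: "path_in E ?U p" "hd p = w" "last p = w'" using path[OF wU] by blast
    have "length p \<le> 2" using short[OF p(1)] p w by simp
    moreover have "p \<noteq> []" using p(1) by (simp add: path_in_def)
    ultimately have "p = [w, w']" using p(2,3) w(3)
      by (cases p; cases "tl p") (auto split: if_splits)
    then show ?thesis using p(1) by (simp add: path_in_def)
  qed
  have tri: False if w: "x \<in> N i" "y \<in> N i" "{x, z} \<in> E" "{z, y} \<in> E" "z \<in> ?U" "x \<noteq> y" for x y z i
  proof -
    have "z \<noteq> x" "z \<noteq> y" using sgraphD[OF sg w(3)] sgraphD[OF sg w(4)] by blast+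
    moreover have "x \<in> ?U" "y \<in> ?U" using w NU by blast+
    ultimately have "path_in E ?U [x, z, y]" using w by (simp add: path_in_def)
    then show False using short[of "[x, z, y]" i] w by simp
  qed
  have N2: "card (N i) \<le> 2" for i
  proof (rule ccontr)
    assume "\<not> card (N i) \<le> 2"
    then have le: "3 \<le> card (N i)" by simp
    obtain T where T: "T \<subseteq> N i" "card T = 3" by (rule obtain_subset_with_card_n[OF le])
    then obtain x y z where xyz: "T = {x, y, z}" "x \<noteq> y" "x \<noteq> z" "y \<noteq> z" by (auto simp: card_3_iff)
    have m: "x \<in> N i" "y \<in> N i" "z \<in> N i" using T(1) xyz(1) by blast+
    have "z \<in> ?U" using m NU by blast
    then show False using tri[OF m(1,2) adj[OF m(1,3) xyz(3)] adj[OF m(3,2)]] xyz by blast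
  qed
  define T where "T i \<longleftrightarrow> N i \<noteq> {}" for i
  define T2 where "T2 i \<longleftrightarrow> card (N i) = 2" for i
  have c4: "4 \<le> c" using \<mu> by simp
  have gap: "2 \<le> b - a" if ab: "a < b" "b < a + c" "T a" "T b" for a b
  proof -
    obtain w w' where w: "w \<in> N a" "w' \<in> N b" using ab by (auto simp: T_def)
    have W: "w \<in> reach E ?U u" "w' \<in> reach E ?U u" using w NU unfolding WU by blast+
    have "a + 2 \<le> b" by (rule attached_ear[OF u ab(1,2) W Ne[OF w(1)] Ne[OF w(2)]])
    then show ?thesis by simp
  qed
  have Ts: "\<not> T (Suc i)" if "T i" for i using gap[of i "Suc i"] that c4 by auto
  \<comment> \<open>One of the two outside neighbors of \<open>f i\<close> differs from a given one
    of \<open>f (i + 2)\<close>. A path between them has at least two vertices, too many for an ear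
    over an arc of length 2.\<close>
  have T2i: "T i \<and> \<not> T (i + 2)" if i: "T2 i" for i
  proof
    show "T i" using i by (auto simp: T2_def T_def)
    show "\<not> T (i + 2)"
    proof
      assume "T (i + 2)"
      then obtain w'' where w'': "w'' \<in> N (i + 2)" by (auto simp: T_def)
      obtain x y where xy: "N i = {x, y}" "x \<noteq> y" using i by (auto simp: T2_def card_2_iff)
      then obtain w where w: "w \<in> N i" "w \<noteq> w''" by blast
      have wU: "w \<in> ?U" "w'' \<in> ?U" using w w'' NU by blast+
      obtain p where p: "path_in E ?U p" "hd p = w" "last p = w''" using path[OF wU] by blast
      have pn: "p \<noteq> []" using p(1) by (simp add: path_in_def)
      have "length p \<noteq> 1" using p(2,3) w(2) by (auto simp: length_Suc_conv)
      moreover have "0 < length p" using pn by simp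
      moreover have ear: "ear i (i + 2) p"
        by (rule ear_of_ends[OF p(1)]) (use Ne[OF w(1)] Ne[OF w''] p c4 in simp_all)
      moreover have "length p + 1 \<le> i + 2 - i" by (rule ear_long(1)[OF ear pn])
      ultimately show False by linarith
    qed
  qed
  let ?T = "{i. i < c \<and> T i}" and ?T2 = "{i. i < c \<and> T2 i}" and ?S = "{i. i < c \<and> sh i}"
  have cT: "2 * card ?T + card ?T2 \<le> c"
    by (rule card_spread[OF _ Ts T2i]) (auto simp: T_def dest: Ncong)
  have "2 * card ?S + card {i. i < c \<and> False} \<le> c"
    by (rule card_spread[of sh "\<lambda>_. False", OF sh_cong sh_not_consecutive[OF u]]) auto
  then have cS: "2 * card ?S \<le> c" by simp
  \<comment> \<open>Two vertices of \<open>Z\<close> with the same two outside neighbors would be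
    hubs of two parallel one-vertex ears. The ear through both neighbors supplies the distance that
    \<open>four_paths\<close> asks for.\<close>
  have injN: "inj_on N ?T2"
  proof (rule linorder_inj_onI')
    fix i j assume ij: "i < j" "i \<in> ?T2" "j \<in> ?T2"
    show "N i \<noteq> N j"
    proof
      assume eq: "N i = N j"
      obtain x y where xy: "N i = {x, y}" "x \<noteq> y" using ij(2) by (auto simp: T2_def card_2_iff)
      have m: "x \<in> N i" "y \<in> N i" "x \<in> N j" "y \<in> N j" using xy eq by blast+
      have xU: "x \<in> ?U" "y \<in> ?U" using m NU by blast+
      have exy: "{x, y} \<in> E" by (rule adj[OF m(1,2) xy(2)])
      have jc: "j < c" and ij': "j < i + c" using ij by simp_all
      have e: "{f i, x} \<in> E" "{f i, y} \<in> E" "{f j, x} \<in> E" "{f j, y} \<in> E" using m Ne by blast+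
      have "path_in E ?U [x, y]" using exy xU xy(2) by (simp add: path_in_def)
      then have "ear i j [x, y]" by (rule ear_of_ends) (use e ij ij' in simp_all)
      then have far: "3 \<le> j - i" "3 \<le> i + c - j" using ear_long[of i j "[x, y]"] by simp_all
      have "\<not> Psep V E 2"
      proof (rule four_paths(2)[OF sg, of "arc_list i (i + c)" "[x]" "[y]" "j - i"])
        have "set (arc_list i (i + c)) = Z" unfolding arc_list_simps(1) by (rule Z_eq[symmetric])
        then show "distinct (arc_list i (i + c) @ [x] @ [y])"
          using distinct_arc_list[of "i + c" i] xU xy(2) by simp
        show "adjs E (arc_list i (i + c) @ [arc_list i (i + c) ! 0])" using arc_closed[of i] c4 by simp
        have idx: "arc_list i (i + c) ! (j - i) = f j" "arc_list i (i + c) ! 0 = f i" 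
          using ij(1) jc c4 by simp_all
        show "adjs E (arc_list i (i + c) ! 0 # [x] @ [arc_list i (i + c) ! (j - i)])"
          "adjs E (arc_list i (i + c) ! 0 # [y] @ [arc_list i (i + c) ! (j - i)])"
          unfolding idx using e by (simp_all add: insert_commute)
      qed (use far ij in simp_all)
      then show False using sep by simp
    qed
  qed
  let ?F = "N ` ?T2"
  have FE: "?F \<subseteq> E"
  proof
    fix e assume "e \<in> ?F"
    then obtain i where i: "T2 i" "e = N i" by auto
    then obtain x y where xy: "N i = {x, y}" "x \<noteq> y" by (auto simp: T2_def card_2_iff)
    have m: "x \<in> N i" "y \<in> N i" using xy by blast+
    have "{x, y} \<in> E" by (rule adj[OF m xy(2)])
    then show "e \<in> E" using i(2) xy(1) by simp
  qed
  \<comment> \<open>The two-element sets \<open>N i\<close> are edges of a forest outside: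
    \<open>no_cycle_outside\<close> excludes longer cycles, and \<open>tri\<close> excludes
    triangles.\<close>
  have cF: "card ?T2 + 1 \<le> card ?U"
  proof -
    have "\<not> set xs \<subseteq> ?U" if xs: "lcyc ?F xs" for xs
    proof
      assume sub: "set xs \<subseteq> ?U"
      have xE: "lcyc E xs" by (rule lcyc_mono[OF xs FE])
      have "\<not> 4 \<le> length xs" using no_cycle_outside[OF xE] sub by blast
      then have "length xs = 3" using xs by (simp add: lcyc_def)
      then obtain a b d where abd: "xs = [a, b, d]" by (auto simp: length_Suc_conv eval_nat_numeral)
      have "{a, b} \<in> ?F" "a \<noteq> b" using xs by (simp_all add: lcyc_def abd)
      then obtain i where i: "{a, b} = N i" by (elim imageE)
      have "{a, d} \<in> E" "{d, b} \<in> E" using xE by (simp_all add: lcyc_def abd insert_commute)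
      moreover have "d \<in> ?U" "a \<in> N i" "b \<in> N i" using sub by (simp_all add: abd flip: i)
      ultimately show False using tri[of a i b d] \<open>a \<noteq> b\<close> by blast
    qed
    moreover have "?U \<subseteq> V" "?U \<noteq> {}" using u by blast+
    ultimately have "card {e \<in> ?F. e \<subseteq> ?U} + 1 \<le> card ?U"
      using acyclic_edge_count[OF sgraph_mono[OF sg FE]] by blast
    moreover have "{e \<in> ?F. e \<subseteq> ?U} = ?F"
    proof -
      have "e \<subseteq> ?U" if "e \<in> ?F" for e using that NU by (elim imageE) simp
      then show ?thesis by (intro equalityI subsetI) simp_all
    qed
    ultimately show ?thesis using card_image[OF injN] by simp
  qed
  have cU: "2 * card {e \<in> E. e \<subseteq> ?U} \<le> 3 * card ?U"
    using cactus_edge_count[OF sg Diff_subset no_cycle_outside] by blast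
  have cZ: "card {e \<in> E. e \<subseteq> Z} \<le> c + card ?S"
    using card_inside no_chords_if_outside[OF u] by simp
  let ?X = "\<Union>i<c. (\<lambda>w. {f i, w}) ` N i"
  have "E \<subseteq> {e \<in> E. e \<subseteq> Z} \<union> {e \<in> E. e \<subseteq> ?U} \<union> ?X"
  proof
    fix e assume e: "e \<in> E"
    then obtain x y where xy: "x \<in> V" "y \<in> V" "e = {x, y}" by (rule sgraphE[OF sg])
    have X: "{a, b} \<in> ?X" if a: "a \<in> Z" "b \<in> ?U" "{a, b} \<in> E" for a b
    proof -
      obtain k where k: "k < c" "a = f k" using Z_index[OF a(1)] by blast
      then have "b \<in> N k" using a by (simp add: N_def)
      then show ?thesis using k by blast
    qed
    consider "x \<in> Z" "y \<in> Z" | "x \<in> Z" "y \<in> ?U" | "x \<in> ?U" "y \<in> Z" | "x \<in> ?U" "y \<in> ?U" using xy by blast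
    then show "e \<in> {e \<in> E. e \<subseteq> Z} \<union> {e \<in> E. e \<subseteq> ?U} \<union> ?X"
    proof cases
      case 1
      then have "e \<in> {e \<in> E. e \<subseteq> Z}" using e xy(3) by simp
      then show ?thesis by (intro UnI1)
    next
      case 2
      then have "e \<in> ?X" using X[of x y] e xy(3) by simp
      then show ?thesis by (rule UnI2)
    next
      case 3
      then have "e \<in> ?X" using X[of y x] e xy(3) by (simp add: insert_commute)
      then show ?thesis by (rule UnI2)
    next
      case 4
      then have "e \<in> {e \<in> E. e \<subseteq> ?U}" using e xy(3) by simp
      then show ?thesis by (intro UnI1 UnI2)
    qed
  qed
  moreover have "finite ?X" using fN by simp
  moreover have "finite E" by (rule sgraph_finite_edges[OF sg])
  ultimately have "card E \<le> card ({e \<in> E. e \<subseteq> Z} \<union> {e \<in> E. e \<subseteq> ?U} \<union> ?X)" by (intro card_mono) simp_all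
  also have "\<dots> \<le> card {e \<in> E. e \<subseteq> Z} + card {e \<in> E. e \<subseteq> ?U} + card ?X"
    by (meson add_mono card_Un_le le_refl order_trans)
  finally have cE: "card E \<le> card {e \<in> E. e \<subseteq> Z} + card {e \<in> E. e \<subseteq> ?U} + card ?X" .
  have "card ?X \<le> (\<Sum>i<c. card ((\<lambda>w. {f i, w}) ` N i))" by (rule card_UN_le) simp
  also have "\<dots> \<le> (\<Sum>i<c. of_bool (T i) + of_bool (T2 i))"
  proof (rule sum_mono)
    fix i
    have "card ((\<lambda>w. {f i, w}) ` N i) \<le> card (N i)" by (rule card_image_le[OF fN])
    also have "\<dots> \<le> of_bool (T i) + of_bool (T2 i)"
      using N2[of i] fN[of i] by (cases "N i = {}") (auto simp: T_def T2_def of_bool_def)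
    finally show "card ((\<lambda>w. {f i, w}) ` N i) \<le> of_bool (T i) + of_bool (T2 i)" .
  qed
  also have "\<dots> = card ?T + card ?T2"
    by (simp add: sum.distrib sum_of_bool_eq lessThan_def Int_def conj_commute)
  finally have cX: "card ?X \<le> card ?T + card ?T2" .
  have "card V = c + card ?U"
    using card_Diff_subset[OF finite_Z Z_subset] card_mono[OF fV Z_subset] card_Z by simp
  then show ?thesis using cE cX cU cZ cF cT cS by linarith
qed

section \<open>The Hamiltonian case\<close>

lemma chords_unique:
  assumes "e \<in> chords" "e' \<in> chords" "f i \<in> e" "f i \<in> e'"
  shows "e = e'"
proof -
  obtain l where l: "e = {f i, f l}" "i + 3 \<le> l" "l + 3 \<le> i + c" by (rule chord_at[OF assms(1,3)])
  obtain l' where l': "e' = {f i, f l'}" "i + 3 \<le> l'" "l' + 3 \<le> i + c" by (rule chord_at[OF assms(2,4)])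
  \<comment> \<open>Two long chords from one vertex would cut off arcs with only that vertex in
    common. Hence long chords form a matching.\<close>
  have le: "\<not> a < b" if "i + 3 \<le> a" "b + 3 \<le> i + c" "{f i, f a} \<in> E" "{f i, f b} \<in> E" for a b
  proof
    assume ab: "a < b"
    have "arc_cycle {} i a" "arc_cycle {} b (i + c)"
      using chord_arc_cycle(1)[OF that(3)] chord_arc_cycle(2)[OF that(4)] that ab by simp_all
    then show False using noncrossing[of i a b "i + c" "{}" "{}"] that ab by simp
  qed
  have E: "{f i, f l} \<in> E" "{f i, f l'} \<in> E" using chord_in_E assms(1,2) l(1) l'(1) by blast+
  have "l = l'" using le[OF l(2) l'(3) E] le[OF l'(2) l(3) E(2,1)] by simp
  then show ?thesis using l l' by simp
qed

lemma finite_chords: "finite chords"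
  using sgraph_finite_edges[OF sg] by (rule rev_finite_subset) (auto simp: chords_def)

lemma card_chords: "2 * card chords \<le> c"
proof -
  have ch: "\<exists>i j. e = {f i, f j} \<and> f i \<noteq> f j" if e: "e \<in> chords" for e
  proof -
    obtain k l where kl: "e = {f k, f l}" "{f k, f l} \<in> E" using e by (auto simp: chords_def)
    have "f k \<noteq> f l" using sgraphD[OF sg kl(2)] by blast
    then show ?thesis using kl(1) by blast
  qed
  have dis: "disjoint chords"
    unfolding disjoint_def
  proof (intro ballI impI)
    fix a b assume ab: "a \<in> chords" "b \<in> chords" "a \<noteq> b"
    show "a \<inter> b = {}"
    proof (rule ccontr)
      assume "a \<inter> b \<noteq> {}"
      then obtain y where y: "y \<in> a" "y \<in> b" by blast
      obtain i j where "a = {f i, f j}" using ch[OF ab(1)] by blast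
      then have "y = f i \<or> y = f j" using y(1) by simp
      then show False using chords_unique[OF ab(1,2)] y ab(3) by blast
    qed
  qed
  have c2: "card e = 2" "finite e" "e \<subseteq> Z" if e: "e \<in> chords" for e
  proof -
    obtain i j where "e = {f i, f j}" "f i \<noteq> f j" using ch[OF e] by blast
    then show "card e = 2" "finite e" "e \<subseteq> Z" by simp_all
  qed
  have "card (\<Union> chords) = (\<Sum>e\<in>chords. card e)" by (rule card_Union_disjoint[OF dis c2(2)])
  also have "\<dots> = (\<Sum>e\<in>chords. 2)" by (rule sum.cong[OF refl c2(1)])
  finally have "card (\<Union> chords) = 2 * card chords" by simp
  moreover have "card (\<Union> chords) \<le> card Z" using c2(3) by (intro card_mono[OF finite_Z] Union_least)
  ultimately show ?thesis using card_Z by simp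
qed

text \<open>Adjacent blocks are long cycles that share only \<open>f (i + 3)\<close>. For
  \<open>c = 6\<close> they would share both ends, hence \<open>7 \<le> c\<close>.\<close>

lemma two_blocks:
  assumes "sh i" "sh (Suc i)" "sh (i + 3)" "sh (i + 4)" "7 \<le> c"
  shows False
proof -
  have "arc_cycle {} i (i + 3)" by (rule block[OF assms(1,2) refl])
  moreover have "arc_cycle {} (i + 3) (i + 3 + 3)" by (rule block[OF assms(3) _ refl]) (use assms(4) in \<open>simp add: add.commute\<close>)
  ultimately show False using noncrossing[of i "i + 3" "i + 3" "i + 3 + 3" "{}" "{}"] assms(5) by simp
qed

text \<open>A long chord that ends at neither inner vertex of the block cuts off an arc having at
  most one vertex in common with it, unless it joins the two ends of the block. Each inner vertex
  has at most one long chord.\<close>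

lemma block_chords:
  assumes b: "sh i" "sh (Suc i)"
  shows "card chords \<le> 3"
proof -
  have B: "arc_cycle {} i (i + 3)" by (rule block[OF b refl])
  have sub: "chords \<subseteq> {e \<in> chords. f (i + 1) \<in> e} \<union> {e \<in> chords. f (i + 2) \<in> e} \<union> {{f i, f (i + 3)}}"
  proof
    fix e assume e: "e \<in> chords"
    obtain a d where ad: "i \<le> a" "a + 3 \<le> d" "d < i + c" "d + 3 \<le> a + c" "e = {f a, f d}"
      by (rule chord_window[OF e])
    have adE: "{f a, f d} \<in> E" using chord_in_E[OF e] ad(5) by simp
    note arcs = chord_arc_cycle[OF adE ad(2,4) refl]
    consider "a = i" "d = i + 3" | "a = i" "i + 3 < d" | "a = i + 1" | "a = i + 2" | "i + 3 \<le> a" using ad by linarith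
    then show "e \<in> {e \<in> chords. f (i + 1) \<in> e} \<union> {e \<in> chords. f (i + 2) \<in> e} \<union> {{f i, f (i + 3)}}"
    proof cases
      case 2
      then show ?thesis using noncrossing[of i "i + 3" d "a + c" "{}" "{}", OF _ _ _ _ _ B arcs(2)] ad by simp
    next
      case 5
      then show ?thesis using noncrossing[of i "i + 3" a d "{}" "{}", OF _ _ _ _ _ B arcs(1)] ad by simp
    qed (use e ad in simp_all)
  qed
  have one: "card {e \<in> chords. f j \<in> e} \<le> 1" for j
  proof -
    have "\<forall>a\<in>{e \<in> chords. f j \<in> e}. \<forall>b\<in>{e \<in> chords. f j \<in> e}. a = b"
    proof (intro ballI)
      fix a b assume "a \<in> {e \<in> chords. f j \<in> e}" "b \<in> {e \<in> chords. f j \<in> e}"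
      then show "a = b" using chords_unique[of a b j] by simp
    qed
    moreover have "finite {e \<in> chords. f j \<in> e}" using finite_chords by simp
    ultimately show ?thesis using card_le_Suc0_iff_eq[of "{e \<in> chords. f j \<in> e}"] by simp
  qed
  have "card chords \<le> card ({e \<in> chords. f (i + 1) \<in> e} \<union> {e \<in> chords. f (i + 2) \<in> e} \<union> {{f i, f (i + 3)}})"
    by (rule card_mono[OF _ sub]) (use finite_chords in simp)
  also have "\<dots> \<le> card {e \<in> chords. f (i + 1) \<in> e} + card {e \<in> chords. f (i + 2) \<in> e} + card {{f i, f (i + 3)}}"
    by (meson add_mono card_Un_le le_refl order_trans)
  also have "\<dots> \<le> 3" using one[of "i + 1"] one[of "i + 2"] by simp
  finally show ?thesis .
qed

text \<open>The tight case. Adjacent blocks exclude \<open>sh 4\<close> and \<open>sh 6\<close>, so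
  three long chords are required, and the blocks at 0, 1 and 2 admit only three. With these,
  \<open>f 2\<close> and \<open>f 3\<close> are both adjacent to \<open>f 0\<close>,
  \<open>f 1\<close>, \<open>f 4\<close> and \<open>f 5\<close>.\<close>

lemma seven:
  assumes VZ: "V = Z" and c7: "c = 7" and e: "15 \<le> card E" and s: "sh 0" "sh 1" "sh 2" "sh 3" "sh 5"
  shows False
proof -
  have n4: "\<not> sh 4" using two_blocks[of 0] s c7 by auto
  have n6: "\<not> sh 6" using two_blocks[of 2] s c7 by auto
  have "{i. i < c \<and> sh i} \<subseteq> {0, 1, 2, 3, 5}"
  proof
    fix i assume "i \<in> {i. i < c \<and> sh i}"
    then have "i < 7" "sh i" using c7 by simp_all
    then consider "i = 0" | "i = 1" | "i = 2" | "i = 3" | "i = 5" | "i = 4" | "i = 6" by linarith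
    then show "i \<in> {0, 1, 2, 3, 5}" using n4 n6 \<open>sh i\<close> by cases simp_all
  qed
  then have "card {i. i < c \<and> sh i} \<le> card {0, 1, 2, 3, 5 :: nat}" by (intro card_mono) simp_all
  then have cs: "card {i. i < c \<and> sh i} \<le> 5" by simp
  have "{e \<in> E. e \<subseteq> Z} = E"
  proof -
    have "e \<subseteq> Z" if "e \<in> E" for e using that by (rule sgraphE[OF sg]) (simp add: VZ)
    then show ?thesis by blast
  qed
  then have c3: "3 \<le> card chords" using card_inside cs e c7 by simp
  have B: "arc_cycle {} 0 (0 + 3)" "arc_cycle {} 1 (1 + 3)" "arc_cycle {} 2 (2 + 3)"
    using block[of 0] block[of 1] block[of 2] s by (simp_all add: eval_nat_numeral)
  let ?K = "{{f 0, f 3}, {f 1, f 4}, {f 2, f 5}}"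
  have sub: "chords \<subseteq> ?K"
  proof
    fix e assume e: "e \<in> chords"
    obtain a d where ad: "0 \<le> a" "a + 3 \<le> d" "d < 0 + c" "d + 3 \<le> a + c" "e = {f a, f d}"
      by (rule chord_window[OF e])
    have adE: "{f a, f d} \<in> E" using chord_in_E[OF e] ad(5) by simp
    note arcs = chord_arc_cycle[OF adE ad(2,4) refl]
    have "d = a + 3 \<or> d = a + 4" "a \<le> 3" using ad c7 by linarith+
    then show "e \<in> ?K"
    proof (elim disjE)
      assume d: "d = a + 3"
      show ?thesis
      proof (cases "a = 3")
        case True
        then show ?thesis
          using noncrossing[of 0 "0 + 3" a d "{}" "{}", OF _ _ _ _ _ B(1) arcs(1)] c7 d by simp
      next
        case False
        then have "a = 0 \<or> a = 1 \<or> a = 2" using \<open>a \<le> 3\<close> by linarith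
        then show ?thesis using ad(5) d by (elim disjE) simp_all
      qed
    next
      assume d: "d = a + 4"
      show ?thesis
      proof (cases "a = 0")
        case True
        then show ?thesis
          using noncrossing[of 1 "1 + 3" d "a + c" "{}" "{}", OF _ _ _ _ _ B(2) arcs(2)] c7 d by simp
      next
        case False
        then have "a = 1 \<or> a = 2" using ad(3) c7 d by linarith
        then show ?thesis
          using noncrossing[of 2 "2 + 3" d "a + c" "{}" "{}", OF _ _ _ _ _ B(3) arcs(2)] c7 d
          by (elim disjE) simp_all
      qed
    qed
  qed
  have "card ?K \<le> 3" by (simp add: card_insert_if)
  then have "chords = ?K" using card_seteq[OF _ sub] c3 by simp
  then have K: "{f 0, f 3} \<in> E" "{f 2, f 5} \<in> E" using chord_in_E by blast+
  have ne: "f i \<noteq> f j" if "i < j" "j < 7" for i j using f_neq[of i j] that c7 by simp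
  have st: "{f 1, f 2} \<in> E" "{f 3, f 4} \<in> E" using step[of 1] step[of 3] by (simp_all add: eval_nat_numeral)
  have s': "{f 0, f 2} \<in> E" "{f 1, f 3} \<in> E" "{f 2, f 4} \<in> E" "{f 3, f 5} \<in> E"
    using s(1-4) by (simp_all add: sh_def eval_nat_numeral)
  have comm: "{f j, f i} \<in> E" if "{f i, f j} \<in> E" for i j using that by (simp add: insert_commute)
  have "\<not> Psep V E 2"
  proof (rule four_paths(2)[OF sg, of "[f 2, f 0, f 3, f 1]" "[f 4]" "[f 5]" 2])
    show "distinct ([f 2, f 0, f 3, f 1] @ [f 4] @ [f 5])"
      using ne[of 0 1] ne[of 0 2] ne[of 0 3] ne[of 0 4] ne[of 0 5] ne[of 1 2] ne[of 1 3] ne[of 1 4] ne[of 1 5]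
        ne[of 2 3] ne[of 2 4] ne[of 2 5] ne[of 3 4] ne[of 3 5] ne[of 4 5] by auto
    show "adjs E ([f 2, f 0, f 3, f 1] @ [[f 2, f 0, f 3, f 1] ! 0])" using K st s' comm by simp
    show "adjs E ([f 2, f 0, f 3, f 1] ! 0 # [f 4] @ [[f 2, f 0, f 3, f 1] ! 2])"
      "adjs E ([f 2, f 0, f 3, f 1] ! 0 # [f 5] @ [[f 2, f 0, f 3, f 1] ! 2])" using K st s' comm by simp_all
  qed simp_all
  then show False using sep by simp
qed

lemma seven_shift:
  assumes "V = Z" "c = 7" "15 \<le> card E" "\<And>j. j \<in> {0, 1, 2, 3, 5} \<Longrightarrow> sh (j + r)"
  shows False
proof -
  interpret s: sep_cycle V E "\<lambda>n. f (n + r)" c by (rule sep_shift)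
  have "s.sh j" if "j \<in> {0, 1, 2, 3, 5}" for j
    using assms(4)[OF that] by (simp add: sh_def s.sh_def ac_simps)
  then show False using s.seven assms(1-3) unfolding range_shift by simp
qed

text \<open>Only the short chords at 0 and \<open>m\<close> may be missing. From
  \<open>c = 8\<close> on, no \<open>m\<close> meets all of three candidate pairs of adjacent
  blocks. For \<open>c = 7\<close> the third pair would use index 7, that is 0; the remaining cases
  \<open>m = 2\<close> and \<open>m = 5\<close> are rotations of \<open>seven\<close>.\<close>

lemma hamiltonian_aux:
  assumes VZ: "V = Z" and c7: "7 \<le> c" and e: "2 * c + 1 \<le> card E"
    and s: "\<And>i. 0 < i \<Longrightarrow> i < c \<Longrightarrow> i \<noteq> m \<Longrightarrow> sh i"
  shows False
proof (cases "c = 7")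
  case False
  then have c8: "8 \<le> c" using c7 by simp
  have "m \<notin> {1, 2, 4, 5} \<or> m \<notin> {2, 3, 5, 6} \<or> m \<notin> {3, 4, 6, 7}" by auto
  then consider "m \<notin> {1, 2, 4, 5}" | "m \<notin> {2, 3, 5, 6}" | "m \<notin> {3, 4, 6, 7}" by blast
  then show False
  proof cases
    case 1
    then show False using two_blocks[of 1] s[of 1] s[of 2] s[of 4] s[of 5] c8 by (simp add: eval_nat_numeral)
  next
    case 2
    then show False using two_blocks[of 2] s[of 2] s[of 3] s[of 5] s[of 6] c8 by (simp add: eval_nat_numeral)
  next
    case 3
    then show False using two_blocks[of 3] s[of 3] s[of 4] s[of 6] s[of 7] c8 by (simp add: eval_nat_numeral)
  qed
next
  case True
  have wrap: "sh (i + 7)" if "sh i" for i using sh_cong[of i "i + 7"] per[of i] that True by simp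
  have e15: "15 \<le> card E" using e True by simp
  have nums: "sh n" if "n \<in> {1, 2, 3, 4, 5, 6}" "n \<noteq> m" for n using s[of n] that True by auto
  have "m \<notin> {1, 2, 4, 5} \<or> m \<notin> {2, 3, 5, 6} \<or> m = 2 \<or> m = 5" by auto
  then consider "m \<notin> {1, 2, 4, 5}" | "m \<notin> {2, 3, 5, 6}" | "m = 2" | "m = 5" by blast
  then show False
  proof cases
    case 1
    then have "sh 1" "sh 2" "sh 4" "sh 5" using nums by auto
    then show False using two_blocks[of 1] True by (simp add: eval_nat_numeral)
  next
    case 2
    then have "sh 2" "sh 3" "sh 5" "sh 6" using nums by auto
    then show False using two_blocks[of 2] True by (simp add: eval_nat_numeral)
  next
    case 3
    have "sh (j + 3)" if "j \<in> {0, 1, 2, 3, 5}" for j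
      using that nums[of 3] nums[of 4] nums[of 5] nums[of 6] wrap[OF nums[of 1]] 3 by auto
    then show False using seven_shift[OF VZ True e15] by blast
  next
    case 4
    have "sh (j + 1)" if "j \<in> {0, 1, 2, 3, 5}" for j
      using that nums[of 1] nums[of 2] nums[of 3] nums[of 4] nums[of 6] 4 by (auto simp: eval_nat_numeral)
    then show False using seven_shift[OF VZ True e15] by blast
  qed
qed

text \<open>Suppose there are more than \<open>2 * c\<close> edges. There are at most
  \<open>c / 2\<close> long chords, so two short ones are consecutive. Their block leaves at most
  three long chords, so at most two short chords are missing, and one of these can be moved to index
  0.\<close>

lemma hamiltonian_edges:
  assumes VZ: "V = Z" shows "card E \<le> 2 * card V"
proof (rule ccontr)
  assume "\<not> ?thesis"
  then have e: "2 * c + 1 \<le> card E" using card_Z VZ by simp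
  have cV: "card V = c" using card_Z VZ by simp
  have fV: "finite V" by (rule sgraph_finite[OF sg])
  have all: "{e \<in> E. e \<subseteq> Z} = E"
  proof -
    have "e \<subseteq> Z" if "e \<in> E" for e using that by (rule sgraphE[OF sg]) (simp add: VZ)
    then show ?thesis by blast
  qed
  let ?S = "{i. i < c \<and> sh i}" and ?M = "{i. i < c \<and> \<not> sh i}"
  have cE: "card E \<le> c + card ?S + card chords" using card_inside all by simp
  have "\<exists>i. sh i \<and> sh (Suc i)"
  proof (rule ccontr)
    assume "\<not> ?thesis"
    then have n: "\<And>i. sh i \<Longrightarrow> \<not> sh (Suc i)" by blast
    have "2 * card ?S + card {i. i < c \<and> False} \<le> c"
      by (rule card_spread[of sh "\<lambda>_. False", OF sh_cong n]) auto
    then show False using cE e card_chords by simp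
  qed
  then have "card chords \<le> 3" using block_chords by blast
  then have S: "c \<le> card ?S + 2" using cE e by linarith
  have SM: "card ?S + card ?M = c"
  proof -
    have "card ?S + card ?M = card (?S \<union> ?M)" by (rule card_Un_disjoint[symmetric]) auto
    also have "?S \<union> ?M = {..<c}" by auto
    finally show ?thesis by simp
  qed
  have M2: "card ?M \<le> 2" using S SM by linarith
  have "card E \<le> c choose 2"
  proof -
    have "card E \<le> card {A. A \<subseteq> V \<and> card A = 2}"
      by (rule card_mono) (use fV sg in \<open>auto simp: sgraph_def card_insert_if\<close>)
    then show ?thesis using n_subsets[OF fV, of 2] cV by simp
  qed
  then have "6 \<le> c"
  proof -
    have "c = 4 \<or> c = 5 \<or> 6 \<le> c" using \<mu>(2) by linarith
    then show ?thesis using \<open>card E \<le> c choose 2\<close> e by (auto simp: choose_two)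
  qed
  moreover have "c \<noteq> 6" using dense_on_six_vertices[OF sg] cV e sep by auto
  ultimately have c7: "7 \<le> c" by simp
  show False
  proof (cases "?M = {}")
    case True
    then show False using hamiltonian_aux[OF VZ c7 e, of 0] by blast
  next
    case False
    then obtain a where a: "a \<in> ?M" by blast
    have fM: "finite ?M" by simp
    have "card (?M - {a}) \<le> Suc 0" using card_Diff_singleton[OF a] M2 by simp
    then have one: "\<forall>x\<in>?M - {a}. \<forall>y\<in>?M - {a}. x = y" using card_le_Suc0_iff_eq[of "?M - {a}"] by simp
    interpret s: sep_cycle V E "\<lambda>n. f (n + a)" c by (rule sep_shift)
    have VZ': "V = range (\<lambda>n. f (n + a))" using VZ range_shift by simp
    obtain m where m: "\<And>n. n \<in> ?M - {a} \<Longrightarrow> f n = f (m + a)"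
    proof (cases "?M - {a} = {}")
      case True
      then show ?thesis using that[of 0] by blast
    next
      case False
      then obtain b where b: "b \<in> ?M - {a}" by blast
      have "f b \<in> range (\<lambda>n. f (n + a))" unfolding range_shift by simp
      then obtain m where "f b = f (m + a)" by blast
      moreover have "n = b" if "n \<in> ?M - {a}" for n using one b that by blast
      ultimately show ?thesis using that[of m] by metis
    qed
    have "s.sh i" if i: "0 < i" "i < c" "i \<noteq> m mod c" for i
    proof -
      obtain n where n: "n < c" "f (i + a) = f n" using Z_index[of "f (i + a)"] by auto
      have "sh n"
      proof (rule ccontr)
        assume "\<not> sh n"
        then have nM: "n \<in> ?M" using n by simp
        show False
        proof (cases "n = a")
          case True
          then show False using n(2) f_neq[of a "i + a"] i by simp
        next
          case False
          then have "f n = f (m + a)" using m[of n] nM by blast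
          \<comment> \<open>Adding \<open>c * a - a\<close> undoes the shift by \<open>a\<close>
            modulo \<open>c\<close> while staying within the naturals.\<close>
          then have "f (i + a + (c * a - a)) = f (m + a + (c * a - a))" using n(2) f_eq_add by metis
          moreover have "a \<le> c * a" using c7 by simp
          ultimately have "f (i + c * a) = f (m + c * a)" by simp
          then have "i mod c = m mod c" unfolding f_eq_iff by simp
          then show False using i by simp
        qed
      qed
      then have "sh (i + a)" using sh_cong n(2) by metis
      then show ?thesis by (simp add: sh_def s.sh_def ac_simps)
    qed
    then show False using s.hamiltonian_aux[OF VZ' c7 e] by blast
  qed
qed

lemma few_edges: "card E \<le> 2 * card V"
proof (cases "V = Z")
  case True
  then show ?thesis by (rule hamiltonian_edges)
next
  case False
  then obtain u where "u \<in> V - Z" using Z_subset by blast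
  then show ?thesis by (rule edges_with_outside)
qed

end

lemma edges_of_separated:
  assumes sg: "sgraph V E" and conn: "connected_in E V" and V: "V \<noteq> {}"
    and sep: "Psep V E 2" and deg: "\<And>v. v \<in> V \<Longrightarrow> 3 \<le> card (nb E v)"
  shows "card E \<le> 2 * card V"
proof -
  have fV: "finite V" by (rule sgraph_finite[OF sg])
  have d: "3 \<le> card (nb E v \<inter> V)" if "v \<in> V" for v
    using nb_subset[OF sg, of v] deg[OF that] by (simp add: Int_absorb2 subset_Diff_insert)
  obtain x0 where x0: "lcyc E x0" "Suc 3 \<le> length x0"
    by (rule long_cycle_of_min_degree[OF sg subset_refl V d]) auto
  have bound: "length xs \<le> card V" if "lcyc E xs" for xs
  proof -
    have "adjs E xs" "2 \<le> length xs" "distinct xs" using that by (simp_all add: lcyc_def)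
    then have "set xs \<subseteq> V" using adjs_subset[OF sg] by blast
    then show ?thesis using card_mono[OF fV] distinct_card[OF \<open>distinct xs\<close>] by metis
  qed
  have "\<exists>xs. lcyc E xs \<and> (\<forall>ys. lcyc E ys \<longrightarrow> length ys \<le> length xs)"
    by (rule ex_has_greatest_nat[of "lcyc E" x0 length "card V + 1"]) (use x0 bound in \<open>auto simp: less_Suc_eq_le\<close>)
  then obtain xs where xs: "lcyc E xs" "\<And>ys. lcyc E ys \<Longrightarrow> length ys \<le> length xs" by blast
  have l4: "4 \<le> length xs" using xs(2)[OF x0(1)] x0(2) by simp
  have "big_cycle V E (\<lambda>i. xs ! (i mod length xs)) (length xs) 4"
  proof (rule big_cycle_of_lcyc[OF sg xs(1) l4])
    fix as bs assume ab: "lcyc E as" "lcyc E bs" "4 \<le> length as" "4 \<le> length bs"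
    show "2 \<le> card (set as \<inter> set bs)" using two_cycles(2)[OF sg conn ab(1,2) _ ab(3,4)] sep by linarith
  qed simp
  then interpret sep_cycle V E "\<lambda>i. xs ! (i mod length xs)" "length xs"
    using sep deg xs(2) by (simp add: sep_cycle_def sep_cycle_axioms_def)
  show ?thesis by (rule few_edges)
qed

text \<open>A vertex of degree at most 2 can be removed, and components can be counted separately.
  What remains is connected of minimum degree 3.\<close>

lemma sparse_of_separated:
  assumes sg: "sgraph V E" and sep: "Psep V E 2" and "S \<subseteq> V"
  shows "card {e \<in> E. e \<subseteq> S} \<le> 2 * card S"
  using assms(3)
proof (induction "card S" arbitrary: S rule: less_induct)
  case less
  have fS: "finite S" using less.prems sgraph_finite[OF sg] finite_subset by blast
  have IH: "card {e \<in> E. e \<subseteq> T} \<le> 2 * card T" if T: "T \<subset> S" for T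
    using less.hyps[OF psubset_card_mono[OF fS T]] T less.prems by blast
  consider "S = {}" | v where "v \<in> S" "card (nb E v \<inter> S) < 3"
    | u where "u \<in> S" "reach E S u \<noteq> S"
    | u where "u \<in> S" "reach E S u = S" "\<And>v. v \<in> S \<Longrightarrow> 3 \<le> card (nb E v \<inter> S)"
  proof (cases "\<exists>v\<in>S. card (nb E v \<inter> S) < 3")
    case True
    then show ?thesis using that(2) by blast
  next
    case False
    then have "\<And>v. v \<in> S \<Longrightarrow> 3 \<le> card (nb E v \<inter> S)" using not_less by blast
    then show ?thesis using that(1,3,4) by blast
  qed
  then show ?case
  proof cases
    case 1
    have "{e \<in> E. e \<subseteq> S} = {}" using sg by (auto simp: sgraph_def 1)
    then show ?thesis by (simp only: card.empty)
  next
    case (2 v)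
    have "card {e \<in> E. e \<subseteq> S - {v}} \<le> 2 * card (S - {v})" using IH[of "S - {v}"] 2(1) by blast
    moreover have "card (S - {v}) + 1 = card S" using 2(1) fS card_gt_0_iff[of S] by auto
    ultimately show ?thesis using card_induced_remove[OF sg less.prems 2(1)] 2(2) by linarith
  next
    case (3 u)
    let ?W = "reach E S u"
    have WS: "?W \<subseteq> S" by (rule reach_subset[OF 3(1)])
    have uW: "u \<in> ?W" by (rule self_in_reach)
    have "{e \<in> E. e \<subseteq> S} \<subseteq> {e \<in> E. e \<subseteq> ?W} \<union> {e \<in> E. e \<subseteq> S - ?W}"
    proof
      fix e assume "e \<in> {e \<in> E. e \<subseteq> S}"
      then have e: "e \<in> E" "e \<subseteq> S" by simp_all
      obtain x y where xy: "e = {x, y}" using sgraphE[OF sg e(1)] by metis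
      have xyS: "x \<in> S" "y \<in> S" "{x, y} \<in> E" "{y, x} \<in> E" using e xy by (simp_all add: insert_commute)
      have "x \<in> ?W \<longleftrightarrow> y \<in> ?W" using reach_step[OF _ xyS(1-3)] reach_step[OF _ xyS(2,1,4)] by blast
      then show "e \<in> {e \<in> E. e \<subseteq> ?W} \<union> {e \<in> E. e \<subseteq> S - ?W}" using e(1) xyS xy by (cases "x \<in> ?W") simp_all
    qed
    then have "card {e \<in> E. e \<subseteq> S} \<le> card ({e \<in> E. e \<subseteq> ?W} \<union> {e \<in> E. e \<subseteq> S - ?W})"
      by (rule card_mono[rotated]) (use sgraph_finite_edges[OF sg] in simp)
    also have "\<dots> \<le> card {e \<in> E. e \<subseteq> ?W} + card {e \<in> E. e \<subseteq> S - ?W}" by (rule card_Un_le)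
    also have "\<dots> \<le> 2 * card ?W + 2 * card (S - ?W)"
      using IH[of ?W] IH[of "S - ?W"] WS 3(2) uW 3(1) by (intro add_mono) blast+
    also have "\<dots> = 2 * card S"
      using card_Diff_subset[OF finite_subset[OF WS fS] WS] card_mono[OF fS WS] by simp
    finally show ?thesis .
  next
    case (4 u)
    let ?E = "{e \<in> E. e \<subseteq> S}"
    have "connected_in E S" using connected_in_reach[OF 4(1), of E] 4(2) by simp
    then have conn: "connected_in ?E S" by (simp add: connected_in_induced)
    have Sne: "S \<noteq> {}" using 4(1) by blast
    have d: "3 \<le> card (nb ?E v)" if "v \<in> S" for v using 4(3)[OF that] nb_induced[OF that, of E] by simp
    show ?thesis
      by (rule edges_of_separated[OF sgraph_induced[OF sg less.prems] conn Sne Psep_induced[OF sep sg less.prems] d])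
  qed
qed

theorem Psep_2_imp_Pconf_3:
  assumes "sgraph V E" "Psep V E 2" shows "Pconf V E 3"
  using Pconf_of_sparse[OF assms(1), of 2] sparse_of_separated[OF assms] by (simp add: eval_nat_numeral)

section \<open>Planar examples\<close>

text \<open>Vertices 0 and 1 are hubs above and below the real line, which carries all others in
  order. All examples are subgraphs of this one infinite plane drawing.\<close>

fun pt :: "nat \<Rightarrow> complex" where
  "pt 0 = \<i>"
| "pt (Suc 0) = - \<i>"
| "pt (Suc (Suc n)) = of_nat n"

definition straight :: "nat set \<Rightarrow> real \<Rightarrow> complex" where
  "straight e = linepath (pt (Min e)) (pt (Max e))"

inductive_set drawn :: "nat set set" where
  up: "{0, n + 2} \<in> drawn"
| down: "{1, n + 2} \<in> drawn"
| flat: "{n + 2, n + 3} \<in> drawn"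

text \<open>The only edge whose relative interior may contain a given point.\<close>

definition owner :: "complex \<Rightarrow> nat set" where
  "owner z = (if 0 < Im z then {0, nat \<lfloor>Re z / (1 - Im z)\<rfloor> + 2}
    else if Im z < 0 then {1, nat \<lfloor>Re z / (1 + Im z)\<rfloor> + 2}
    else {nat \<lfloor>Re z\<rfloor> + 2, nat \<lfloor>Re z\<rfloor> + 3})"

lemma inj_pt: "inj pt"
proof (rule injI)
  fix m n assume "pt m = pt n"
  then show "m = n"
    by (cases m rule: pt.cases; cases n rule: pt.cases) (auto simp: complex_eq_iff)
qed

lemma owner_of_interior:
  assumes e: "e \<in> drawn" and z: "z \<in> path_image (straight e)" "z \<notin> pt ` e"
  shows "owner z = e" "z \<notin> range pt"
proof -
  have "owner z = e \<and> z \<notin> range pt"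
    using e
  proof cases
    case (up n)
    have "Min e = 0" "Max e = Suc (Suc n)" using up by simp_all
    \<comment> \<open>At parameter \<open>t\<close> the point has height \<open>1 - t\<close> and
      abscissa \<open>t * n\<close>, so the quotient in \<open>owner\<close> recovers
      \<open>n\<close>.\<close>
    then obtain t where t: "0 \<le> t" "t \<le> 1" "z = (1 - t) *\<^sub>R \<i> + t *\<^sub>R of_nat n"
      using z(1) by (auto simp: straight_def in_segment)
    have zn: "z \<noteq> \<i>" "z \<noteq> of_nat n" using z(2) up by auto
    have "t \<noteq> 0" "t \<noteq> 1" using zn t(3) by auto
    then have t': "0 < t" "t < 1" using t by simp_all
    have im: "Im z = 1 - t" "Re z = t * n" using t(3) by simp_all
    have "owner z = e" using im t' up by (simp add: owner_def)
    moreover have "z \<noteq> pt m" for m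
      using im t' by (cases m rule: pt.cases) (auto simp: complex_eq_iff)
    ultimately show ?thesis by auto
  next
    case (down n)
    have "Min e = Suc 0" "Max e = Suc (Suc n)" using down by simp_all
    then obtain t where t: "0 \<le> t" "t \<le> 1" "z = (1 - t) *\<^sub>R (- \<i>) + t *\<^sub>R of_nat n"
      using z(1) by (auto simp: straight_def in_segment)
    have zn: "z \<noteq> - \<i>" "z \<noteq> of_nat n" using z(2) down by auto
    have "t \<noteq> 0" "t \<noteq> 1" using zn t(3) by auto
    then have t': "0 < t" "t < 1" using t by simp_all
    have im: "Im z = t - 1" "Re z = t * n" using t(3) by simp_all
    have "owner z = e" using im t' down by (simp add: owner_def)
    moreover have "z \<noteq> pt m" for m
      using im t' by (cases m rule: pt.cases) (auto simp: complex_eq_iff)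
    ultimately show ?thesis by auto
  next
    case (flat n)
    have "Min e = Suc (Suc n)" "Max e = Suc (Suc (Suc n))" using flat by (simp_all add: eval_nat_numeral)
    then obtain t where t: "0 \<le> t" "t \<le> 1" "z = (1 - t) *\<^sub>R of_nat n + t *\<^sub>R of_nat (Suc n)"
      using z(1) by (auto simp: straight_def in_segment)
    have zn: "z \<noteq> of_nat n" "z \<noteq> of_nat (Suc n)" using z(2) flat by (auto simp: eval_nat_numeral)
    have "t \<noteq> 0" "t \<noteq> 1" using zn t(3) by auto
    then have t': "0 < t" "t < 1" using t by simp_all
    have im: "Im z = 0" "Re z = n + t" using t(3) by (simp_all add: algebra_simps)
    have "\<lfloor>real n + t\<rfloor> = int n" using t' by (simp add: floor_eq_iff)
    then have "owner z = e" using im flat by (simp add: owner_def)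
    moreover have "z \<noteq> pt m" for m
    proof
      assume m: "z = pt m"
      show False
      proof (cases m rule: pt.cases)
        case (3 k)
        then have "real k = real n + t" using m im by (simp add: complex_eq_iff)
        then have "real n < real k" "real k < real (Suc n)" using t' by simp_all
        then show False by simp
      qed (use m im in \<open>auto simp: complex_eq_iff\<close>)
    qed
    ultimately show ?thesis by auto
  qed
  then show "owner z = e" "z \<notin> range pt" by simp_all
qed

lemma planar_of_drawn:
  assumes V: "finite V" "V \<noteq> {}" and E: "\<And>e. e \<in> E \<Longrightarrow> e \<subseteq> V" "E \<subseteq> drawn"
  shows "planar_graph V E"
  unfolding planar_graph_def
proof
  have two: "\<exists>x y. x < y \<and> e = {x, y}" if "e \<in> drawn" for e
    using that
  proof cases
    case (up n)
    then show ?thesis by (intro exI[of _ 0] exI[of _ "n + 2"]) simp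
  next
    case (down n)
    then show ?thesis by (intro exI[of _ 1] exI[of _ "n + 2"]) simp
  next
    case (flat n)
    then show ?thesis by (intro exI[of _ "n + 2"] exI[of _ "n + 3"]) simp
  qed
  show "simple_graph V E"
    unfolding simple_graph_def
  proof (intro conjI ballI V)
    fix e assume e: "e \<in> E"
    then obtain x y where xy: "x < y" "e = {x, y}" using two[of e] E(2) by blast
    then have "x \<in> V" "y \<in> V" "x \<noteq> y" using E(1)[OF e] by simp_all
    then show "\<exists>x\<in>V. \<exists>y\<in>V. x \<noteq> y \<and> e = {x, y}" using xy(2) by blast
  qed
  have ends: "arc (straight e)" "{pathstart (straight e), pathfinish (straight e)} = pt ` e"
    "pt ` e \<subseteq> path_image (straight e)" if e: "e \<in> E" for e
  proof -
    obtain x y where xy: "x < y" "e = {x, y}" using two[of e] e E(2) by blast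
    then have s: "straight e = linepath (pt x) (pt y)" by (simp add: straight_def)
    have "pt x \<noteq> pt y" using inj_pt xy by (auto dest: injD)
    then show "arc (straight e)" by (simp add: s)
    show "{pathstart (straight e), pathfinish (straight e)} = pt ` e" "pt ` e \<subseteq> path_image (straight e)"
      unfolding s unfolding xy(2) by simp_all
  qed
  show "\<exists>p \<gamma>. plane_drawing V E p \<gamma>"
    unfolding plane_drawing_def
  proof (intro exI[of _ pt] exI[of _ straight] conjI ballI impI)
    show "inj_on pt V" using inj_pt by (rule inj_on_subset) simp
  next
    fix e assume e: "e \<in> E"
    show "arc (straight e)" "{pathstart (straight e), pathfinish (straight e)} = pt ` e" using ends[OF e] by simp_all
    show "path_image (straight e) \<inter> pt ` V = pt ` e"
    proof
      show "path_image (straight e) \<inter> pt ` V \<subseteq> pt ` e"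
        using owner_of_interior(2)[of e] e E(2) by blast
      show "pt ` e \<subseteq> path_image (straight e) \<inter> pt ` V" using ends(3)[OF e] E(1)[OF e] by blast
    qed
  next
    fix e e' assume e: "e \<in> E" "e' \<in> E" "e \<noteq> e'"
    show "path_image (straight e) \<inter> path_image (straight e') \<subseteq> pt ` (e \<inter> e')"
    proof
      fix z assume z: "z \<in> path_image (straight e) \<inter> path_image (straight e')"
      have d: "e \<in> drawn" "e' \<in> drawn" using e E(2) by blast+
      have zi: "z \<in> path_image (straight e)" "z \<in> path_image (straight e')" using z by simp_all
      \<comment> \<open>A point inside one edge is no vertex, hence inside the other edge as well,
        and would have two owners.\<close>
      note o = owner_of_interior[OF d(1) zi(1)] owner_of_interior[OF d(2) zi(2)]
      have "z \<in> pt ` e" "z \<in> pt ` e'" using o e(3) by blast+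
      then show "z \<in> pt ` (e \<inter> e')" using image_Int[OF inj_pt] by blast
    qed
  qed
qed

section \<open>From colorability to the values of the parameters\<close>

lemma not_Psep_1:
  assumes "sgraph V E" "E \<noteq> {}" shows "\<not> Psep V E 1"
proof
  assume P: "Psep V E 1"
  obtain e where e: "e \<in> E" using assms(2) by blast
  obtain x y where xy: "x \<in> V" "y \<in> V" "e = {x, y}" by (rule sgraphE[OF assms(1) e])
  have "list_assignment V 1 (\<lambda>_. {0})" "separated E (\<lambda>_. {0})" by (simp_all add: list_assignment_def separated_def)
  then obtain \<phi> where \<phi>: "proper_coloring E \<phi>" "\<forall>v\<in>V. \<phi> v \<in> {0 :: nat}" using P unfolding Psep_def by blast
  have "{x, y} \<in> E" using e xy(3) by simp
  then have "\<phi> x \<noteq> \<phi> y" using \<phi>(1) unfolding proper_coloring_def by blast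
  moreover have "\<phi> x = 0" "\<phi> y = 0" using \<phi>(2) xy by blast+
  ultimately show False by simp
qed

lemma parameters:
  assumes sg: "sgraph V E" and "1 \<le> i" "1 \<le> j" "1 \<le> k" "Psep V E i" "Pad V E j" "Pconf V E k"
    and "\<And>m. 1 \<le> m \<Longrightarrow> m < i \<Longrightarrow> \<not> Psep V E m" "\<And>m. 1 \<le> m \<Longrightarrow> m < j \<Longrightarrow> \<not> Pad V E m"
    "\<And>m. 1 \<le> m \<Longrightarrow> m < k \<Longrightarrow> \<not> Pconf V E m"
  shows "(ch_sep V E, ch_ad V E, chi_conflict V E) = (i, j, k)"
proof -
  have least: "(LEAST k. 1 \<le> k \<and> P k) = n" if "1 \<le> n" "P n" "\<And>m. 1 \<le> m \<Longrightarrow> m < n \<Longrightarrow> \<not> P m" for P and n :: nat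
  proof (rule Least_equality)
    show "1 \<le> n \<and> P n" using that by simp
    fix m assume "1 \<le> m \<and> P m"
    then show "n \<le> m" using that(3)[of m] not_le by blast
  qed
  have "ch_sep V E = i"
    unfolding ch_sep_def Psep_def[symmetric] by (rule least) (use assms in auto)
  moreover have "ch_ad V E = j"
    unfolding ch_ad_def Pad_def[symmetric] by (rule least) (use assms in auto)
  moreover have "chi_conflict V E = k"
    unfolding chi_conflict_def Pconf_def[symmetric] by (rule least) (use assms in auto)
  ultimately show ?thesis by simp
qed

lemma below: "m < 2 \<Longrightarrow> 1 \<le> m \<Longrightarrow> m = 1" "m < 3 \<Longrightarrow> 1 \<le> m \<Longrightarrow> m = 1 \<or> m = 2"
  "m < 4 \<Longrightarrow> 1 \<le> m \<Longrightarrow> m = 1 \<or> m = 2 \<or> m = 3" for m :: nat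
  by auto

context
  fixes V :: "'a set" and E :: "'a set set"
  assumes sg: "sgraph V E" and ne: "E \<noteq> {}"
begin

lemma lower_1: "\<not> Psep V E 1" "\<not> Pad V E 1" "\<not> Pconf V E 1"
  using not_Psep_1[OF sg ne] Pad_imp_Psep[OF _ sg] Pconf_imp_Pad[OF _ sg] by blast+

lemma parameters_222:
  assumes "Pconf V E 2" shows "(ch_sep V E, ch_ad V E, chi_conflict V E) = (2, 2, 2)"
proof -
  have "Pad V E 2" by (rule Pconf_imp_Pad[OF assms sg]) simp
  moreover from this have "Psep V E 2" by (rule Pad_imp_Psep[OF _ sg])
  ultimately show ?thesis using assms lower_1 below by (intro parameters[OF sg]) (blast | simp)+
qed

lemma parameters_233:
  assumes "Psep V E 2" "\<not> Pad V E 2" "Pconf V E 3"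
  shows "(ch_sep V E, ch_ad V E, chi_conflict V E) = (2, 3, 3)"
proof -
  have "Pad V E 3" by (rule Pconf_imp_Pad[OF assms(3) sg]) simp
  moreover have "\<not> Pconf V E 2"
  proof
    assume "Pconf V E 2"
    then have "Pad V E 2" by (rule Pconf_imp_Pad[OF _ sg]) simp
    then show False using assms(2) by simp
  qed
  ultimately show ?thesis using assms lower_1 below by (intro parameters[OF sg]) (blast | simp)+
qed

lemma parameters_3jk:
  assumes "\<not> Psep V E 2"
  shows "Pconf V E 3 \<Longrightarrow> (ch_sep V E, ch_ad V E, chi_conflict V E) = (3, 3, 3)"
    "\<not> Pconf V E 3 \<Longrightarrow> Pconf V E 4 \<Longrightarrow> Psep V E 3 \<Longrightarrow> Pad V E 3 \<Longrightarrow>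
      (ch_sep V E, ch_ad V E, chi_conflict V E) = (3, 3, 4)"
    "Pconf V E 4 \<Longrightarrow> Psep V E 3 \<Longrightarrow> \<not> Pad V E 3 \<Longrightarrow> (ch_sep V E, ch_ad V E, chi_conflict V E) = (3, 4, 4)"
    "Pconf V E 4 \<Longrightarrow> \<not> Psep V E 3 \<Longrightarrow> (ch_sep V E, ch_ad V E, chi_conflict V E) = (4, 4, 4)"
proof -
  have n2: "\<not> Pad V E 2" using assms Pad_imp_Psep[OF _ sg] by blast
  have n2': "\<not> Pconf V E 2"
  proof
    assume "Pconf V E 2"
    then have "Pad V E 2" by (rule Pconf_imp_Pad[OF _ sg]) simp
    then show False using n2 by simp
  qed
  have p3: "Pad V E 3" if "Pconf V E 3" by (rule Pconf_imp_Pad[OF that sg]) simp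
  have s3: "Psep V E 3" if "Pad V E 3" by (rule Pad_imp_Psep[OF that sg])
  have p4: "Pad V E 4" if "Pconf V E 4" by (rule Pconf_imp_Pad[OF that sg]) simp
  have s4: "Psep V E 4" if "Pad V E 4" by (rule Pad_imp_Psep[OF that sg])
  show "(ch_sep V E, ch_ad V E, chi_conflict V E) = (3, 3, 3)" if "Pconf V E 3"
    using that p3 s3 assms n2 n2' lower_1 below by (intro parameters[OF sg]) (blast | simp)+
  show "(ch_sep V E, ch_ad V E, chi_conflict V E) = (3, 3, 4)"
    if "\<not> Pconf V E 3" "Pconf V E 4" "Psep V E 3" "Pad V E 3"
    using that assms n2 n2' lower_1 below by (intro parameters[OF sg]) (blast | simp)+
  show "(ch_sep V E, ch_ad V E, chi_conflict V E) = (3, 4, 4)" if "Pconf V E 4" "Psep V E 3" "\<not> Pad V E 3"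
    using that p3 p4 assms n2 n2' lower_1 below by (intro parameters[OF sg]) (blast | simp)+
  show "(ch_sep V E, ch_ad V E, chi_conflict V E) = (4, 4, 4)" if "Pconf V E 4" "\<not> Psep V E 3"
    using that p3 s3 p4 s4 assms n2 n2' lower_1 below by (intro parameters[OF sg]) (blast | simp)+
qed

end

lemma parameters_edgeless:
  assumes "finite V" shows "(ch_sep V {}, ch_ad V {}, chi_conflict V {}) = (1, 1, 1)"
proof -
  have sg: "sgraph V {}" using assms by (simp add: sgraph_def)
  have c: "Pconf V {} 1" by (auto simp: Pconf_def conflict_colorable_def intro!: exI[of _ "\<lambda>_. 1"])
  have a: "Pad V {} 1" by (rule Pconf_imp_Pad[OF c sg]) simp
  have "Psep V {} 1" by (rule Pad_imp_Psep[OF a sg])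
  then show ?thesis using a c by (intro parameters[OF sg]) simp_all
qed

lemma planar_parameters:
  assumes G: "planar_graph V E"
  shows "(ch_sep V E, ch_ad V E, chi_conflict V E) \<in>
    {(1, 1, 1), (2, 2, 2), (2, 3, 3), (3, 3, 3), (3, 3, 4), (3, 4, 4), (4, 4, 4)}"
proof (cases "E = {}")
  case True
  have "finite V" using G by (simp add: planar_graph_def simple_graph_def)
  then show ?thesis using parameters_edgeless[of V] True by simp
next
  case False
  have sg: "sgraph V E" using G by (simp add: planar_graph_def simple_graph_def sgraph_def)
  have P4: "Pconf V E 4" by (rule planar_Pconf_4[OF G])
  consider "Pad V E 2" | "\<not> Pad V E 2" "Psep V E 2" | "\<not> Psep V E 2" "Pconf V E 3"
    | "\<not> Psep V E 2" "\<not> Pconf V E 3" "Psep V E 3" "Pad V E 3"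
    | "\<not> Psep V E 2" "Psep V E 3" "\<not> Pad V E 3" | "\<not> Psep V E 2" "\<not> Psep V E 3" by blast
  then show ?thesis
  proof cases
    case 1
    then show ?thesis using parameters_222[OF sg False Pad_2_imp_Pconf_2[OF sg]] by simp
  next
    case 2
    then show ?thesis using parameters_233[OF sg False 2(2,1) Psep_2_imp_Pconf_3[OF sg]] by simp
  next
    case 3
    then show ?thesis using parameters_3jk(1)[OF sg False] by simp
  next
    case 4
    then show ?thesis using parameters_3jk(2)[OF sg False] P4 by simp
  next
    case 5
    then show ?thesis using parameters_3jk(3)[OF sg False] P4 by simp
  next
    case 6
    then show ?thesis using parameters_3jk(4)[OF sg False] P4 by simp
  qed
qed

section \<open>The five examples\<close>

lemma Pconf_of_lower_degree:
  fixes V :: "nat set"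
  assumes sg: "sgraph V E" and low: "\<And>u v. {u, v} \<in> E \<Longrightarrow> u < v \<Longrightarrow> u \<in> B v"
    "\<And>v. finite (B v)" "\<And>v. card (B v) \<le> k"
  shows "Pconf V E (Suc k)"
proof (rule Pconf_of_sparse[OF sg])
  fix S assume S: "S \<subseteq> V"
  then have fS: "finite S" using sgraph_finite[OF sg] finite_subset by blast
  \<comment> \<open>Every edge is charged to its larger end.\<close>
  have "{e \<in> E. e \<subseteq> S} \<subseteq> (\<Union>v\<in>S. (\<lambda>u. {u, v}) ` B v)"
  proof
    fix e assume "e \<in> {e \<in> E. e \<subseteq> S}"
    then have e: "e \<in> E" "e \<subseteq> S" by simp_all
    obtain x y where xy: "x \<noteq> y" "e = {x, y}" by (rule sgraphE[OF sg e(1)])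
    have "\<exists>u v. u < v \<and> e = {u, v}"
    proof (cases "x < y")
      case False
      then have "y < x \<and> e = {y, x}" using xy by (simp add: insert_commute)
      then show ?thesis by blast
    qed (use xy in blast)
    then obtain u v where uv: "u < v" "e = {u, v}" by blast
    then have "u \<in> B v" "v \<in> S" using low(1)[of u v] e by simp_all
    then show "e \<in> (\<Union>v\<in>S. (\<lambda>u. {u, v}) ` B v)" using uv(2) by blast
  qed
  then have "card {e \<in> E. e \<subseteq> S} \<le> card (\<Union>v\<in>S. (\<lambda>u. {u, v}) ` B v)"
    by (rule card_mono[rotated]) (use fS low(2) in simp)
  also have "\<dots> \<le> (\<Sum>v\<in>S. card ((\<lambda>u. {u, v}) ` B v))" by (rule card_UN_le[OF fS])
  also have "\<dots> \<le> (\<Sum>v\<in>S. k)" by (rule sum_mono) (meson low(2,3) card_image_le order_trans)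
  finally show "card {e \<in> E. e \<subseteq> S} \<le> k * card S" by (simp add: mult.commute)
qed

text \<open>If the choice fails, \<open>X - F\<close> and \<open>Y - F\<close> are the same
  singleton. Counting then puts all \<open>n\<close> elements of \<open>F\<close> into both sets,
  which therefore share at least two elements.\<close>

lemma separated_pair:
  assumes X: "finite X" "card X = Suc n" and Y: "finite Y" "card Y = Suc n" and XY: "card (X \<inter> Y) \<le> 1"
    and F: "finite F" "card F \<le> n" and n: "1 \<le> n"
  obtains a b where "a \<in> X - F" "b \<in> Y - F" "a \<noteq> b"
proof (rule ccontr)
  assume no: "\<not> thesis"
  have ne: "card A \<le> card (A - F) + card F" if "finite A" for A :: "'a set"
  proof -
    have "card A = card (A - F) + card (A \<inter> F)" using card_Int_Diff[OF that, of F] by simp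
    also have "card (A \<inter> F) \<le> card F" by (rule card_mono[OF F(1)]) simp
    finally show ?thesis by simp
  qed
  have "card (X - F) \<noteq> 0" "card (Y - F) \<noteq> 0" using ne[OF X(1)] ne[OF Y(1)] X(2) Y(2) F(2) by linarith+
  then have "X - F \<noteq> {}" "Y - F \<noteq> {}" by (metis card.empty)+
  then obtain a b where ab: "a \<in> X - F" "b \<in> Y - F" by blast
  have "a = b" using that[OF ab] no by blast
  have sx: "X - F \<subseteq> {b}" using that[of _ b] ab no by blast
  have sy: "Y - F \<subseteq> {a}" using that[of a] ab no by blast
  have cx: "card (X - F) \<le> 1" "card (Y - F) \<le> 1"
    using card_mono[OF _ sx] card_mono[OF _ sy] by simp_all
  have full: "F \<subseteq> A" if "finite A" "card A = Suc n" "card (A - F) \<le> 1" for A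
  proof -
    have "card A = card (A - F) + card (A \<inter> F)" using card_Int_Diff[OF that(1), of F] by simp
    then have "card F \<le> card (F \<inter> A)" using that(2,3) F(2) by (simp add: Int_commute)
    then have "F \<inter> A = F" using card_seteq[OF F(1), of "F \<inter> A"] by simp
    then show ?thesis by blast
  qed
  have FX: "F \<subseteq> X" "F \<subseteq> Y" using full[OF X cx(1)] full[OF Y cx(2)] by simp_all
  have "n \<le> card F" using ne[OF X(1)] X(2) cx(1) by simp
  then have "Suc 1 \<le> card (insert a F)" using n ab(1) F(1) by simp
  also have "\<dots> \<le> card (X \<inter> Y)"
    by (rule card_mono) (use X FX ab \<open>a = b\<close> in auto)
  finally show False using XY by simp
qed

text \<open>Given separated lists, any color at the shared vertex 0 leaves a choice on each of the
  two opposite edges, by \<open>separated_pair\<close>. Without separation \<open>dumbbell\<close>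
  applies to the path 2, 3, 0, 4, 5.\<close>

lemma bowtie:
  defines "E \<equiv> {{0, 2}, {0, 3}, {0, 4}, {0, 5}, {2, 3}, {4, 5 :: nat}}"
  defines "V \<equiv> {0, 2, 3, 4, 5 :: nat}"
  shows "planar_graph V E" "(ch_sep V E, ch_ad V E, chi_conflict V E) = (2, 3, 3)"
proof -
  have "E \<subseteq> drawn"
    using drawn.up[of 0] drawn.up[of 1] drawn.up[of 2] drawn.up[of 3] drawn.flat[of 0] drawn.flat[of 2]
    by (simp add: E_def eval_nat_numeral)
  then show G: "planar_graph V E" by (intro planar_of_drawn) (auto simp: V_def E_def)
  then have sg: "sgraph V E" by (simp add: planar_graph_def simple_graph_def sgraph_def)
  have "Pconf V E (Suc 2)"
    by (rule Pconf_of_lower_degree[OF sg, of "\<lambda>v. {0, v - 1}"])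
      (auto simp: E_def doubleton_eq_iff card_insert_if)
  then have P3: "Pconf V E 3" by (simp add: eval_nat_numeral)
  have nP: "\<not> Pad V E 2"
    by (rule dumbbell(1)[OF sg, of "[2, 3, 0, 4, 5]" 2 2]) (auto simp: E_def insert_commute)
  have P2: "Psep V E 2"
    unfolding Psep_def
  proof (intro allI impI)
    fix L assume L: "list_assignment V 2 L \<and> separated E L"
    have c: "finite (L v)" "card (L v) = Suc 1" if "v \<in> V" for v using L that by (simp_all add: list_assignment_def)
    have s: "card (L 2 \<inter> L 3) \<le> 1" "card (L 4 \<inter> L 5) \<le> 1" using L by (auto simp: separated_def E_def)
    have v: "0 \<in> V" "2 \<in> V" "3 \<in> V" "4 \<in> V" "5 \<in> V" by (simp_all add: V_def)
    obtain a where a: "a \<in> L 0" using c(2)[OF v(1)] by fastforce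
    have F: "finite {a}" "card {a} \<le> 1" by simp_all
    obtain p q where pq: "p \<in> L 2 - {a}" "q \<in> L 3 - {a}" "p \<noteq> q"
      by (rule separated_pair[OF c[OF v(2)] c[OF v(3)] s(1) F]) simp
    obtain r t where rt: "r \<in> L 4 - {a}" "t \<in> L 5 - {a}" "r \<noteq> t"
      by (rule separated_pair[OF c[OF v(4)] c[OF v(5)] s(2) F]) simp
    let ?\<phi> = "(\<lambda>_. a)(2 := p, 3 := q, 4 := r, 5 := t)"
    have "proper_coloring E ?\<phi>" using pq rt unfolding proper_coloring_def E_def
      by (auto simp: doubleton_eq_iff)
    moreover have "\<forall>v\<in>V. ?\<phi> v \<in> L v" using a pq rt by (simp add: V_def)
    ultimately show "\<exists>\<phi>. proper_coloring E \<phi> \<and> (\<forall>v\<in>V. \<phi> v \<in> L v)" by blast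
  qed
  show "(ch_sep V E, ch_ad V E, chi_conflict V E) = (2, 3, 3)"
    by (rule parameters_233[OF sg _ P2 nP P3]) (simp add: E_def)
qed

lemma bipartite_2_4:
  defines "E \<equiv> {{0, 2}, {0, 3}, {0, 4}, {0, 5}, {1, 2}, {1, 3}, {1, 4}, {1, 5 :: nat}}"
  defines "V \<equiv> {0, 1, 2, 3, 4, 5 :: nat}"
  shows "planar_graph V E" "(ch_sep V E, ch_ad V E, chi_conflict V E) = (3, 3, 3)"
proof -
  have "E \<subseteq> drawn"
    using drawn.up[of 0] drawn.up[of 1] drawn.up[of 2] drawn.up[of 3]
      drawn.down[of 0] drawn.down[of 1] drawn.down[of 2] drawn.down[of 3]
    by (simp add: E_def eval_nat_numeral)
  then show G: "planar_graph V E" by (intro planar_of_drawn) (auto simp: V_def E_def)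
  then have sg: "sgraph V E" by (simp add: planar_graph_def simple_graph_def sgraph_def)
  have "Pconf V E (Suc 2)"
    by (rule Pconf_of_lower_degree[OF sg, of "\<lambda>v. {0, 1}"])
      (auto simp: E_def doubleton_eq_iff)
  then have P3: "Pconf V E 3" by (simp add: eval_nat_numeral)
  \<comment> \<open>K_{2,4} is the cycle 0, 2, 1, 3 with the one-vertex ears 4 and 5 between its
    opposite vertices 0 and 1.\<close>
  have "\<not> Psep V E 2"
    by (rule four_paths(2)[OF sg, of "[0, 2, 1, 3]" "[4]" "[5]" 2]) (auto simp: E_def insert_commute)
  then show "(ch_sep V E, ch_ad V E, chi_conflict V E) = (3, 3, 3)"
    by (rule parameters_3jk(1)[OF sg _ _ P3, rotated]) (simp add: E_def)
qed

text \<open>Two hubs joined to nine disjoint edges, one for each pair of colors at the hubs.\<close>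

lemma nine_edges:
  defines "E \<equiv> (\<lambda>n. {0, n}) ` {2..<20} \<union> (\<lambda>n. {1, n}) ` {2..<20} \<union> (\<lambda>t. {2 * t + 2, 2 * t + 3}) ` {..<9 :: nat}"
  defines "V \<equiv> {..<20 :: nat}"
  shows "planar_graph V E" "(ch_sep V E, ch_ad V E, chi_conflict V E) = (3, 4, 4)"
proof -
  have E1: "{0, n} \<in> E" "{1, n} \<in> E" if "2 \<le> n" "n < 20" for n using that by (simp_all add: E_def)
  have E2: "{2 * t + 2, 2 * t + 3} \<in> E" if "t < 9" for t using that by (simp add: E_def)
  have Ecases: "(\<exists>n. 2 \<le> n \<and> n < 20 \<and> e = {0, n}) \<or> (\<exists>n. 2 \<le> n \<and> n < 20 \<and> e = {1, n}) \<or>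
      (\<exists>t<9. e = {2 * t + 2, 2 * t + 3})" if "e \<in> E" for e
    using that by (auto simp: E_def)
  have "e \<in> drawn" if "e \<in> E" for e
    using Ecases[OF that]
  proof (elim disjE exE conjE)
    fix n :: nat assume "2 \<le> n" "e = {0, n}"
    moreover from this have "n - 2 + 2 = n" by simp
    ultimately show ?thesis using drawn.up[of "n - 2"] by metis
  next
    fix n :: nat assume "2 \<le> n" "e = {1, n}"
    moreover from this have "n - 2 + 2 = n" by simp
    ultimately show ?thesis using drawn.down[of "n - 2"] by metis
  next
    fix t :: nat assume "e = {2 * t + 2, 2 * t + 3}"
    then show ?thesis using drawn.flat[of "2 * t"] by metis
  qed
  then have drawn: "E \<subseteq> drawn" by blast
  have "0 \<in> V" "finite V" by (simp_all add: V_def)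
  then have V: "finite V" "V \<noteq> {}" by blast+
  have "e \<subseteq> V" if "e \<in> E" for e using that by (auto simp: V_def E_def)
  then show G: "planar_graph V E" by (rule planar_of_drawn[OF V _ drawn])
  then have sg: "sgraph V E" by (simp add: planar_graph_def simple_graph_def sgraph_def)
  have P4: "Pconf V E 4" by (rule planar_Pconf_4[OF G])
  have c: "{n, 0} \<in> E" "{n, 1} \<in> E" if "2 \<le> n" "n < 20" for n using E1[OF that] by (simp_all add: insert_commute)
  have nS: "\<not> Psep V E 2"
    by (rule four_paths(2)[OF sg, of "[0, 2, 1, 3]" "[4]" "[5]" 2]) (use E1 c in simp_all)
  have S3: "Psep V E 3"
    unfolding Psep_def
  proof (intro allI impI)
    fix L assume L: "list_assignment V 3 L \<and> separated E L"
    have c: "finite (L v)" "card (L v) = Suc 2" if "v \<in> V" for v using L that by (simp_all add: list_assignment_def)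
    have v: "0 \<in> V" "1 \<in> V" by (simp_all add: V_def)
    obtain a where a: "a \<in> L 0" using c(2)[OF v(1)] by fastforce
    obtain b where b: "b \<in> L 1" using c(2)[OF v(2)] by fastforce
    \<comment> \<open>The hubs are colored first; the two colors this forbids leave a proper choice
      on each of the nine edges.\<close>
    have "\<exists>p q. p \<in> L (2 * t + 2) - {a, b} \<and> q \<in> L (2 * t + 3) - {a, b} \<and> p \<noteq> q" if "t < 9" for t
    proof -
      have vt: "2 * t + 2 \<in> V" "2 * t + 3 \<in> V" using that by (simp_all add: V_def)
      have s: "card (L (2 * t + 2) \<inter> L (2 * t + 3)) \<le> 1" using L E2[OF that] by (simp add: separated_def)
      have F: "finite {a, b}" "card {a, b} \<le> 2" by (simp_all add: card_insert_if)
      obtain p q where "p \<in> L (2 * t + 2) - {a, b}" "q \<in> L (2 * t + 3) - {a, b}" "p \<noteq> q"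
        by (rule separated_pair[OF c[OF vt(1)] c[OF vt(2)] s F]) simp
      then show ?thesis by blast
    qed
    then obtain p q where pq: "\<And>t. t < 9 \<Longrightarrow> p t \<in> L (2 * t + 2) - {a, b} \<and> q t \<in> L (2 * t + 3) - {a, b} \<and> p t \<noteq> q t"
      by metis
    define \<phi> where "\<phi> n = (if n = 0 then a else if n = 1 then b else if even n then p ((n - 2) div 2) else q ((n - 3) div 2))" for n
    have \<phi>01: "\<phi> 0 = a" "\<phi> 1 = b" by (simp_all add: \<phi>_def)
    have \<phi>p: "\<phi> (2 * t + 2) = p t" "\<phi> (2 * t + 3) = q t" for t by (simp_all add: \<phi>_def)
    have pair: "\<exists>t<9. n = 2 * t + 2 \<or> n = 2 * t + 3" if "2 \<le> n" "n < 20" for n :: nat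
      using that by (intro exI[of _ "(n - 2) div 2"]) presburger
    have \<phi>n: "\<phi> n \<in> L n - {a, b}" if n: "2 \<le> n" "n < 20" for n
    proof -
      obtain t where t: "t < 9" "n = 2 * t + 2 \<or> n = 2 * t + 3" using pair[OF n] by blast
      then show ?thesis using pq[OF t(1)] \<phi>p[of t] by metis
    qed
    have ok: "\<phi> x \<noteq> \<phi> y" if e: "{x, y} \<in> E" for x y
      using Ecases[OF e]
    proof (elim disjE exE conjE)
      fix n assume n: "2 \<le> n" "n < 20" "{x, y} = {0, n}"
      then show ?thesis using \<phi>n[OF n(1,2)] \<phi>01 by (auto simp: doubleton_eq_iff)
    next
      fix n assume n: "2 \<le> n" "n < 20" "{x, y} = {1, n}"
      then show ?thesis using \<phi>n[OF n(1,2)] \<phi>01 by (auto simp: doubleton_eq_iff)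
    next
      fix t :: nat assume t: "t < 9" "{x, y} = {2 * t + 2, 2 * t + 3}"
      then have "(x = 2 * t + 2 \<and> y = 2 * t + 3) \<or> (x = 2 * t + 3 \<and> y = 2 * t + 2)" by (simp add: doubleton_eq_iff)
      then show ?thesis using pq[OF t(1)] \<phi>p[of t] by metis
    qed
    have "\<phi> v \<in> L v" if "v \<in> V" for v
    proof -
      consider "v = 0" | "v = 1" | "2 \<le> v" by linarith
      then show ?thesis using \<phi>01 a b \<phi>n[of v] that by cases (simp_all add: V_def)
    qed
    then show "\<exists>\<phi>. proper_coloring E \<phi> \<and> (\<forall>v\<in>V. \<phi> v \<in> L v)" using ok unfolding proper_coloring_def by blast
  qed
  have nA: "\<not> Pad V E 3"
  proof
    assume P: "Pad V E 3"
    \<comment> \<open>The edge with number \<open>t\<close> has the hub colors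
      \<open>t div 3\<close> and \<open>3 + t mod 3\<close> and its own color 6 in the lists of both
      ends.\<close>
    define i j where "i n = (n - 2) div 2 div 3" and "j n = 3 + (n - 2) div 2 mod 3" for n :: nat
    define L where "L n = (if n = 0 then {0, 1, 2} else if n = 1 then {3, 4, 5} else {i n, j n, 6})" for n
    define f where "f e = (if 0 \<in> e then i (Max e) else if 1 \<in> e then j (Max e) else 6)" for e
    have "list_assignment V 3 L"
      unfolding list_assignment_def
    proof
      fix v assume v: "v \<in> V"
      have "(v - 2) div 2 div 3 < 3" using v by (simp add: V_def less_mult_imp_div_less)
      moreover have "(v - 2) div 2 mod 3 < 3" by simp
      ultimately have "i v < 3" "3 \<le> j v" "j v < 6" unfolding i_def j_def by linarith+
      then show "finite (L v) \<and> card (L v) = 3" by (simp add: L_def)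
    qed
    then obtain c where c: "adapted_coloring E f c" "\<forall>v\<in>V. c v \<in> L v" using P unfolding Pad_def by blast
    have cL: "c v \<in> L v" if "v < 20" for v using c(2) that by (simp add: V_def)
    have c0: "c 0 < 3" "3 \<le> c 1" "c 1 < 6" using cL[of 0] cL[of 1] by (auto simp: L_def)
    \<comment> \<open>This is the edge whose ends must refuse the colors chosen at both hubs, so
      that both are left with 6.\<close>
    define t where "t = 3 * c 0 + (c 1 - 3)"
    have t9: "t < 9" using c0 by (simp add: t_def)
    have split: "(3 * a + b) div 3 = a" "(3 * a + b) mod 3 = b" if "b < 3" for a b :: nat using that by simp_all
    have c1: "c 1 - 3 < 3" using c0 by simp
    have td: "t div 3 = c 0" "t mod 3 = c 1 - 3" unfolding t_def by (rule split[OF c1])+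
    have six: "c n = 6" if n: "2 \<le> n" "n < 20" "(n - 2) div 2 = t" for n
    proof -
      have ij: "i n = c 0" "j n = c 1" using n(3) td c0 by (simp_all add: i_def j_def)
      have "f {0, n} = i n" "f {1, n} = j n" using n by (simp_all add: f_def)
      then have "\<not> (c 0 = c n \<and> c n = i n)" "\<not> (c 1 = c n \<and> c n = j n)"
        using c(1) E1[OF n(1,2)] unfolding adapted_coloring_def by metis+
      then have "c n \<noteq> i n" "c n \<noteq> j n" using ij by auto
      then show ?thesis using cL[OF n(2)] n(1) by (simp add: L_def)
    qed
    have "c (2 * t + 2) = 6" "c (2 * t + 3) = 6" using six t9 by simp_all
    moreover have "f {2 * t + 2, 2 * t + 3} = 6" by (simp add: f_def)
    ultimately show False using c(1) E2[OF t9] unfolding adapted_coloring_def by metis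
  qed
  show "(ch_sep V E, ch_ad V E, chi_conflict V E) = (3, 4, 4)"
    by (rule parameters_3jk(3)[OF sg _ nS P4 S3 nA]) (use E2[of 0] in auto)
qed

lemma single_edge:
  "planar_graph {0, 2 :: nat} {{0, 2}}"
  "(ch_sep {0, 2 :: nat} {{0, 2}}, ch_ad {0, 2 :: nat} {{0, 2}}, chi_conflict {0, 2 :: nat} {{0, 2}}) = (2, 2, 2)"
proof -
  have "{0, 2} \<in> drawn" using drawn.up[of 0] by (simp only: add_0)
  then show G: "planar_graph {0, 2 :: nat} {{0, 2}}" by (intro planar_of_drawn) auto
  then have sg: "sgraph {0, 2 :: nat} {{0, 2}}" by (simp add: planar_graph_def simple_graph_def sgraph_def)
  have "Pconf {0, 2 :: nat} {{0, 2}} (Suc 1)"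
    by (rule Pconf_of_lower_degree[OF sg, of "\<lambda>_. {0}"]) (auto simp: doubleton_eq_iff)
  then show "(ch_sep {0, 2 :: nat} {{0, 2}}, ch_ad {0, 2 :: nat} {{0, 2}}, chi_conflict {0, 2 :: nat} {{0, 2}}) = (2, 2, 2)"
    by (intro parameters_222[OF sg]) (simp_all add: numeral_2_eq_2)
qed

theorem corollary4p8:
  fixes i j k :: nat
  assumes "1 \<le> i" "1 \<le> j" "1 \<le> k"
    and "(i, j, k) \<notin> {(3, 3, 4), (4, 4, 4)}"
  shows "(\<exists>(V :: nat set) E. planar_graph V E \<and>
            (ch_sep V E, ch_ad V E, chi_conflict V E) = (i, j, k))
         \<longleftrightarrow> (i, j, k) \<in> {(1, 1, 1), (2, 2, 2), (2, 3, 3), (3, 3, 3), (3, 4, 4)}"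
proof
  assume "\<exists>(V :: nat set) E. planar_graph V E \<and> (ch_sep V E, ch_ad V E, chi_conflict V E) = (i, j, k)"
  then obtain V :: "nat set" and E where G: "planar_graph V E" "(ch_sep V E, ch_ad V E, chi_conflict V E) = (i, j, k)"
    by blast
  show "(i, j, k) \<in> {(1, 1, 1), (2, 2, 2), (2, 3, 3), (3, 3, 3), (3, 4, 4)}"
    using planar_parameters[OF G(1)] assms(4) unfolding G(2) by blast
next
  assume "(i, j, k) \<in> {(1, 1, 1), (2, 2, 2), (2, 3, 3), (3, 3, 3), (3, 4, 4)}"
  then consider "(i, j, k) = (1, 1, 1)" | "(i, j, k) = (2, 2, 2)" | "(i, j, k) = (2, 3, 3)"
    | "(i, j, k) = (3, 3, 3)" | "(i, j, k) = (3, 4, 4)" by blast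
  then show "\<exists>(V :: nat set) E. planar_graph V E \<and> (ch_sep V E, ch_ad V E, chi_conflict V E) = (i, j, k)"
  proof cases
    case 1
    have "planar_graph {0 :: nat} {}" by (rule planar_of_drawn) simp_all
    then show ?thesis unfolding 1 using parameters_edgeless[of "{0 :: nat}"] by blast
  next
    case 2
    show ?thesis unfolding 2 using single_edge by blast
  next
    case 3
    show ?thesis unfolding 3 using bowtie by blast
  next
    case 4
    show ?thesis unfolding 4 using bipartite_2_4 by blast
  next
    case 5
    show ?thesis unfolding 5 using nine_edges by blast
  qed
qed

end
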